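(* Let $I=(-1,1)$ and let $g\in\dot H^{\frac12}(\mathbb R,\mathbb S^1)\cap C^0(\mathbb R,\mathbb S^1)$ be non-constant outside $I$ (i.e. in $\mathbb R\setminus I$) and such that $g(-1)=g(1)$. Let $u_0$ minimize $E$ in $\mathcal E_g$ and assume that $\deg(u_0,\bar I)=0$. Set $d_0:=\deg(u_0)$. Then there are at least $3$ half-harmonic maps (in $I$) belonging to $\mathcal E_g$: the absolute minimizer $u_0\in\mathcal E_{g,d_0}$, and maps $u_+$ and $u_-$ minimizing $E$ in $\mathcal E_{g,d_0+1}$ and in $\mathcal E_{g,d_0-1}$ respectively.
   Context: $\mathbb S^1=\{z\in\mathbb C:|z|=1\}$, with $\mathbb C\simeq\mathbb R^2$. $\dot H^{\frac12}(\mathbb R,\mathbb S^1)$ is the set of measurable $u:\mathbb R\to\mathbb C$ (up to a.e. equality) with $|u|=1$ a.e. and $\int_{\mathbb R}\int_{\mathbb R}\frac{|u(x)-u(y)|^2}{|x-y|^2}\,dx\,dy<\infty$. The energy is $E(u)=\frac1{2\pi}\int_{\mathbb R}\int_{\mathbb R}\frac{|u(x)-u(y)|^2}{|x-y|^2}\,dx\,dy=\int_{\mathbb R^2_+}|\nabla\tilde u|^2\,dx\,dy$, where $\tilde u$ is the Poisson harmonic extension of $u$ to the upper half-plane $\mathbb R^2_+$. For $g\in\dot H^{\frac12}(\mathbb R,\mathbb S^1)$ and $d\in\mathbb Z$: $\mathcal E_g:=\{u\in\dot H^{\frac12}(\mathbb R,\mathbb S^1):u=g\text{ in }\mathbb R\setminus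 I\}$ and $\mathcal E_{g,d}:=\{u\in\mathcal E_g:\deg(u)=d\}$. Degree: $\deg(u):=\deg(u\circ\pi)\in\mathbb Z$, where $\pi:\mathbb S^1\setminus\{i\}\to\mathbb R$, $\pi(e^{i\theta})=\frac{\cos\theta}{1-\sin\theta}$, is the stereographic projection from the north pole. The degree on $H^{\frac12}(\mathbb S^1,\mathbb S^1)$ is the unique extension, continuous in the $H^{\frac12}$ norm, of the usual degree $\frac1{2\pi i}\int_{\mathbb S^1}\bar f f'\,d\theta$ of $C^1$ maps (equivalently $\deg f=\sum_{n\in\mathbb Z}n|\hat f(n)|^2$). A map $u\in\dot H^{\frac12}(\mathbb R,\mathbb S^1)$ is half-harmonic in $I$ if $(-\Delta)^{\frac12}u(x):=-\frac{\partial\tilde u}{\partial y}(x,0)\perp T_{u(x)}\mathbb S^1$ for $x\in I$. Equivalently, $u$ is a critical point of $E$ in $\mathcal E_u$. In weak form: for all $\varphi\in C_c^\infty(I,\mathbb R)$, $\int_{\mathbb R}\int_{\mathbb R}\frac{(u(x)-u(y))\cdot(iu(x)\varphi(x)-iu(y)\varphi(y))}{|x-y|^2}\,dx\,dy=0$. It is known that half-harmonic maps in $I$ which are continuous in $\mathbb R\setminus I$ are continuous in $\bar I$. For continuous $u:\bar I=[-1,1]\to\mathbb S^1$ with $u(-1)=u(1)$, $\deg(u,\bar I):=\frac{\varphi(1)-\varphi(-1)}{2\pi}\in\mathbb Z$, where $\varphi\in C^0([-1,1],\mathbb R)$ is any continuous lifting, $u=e^{i\varphi}$. In particular $\deg(u_0,\bar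 I)$ is well defined. *)

theory Defs
  imports "HOL-Analysis.Analysis"
begin

text \<open>
  Elements of the function spaces are represented by functions, not by classes modulo equality
  almost everywhere. Every notion below is invariant under modification on a null set, except
  where pointwise continuity or differentiability is asked for explicitly.
\<close>

definition gagliardo :: "(real \<Rightarrow> complex) \<Rightarrow> ennreal" where
  "gagliardo u =
     (\<integral>\<^sup>+ x. (\<integral>\<^sup>+ y. ennreal ((cmod (u x - u y))\<^sup>2 / \<bar>x - y\<bar>\<^sup>2) \<partial>lebesgue) \<partial>lebesgue)"

definition Hhalf :: "(real \<Rightarrow> complex) set" where
  "Hhalf = {u. u \<in> borel_measurable lebesgue \<and> (AE x in lebesgue. cmod (u x) = 1) \<and>
               gagliardo u < \<infinity>}"

definition energy :: "(real \<Rightarrow> complex) \<Rightarrow> ennreal" where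
  "energy u = ennreal (1 / (2 * pi)) * gagliardo u"

definition energy_class :: "(real \<Rightarrow> complex) \<Rightarrow> (real \<Rightarrow> complex) set" where
  "energy_class g =
     {u \<in> Hhalf. AE x in lebesgue. x \<notin> {-1<..<1} \<longrightarrow> u x = g x}"

text \<open>
  A map on the circle is a function on \<open>complex\<close> whose values off the unit circle are irrelevant;
  arc length is Lebesgue measure on \<open>[0, 2\<pi>]\<close>, transported by \<open>cis\<close>.
\<close>

definition circle_Hhalf_norm_sq :: "(complex \<Rightarrow> complex) \<Rightarrow> ennreal" where
  "circle_Hhalf_norm_sq f =
     (\<integral>\<^sup>+ s\<in>{0..2*pi}. ennreal ((cmod (f (cis s)))\<^sup>2) \<partial>lebesgue) +
     (\<integral>\<^sup>+ s\<in>{0..2*pi}. (\<integral>\<^sup>+ t\<in>{0..2*pi}.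
        ennreal ((cmod (f (cis s) - f (cis t)))\<^sup>2 / (cmod (cis s - cis t))\<^sup>2) \<partial>lebesgue) \<partial>lebesgue)"

definition circle_Hhalf :: "(complex \<Rightarrow> complex) set" where
  "circle_Hhalf = {f. (\<lambda>t. f (cis t)) \<in> borel_measurable lebesgue \<and>
                      (AE t in lebesgue. cmod (f (cis t)) = 1) \<and>
                      circle_Hhalf_norm_sq f < \<infinity>}"

definition circle_C1 :: "(complex \<Rightarrow> complex) set" where
  "circle_C1 = {f. (\<forall>z\<in>sphere 0 1. f z \<in> sphere 0 1) \<and>
                   (\<lambda>t. f (cis t)) C1_differentiable_on UNIV}"

text \<open>
  The first clause only normalises the values outside the space, so that the extension is unique
  as a total function.
\<close>

definition circle_degree :: "(complex \<Rightarrow> complex) \<Rightarrow> int" where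
  "circle_degree = (THE D.
     (\<forall>f. f \<notin> circle_Hhalf \<longrightarrow> D f = 0) \<and>
     (\<forall>f\<in>circle_C1. of_int (D f) =
        1 / (2 * of_real pi * \<i>) *
        integral {0..2*pi} (\<lambda>t. cnj (f (cis t)) * vector_derivative (\<lambda>s. f (cis s)) (at t))) \<and>
     (\<forall>F. \<forall>f\<in>circle_Hhalf. (\<forall>n::nat. F n \<in> circle_Hhalf) \<longrightarrow>
        (\<lambda>n. circle_Hhalf_norm_sq (\<lambda>z. F n z - f z)) \<longlonglongrightarrow> 0 \<longrightarrow>
        (\<lambda>n. D (F n)) \<longlonglongrightarrow> D f))"

text \<open>
  Stereographic projection from \<open>\<i>\<close>; the value at \<open>\<i>\<close> itself is arbitrary.
\<close>

definition stereographic :: "complex \<Rightarrow> real" where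
  "stereographic z = Re z / (1 - Im z)"

definition Hhalf_degree :: "(real \<Rightarrow> complex) \<Rightarrow> int" where
  "Hhalf_degree u = circle_degree (u \<circ> stereographic)"

definition energy_class_deg :: "(real \<Rightarrow> complex) \<Rightarrow> int \<Rightarrow> (real \<Rightarrow> complex) set" where
  "energy_class_deg g d = {u \<in> energy_class g. Hhalf_degree u = d}"

text \<open>
  \<open>lift_degree\<close> is meant for continuous \<open>v\<close> on \<open>[-1,1]\<close> with values in the unit circle and
  \<open>v (-1) = v 1\<close>; \<open>interval_degree\<close> applies it to the continuous representative of \<open>u\<close>.
\<close>

definition lift_degree :: "(real \<Rightarrow> complex) \<Rightarrow> int" where
  "lift_degree v = (THE d. \<exists>\<phi>. continuous_on {-1..1} \<phi> \<and>
     (\<forall>x\<in>{-1..1}. v x = exp (\<i> * of_real (\<phi> x))) \<and>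
     of_int d = (\<phi> 1 - \<phi> (-1)) / (2 * pi))"

definition interval_degree :: "(real \<Rightarrow> complex) \<Rightarrow> int" where
  "interval_degree u = (THE d. \<exists>v. continuous_on {-1..1} v \<and>
     v ` {-1..1} \<subseteq> sphere 0 1 \<and> v (-1) = v 1 \<and>
     (AE x in lebesgue. x \<in> {-1..1} \<longrightarrow> u x = v x) \<and> d = lift_degree v)"

definition test_functions :: "(real \<Rightarrow> real) set" where
  "test_functions = {\<phi>. (\<forall>n x. (deriv ^^ n) \<phi> differentiable (at x)) \<and>
     compact (closure {x. \<phi> x \<noteq> 0}) \<and> closure {x. \<phi> x \<noteq> 0} \<subseteq> {-1<..<1}}"

text \<open>
  The weak form of the equation. For \<open>u \<in> Hhalf\<close> the integrand is absolutely integrable on the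
  plane, by the Cauchy-Schwarz inequality, so the iterated Bochner integral is the double integral.
\<close>

definition half_harmonic :: "(real \<Rightarrow> complex) \<Rightarrow> bool" where
  "half_harmonic u \<longleftrightarrow> u \<in> Hhalf \<and>
     (\<forall>\<phi>\<in>test_functions.
        (LINT x|lebesgue. (LINT y|lebesgue.
           ((u x - u y) \<bullet> (\<i> * u x * of_real (\<phi> x) - \<i> * u y * of_real (\<phi> y)))
             / \<bar>x - y\<bar>\<^sup>2)) = 0)"

end

theory Submission
 imports Defs "HOL-Probability.Probability" "HOL-Complex_Analysis.Complex_Analysis" "HOL-Real_Asymp.Real_Asymp"
begin

text \<open>
 Let \<open>G u\<close> denote the integral of \<open>|u x - u y|\<^sup>2 / |x - y|\<^sup>2\<close>. If \<open>w\<^sub>k\<close> tends to \<open>1\<close> almost everywhere with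
 bounded energy, then \<open>G (u w\<^sub>k) = G u + G w\<^sub>k + o(1)\<close>, and \<open>G w \<ge> 4 \<pi>\<^sup>2 |deg w|\<close>. A minimizing sequence in the class of
 degree \<open>d\<^sub>0 \<plusminus> 1\<close> whose limit has another degree therefore loses at least \<open>4 \<pi>\<^sup>2\<close>, so a minimizer exists as soon
 as some competitor has energy below \<open>G u\<^sub>0 + 4 \<pi>\<^sup>2\<close>.

 The competitor is \<open>u\<^sub>0\<close> times a bubble of degree \<open>\<plusminus>1\<close> and width of order \<open>e\<close>, centred at \<open>t \<in> I\<close>. Write \<open>u\<^sub>0 = cis f\<close> on the closure of \<open>I\<close>,
 where \<open>f (-1) = f 1\<close> because the degree of \<open>u\<^sub>0\<close> on \<open>I\<close> vanishes; hence \<open>f a = f b\<close> for some interior \<open>a < b\<close>. To first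
 order the interaction of the bubble with \<open>u\<^sub>0\<close> is linear in \<open>f\<close>, and averaging over \<open>t \<in> [a, b]\<close> replaces \<open>f\<close> by a
 primitive of \<open>z \<mapsto> f (b + z) - f (a + z)\<close>, which makes it \<open>o(e)\<close>. The second order term is a gain of order \<open>e\<close>, because
 \<open>u\<^sub>0\<close> is not constant outside \<open>I\<close>.
\<close>

text \<open>The bubble and the lower bound for degree one share the leading constant
  \<open>4 * pi^2\<close>, so everything is decided by terms of order \<open>e\<close>, and no
  constant may be lost on either side. This dictates the shape of the bubble: it has to equal
  \<open>1\<close> exactly outside I and still exceed \<open>4 * pi^2\<close> only by
  O(\<open>e^2\<close>). Part of its interaction with \<open>u0\<close> pairs with an admissible
  phase variation and vanishes by stationarity. What is left has no sign; formally it is a multiple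
  of the derivative of \<open>f\<close> at the centre, while \<open>f\<close> is merely continuous,
  so a favourable centre cannot be chosen pointwise. Two facts must be available before this can
  start. The minimizer needs a representative that is continuous up to the end points of I and
  attains the boundary values; without it neither \<open>f\<close> nor the hypothesis on the degree
  in I is usable. And the degree is a definite description, so its existence, uniqueness, additivity
  and sharp energy bound have to be obtained from concrete windings. The degree
  \<open>d0 - 1\<close> is reduced to the case of a bubble of degree \<open>1\<close> by complex
  conjugation.\<close>

abbreviation (input) TP :: "real set" where "TP \<equiv> {0..2 * pi}"
abbreviation (input) ind :: "'a set => 'a => 'b::zero_neq_one" where "ind \<equiv> indicator"
abbreviation (input) en :: "real => ennreal" where "en \<equiv> ennreal"
abbreviation (input) seqlim :: "(nat => 'a::topological_space) => 'a => bool" (infix "---->" 60) where "X ----> L \<equiv> X \<longlonglongrightarrow> L"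
abbreviation (input) LL :: "(real \<times> real) measure" where "LL \<equiv> lborel \<Otimes>\<^sub>M lborel"
abbreviation (input) BB :: "(real \<times> real) measure" where "BB \<equiv> borel \<Otimes>\<^sub>M borel"
abbreviation (input) NPb :: "(real \<times> real => ennreal) => ennreal" (binder "NP " 10) where "NPb f \<equiv> nn_integral LL f"
abbreviation (input) csq :: "complex => real" where "csq z \<equiv> (cmod z)^2"
abbreviation (input) em :: "real set => ennreal" where "em \<equiv> emeasure lborel"
lemmas sq_eq = power2_eq_square and ind_def = indicator_def and borel_cont = borel_measurable_continuous_onI
lemmas Bintegrable_add = Bochner_Integration.integrable_add and Bintegrable_bound = Bochner_Integration.integrable_bound
 and Bintegrable_diff = Bochner_Integration.integrable_diff and Bintegral_add = Bochner_Integration.integral_add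
 and Bintegral_cnj = Bochner_Integration.integral_cnj and Bintegral_cong = Bochner_Integration.integral_cong and Bintegral_diff = Bochner_Integration.integral_diff

subsection \<open>The energy as an integral over pairs\<close>

abbreviation BM :: "('a::topological_space => 'b::topological_space) set" where "BM \<equiv> borel_measurable borel"
abbreviation BM2 :: "(real \<times> real => 'b::topological_space) set" where "BM2 \<equiv> borel_measurable BB"
abbreviation NLb :: "(real => ennreal) => ennreal" (binder "NL " 10) where "NLb f \<equiv> nn_integral lborel f"
abbreviation ILb :: "(real => 'b::{banach,second_countable_topology}) => 'b" (binder "IL " 10) where "ILb f \<equiv> integral\<^sup>L lborel f"

text \<open>With the weight inside the measure, energies are squared L2 norms of differences, and
  Cauchy-Schwarz, Fatou and dominated convergence apply directly. On the diagonal the weight is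
  \<open>1 / 0 = 0\<close>.\<close>

definition gm :: "(real \<times> real) measure" where
 "gm = density LL (%p. en (1 / (fst p - snd p)^2))"

abbreviation (input) emg :: "(real \<times> real) set => ennreal" where "emg \<equiv> emeasure gm"
abbreviation NGb :: "(real \<times> real => ennreal) => ennreal" (binder "NG " 10) where "NGb f \<equiv> nn_integral gm f"
abbreviation IGb :: "(real \<times> real => real) => real" (binder "IG " 10) where "IGb f \<equiv> integral\<^sup>L gm f"

lemma sets_gm [simp, measurable_cong]: "sets gm = sets BB"
 by (simp add: gm_def cong: sets_pair_measure_cong)

lemma space_gm [simp]: "space gm = UNIV"
 by (simp add: gm_def space_pair_measure)

lemma pair_lborel_sigma_finite: "sigma_finite_measure LL"
 by (simp add: lborel_prod sigma_finite_lborel)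

lemma gm_sigma_finite: "sigma_finite_measure gm"
 unfolding gm_def
 by (subst sigma_finite_measure.sigma_finite_iff_density_finite[OF pair_lborel_sigma_finite]) auto

lemma nn_integral_gm:
 assumes [measurable]: "f \<in> BM2"
 shows "(NG p. f p) = (NP p. en (1 / (fst p - snd p)^2) * f p)"
 unfolding gm_def by (subst nn_integral_density) auto

lemma nn_integral_gm_iter:
 assumes [measurable]: "f \<in> BM2"
 shows "(NG p. f p) = (NL x. NL y. en (1 / (x - y)^2) * f (x, y))"
 unfolding nn_integral_gm[OF assms]
 by (subst lborel.nn_integral_fst[symmetric]) (auto intro!: measurable_compose[OF _ assms])

definition gag :: "(real => 'b::{real_normed_vector,second_countable_topology}) => ennreal" where
 "gag u = (NG p. en ((norm (u (fst p) - u (snd p)))^2))"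

definition gagr :: "(real => 'b::{real_normed_vector,second_countable_topology}) => real" where
 "gagr u = (IG p. (norm (u (fst p) - u (snd p)))^2)"

definition Hmaps :: "(real => complex) set" where
 "Hmaps = {u. u \<in> BM \<and> (\<forall>x. cmod (u x) = 1) \<and> gag u < \<infinity>}"

text \<open>For \<open>u = cis f\<close> this is \<open>sin (f x - f y)\<close>, the density of the
  first variation of the energy under a change of phase.\<close>

definition cross :: "(real => complex) => real \<times> real => real" where
 "cross u p = Im (u (fst p) * cnj (u (snd p)))"

abbreviation dsq :: "(real => 'b::real_normed_vector) => real \<times> real => real" where
 "dsq u p \<equiv> (norm (u (fst p) - u (snd p)))^2"

lemma measurable_cnj [measurable]: "cnj \<in> BM"
 by (intro borel_cont continuous_intros)

lemma HmapsD:
 assumes "u \<in> Hmaps"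
 shows "u \<in> BM" "cmod (u x) = 1" "gag u < \<infinity>"
 using assms by (auto simp: Hmaps_def)

lemma measurable_dsq:
 fixes u :: "real => 'b::{real_normed_vector,second_countable_topology}"
 assumes [measurable]: "u \<in> BM"
 shows "dsq u \<in> borel_measurable gm"
 by measurable

lemma measurable_cross:
 assumes [measurable]: "u \<in> BM"
 shows "cross u \<in> borel_measurable gm"
 unfolding cross_def by measurable

lemma integrable_dsq:
 fixes u :: "real => 'b::{real_normed_vector,second_countable_topology}"
 assumes [measurable]: "u \<in> BM" and "gag u < \<infinity>"
 shows "integrable gm (dsq u)"
 using assms(2) by (intro integrableI_bounded measurable_dsq[OF assms(1)]) (simp add: gag_def)

lemma gag_eq_gagr:
 fixes u :: "real => 'b::{real_normed_vector,second_countable_topology}"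
 assumes "u \<in> BM" "gag u < \<infinity>"
 shows "gag u = en (gagr u)"
 unfolding gag_def gagr_def
 by (intro nn_integral_eq_integral integrable_dsq assms) auto

lemma gagr_nonneg: "gagr u \<ge> 0"
 unfolding gagr_def by (intro integral_nonneg_AE) auto

lemma gagliardo_eq_gag:
 assumes [measurable]: "u \<in> BM"
 shows "gagliardo u = gag u"
proof -
 have "gagliardo u = (NL x. (NL y. en (csq (u x - u y) / abs (x - y)^2)))"
  unfolding gagliardo_def by (simp add: nn_integral_completion)
 also have "... = gag u"
  unfolding gag_def
  by (subst nn_integral_gm_iter) (auto simp: ennreal_mult[symmetric] field_simps)
 finally show ?thesis .
qed

text \<open>This is the addition formula for \<open>2 - 2 * cos (\<alpha> + \<beta>)\<close>, where
  \<alpha> and \<beta> are the arguments of \<open>a * cnj b\<close> and \<open>c * cnj d\<close>.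
  The product of imaginary parts is an interaction without sign; the product of squares is always a
  gain.\<close>

lemma unit_prod_identity:
 fixes a b c d :: complex
 assumes "cmod a = 1" "cmod b = 1" "cmod c = 1" "cmod d = 1"
 shows "csq (a * c - b * d) = csq (a - b) + csq (c - d) + (2 * Im (a * cnj b) * Im (c * cnj d) - csq (a - b) * csq (c - d) / 2)"
proof -
 have n: "(Re z)^2 + (Im z)^2 = 1" if "cmod z = 1" for z
  using that by (simp add: cmod_power2[symmetric])
 have l: "csq (z - w) = 2 - 2 * (Re z * Re w + Im z * Im w)" if "cmod z = 1" "cmod w = 1" for z w
  using n[OF that(1)] n[OF that(2)] unfolding cmod_power2 minus_complex.simps by (simp add: sq_eq algebra_simps)
 have "cmod (a*c) = 1" "cmod (b*d) = 1" using assms by (auto simp: norm_mult)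
 hence 1: "csq (a * c - b * d) = 2 - 2 * (Re (a*c) * Re (b*d) + Im (a*c) * Im (b*d))"
  by (rule l)
 show ?thesis
  unfolding 1 l[OF assms(1,2)] l[OF assms(3,4)] by (simp add: algebra_simps add_divide_distrib diff_divide_distrib)
qed

lemma abs_Im_mult_cnj_le:
 assumes "cmod a = 1" "cmod b = 1"
 shows "abs (Im (a * cnj b)) <= cmod (a - b)" "abs (Im (a * cnj b)) <= 1"
proof -
 have "Im (a * cnj b) = Im ((a - b) * cnj b)"
  by (simp add: algebra_simps)
 thus "abs (Im (a * cnj b)) <= cmod (a - b)"
  using abs_Im_le_cmod[of "(a - b) * cnj b"] assms by (simp add: norm_mult)
 show "abs (Im (a * cnj b)) <= 1"
  using abs_Im_le_cmod[of "a * cnj b"] assms by (simp add: norm_mult)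
qed

lemma cross_le:
 assumes "u \<in> Hmaps"
 shows "abs (cross u p) <= norm (u (fst p) - u (snd p))" "abs (cross u p) <= 1" "(cross u p)^2 <= dsq u p"
proof -
 show *: "abs (cross u p) <= norm (u (fst p) - u (snd p))" "abs (cross u p) <= 1"
  using abs_Im_mult_cnj_le HmapsD[OF assms] unfolding cross_def by auto
 show "(cross u p)^2 <= dsq u p"
  using power_mono[OF *(1), of 2] by simp
qed

lemma dsq_le4:
 assumes "u \<in> Hmaps"
 shows "dsq u p <= 4"
proof -
 have "norm (u (fst p) - u (snd p)) <= 2"
  using norm_triangle_ineq4[of "u (fst p)" "u (snd p)"] HmapsD[OF assms] by simp
 from power_mono[OF this, of 2] show ?thesis by simp
qed

lemma integrable_prod_of_squares:
 assumes [measurable]: "f \<in> borel_measurable M" "g \<in> borel_measurable M"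
  and "integrable M (%p. (f p)^2)" "integrable M (%p. (g p)^2)"
 shows "integrable M (%p. f p * g p :: real)"
proof (rule Bintegrable_bound)
 show "integrable M (%p. (f p)^2 + (g p)^2)" using assms by auto
 show "AE p in M. norm (f p * g p) <= norm ((f p)^2 + (g p)^2)"
 proof (intro AE_I2)
  fix p
  have "2 * abs (f p * g p) <= (f p)^2 + (g p)^2"
   using sum_squares_bound[of "abs (f p)" "abs (g p)"] by (simp add: abs_mult)
  thus "norm (f p * g p) <= norm ((f p)^2 + (g p)^2)"
   by simp
 qed
qed auto

lemma integrable_cross_sq:
 assumes "u \<in> Hmaps" shows "integrable gm (%p. (cross u p)^2)"
proof (rule Bintegrable_bound)
 show "integrable gm (dsq u)" using integrable_dsq HmapsD[OF assms] by blast
 show "(%p. (cross u p)^2) \<in> borel_measurable gm"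
  using measurable_cross[OF HmapsD(1)[OF assms]] by measurable
qed (use cross_le(3)[OF assms] in auto)

lemma integrable_cross_mult:
 assumes "u \<in> Hmaps" "w \<in> Hmaps" shows "integrable gm (%p. cross u p * cross w p)"
 using assms by (intro integrable_prod_of_squares integrable_cross_sq measurable_cross HmapsD)

lemma integrable_dsq_mult:
 assumes "u \<in> Hmaps" "w \<in> Hmaps" shows "integrable gm (%p. dsq u p * dsq w p)"
proof (rule Bintegrable_bound)
 show "integrable gm (%p. 4 * dsq u p)" using integrable_dsq HmapsD[OF assms(1)] by auto
 show "(%p. dsq u p * dsq w p) \<in> borel_measurable gm"
  using HmapsD(1)[OF assms(1)] HmapsD(1)[OF assms(2)] by (intro borel_measurable_times measurable_dsq)
 show "AE p in gm. norm (dsq u p * dsq w p) <= norm (4 * dsq u p)"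
  using dsq_le4[OF assms(2)] by (auto intro!: mult_mono simp: mult.commute[of 4])
qed

proposition gagr_mult:
 assumes u: "u \<in> Hmaps" and w: "w \<in> Hmaps"
 shows "(%x. u x * w x) \<in> Hmaps"
  and "gagr (%x. u x * w x) = gagr u + gagr w + (2 * (IG p. cross u p * cross w p) - (IG p. dsq u p * dsq w p) / 2)"
proof -
 have [measurable]: "u \<in> BM" "w \<in> BM"
  using u w HmapsD by auto
 note i = integrable_dsq[OF HmapsD(1,3)[OF u]] integrable_dsq[OF HmapsD(1,3)[OF w]]
  integrable_cross_mult[OF u w] integrable_dsq_mult[OF u w]
 have eq: "dsq (%x. u x * w x) p = dsq u p + dsq w p + (2 * (cross u p * cross w p) - dsq u p * dsq w p / 2)" for p
  using unit_prod_identity HmapsD(2)[OF u] HmapsD(2)[OF w] unfolding cross_def by (simp add: mult.assoc)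
 have int: "integrable gm (dsq (%x. u x * w x))"
  unfolding eq using i by auto
 hence "gag (%x. u x * w x) < \<infinity>"
  unfolding gag_def integrable_iff_bounded by simp
 thus "(%x. u x * w x) \<in> Hmaps"
  using HmapsD(2)[OF u] HmapsD(2)[OF w] by (simp add: Hmaps_def norm_mult)
 show "gagr (%x. u x * w x) = gagr u + gagr w + (2 * (IG p. cross u p * cross w p) - (IG p. dsq u p * dsq w p) / 2)"
  unfolding gagr_def eq using i by simp
qed

section \<open>Conjugation, weak limits, first variation and splitting of the energy\<close>

lemma gag_cnj [simp]: "gag (%x. cnj (u x)) = gag u" "gagr (%x. cnj (u x)) = gagr u"
 unfolding gag_def gagr_def complex_cnj_diff[symmetric] complex_mod_cnj by simp_all

lemma Hmaps_cnj: "u \<in> Hmaps ==> (%x. cnj (u x)) \<in> Hmaps"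
 unfolding Hmaps_def by auto

text \<open>Subtracting \<open>h * (a k x)^2\<close> from \<open>abs (a k x * b x)\<close> leaves
  something dominated by \<open>(b x)^2 / h\<close>, which tends to zero by dominated convergence;
  the subtracted part integrates to at most \<open>h * C\<close> for every \<open>k\<close>. The
  sequence itself may keep its L2 norm: this covers energy that concentrates.\<close>

lemma weak_null_product:
 fixes a :: "nat => 'a => real" and b :: "'a => real"
 assumes [measurable]: "!!k. a k \<in> borel_measurable M" "b \<in> borel_measurable M"
  and ia: "!!k. integrable M (%x. (a k x)^2)" and bd: "!!k. (\<integral>x. (a k x)^2 \<partial>M) <= C"
  and ib: "integrable M (%x. (b x)^2)"
  and lim: "AE x in M. (%k. a k x) ----> 0"
 shows "(%k. \<integral>x. abs (a k x * b x) \<partial>M) ----> 0"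
proof (rule LIMSEQ_I)
 fix r :: real assume r: "r > 0"
 define C' where "C' = max C 0 + 1"
 have C': "C' > 0" "!!k. (\<integral>x. (a k x)^2 \<partial>M) <= C'" using bd unfolding C'_def by (auto intro: order_trans[OF bd])
 define h where "h = r / (2 * C')"
 have h: "h > 0" using r C' by (simp add: h_def)
 define f where "f k x = max 0 (abs (a k x * b x) - h * (a k x)^2)" for k x
 have fb: "f k x <= (b x)^2 / h" for k x
 proof -
  define A B where "A = abs (a k x)" and "B = abs (b x)"
  have AB: "abs (a k x * b x) = A * B" "(a k x)^2 = A * A" "(b x)^2 = B * B"
   by (auto simp: A_def B_def abs_mult sq_eq)
  have "0 <= (h * A - B / 2)^2" by simp
  hence "h * (A * B - h * (A * A)) <= B * B / 4"
   by (simp add: sq_eq algebra_simps)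
  moreover have "B * B / 4 <= B * B" by simp
  ultimately have "h * (abs (a k x * b x) - h * (a k x)^2) <= (b x)^2"
   unfolding AB by linarith
  hence "abs (a k x * b x) - h * (a k x)^2 <= (b x)^2 / h"
   using h by (simp add: field_simps)
  thus ?thesis unfolding f_def using h by simp
 qed
 have "(%k. \<integral>x. f k x \<partial>M) ----> (\<integral>x. 0 \<partial>M)"
 proof (rule integral_dominated_convergence)
  show "integrable M (%x. (b x)^2 / h)" using ib by simp
  show "AE x in M. (%k. f k x) ----> 0"
   using lim
  proof eventually_elim
   case (elim x)
   have "(%k. max 0 (abs (a k x * b x) - h * (a k x)^2)) ----> max 0 (abs (0 * b x) - h * 0^2)"
    by (intro tendsto_intros elim)
   thus ?case unfolding f_def by simp
  qed
  show "AE x in M. norm (f k x) <= (b x)^2 / h" for k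
   using fb by (intro AE_I2) (simp add: f_def)
 qed (auto simp: f_def[abs_def])
 hence "eventually (%k. (\<integral>x. f k x \<partial>M) < r / 2) sequentially"
  using r by (intro order_tendstoD(2)) auto
 then obtain N where N: "!!k. k \<ge> N ==> (\<integral>x. f k x \<partial>M) < r/2"
  by (auto simp: eventually_sequentially)
 have "norm ((\<integral>x. abs (a k x * b x) \<partial>M) - 0) < r" if "k \<ge> N" for k
 proof -
  have "(\<integral>x. abs (a k x * b x) \<partial>M) <= (\<integral>x. f k x + h * (a k x)^2 \<partial>M)"
  proof (rule integral_mono)
   show "integrable M (%x. abs (a k x * b x))"
    using integrable_prod_of_squares[OF _ _ ia ib] by auto
   have "integrable M (f k)"
   proof (rule Bintegrable_bound)
    show "integrable M (%x. (b x)^2 / h)" using ib by simp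
    show "AE x in M. norm (f k x) <= norm ((b x)^2 / h)"
     using fb h by (intro AE_I2) (simp add: f_def)
   qed (auto simp: f_def[abs_def])
   thus "integrable M (%x. f k x + h * (a k x)^2)" using ia by auto
  qed (simp add: f_def)
  also have "... = (\<integral>x. f k x \<partial>M) + h * (\<integral>x. (a k x)^2 \<partial>M)"
  proof -
   have "integrable M (f k)"
   proof (rule Bintegrable_bound)
    show "integrable M (%x. (b x)^2 / h)" using ib by simp
    show "AE x in M. norm (f k x) <= norm ((b x)^2 / h)"
     using fb h by (intro AE_I2) (simp add: f_def)
   qed (auto simp: f_def[abs_def])
   thus ?thesis using ia by simp
  qed
  also have "... < r/2 + h * C'"
   using N[OF that] C'(2)[of k] h by (intro add_less_le_mono mult_left_mono) auto
  also have "... = r" using C' by (simp add: h_def)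
  finally show ?thesis by (simp add: integral_nonneg_AE)
 qed
 thus "\<exists>no. \<forall>k\<ge>no. norm ((\<integral>x. abs (a k x * b x) \<partial>M) - 0) < r" by blast
qed

lemma AE_lborel_pair:
 assumes "AE x in lborel. P x"
 shows "AE p in LL. P (fst p) \<and> P (snd p)"
proof -
 from assms obtain N where N: "{x \<in> space lborel. \<not> P x} \<subseteq> N" "N \<in> null_sets lborel"
  by (auto simp: eventually_ae_filter)
 hence [measurable]: "N \<in> sets borel" by auto
 have nN: "AE x in lborel. x \<notin> N" using N(2) by (rule AE_not_in)
 let ?a = "LL"
 have "AE p in ?a. fst p \<notin> N \<and> snd p \<notin> N"
 proof (rule lborel_pair.AE_pair_measure)
  show "AE x in lborel. AE y in lborel. fst (x, y) \<notin> N \<and> snd (x, y) \<notin> N"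
   using nN by eventually_elim (use nN in \<open>auto\<close>)
  have "{p \<in> space BB. fst p \<notin> N \<and> snd p \<notin> N} \<in> sets BB"
   by measurable
  thus "{p \<in> space ?a. fst p \<notin> N \<and> snd p \<notin> N} \<in> sets ?a"
   by (simp add: space_pair_measure cong: sets_pair_measure_cong)
 qed
 thus ?thesis by eventually_elim (use N(1) in auto)
qed

lemma AE_lborel_imp_AE_gm:
 assumes "AE x in lborel. P x"
 shows "AE p in gm. P (fst p) \<and> P (snd p)"
 using AE_lborel_pair[OF assms] unfolding gm_def by (subst AE_density) auto

lemma norm_cis_diff_le: "cmod (cis a - cis b) <= abs (a - b)"
proof -
 have "csq (cis a - cis b) = 2 - 2 * cos (a - b)"
  using sin_cos_squared_add[of a] sin_cos_squared_add[of b]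
  unfolding cmod_power2 by (simp add: cos_diff sq_eq algebra_simps)
 also have "... = (2 * sin ((a - b) / 2))^2"
  using cos_double_sin[of "(a - b) / 2"] unfolding mult_2 field_sum_of_halves by (simp add: sq_eq)
 also have "... <= (a - b)^2"
  using abs_sin_x_le_abs_x[of "(a - b) / 2"] by (intro iffD1[OF abs_le_square_iff]) simp
 finally show ?thesis
  by (metis abs_ge_zero power2_abs power2_le_imp_le)
qed

lemma abs_sin_minus_id_le: "abs (sin a - a) <= a^2 / 2" for a :: real
proof -
 have "abs (sin a - (\<Sum>m<2. sin_coeff m * a ^ m)) <= inverse (fact 2) * abs a ^ 2"
  by (rule Maclaurin_sin_bound)
 thus ?thesis by (simp add: numeral_2_eq_2 sin_coeff_def)
qed

lemma Hmaps_cis: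
 assumes [measurable]: "h \<in> BM" and f: "gag h < \<infinity>"
 shows "(%x. cis (t * h x)) \<in> Hmaps" and "gagr (%x. cis (t * h x)) <= t^2 * gagr h"
proof -
 have m: "(%x. cis (t * h x)) \<in> BM"
  unfolding cis_conv_exp by (rule borel_measurable_continuous_on[of exp]) (auto intro: continuous_intros)
 have le: "dsq (%x. cis (t * h x)) p <= t^2 * dsq h p" for p
 proof -
  have "norm (cis (t * h (fst p)) - cis (t * h (snd p))) <= abs (t * (h (fst p) - h (snd p)))"
   using norm_cis_diff_le by (simp add: right_diff_distrib)
  from power_mono[OF this, of 2] show ?thesis by (simp add: power_mult_distrib)
 qed
 have i: "integrable gm (%p. t^2 * dsq h p)" using integrable_dsq[OF _ f] by auto
 have i2: "integrable gm (dsq (%x. cis (t * h x)))"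
  by (rule Bintegrable_bound[OF i measurable_dsq[OF m]]) (use le in auto)
 hence "gag (%x. cis (t * h x)) < \<infinity>"
  unfolding gag_def integrable_iff_bounded by simp
 thus "(%x. cis (t * h x)) \<in> Hmaps" using m by (simp add: Hmaps_def)
 show "gagr (%x. cis (t * h x)) <= t^2 * gagr h"
  unfolding gagr_def integral_mult_right_zero[symmetric] using i i2 le by (intro integral_mono) auto
qed

text \<open>By the product formula and \<open>abs (sin a - a) <= a^2 / 2\<close>, the energy along
  \<open>u * cis (t * h)\<close> exceeds that of \<open>u\<close> by at most a quadratic polynomial
  in \<open>t\<close> without constant term. Nonnegativity for all \<open>t\<close> kills its linear
  coefficient. Minimality is asked only along this curve, so the result also serves minimizers
  inside a degree class.\<close>

proposition euler_lagrange:
 fixes h :: "real => real"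
 assumes u: "u \<in> Hmaps" and [measurable]: "h \<in> BM" and f: "gag h < \<infinity>"
  and min: "!!t. gagr u <= gagr (%x. u x * cis (t * h x))"
 shows "(IG p. cross u p * (h (fst p) - h (snd p))) = 0"
proof -
 define I where "I = (IG p. cross u p * (h (fst p) - h (snd p)))"
 define N where "N = gagr h"
 have [measurable]: "cross u \<in> borel_measurable gm" using u by (intro measurable_cross HmapsD)
 have ih: "integrable gm (%p. (h (fst p) - h (snd p))^2)" using integrable_dsq[OF _ f] by simp
 have ic: "integrable gm (%p. cross u p * (h (fst p) - h (snd p)))"
  by (rule integrable_prod_of_squares[OF _ _ integrable_cross_sq[OF u] ih]) auto
 have "0 <= 2 * t * (N * t + I)" for t
 proof -
  define e where "e = (%x. cis (t * h x))"
  have e: "e \<in> Hmaps" "gagr e <= t^2 * N"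
   unfolding e_def N_def using Hmaps_cis[OF _ f] by auto
  have ce: "cross e p = sin (t * (h (fst p) - h (snd p)))" for p
   by (simp add: cross_def e_def cis_cnj cis_mult right_diff_distrib)
  have "(IG p. cross u p * cross e p) <= (IG p. t * (cross u p * (h (fst p) - h (snd p))) + t^2 / 2 * (h (fst p) - h (snd p))^2)"
  proof (rule integral_mono[OF integrable_cross_mult[OF u e(1)]])
   show "integrable gm (%p. t * (cross u p * (h (fst p) - h (snd p))) + t^2 / 2 * (h (fst p) - h (snd p))^2)"
    using ih ic by auto
   fix p
   define a where "a = t * (h (fst p) - h (snd p))"
   have "cross u p * (sin a - a) <= 1 * (a^2 / 2)"
   proof -
    have "cross u p * (sin a - a) <= abs (cross u p) * abs (sin a - a)"
     by (metis abs_ge_self abs_mult)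
    also have "... <= 1 * (a^2 / 2)"
     using cross_le(2)[OF u] abs_sin_minus_id_le by (intro mult_mono) auto
    finally show ?thesis .
   qed
   thus "cross u p * cross e p <= t * (cross u p * (h (fst p) - h (snd p))) + t^2 / 2 * (h (fst p) - h (snd p))^2"
    unfolding ce a_def[symmetric] by (simp add: a_def sq_eq algebra_simps)
  qed
  also have "... = t * I + (t^2 * N) / 2"
   unfolding I_def N_def gagr_def using ih ic by simp
  finally have 1: "(IG p. cross u p * cross e p) <= t * I + (t^2 * N) / 2" .
  have "0 <= (IG p. dsq u p * dsq e p)" by (intro integral_nonneg_AE) auto
  moreover have "gagr u <= gagr (%x. u x * e x)" using min[of t] by (simp add: e_def)
  moreover have "0 <= s + 2 * (q + s / 2)"
   if "0 <= Y" "a <= b" "X <= q + s / 2" "c <= s" "b = a + c + (2 * X - Y / 2)" for X Y a b c q s :: real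
   using that by simp
  ultimately have "0 <= t^2 * N + 2 * (t * I + (t^2 * N) / 2)"
   using 1 e(2) gagr_mult(2)[OF u e(1)] by blast
  thus ?thesis by (simp add: sq_eq algebra_simps)
 qed note * = this
 have N: "N \<ge> 0" unfolding N_def by (rule gagr_nonneg)
 have "I = 0"
 proof (rule ccontr)
  assume "I ~= 0"
  \<comment> \<open>The \<open>+ 1\<close> keeps the denominator positive when \<open>h\<close> has
    no energy.\<close>
  define t where "t = - I / (N + 1)"
  have Nt: "N * t + I = I / (N + 1)"
   using N by (simp add: t_def field_simps)
  have "2 * t * (N * t + I) = - (2 * (I / (N + 1))^2)"
   unfolding Nt by (simp add: t_def sq_eq)
  moreover have "2 * (I / (N + 1))^2 > 0"
   using N \<open>I \<noteq> 0\<close> by simp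
  ultimately show False using *[of t] by linarith
 qed
 thus ?thesis by (simp add: I_def)
qed

text \<open>A Brezis-Lieb splitting. Of the two interaction terms in \<open>gagr_mult\<close>, the
  one with \<open>cross\<close> vanishes because \<open>cross (w k)\<close> is bounded in L2 and
  tends to zero almost everywhere; the other is dominated by \<open>4 * dsq u\<close>.\<close>

proposition energy_splitting:
 assumes u: "u \<in> Hmaps" and w: "!!k. w k \<in> Hmaps" and bd: "!!k. gagr (w k) <= C"
  and lim: "AE x in lborel. (%k. w k x) ----> 1"
 shows "(%k. gagr (%x. u x * w k x) - gagr u - gagr (w k)) ----> 0"
proof -
 have limp: "AE p in gm. (%k. w k (fst p)) ----> 1 \<and> (%k. w k (snd p)) ----> 1"
  by (rule AE_lborel_imp_AE_gm[OF lim])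
 have mw: "w k \<in> BM" for k using w HmapsD by blast
 have mu: "u \<in> BM" using u HmapsD by blast
 have "(%k. (IG p. abs (cross (w k) p * cross u p))) ----> 0"
 proof (rule weak_null_product)
  show "(IG x. (cross (w k) x)^2) <= C" for k
  proof -
   have "(IG x. (cross (w k) x)^2) <= gagr (w k)"
    unfolding gagr_def using cross_le(3)[OF w] integrable_cross_sq[OF w] integrable_dsq[OF HmapsD(1,3)[OF w]]
    by (intro integral_mono) auto
   thus ?thesis using bd[of k] by simp
  qed
  show "AE x in gm. (%k. cross (w k) x) ----> 0"
   using limp
  proof eventually_elim
   case (elim p)
   hence "(%k. Im (w k (fst p) * cnj (w k (snd p)))) ----> Im (1 * cnj 1)"
    by (intro tendsto_intros) auto
   thus ?case by (simp add: cross_def)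
  qed
 qed (use u w in \<open>auto intro: integrable_cross_sq measurable_cross HmapsD\<close>)
 hence "(%k. abs (IG p. cross u p * cross (w k) p)) ----> 0"
  by (rule Lim_null_comparison[rotated])
   (auto simp: mult.commute abs_mult[symmetric] intro!: always_eventually order_trans[OF integral_abs_bound])
 hence 1: "(%k. (IG p. cross u p * cross (w k) p)) ----> 0"
  by (simp add: tendsto_rabs_zero_iff)
 have 2: "(%k. (IG p. dsq u p * dsq (w k) p)) ----> (IG p. 0)"
 proof (rule integral_dominated_convergence)
  show "integrable gm (%p. 4 * dsq u p)" using integrable_dsq HmapsD[OF u] by auto
  show "(%p. dsq u p * dsq (w k) p) \<in> borel_measurable gm" for k
   by (intro borel_measurable_times measurable_dsq mu mw)
  show "AE p in gm. norm (dsq u p * dsq (w k) p) <= 4 * dsq u p" for k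
   using dsq_le4[OF w] by (auto intro!: mult_mono simp: mult.commute[of 4])
  show "AE p in gm. (%k. dsq u p * dsq (w k) p) ----> 0"
   using limp
  proof eventually_elim
   case (elim p)
   hence "(%k. dsq u p * (norm (w k (fst p) - w k (snd p)))^2) ----> dsq u p * (norm (1 - 1::complex))^2"
    by (intro tendsto_intros) auto
   thus ?case by simp
  qed
 qed simp
 have "(%k. 2 * (IG p. cross u p * cross (w k) p) - (IG p. dsq u p * dsq (w k) p) / 2) ----> 2 * 0 - (IG p. 0) / 2"
  by (intro tendsto_intros 1 2) simp
 thus ?thesis
  using gagr_mult(2)[OF u w] by simp
qed

subsection \<open>Inserting a bubble into a minimizer\<close>

text \<open>The profile \<open>1 - X^2\<close> is made for two cancellations:
  \<open>x * tent y - y * tent x\<close> contains the factor \<open>x - y\<close>, which cancels the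
  singular weight, and the integral of \<open>1 / (x - y)^2\<close> over the exterior of
  \<open>[-1,1]\<close> is \<open>2 / tent x\<close>. The energy of the bubble thereby reduces to
  moments of \<open>1 / bubden\<close>.\<close>

definition tent :: "real => real" where "tent X = max 0 (1 - X^2)"

definition bubden :: "real => real => real" where "bubden e X = X^2 + (e * tent X)^2"

text \<open>A perturbation of the half-harmonic map \<open>(x - i e) / (x + i e)\<close>, equal to \<open>1\<close> outside \<open>[-1,1]\<close>.\<close>
definition bubble :: "real => real => complex" where
 "bubble e X = Complex X (- (e * tent X)) / Complex X (e * tent X)"

definition mom0 :: "real => real" where "mom0 e = (IL x. ind {-1..1} x * (1 / bubden e x))"
definition mom2 :: "real => real" where "mom2 e = (IL x. ind {-1..1} x * (x^2 / bubden e x))"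

lemma tent_bounds: "0 <= tent X" "tent X <= 1" by (auto simp: tent_def)

lemma tent_inside: "abs X <= 1 ==> tent X = 1 - X^2"
 by (auto simp: tent_def max_def abs_square_le_1)

lemma tent_outside: "abs X \<ge> 1 ==> tent X = 0"
 using one_le_power[of "abs X" 2] by (auto simp: tent_def)

lemma continuous_on_tent: "continuous_on S tent"
 unfolding tent_def by (intro continuous_intros)

lemma bubden_pos: "0 < e ==> 0 < bubden e X"
 by (cases "X = 0") (auto simp: bubden_def tent_def intro: add_pos_nonneg)

lemma continuous_on_bubden: "continuous_on S (bubden e)"
 unfolding bubden_def by (intro continuous_intros continuous_on_tent)

lemma measurable_tent [measurable]: "tent \<in> BM"
 by (intro borel_cont continuous_on_tent)

lemma measurable_bubden [measurable]: "bubden e \<in> BM"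
 by (intro borel_cont continuous_on_bubden)

lemma Re_bubble: "Re (bubble e X) = (X^2 - (e * tent X)^2) / bubden e X"
 and Im_bubble: "Im (bubble e X) = - (2 * e * X * tent X) / bubden e X"
 by (simp_all add: bubble_def Re_divide Im_divide bubden_def sq_eq)

lemma continuous_on_bubble:
 assumes "0 < e" shows "continuous_on S (bubble e)"
proof -
 have eq: "bubble e = (%X. Complex ((X^2 - (e * tent X)^2) / bubden e X) (- (2 * e * X * tent X) / bubden e X))"
  by (intro ext complex_eqI) (simp_all add: Re_bubble Im_bubble)
 show ?thesis unfolding eq using bubden_pos[OF assms]
  by (intro continuous_on_Complex continuous_intros continuous_on_tent continuous_on_bubden)
   (auto simp: less_imp_neq[symmetric])
qed

lemma measurable_bubble [measurable]: "0 < e ==> bubble e \<in> BM"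
 by (intro borel_cont continuous_on_bubble)

lemma norm_bubble: "0 < e ==> cmod (bubble e X) = 1"
proof -
 assume "0 < e"
 hence "Complex X (e * tent X) ~= 0"
  using bubden_pos[of e X] by (auto simp: bubden_def complex_eq_iff)
 moreover have "cmod (Complex X (- (e * tent X))) = cmod (Complex X (e * tent X))"
  by (simp add: complex_norm)
 ultimately show ?thesis by (simp add: bubble_def norm_divide)
qed

lemma bubble_outside: "0 < e ==> (abs X) \<ge> 1 ==> bubble e X = 1"
 by (auto simp: bubble_def tent_outside complex_eq_iff Re_divide Im_divide)

lemma Re_bubble_core:
 assumes "0 < e" "e <= 1" "abs X <= e / 2"
 shows "Re (bubble e X) <= 0"
proof -
 have 1: "X^2 <= (e / 2)^2" using assms power_mono[of "abs X" "e/2" 2] by simp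
 have "(e / 2)^2 <= (1 / 2)^2" using assms by (intro power_mono) auto
 hence "3 / 4 <= tent X" using 1 by (simp add: tent_def sq_eq)
 hence "e / 2 <= e * tent X" using assms by simp
 hence "(e / 2)^2 <= (e * tent X)^2" using assms by (intro power_mono) auto
 with 1 have "X^2 <= (e * tent X)^2" by linarith
 thus ?thesis using bubden_pos[OF assms(1), of X] by (simp add: Re_bubble divide_le_0_iff)
qed

text \<open>On \<open>(-1,1)\<close> this is \<open>arctan (X / (e * (1 - X^2)))\<close>. Written
  with \<open>Arg\<close> it stays continuous across the end points, since for \<open>0 < e\<close>
  the point \<open>Complex (e * tent X) (- X)\<close> never meets the nonpositive real axis.\<close>

definition bub_angle :: "real => real => real" where
 "bub_angle e X = - Arg (Complex (e * tent X) (- X))"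

lemma
 assumes e: "0 < e"
 shows continuous_bub_angle: "continuous_on S (bub_angle e)"
  and bubble_eq_cis: "bubble e X = cis (pi + 2 * bub_angle e X)"
  and bub_angle_ends: "bub_angle e 1 = pi / 2" "bub_angle e (-1) = - pi / 2"
  and bub_angle_deriv: "abs X < 1 ==> (bub_angle e has_real_derivative e * (1 + X^2) / bubden e X) (at X)"
proof -
 define q where "q X = Complex (e * tent X) (- X)" for X
 have q0: "q X ~= 0" for X using bubden_pos[OF e, of X] by (auto simp: q_def bubden_def complex_eq_iff)
 have qn: "q X \<notin> \<real>\<^sub>\<le>\<^sub>0" for X
 proof
  assume a: "q X \<in> \<real>\<^sub>\<le>\<^sub>0"
  hence "X = 0" "e * tent X <= 0" by (auto simp: q_def complex_nonpos_Reals_iff)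
  thus False using e by (simp add: tent_def)
 qed
 have "continuous_on S q" for S
  unfolding q_def by (intro continuous_on_Complex continuous_intros continuous_on_tent)
 thus "continuous_on S (bub_angle e)"
  unfolding bub_angle_def q_def[symmetric] using qn
  by (intro continuous_intros continuous_on_compose2[OF continuous_on_Arg]) auto
 have "q X = of_real (cmod (q X)) * cis (Arg (q X))"
  using cis_Arg[OF q0[of X]] q0[of X] by (simp add: sgn_div_norm scaleR_conv_of_real)
 hence c: "cnj (q X) / q X = cis (- 2 * Arg (q X))"
  using q0[of X] by (metis (no_types, lifting) Arg_zero cis_cnj cis_divide complex_cnj_complex_of_real complex_cnj_mult
    diff_minus_eq_add minus_diff_eq mult_2 mult_divide_mult_cancel_left mult_minus_left mult_zero_left uminus_add_conv_diff)
 have "Complex X (- (e * tent X)) = - \<i> * cnj (q X)" "Complex X (e * tent X) = \<i> * q X"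
  by (auto simp: q_def complex_eq_iff)
 hence "bubble e X = - (cnj (q X) / q X)"
  unfolding bubble_def by simp
 thus "bubble e X = cis (pi + 2 * bub_angle e X)"
  unfolding c bub_angle_def q_def[symmetric] by (simp add: complex_eq_iff)
 show "bub_angle e 1 = pi / 2" "bub_angle e (-1) = - pi / 2"
  by (simp_all add: bub_angle_def tent_def complex_eq_iff[of "Complex _ _"] Complex_eq Arg_minus_ii Arg_ii)
 assume X: "abs X < 1"
 have at: "bub_angle e Y = arctan (Y / (e * (1 - Y^2)))" if "Y \<in> {-1<..<1}" for Y
 proof -
  have "Y^2 < 1" using that by (simp add: abs_square_less_1 abs_less_iff)
  hence "Re (q Y) > 0" using that e by (simp add: q_def tent_def)
  hence "Arg (q Y) = arctan (Im (q Y) / Re (q Y))" by (rule arg_conv_arctan)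
  thus ?thesis using that \<open>Y^2 < 1\<close> unfolding bub_angle_def q_def[symmetric]
   by (simp add: q_def tent_def arctan_minus[symmetric])
 qed
 have X2: "X^2 < 1" using X by (simp add: abs_square_less_1)
 let ?a = "1 * (e * (1 - X^2)) - X * (e * (0 - 2 * X))"
 let ?b = "%Y. arctan (Y / (e * (1 - Y^2)))"
 let ?c = "(e * (1 - X^2)) * (e * (1 - X^2))"
 have "(?b has_real_derivative ?a / ?c * inverse (1 + (X / (e * (1 - X^2)))^2)) (at X)"
  using X2 e by (auto intro!: derivative_eq_intros)
 moreover have "?a / ?c * inverse (1 + (X / (e * (1 - X^2)))^2) = e * (1 + X^2) / bubden e X"
 proof -
  define c where "c = e * (1 - X^2)"
  have c: "c ~= 0" using X2 e by (simp add: c_def)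
  have bc: "bubden e X = c^2 + X^2" using X by (simp add: bubden_def tent_inside c_def)
  have "inverse (1 + (X / c)^2) = c^2 / (c^2 + X^2)"
   using c by (simp add: field_simps sq_eq)
  moreover have "1 * c - X * (e * (0 - 2 * X)) = e * (1 + X^2)"
   by (simp add: c_def sq_eq algebra_simps)
  ultimately show ?thesis using c unfolding c_def[symmetric] bc by (simp add: sq_eq)
 qed
 ultimately have "(?b has_real_derivative e * (1 + X^2) / bubden e X) (at X)"
  by simp
 thus "(bub_angle e has_real_derivative e * (1 + X^2) / bubden e X) (at X)"
  by (rule has_field_derivative_transform_within_open[where S="{-1<..<1}"]) (use X at in auto)
qed

section \<open>Moments and energy of the bubble\<close>

lemma integrable_indicator_continuous:
 fixes f :: "real => real"
 assumes "continuous_on {a..b} f"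
 shows "integrable lborel (%x. ind {a..b} x * f x)"
 using borel_integrable_atLeastAtMost'[OF assms] by (simp add: set_integrable_def)

lemma integrable_moments:
 assumes e: "0 < e"
 shows "integrable lborel (%x. ind {-1..1} x * (x ^ k / bubden e x))"
 using bubden_pos[OF e]
 by (intro integrable_indicator_continuous continuous_intros continuous_on_bubden) (auto simp: less_imp_neq[symmetric])

lemma integrable_mom:
 assumes e: "0 < e"
 shows "integrable lborel (%x. ind {-1..1} x * (1 / bubden e x))"
  "integrable lborel (%x. ind {-1..1} x * (x / bubden e x))"
  "integrable lborel (%x. ind {-1..1} x * (x^2 / bubden e x))"
 using integrable_moments[OF e, of 0] integrable_moments[OF e, of 1] integrable_moments[OF e, of 2] by auto

text \<open>\<open>e * (1 + X^2) / bubden e X\<close> is the derivative of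
  \<open>bub_angle e\<close>, whose total increment is \<open>pi\<close>.\<close>

lemma mom_sum:
 assumes e: "0 < e" shows "mom0 e + mom2 e = pi / e"
proof -
 let ?a = "%X. e * (1 + X^2) / bubden e X"
 have "(?a has_integral (bub_angle e 1 - bub_angle e (-1))) {-1..1}"
  using bub_angle_deriv[OF e] continuous_bub_angle[OF e]
  by (intro fundamental_theorem_of_calculus_interior) (auto simp: has_real_derivative_iff_has_vector_derivative)
 hence 1: "(?a has_integral pi) {-1..1}"
  by (simp add: bub_angle_ends[OF e])
 have c: "continuous_on {-1..1} ?a"
  using bubden_pos[OF e] by (intro continuous_intros continuous_on_bubden) (auto simp: less_imp_neq[symmetric])
 have "pi = (IL x. ind {-1..1} x * (e * (1 + x^2) / bubden e x))"
  using integral_unique[OF 1] set_borel_integral_eq_integral(2)[OF borel_integrable_atLeastAtMost'[OF c]]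
  by (simp add: set_lebesgue_integral_def)
 also have "... = (IL x. e * (ind {-1..1} x * (1 / bubden e x)) + e * (ind {-1..1} x * (x^2 / bubden e x)))"
  by (intro Bintegral_cong) (auto simp: ind_def add_divide_distrib distrib_left)
 also have "... = e * mom0 e + e * mom2 e"
  unfolding mom0_def mom2_def integral_mult_right_zero[symmetric]
  by (intro Bintegral_add integrable_mult_right integrable_mom e)
 finally show ?thesis using e by (simp add: field_simps)
qed

lemma mom_nonneg: "0 < e ==> 0 <= mom0 e" "0 < e ==> 0 <= mom2 e"
 unfolding mom0_def mom2_def using bubden_pos[of e]
 by (auto intro!: integral_nonneg_AE simp: less_imp_le)

lemma mom2_bounds:
 assumes e: "0 < e" shows "mom2 e <= 2" "2 - mom2 e <= e^2 * mom0 e"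
proof -
 note i0 = integrable_mom(1)[OF e] and i2 = integrable_mom(3)[OF e]
 have ii: "integrable lborel (%x. ind {-1..1::real} x * (1::real))"
  by (rule integrable_indicator_continuous) auto
 have two: "(IL x. ind {-1..1::real} x * (1::real)) = 2" by simp
 show "mom2 e <= 2"
  unfolding mom2_def two[symmetric] using bubden_pos[OF e]
  by (intro integral_mono i2 ii mult_left_mono) (auto simp: bubden_def divide_le_eq)
 have "2 - mom2 e = (IL x. ind {-1..1} x * 1 - ind {-1..1} x * (x^2 / bubden e x))"
  unfolding mom2_def by (subst Bintegral_diff[OF ii i2]) (use two in simp)
 also have "... <= (IL x. e^2 * (ind {-1..1} x * (1 / bubden e x)))"
 proof (intro integral_mono)
  fix x :: real
  have b: "bubden e x > 0" using bubden_pos[OF e] .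
  have "1 - x^2 / bubden e x = (e * tent x)^2 / bubden e x"
   using b by (simp add: field_simps) (simp add: bubden_def power_mult_distrib)
  also have "... <= e^2 / bubden e x"
   using b tent_bounds[of x] by (intro divide_right_mono) (auto simp: power_mult_distrib power_le_one mult_left_le)
  finally show "ind {-1..1} x * 1 - ind {-1..1} x * (x^2 / bubden e x) <= e^2 * (ind {-1..1} x * (1 / bubden e x))"
   by (auto simp: ind_def)
 qed (intro integrable_mult_right i0 Bintegrable_diff ii i2)+
 also have "... = e^2 * mom0 e" unfolding mom0_def by (rule integral_mult_right_zero)
 finally show "2 - mom2 e <= e^2 * mom0 e" .
qed

lemma mom1:
 assumes e: "0 < e" shows "(IL x. ind {-1..1} x * (x / bubden e x)) = 0"
proof -
 let ?f = "%x::real. ind {-1..1} x * (x / bubden e x)"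
 have "(IL x. ?f x) = (IL x. ?f (0 + (-1) * x))"
  by (subst lborel_integral_real_affine[where c="-1" and t=0]) auto
 also have "... = (IL x. - ?f x)"
  by (intro Bintegral_cong) (auto simp: ind_def bubden_def tent_def)
 finally show ?thesis by simp
qed

text \<open>The two Jacobian factors \<open>r\<close> cancel the \<open>r^2\<close> in the squared
  distance. The energy is scale invariant, so shrinking a bubble is free of cost.\<close>

lemma nn_integral_gm_affine:
 assumes r: "r > 0" and [measurable]: "F \<in> BM2"
 shows "(NG p. F ((fst p - t) / r, (snd p - t) / r)) = (NG p. F p)"
proof -
 let ?d = "%x y. 1 / ((t + r * x) - (t + r * y))^2"
 let ?a = "%x. abs r * (NL y. en (?d x y) * F (((t + r * x) - t) / r, ((t + r * y) - t) / r))"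
 let ?c = "%x. NL y. en (1 / (x - y)^2) * F (x, y)"
 have "(NG p. F ((fst p - t) / r, (snd p - t) / r)) = (NL x. NL y. en (1 / (x - y)^2) * F ((x - t) / r, (y - t) / r))"
  by (subst nn_integral_gm_iter) auto
 also have "... = (NL x. abs r * (NL y. en (1 / ((t + r * x) - y)^2) * F (((t + r * x) - t) / r, (y - t) / r)))"
  using r by (subst nn_integral_real_affine[where c=r and t=t]) (auto simp: nn_integral_cmult)
 also have "... = (NL x. abs r * ?a x)"
  using r by (intro nn_integral_cong arg_cong2[where f="(*)"] refl, subst nn_integral_real_affine[where c=r and t=t]) auto
 also have "... = (NL x. ?c x)"
 proof (intro nn_integral_cong)
  fix x :: real
  let ?b = "%y. abs r * (en (?d x y) * F (((t + r * x) - t) / r, ((t + r * y) - t) / r))"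
  have "abs r * ?a x = (NL y. abs r * ?b y)"
   by (subst nn_integral_cmult[symmetric], measurable, subst nn_integral_cmult[symmetric], measurable)
  also have "... = ?c x"
  proof (intro nn_integral_cong)
   fix y :: real
   have "(t + r * x) - (t + r * y) = r * (x - y)" by (simp add: algebra_simps)
   hence "r * (r * ?d x y) = 1 / (x - y)^2"
    using r by (simp add: sq_eq)
   moreover have "en (abs r) * (en (abs r) * (en z * G)) = en (r * (r * z)) * G" if "z \<ge> 0" for G z
    using r that by (simp add: ennreal_mult mult.assoc)
   ultimately show "abs r * ?b y = en (1 / (x - y)^2) * F (x, y)"
    using r by simp
  qed
  finally show "abs r * ?a x = ?c x" .
 qed
 also have "... = (NG p. F p)"
  by (subst nn_integral_gm_iter) auto
 finally show ?thesis .
qed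

lemma distr_gm_affine:
 assumes r: "r > 0"
 shows "distr gm gm (%p. ((fst p - t) / r, (snd p - t) / r)) = gm"
proof (rule measure_eqI)
 let ?a = "%p. %p. ((fst p - t) / r, (snd p - t) / r)"
 let ?b = "%p. distr gm gm (?a p)"
 fix A assume "A \<in> sets (?b p)"
 hence [measurable]: "A \<in> sets BB" by simp
 have "?a p \<in> gm \<rightarrow>\<^sub>M gm"
  by measurable
 hence "emeasure (?b p) A = (\<integral>\<^sup>+p. ind A p \<partial>(?b p))"
  by (subst nn_integral_indicator) auto
 also have "... = (NG p. ind A ((fst p - t) / r, (snd p - t) / r))"
  by (subst nn_integral_distr) auto
 also have "... = emg A"
  by (subst nn_integral_gm_affine[OF r]) auto
 finally show "emeasure (?b p) A = emg A" .
qed simp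

lemma gag_affine:
 assumes r: "r > 0" and [measurable]: "u \<in> BM"
 shows "gag (%x. u ((x - t) / r)) = gag u"
 unfolding gag_def
 using nn_integral_gm_affine[OF r, of "%p. en (dsq u p)" t] by simp

lemma Hmaps_affine:
 assumes r: "r > 0" and u: "u \<in> Hmaps"
 shows "(%x. u ((x - t) / r)) \<in> Hmaps" "gagr (%x. u ((x - t) / r)) = gagr u"
proof -
 have [measurable]: "u \<in> BM" using u HmapsD by auto
 let ?a = "%x. u ((x - t) / r)"
 show *: "?a \<in> Hmaps"
  using u gag_affine[OF r, of u t] by (auto simp: Hmaps_def)
 have "en (gagr ?a) = en (gagr u)"
  using gag_affine[OF r, of u t] gag_eq_gagr[OF HmapsD(1,3)[OF u]] gag_eq_gagr[OF HmapsD(1,3)[OF *]] by simp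
 thus "gagr ?a = gagr u"
  by (simp add: gagr_nonneg)
qed

lemma nn_integral_outside:
 assumes "abs x < 1"
 shows "(NL y. ind (- {-1..1}) y * en (1 / (x - y)^2)) <= en (2 / tent x)"
proof -
 let ?d = "%a. NL y. en (1 / (a - y)^2) * ind {1..} y"
 have r: "?d a = en (1 / (1 - a))" if "abs a < 1" for a :: real
 proof -
  have "?d a = en (0 - - (1 / (1 - a)))"
  proof (rule nn_integral_FTC_atLeast[where F="%y. - (1 / (y - a))"])
   show "DERIV (%y. - (1 / (y - a))) y :> 1 / (a - y)^2" if "1 <= y" for y
    using that \<open>\<bar>a\<bar> < 1\<close> by (auto intro!: derivative_eq_intros simp: sq_eq field_simps)
   show "((%y. - (1 / (y - a))) \<longlongrightarrow> 0) at_top"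
    by real_asymp
  qed auto
  thus ?thesis by simp
 qed
 let ?a = "NL y. en (1 / (- x - y)^2) * ind {1..} y"
 let ?b = "NL y. en (1 / (x - y)^2) * ind {..-1} y"
 let ?c = "NL y. en (1 / (x - y)^2) * ind {1..} y"
 have "(NL y. ind (- {-1..1}) y * en (1 / (x - y)^2))
  <= (NL y. en (1 / (x - y)^2) * ind {1..} y + en (1 / (x - y)^2) * ind {..-1} y)"
  by (intro nn_integral_mono) (auto simp: ind_def)
 also have "... = ?c + ?b"
  by (intro nn_integral_add) auto
 also have "?b = ?a"
 proof -
  have "?b = (NL y. en (1 / (x - (0 + (-1) * y))^2) * ind {..-1} (0 + (-1) * y))"
   by (subst nn_integral_real_affine[where c="-1" and t=0]) auto
  also have "... = ?a"
   by (intro nn_integral_cong) (auto simp: ind_def sq_eq algebra_simps)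
  finally show ?thesis .
 qed
 also have "?c = en (1 / (1 - x))" using r assms by simp
 also have "?a = en (1 / (1 + x))" using r[of "-x"] assms by simp
 also have "en (1 / (1 - x)) + en (1 / (1 + x)) = en (1 / (1 - x) + 1 / (1 + x))"
  using assms by (subst ennreal_plus) auto
 also have "1 / (1 - x) + 1 / (1 + x) = 2 / tent x"
 proof -
  have t: "tent x = (1 - x) * (1 + x)" using assms by (simp add: tent_inside sq_eq algebra_simps)
  show ?thesis unfolding t using assms by (simp add: field_simps)
 qed
 finally show ?thesis .
qed

lemma dsq_bubble:
 assumes e: "0 < e"
 shows "dsq (bubble e) p = 4 * e^2 * (fst p * tent (snd p) - snd p * tent (fst p))^2 / (bubden e (fst p) * bubden e (snd p))"
proof -
 obtain x y where p: "p = (x, y)" by force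
 define b c where "b = Complex x (e * tent x)" and "c = Complex y (e * tent y)"
 have nb: "csq b = bubden e x" "csq c = bubden e y"
  by (auto simp: b_def c_def cmod_power2 bubden_def)
 have "b ~= 0" "c ~= 0" using nb bubden_pos[OF e] by (metis norm_zero zero_power2 less_irrefl)+
 hence d1: "bubble e x - bubble e y = (cnj b * c - cnj c * b) / (b * c)"
  unfolding bubble_def b_def[symmetric] c_def[symmetric]
  by (simp add: b_def[symmetric] c_def[symmetric] complex_eq_iff[of "cnj _"] diff_frac_eq mult.commute)
   (simp add: b_def c_def complex_eq_iff)
 define r where "r = e * (x * tent y - y * tent x)"
 have d2: "cnj b * c - cnj c * b = 2 * \<i> * of_real r"
  by (simp add: r_def b_def c_def complex_eq_iff algebra_simps)
 have "cmod (bubble e x - bubble e y) = 2 * abs r / (cmod b * cmod c)"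
  unfolding d1 d2 by (simp add: norm_divide norm_mult)
 hence "csq (bubble e x - bubble e y) = 4 * r^2 / (bubden e x * bubden e y)"
  using nb by (simp add: power_divide power_mult_distrib)
 thus ?thesis
  unfolding p by (simp add: r_def power_mult_distrib)
qed

lemma tent_cross: "abs x <= 1 ==> (abs y) <= 1 ==> x * tent y - y * tent x = (x - y) * (1 + x * y)"
 by (simp add: tent_inside sq_eq algebra_simps)

text \<open>Pairs inside the square give \<open>(1 + x * y)^2\<close> over the two densities, which
  factors into moments because the first moment vanishes by parity. Pairs with one point outside are
  handled by \<open>nn_integral_outside\<close>, which leaves \<open>tent x = 1 - x^2\<close> over
  the density and so the difference of moments; they occur twice by symmetry. Pairs outside
  contribute nothing.\<close>

lemma gag_bubble_le_moments:
 assumes e: "0 < e"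
 shows "gag (bubble e) <= en (4 * e^2 * ((mom0 e)^2 + (mom2 e)^2) + 16 * e^2 * (mom0 e - mom2 e))"
proof -
 let ?I = "ind {-1..1::real} :: real => real"
 let ?J = "ind (- {-1..1::real}) :: real => ennreal"
 define T where "T x y = ?I x * (?I y * (4 * e^2 * (1 + x * y)^2 / (bubden e x * bubden e y)))" for x y
 let ?f = "%x. 4 * e^2 * (tent x)^2 / bubden e x"
 define R where "R x y = en (?I x * ?f x) * (?J y * en (1 / (x - y)^2))" for x y
 note [measurable] = measurable_bubble[OF e]
 have [measurable]: "(%p. en (T (fst p) (snd p))) \<in> BM2"
  "(%p. R (fst p) (snd p)) \<in> BM2"
  "(%p. R (snd p) (fst p)) \<in> BM2"
  unfolding T_def R_def by measurable
 have bp: "bubden e x > 0" "bubden e x ~= 0" for x using bubden_pos[OF e, of x] by auto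
 let ?b = "%x. x^2 / bubden e x"
 let ?c = "%x. 1 / bubden e x"
 have mle: "?I x * ?b x <= ?I x * ?c x" for x
 proof (cases "abs x <= 1")
  case True
  hence "x^2 / bubden e x <= 1 / bubden e x"
   using bp(1)[of x] by (intro divide_right_mono) (auto simp: abs_square_le_1)
  thus ?thesis by (simp add: ind_def)
 qed (auto simp: ind_def)
 let ?g = "%x y. dsq (bubble e) (x, y)"
 have point: "en (1 / (x - y)^2) * en (?g x y) <= en (T x y) + R x y + R y x" for x y
 proof (cases "abs x <= 1")
  case x: True
  show ?thesis
  proof (cases "abs y <= 1")
   case y: True
   have "dsq (bubble e) (x, y) = 4 * e^2 * ((x - y)^2 * (1 + x * y)^2) / (bubden e x * bubden e y)"
    using dsq_bubble[OF e, of "(x, y)"] tent_cross[OF x y] by (simp add: power_mult_distrib)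
   hence "1 / (x - y)^2 * dsq (bubble e) (x, y) <= T x y"
    using x y bp[of x] bp[of y] unfolding T_def
    by (cases "x = y") (auto simp: abs_le_iff ind_def)
   hence "en (1 / (x - y)^2) * en (?g x y) <= en (T x y)"
    by (subst ennreal_mult'[symmetric]) (auto intro: ennreal_leI)
   thus ?thesis by (meson add_increasing2 order_trans zero_le)
  next
   case y: False
   hence ty: "tent y = 0" "bubden e y = y^2" "y ~= 0" by (auto simp: tent_outside bubden_def)
   have "dsq (bubble e) (x, y) = 4 * e^2 * (tent x)^2 / bubden e x"
    using dsq_bubble[OF e, of "(x, y)"] ty by (simp add: power_mult_distrib)
   hence "en (1 / (x - y)^2) * en (?g x y) = R x y"
    unfolding R_def using x y by (auto simp: abs_le_iff ind_def mult.commute)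
   thus ?thesis by (simp add: add.commute add.left_commute)
  qed
 next
  case x: False
  hence tx: "tent x = 0" "bubden e x = x^2" "x ~= 0" by (auto simp: tent_outside bubden_def)
  show ?thesis
  proof (cases "abs y <= 1")
   case y: True
   have "dsq (bubble e) (x, y) = 4 * e^2 * (tent y)^2 / bubden e y"
    using dsq_bubble[OF e, of "(x, y)"] tx by (simp add: power_mult_distrib)
   hence "en (1 / (x - y)^2) * en (?g x y) = R y x"
    unfolding R_def using x y by (auto simp: abs_le_iff ind_def mult.commute power2_commute[of x y])
   thus ?thesis by (simp add: add.commute add.left_commute)
  next
   case y: False
   hence "tent y = 0" by (simp add: tent_outside)
   hence "dsq (bubble e) (x, y) = 0"
    using dsq_bubble[OF e, of "(x, y)"] tx by simp
   thus ?thesis by simp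
  qed
 qed
 let ?d = "NL x. NL y. en (T x y)"
 let ?e = "8 * e^2 * (mom0 e - mom2 e)"
 let ?i = "4 * e^2 * ((mom0 e)^2 + (mom2 e)^2)"
 have "gag (bubble e) = (NL x. NL y. en (1 / (x - y)^2) * en (?g x y))"
  unfolding gag_def by (subst nn_integral_gm_iter) auto
 also have "... <= (NL x. NL y. en (T x y) + R x y + R y x)"
  by (intro nn_integral_mono point)
 also have "... = ?d + (NL x. NL y. R x y) + (NL x. NL y. R y x)"
  unfolding T_def R_def by (simp add: nn_integral_add)
 also have "(NL x. NL y. R y x) = (NL x. NL y. R x y)"
  by (rule lborel_pair.Fubini') (simp add: R_def case_prod_beta)
 also have "(NL x. NL y. R x y) <= en ?e"
 proof -
  let ?h = "IL x. 8 * e^2 * (?I x * ?c x - ?I x * ?b x)"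
  have "(NL y. R x y) <= en (8 * e^2 * (?I x * ?c x - ?I x * ?b x))" for x
  proof (cases "abs x < 1")
   case True
   hence t: "tent x > 0" "?I x = 1" "tent x = 1 - x^2" by (auto simp: tent_inside abs_square_less_1 abs_less_iff)
   have "(NL y. R x y) = en (?I x * ?f x) * (NL y. ?J y * en (1 / (x - y)^2))"
    unfolding R_def by (intro nn_integral_cmult) auto
   also have "... <= en (?I x * ?f x) * en (2 / tent x)"
    by (intro mult_left_mono nn_integral_outside True) auto
   also have "... = en (4 * e^2 * (tent x)^2 / bubden e x * (2 / tent x))"
    using bp[of x] t by (subst ennreal_mult) (auto simp: less_imp_le)
   also have "4 * e^2 * (tent x)^2 / bubden e x * (2 / tent x) = 8 * e^2 * (?I x * ?c x - ?I x * ?b x)"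
   proof -
    have "4 * e^2 * (tent x)^2 / bubden e x * (2 / tent x) = 8 * e^2 * (tent x / bubden e x)"
     using t(1) by (simp add: sq_eq)
    thus ?thesis using t(2) by (simp add: t(3) diff_divide_distrib)
   qed
   finally show ?thesis by (simp add: mult.assoc)
  next
   case False
   hence "tent x = 0" by (simp add: tent_outside)
   thus ?thesis by (simp add: R_def)
  qed
  hence "(NL x. NL y. R x y) <= (NL x. en (8 * e^2 * (?I x * ?c x - ?I x * ?b x)))"
   by (intro nn_integral_mono) simp
  also have "... = en ?h"
  proof (rule nn_integral_eq_integral)
   show "integrable lborel (%x. 8 * e^2 * (?I x * ?c x - ?I x * ?b x))"
    by (intro integrable_mult_right Bintegrable_diff integrable_mom e)
   show "AE x in lborel. 0 <= 8 * e^2 * (?I x * ?c x - ?I x * ?b x)"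
    using mle by (intro AE_I2 mult_nonneg_nonneg) auto
  qed
  also have "?h = 8 * e^2 * (mom0 e - mom2 e)"
   unfolding mom0_def mom2_def
   by (subst Bintegral_diff[symmetric, OF integrable_mom(1,3)[OF e]]) (rule integral_mult_right_zero)
  finally show ?thesis .
 qed
 also have "?d = en ?i"
 proof -
  let ?a = "%x. mom0 e * (?I x * ?c x) + mom2 e * (?I x * ?b x)"
  have in1: "(NL y. en (T x y)) = en (4 * e^2 * ?a x)" for x
  proof -
   define k where "k = ?I x * (4 * e^2 / bubden e x)"
   have eq: "T x y = k * (?I y * (1 / bubden e y)) + 2 * x * k * (?I y * (y / bubden e y)) + x^2 * k * (?I y * (y^2 / bubden e y))" for y
    using bp[of y] bp[of x] unfolding T_def k_def by (simp add: field_simps sq_eq)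
   have "(NL y. en (T x y)) = en (IL y. T x y)"
   proof (rule nn_integral_eq_integral)
    show "integrable lborel (T x)" unfolding eq
     by (intro Bintegrable_add integrable_mult_right integrable_mom e)
    show "AE y in lborel. 0 <= T x y" unfolding T_def using bp(1) by (auto intro!: mult_nonneg_nonneg divide_nonneg_nonneg simp: less_imp_le)
   qed
   also have "(IL y. T x y) = k * mom0 e + 2 * x * k * 0 + x^2 * k * mom2 e"
    unfolding eq mom0_def mom2_def mom1[OF e, symmetric] integral_mult_right_zero[symmetric]
    by (subst Bintegral_add, (intro Bintegrable_add integrable_mult_right integrable_mom e)+)
     (subst Bintegral_add, (intro integrable_mult_right integrable_mom e)+, rule refl)
   finally show ?thesis by (simp add: k_def algebra_simps)
  qed
  have "?d = en (IL x. 4 * e^2 * ?a x)"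
   unfolding in1
  proof (rule nn_integral_eq_integral)
   show "integrable lborel (%x. 4 * e^2 * ?a x)"
    by (intro Bintegrable_add integrable_mult_right integrable_mom e)
   show "AE x in lborel. 0 <= 4 * e^2 * ?a x"
    using bp(1) mom_nonneg[OF e] by (auto intro!: mult_nonneg_nonneg add_nonneg_nonneg simp: less_imp_le)
  qed
  also have "(IL x. 4 * e^2 * ?a x) = 4 * e^2 * (mom0 e * mom0 e + mom2 e * mom2 e)"
   unfolding integral_mult_right_zero
   by (subst Bintegral_add, (intro integrable_mult_right integrable_mom e)+)
    (simp only: integral_mult_right_zero mom0_def[symmetric] mom2_def[symmetric])
  finally show ?thesis by (simp add: sq_eq)
 qed
 finally have "gag (bubble e) <= en ?i + en ?e + en ?e"
  by (auto intro: add_mono order_trans)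
 moreover have "mom2 e <= mom0 e"
  unfolding mom0_def mom2_def
  by (intro integral_mono integrable_mom e mle)
 ultimately show ?thesis
  by (simp add: ennreal_plus[symmetric] ac_simps del: ennreal_plus)
qed

text \<open>Put \<open>m = mom2 e\<close>, so that \<open>mom0 e = pi / e - m\<close>. The terms of
  order \<open>e\<close> combine to \<open>8 * pi * e * (2 - m)\<close>, and \<open>2 - m\<close> is
  itself at most \<open>e * pi\<close>. The excess over \<open>4 * pi^2\<close> is therefore
  quadratic in \<open>e\<close>, below the gain of order \<open>e\<close> that has to beat
  it.\<close>

proposition gag_bubble_le:
 assumes e: "0 < e"
 shows "gag (bubble e) <= en (4 * pi^2 + 8 * pi^2 * e^2)"
proof (rule order_trans[OF gag_bubble_le_moments[OF e] ennreal_leI])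
 define m where "m = mom2 e"
 have a0: "mom0 e = pi / e - m" using mom_sum[OF e] by (simp add: m_def)
 have m: "0 <= m" "m <= 2" using mom_nonneg[OF e] mom2_bounds[OF e] by (auto simp: m_def)
 have "2 - m <= e^2 * (pi / e)"
  using mom2_bounds(2)[OF e] m a0 by (smt (verit) m_def mult_left_mono zero_le_power2)
 hence m2: "2 - m <= e * pi" using e by (simp add: sq_eq)
 have "4 * e^2 * ((mom0 e)^2 + m^2) + 16 * e^2 * (mom0 e - m) = 4 * pi^2 + 8 * pi * e * (2 - m) - 8 * e^2 * (m * (4 - m))"
  unfolding a0 using e by (simp add: sq_eq field_simps)
 also have "... <= 4 * pi^2 + 8 * pi * e * (e * pi)"
 proof -
  have "8 * pi * e * (2 - m) <= 8 * pi * e * (e * pi)" using e m2 by (intro mult_left_mono) auto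
  moreover have "0 <= 8 * e^2 * (m * (4 - m))" using m by (intro mult_nonneg_nonneg) auto
  ultimately show ?thesis by linarith
 qed
 finally show "4 * e^2 * ((mom0 e)^2 + (mom2 e)^2) + 16 * e^2 * (mom0 e - mom2 e) <= 4 * pi^2 + 8 * pi^2 * e^2"
  unfolding m_def[symmetric] by (simp add: sq_eq ac_simps)
qed

lemma Hmaps_bubble:
 assumes "0 < e" shows "bubble e \<in> Hmaps" "gagr (bubble e) <= 4 * pi^2 + 8 * pi^2 * e^2"
proof -
 have "gag (bubble e) < \<infinity>" using gag_bubble_le[OF assms] by (rule le_less_trans) simp
 thus *: "bubble e \<in> Hmaps" using measurable_bubble[OF assms] norm_bubble[OF assms] by (simp add: Hmaps_def)
 show "gagr (bubble e) <= 4 * pi^2 + 8 * pi^2 * e^2"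
  using gag_bubble_le[OF assms] unfolding gag_eq_gagr[OF HmapsD(1,3)[OF *]]
  by (subst (asm) ennreal_le_iff) auto
qed

text \<open>The part of \<open>cross (bubble e)\<close> that is not a difference of values of a function supported in \<open>[-1,1]\<close>; that difference is killed by the Euler-Lagrange equation of \<open>u\<close>.\<close>
definition bubker :: "real => real \<times> real => real" where
 "bubker e p = 4 * e ^ 3 * (tent (fst p) * tent (snd p) * ((1 + fst p * snd p) * (fst p - snd p)))
   / (bubden e (fst p) * bubden e (snd p))"

definition invden :: "real => real => real" where
 "invden e X = ind {-1..1} X * (1 / bubden e X)"

lemma measurable_bubker [measurable]: "bubker e \<in> BM2"
 unfolding bubker_def by measurable

lemma measurable_invden [measurable]: "invden e \<in> BM"
 unfolding invden_def by measurable

lemma invden_nonneg: "0 < e ==> 0 <= invden e X"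
 using bubden_pos[of e X] by (auto simp: invden_def)

lemma integral_invden: "0 < e ==> integrable lborel (invden e)" "(IL x. invden e x) = mom0 e"
 using integrable_mom(1)[of e] by (auto simp: invden_def[abs_def] mom0_def)

lemma mom0_le: assumes "0 < e" shows "e * mom0 e <= pi"
proof -
 have "mom0 e <= pi / e" using mom_sum[OF assms] mom_nonneg(2)[OF assms] by linarith
 thus ?thesis using assms by (simp add: field_simps)
qed

lemma tent_prod_cross: "tent x * tent y * (x * tent y - y * tent x) = tent x * tent y * ((1 + x * y) * (x - y))"
proof (cases "abs x <= 1 \<and> abs y <= 1")
 case True
 thus ?thesis using tent_cross[of x y] by (simp add: mult.commute)
next
 case False
 hence "tent x * tent y = 0" by (auto simp: tent_outside)
 thus ?thesis by simp
qed

lemma bubker_alt: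
 assumes e: "0 < e"
 shows "bubker e p = Im (bubble e (fst p)) * (Re (bubble e (snd p)) - 1) - (Re (bubble e (fst p)) - 1) * Im (bubble e (snd p))"
proof -
 obtain x y where p: "p = (x, y)" by force
 have R: "Re (bubble e z) - 1 = - (2 * (e * tent z)^2) / bubden e z" for z
  using bubden_pos[OF e, of z] by (simp add: Re_bubble field_simps) (simp add: bubden_def power_mult_distrib algebra_simps)
 have "Im (bubble e x) * (Re (bubble e y) - 1) - (Re (bubble e x) - 1) * Im (bubble e y)
  = 4 * e ^ 3 * (tent x * tent y * (x * tent y - y * tent x)) / (bubden e x * bubden e y)"
  unfolding R Im_bubble using bubden_pos[OF e, of x] bubden_pos[OF e, of y]
  by (simp add: field_simps sq_eq power3_eq_cube)
 thus ?thesis unfolding p bubker_def tent_prod_cross by simp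
qed

lemma cross_bubble:
 assumes e: "0 < e"
 shows "cross (bubble e) p = Im (bubble e (fst p)) - Im (bubble e (snd p)) + bubker e p"
 unfolding bubker_alt[OF e] cross_def by (simp add: algebra_simps)

lemma one_minus_Re_bubble:
 assumes e: "0 < e"
 shows "0 <= 1 - Re (bubble e X)" "1 - Re (bubble e X) <= 2 * e^2 * invden e X"
proof -
 show "0 <= 1 - Re (bubble e X)" using complex_Re_le_cmod[of "bubble e X"] norm_bubble[OF e, of X] by simp
 show "1 - Re (bubble e X) <= 2 * e^2 * invden e X"
 proof (cases "abs X <= 1")
  case True
  have b: "bubden e X > 0" using bubden_pos[OF e] .
  have "1 - Re (bubble e X) = 2 * (e * tent X)^2 / bubden e X"
   using b by (simp add: Re_bubble field_simps) (simp add: bubden_def power_mult_distrib algebra_simps)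
  also have "... <= 2 * e^2 / bubden e X"
   using b tent_bounds[of X] by (intro divide_right_mono) (auto simp: power_mult_distrib power_le_one mult_left_le)
  finally show ?thesis using True by (simp add: invden_def ind_def abs_le_iff)
 next
  case False
  thus ?thesis using bubble_outside[OF e, of X] invden_nonneg[OF e, of X] by simp
 qed
qed

lemma bubker_le_sum:
 assumes e: "0 < e"
 shows "abs (bubker e p) <= 2 * e^2 * invden e (fst p) + 2 * e^2 * invden e (snd p)"
proof -
 have i: "abs (Im (bubble e X)) <= 1" for X using abs_Im_le_cmod[of "bubble e X"] norm_bubble[OF e, of X] by simp
 have r: "abs (Re (bubble e X) - 1) <= 2 * e^2 * invden e X" for X
  using one_minus_Re_bubble[OF e, of X] by linarith
 have "abs (bubker e p) <= abs (Im (bubble e (fst p))) * abs (Re (bubble e (snd p)) - 1) + abs (Re (bubble e (fst p)) - 1) * abs (Im (bubble e (snd p)))"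
  unfolding bubker_alt[OF e] abs_mult[symmetric] by (rule abs_triangle_ineq4)
 also have "... <= 1 * (2 * e^2 * invden e (snd p)) + (2 * e^2 * invden e (fst p)) * 1"
  using invden_nonneg[OF e] by (intro add_mono mult_mono i r) auto
 finally show ?thesis by simp
qed

lemma bubker_le_prod:
 assumes e: "0 < e"
 shows "abs (bubker e p) <= 8 * e ^ 3 * abs (fst p - snd p) * (invden e (fst p) * invden e (snd p))"
proof (cases "abs (fst p) <= 1 \<and> abs (snd p) <= 1")
 case True
 obtain x y where p: "p = (x, y)" by force
 have xy: "abs x <= 1" "abs y <= 1" using True p by auto
 have b: "bubden e x > 0" "bubden e y > 0" using bubden_pos[OF e] by auto
 let ?a = "abs (1 + x * y) * abs (x - y)"
 let ?b = "bubden e x * bubden e y"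
 let ?c = "2 * abs (x - y)"
 have "abs (x * y) <= 1" using xy by (simp add: abs_mult mult_le_one)
 hence "abs (1 + x * y) <= 2" by linarith
 moreover have "tent x * tent y <= 1" using tent_bounds by (simp add: mult_le_one)
 ultimately have "tent x * tent y * ?a <= 1 * ?c"
  using tent_bounds by (intro mult_mono) auto
 hence "4 * e ^ 3 * (tent x * tent y * ?a) / ?b <= 4 * e ^ 3 * (1 * ?c) / ?b"
  using b e by (intro divide_right_mono mult_left_mono) auto
 moreover have "abs (bubker e p) = 4 * e ^ 3 * (tent x * tent y * ?a) / ?b"
  using b e tent_bounds by (simp add: bubker_def p abs_mult)
 moreover have "8 * e ^ 3 * abs (fst p - snd p) * (invden e (fst p) * invden e (snd p)) = 4 * e ^ 3 * (1 * ?c) / ?b"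
  using xy by (simp add: p invden_def ind_def abs_le_iff)
 ultimately show ?thesis by linarith
next
 case False
 hence "tent (fst p) * tent (snd p) = 0" by (auto simp: tent_outside)
 hence "bubker e p = 0" unfolding bubker_def by (simp only: mult_zero_left mult_zero_right div_0)
 thus ?thesis using e invden_nonneg[OF e] by simp
qed

lemma bubker_outside: "abs (fst p) \<ge> 1 \<or> abs (snd p) \<ge> 1 ==> bubker e p = 0"
 by (auto simp: bubker_def tent_outside)

lemma invden_le_away:
 assumes e: "0 < e" and s: "0 < s" "s <= abs X"
 shows "invden e X <= 1 / s^2"
proof -
 have "s^2 <= X^2" using s power_mono[of s "abs X" 2] by simp
 also have "... <= bubden e X" by (simp add: bubden_def)
 finally have "1 / bubden e X <= 1 / s^2" using s by (intro divide_left_mono) (auto intro!: mult_pos_pos bubden_pos e)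
 thus ?thesis using s by (auto simp: invden_def ind_def)
qed

text \<open>Of two points at least one has distance from \<open>0\<close> not below half of their
  difference, and there the density is bounded by \<open>invden_le_away\<close>.\<close>

lemma invden_prod_le:
 assumes e: "0 < e" and d: "fst p ~= snd p"
 shows "invden e (fst p) * invden e (snd p) <= 4 / (fst p - snd p)^2 * (invden e (fst p) + invden e (snd p))"
proof -
 define s where "s = abs (fst p - snd p) / 2"
 have s: "s > 0" using d by (simp add: s_def)
 have s2s: "2 * s = abs (fst p - snd p)" by (simp add: s_def)
 have s2: "1 / s^2 = 4 / (fst p - snd p)^2" by (simp add: s_def power_divide)
 have nn: "0 <= invden e (fst p)" "0 <= invden e (snd p)" using invden_nonneg[OF e] by auto
 let ?a = "invden e (fst p) + invden e (snd p)"
 have "s <= abs (fst p) \<or> s <= abs (snd p)" 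
  using abs_triangle_ineq4[of "fst p" "snd p"] s2s by linarith
 thus ?thesis
 proof
  assume "s <= abs (fst p)"
  hence "invden e (fst p) * invden e (snd p) <= 1 / s^2 * invden e (snd p)"
   by (intro mult_right_mono invden_le_away[OF e s] nn)
  also have "... <= 1 / s^2 * ?a"
   using nn by (intro mult_left_mono) auto
  finally show ?thesis unfolding s2 .
 next
  assume "s <= abs (snd p)"
  hence "invden e (fst p) * invden e (snd p) <= invden e (fst p) * (1 / s^2)"
   by (intro mult_left_mono invden_le_away[OF e s] nn)
  also have "... <= 1 / s^2 * ?a"
   using nn by (simp add: mult.commute mult_left_mono divide_right_mono)
  finally show ?thesis unfolding s2 .
 qed
qed

text \<open>Compared with \<open>bubker_le_sum\<close> this wins a factor of order
  \<open>e / abs (fst p - snd p)\<close>: at a fixed distance from the diagonal the kernel is one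
  order smaller in \<open>e\<close>.\<close>

lemma bubker_le_far:
 assumes e: "0 < e" and d: "fst p ~= snd p"
 shows "abs (bubker e p) <= 32 * e ^ 3 / abs (fst p - snd p) * (invden e (fst p) + invden e (snd p))"
proof -
 let ?a = "invden e (fst p) + invden e (snd p)"
 have "abs (bubker e p) <= 8 * e ^ 3 * abs (fst p - snd p) * (invden e (fst p) * invden e (snd p))"
  by (rule bubker_le_prod[OF e])
 also have "... <= 8 * e ^ 3 * abs (fst p - snd p) * (4 / (fst p - snd p)^2 * ?a)"
  using e by (intro mult_left_mono invden_prod_le[OF e d]) auto
 also have "... = 32 * e ^ 3 / abs (fst p - snd p) * ?a"
 proof -
  have *: "8 * a * D * (4 / D^2 * q) = 32 * a / D * q" if "D > 0" for a D q :: real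
   using that by (simp add: sq_eq)
  have "abs (fst p - snd p) > 0" using d by simp
  from *[OF this] show ?thesis by (simp only: power2_abs)
 qed
 finally show ?thesis .
qed

lemma bubker_sq:
 assumes e: "0 < e"
 shows "integrable gm (%p. (bubker e p)^2)"
proof (rule Bintegrable_bound)
 note H = Hmaps_bubble(1)[OF e]
 show "integrable gm (%p. 4 * dsq (bubble e) p)" using integrable_dsq[OF HmapsD(1,3)[OF H]] by simp
 have "(bubker e p)^2 <= 4 * dsq (bubble e) p" for p
 proof -
  let ?a = "bubble e (fst p) - bubble e (snd p)"
  have "abs (bubker e p) <= abs (cross (bubble e) p) + abs (Im ?a)"
   unfolding cross_bubble[OF e] by simp
  also have "... <= cmod ?a + cmod ?a"
   by (intro add_mono cross_le(1)[OF H] abs_Im_le_cmod)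
  finally have "abs (bubker e p) <= 2 * cmod ?a" by simp
  from power_mono[OF this, of 2] show ?thesis by (simp add: power_mult_distrib)
 qed
 thus "AE p in gm. norm ((bubker e p)^2) <= norm (4 * dsq (bubble e) p)" by simp
qed measurable

lemma integral_gm_affine:
 fixes F :: "real \<times> real => real"
 assumes r: "r > 0" and [measurable]: "F \<in> BM2"
 shows "(IG p. F ((fst p - t) / r, (snd p - t) / r)) = (IG p. F p)"
  and "integrable gm (%p. F ((fst p - t) / r, (snd p - t) / r)) \<longleftrightarrow> integrable gm F"
proof -
 have m: "(%p. ((fst p - t) / r, (snd p - t) / r)) \<in> gm \<rightarrow>\<^sub>M gm" by measurable
 have F: "F \<in> borel_measurable gm" by measurable
 show "(IG p. F ((fst p - t) / r, (snd p - t) / r)) = (IG p. F p)"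
  using integral_distr[OF m F] unfolding distr_gm_affine[OF r] by simp
 show "integrable gm (%p. F ((fst p - t) / r, (snd p - t) / r)) \<longleftrightarrow> integrable gm F"
  using integrable_distr_eq[OF m F] unfolding distr_gm_affine[OF r] by simp
qed

section \<open>The bubble rescaled to \<open>[t - r, t + r]\<close> and its interaction with
  \<open>u\<close>\<close>

definition wb :: "real => real => real => real => complex" where
 "wb e r t x = bubble e ((x - t) / r)"

definition Ab :: "real => real => real => real \<times> real => real" where
 "Ab e r t p = bubker e ((fst p - t) / r, (snd p - t) / r)"

lemma measurable_Ab [measurable]: "(%q. Ab e r (fst q) (snd q)) \<in> borel_measurable (borel \<Otimes>\<^sub>M BB)"
 "Ab e r t \<in> BM2"
 unfolding Ab_def by measurable

lemma Hmaps_wb: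
 assumes "0 < e" "0 < r"
 shows "wb e r t \<in> Hmaps" "gagr (wb e r t) <= 4 * pi^2 + 8 * pi^2 * e^2"
 unfolding wb_def[abs_def]
 using Hmaps_affine[OF assms(2) Hmaps_bubble(1)[OF assms(1)]] Hmaps_bubble(2)[OF assms(1)] by auto

lemma Ab_sq: "0 < e ==> 0 < r ==> integrable gm (%p. (Ab e r t p)^2)"
 "0 < e ==> 0 < r ==> (IG p. (Ab e r t p)^2) = (IG p. (bubker e p)^2)"
 unfolding Ab_def using integral_gm_affine[of r "%p. (bubker e p)^2" t] bubker_sq[of e] by auto

lemma Ab_outside: "0 < r ==> (abs (fst p - t)) \<ge> r \<or> abs (snd p - t) \<ge> r ==> Ab e r t p = 0"
 unfolding Ab_def by (intro bubker_outside) auto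

lemma cross_wb:
 assumes "0 < e"
 shows "cross (wb e r t) p = Im (wb e r t (fst p)) - Im (wb e r t (snd p)) + Ab e r t p"
 using cross_bubble[OF assms, of "((fst p - t) / r, (snd p - t) / r)"]
 by (simp add: cross_def wb_def Ab_def)

lemma gag_Im_le:
 assumes "w \<in> Hmaps" shows "gag (%x. Im (w x)) < \<infinity>"
proof -
 have "gag (%x. Im (w x)) <= gag w"
  unfolding gag_def
 proof (intro nn_integral_mono ennreal_leI)
  fix p
  have "abs (Im (w (fst p) - w (snd p))) <= cmod (w (fst p) - w (snd p))" by (rule abs_Im_le_cmod)
  from power_mono[OF this, of 2] show "dsq (%x. Im (w x)) p <= dsq w p" by simp
 qed
 thus ?thesis using HmapsD(3)[OF assms] by (rule le_less_trans)
qed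

text \<open>The window of the bubble lies in \<open>[-1,1]\<close>, so \<open>Im (wb e r t)\<close>
  is an admissible phase variation, and the corresponding part of \<open>cross (wb e r t)\<close>
  pairs with \<open>cross u\<close> to zero. Only \<open>Ab\<close> survives in first order; the
  last term is the second order gain.\<close>

lemma bubble_insertion_energy:
 assumes u: "u \<in> Hmaps" and e: "0 < e" and r: "0 < r" and t: "-1 <= t - r" "t + r <= 1"
  and EL: "!!h::real => real. h \<in> BM ==> (\<forall>x. x \<notin> {-1<..<1} --> h x = 0) ==> gag h < \<infinity> ==>
   (IG p. cross u p * (h (fst p) - h (snd p))) = 0"
 shows "gagr (%x. u x * wb e r t x) <= gagr u + 4 * pi^2 + 8 * pi^2 * e^2
   + 2 * (IG p. cross u p * Ab e r t p) - (IG p. dsq u p * dsq (wb e r t) p) / 2"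
proof -
 define w where "w = wb e r t"
 define h where "h x = Im (w x)" for x
 have w: "w \<in> Hmaps" "gagr w <= 4 * pi^2 + 8 * pi^2 * e^2" using Hmaps_wb[OF e r] by (auto simp: w_def)
 have [measurable]: "w \<in> BM" "u \<in> BM" using HmapsD w u by auto
 have [measurable]: "h \<in> BM" unfolding h_def by measurable
 have gh: "gag h < \<infinity>" unfolding h_def[abs_def] by (rule gag_Im_le[OF w(1)])
 have "\<forall>x. x \<notin> {-1<..<1} --> h x = 0"
 proof (intro allI impI)
  fix x :: real assume "x \<notin> {-1<..<1}"
  hence "abs (x - t) \<ge> r" using t r by auto
  hence "abs ((x - t) / r) \<ge> 1" using r by simp
  thus "h x = 0" using bubble_outside[OF e] by (simp add: h_def w_def wb_def)
 qed
 hence E0: "(IG p. cross u p * (h (fst p) - h (snd p))) = 0"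
  by (intro EL gh) auto
 have mc: "cross u \<in> borel_measurable gm" using u by (intro measurable_cross HmapsD)
 have i1: "integrable gm (%p. cross u p * (h (fst p) - h (snd p)))"
  using integrable_dsq[OF _ gh]
  by (intro integrable_prod_of_squares mc integrable_cross_sq u) auto
 have i2: "integrable gm (%p. cross u p * Ab e r t p)"
  by (intro integrable_prod_of_squares mc integrable_cross_sq u Ab_sq e r) measurable
 have "(IG p. cross u p * cross w p) = (IG p. cross u p * (h (fst p) - h (snd p)) + cross u p * Ab e r t p)"
  by (intro Bintegral_cong refl) (simp add: w_def cross_wb[OF e] h_def distrib_left)
 also have "... = (IG p. cross u p * Ab e r t p)"
  using i1 i2 E0 by simp
 finally show ?thesis
  using gagr_mult(2)[OF u w(1)] w(2) unfolding w_def[symmetric] by simp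
qed

section \<open>The phase on the square and the interaction that is linear in it\<close>

definition Qsq :: "real \<times> real => real" where
 "Qsq p = ind {-1..1} (fst p) * ind {-1..1} (snd p)"

lemma measurable_Qsq [measurable]: "Qsq \<in> BM2"
 unfolding Qsq_def by measurable

lemma Qsq_01: "0 <= Qsq p" "Qsq p <= 1"
 by (auto simp: Qsq_def ind_def)

lemma nn_integral_prod_lborel:
 fixes f g :: "real => ennreal"
 assumes [measurable]: "f \<in> BM" "g \<in> BM"
 shows "(NP p. f (fst p) * g (snd p)) = (NL x. f x) * (NL x. g x)"
proof -
 have "(NP p. f (fst p) * g (snd p)) = (NL x. NL y. f x * g y)"
  by (subst lborel.nn_integral_fst[symmetric]) auto
 also have "... = (NL x. f x * (NL y. g y))"
  by (intro nn_integral_cong nn_integral_cmult) auto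
 also have "... = (NL x. f x) * (NL x. g x)"
  by (intro nn_integral_multc) auto
 finally show ?thesis .
qed

lemma nn_integral_gm_le:
 fixes g :: "real \<times> real => real"
 assumes [measurable]: "g \<in> BM2"
  and le: "!!p. g p <= (fst p - snd p)^2 * b p" and b: "!!p. 0 <= b p"
 shows "(NG p. en (g p)) <= (NP p. en (b p))"
proof -
 have "1 / (fst p - snd p)^2 * g p <= b p" for p
 proof (cases "fst p = snd p")
  case False
  thus ?thesis using le[of p] by (simp add: divide_le_eq mult.commute)
 qed (use b in auto)
 thus ?thesis
  by (subst nn_integral_gm) (auto intro!: nn_integral_mono ennreal_leI simp: ennreal_mult'[symmetric])
qed

lemma integrable_Qsq_dist: "integrable gm (%p. Qsq p * (fst p - snd p)^2)"
proof -
 have "(NG p. en (Qsq p * (fst p - snd p)^2)) <= (NP p. en (Qsq p))"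
  by (rule nn_integral_gm_le) (auto simp: Qsq_01 mult.commute)
 also have "... = (NP p. ind {-1..1::real} (fst p) * ind {-1..1::real} (snd p))"
  by (intro nn_integral_cong) (auto simp: Qsq_def ind_def)
 also have "... < \<infinity>"
  by (subst nn_integral_prod_lborel) (auto simp: ennreal_mult_less_top)
 finally show ?thesis
  by (intro integrableI_bounded) (auto simp: Qsq_01 abs_mult)
qed

lemma small_angle_le:
 assumes "abs (a - b) <= 1"
 shows "(a - b)^2 <= 2 * csq (cis a - cis b)"
proof -
 define d where "d = (a - b) / 2"
 have d: "abs d <= 1 / 2" "a - b = 2 * d" using assms by (auto simp: d_def)
 have "abs d - abs (sin d) <= d^2 / 2" using abs_sin_minus_id_le[of d] by linarith
 moreover have "d^2 / 2 <= abs d / 4"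
 proof -
  have "d^2 = abs d * abs d" by (simp add: sq_eq)
  also have "... <= abs d * (1 / 2)" using d(1) by (intro mult_left_mono) auto
  finally show ?thesis by simp
 qed
 ultimately have "3 / 4 * abs d <= abs (sin d)" by simp
 from power_mono[OF this, of 2] have s: "9 / 16 * d^2 <= (sin d)^2" by (simp add: power_mult_distrib power_divide)
 have "csq (cis a - cis b) = 2 - 2 * cos (a - b)"
  using sin_cos_squared_add[of a] sin_cos_squared_add[of b]
  unfolding cmod_power2 by (simp add: cos_diff sq_eq algebra_simps)
 also have "... = 4 * (sin d)^2" unfolding d(2) cos_double_sin by simp
 finally have "csq (cis a - cis b) = 4 * (sin d)^2" .
 moreover have "(a - b)^2 = 4 * d^2" unfolding d(2) by (simp add: power_mult_distrib)
 ultimately show ?thesis using s zero_le_power2[of d] by linarith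
qed

text \<open>Near the diagonal the two phases differ by at most \<open>1\<close>, and
  \<open>small_angle_le\<close> bounds their difference by the chord, hence by the energy density of
  \<open>u\<close>. Away from it the phase is bounded by \<open>M\<close> and the distance is at
  least \<open>d\<close>.\<close>

lemma integrable_phase:
 fixes f :: "real => real"
 assumes u: "u \<in> Hmaps" and c: "continuous_on UNIV f" and M: "!!x. abs (f x) <= M"
  and uf: "!!x. x \<in> {-1..1} ==> u x = cis (f x)"
 shows "integrable gm (%p. Qsq p * (f (fst p) - f (snd p))^2)"
proof -
 have [measurable]: "f \<in> BM" by (intro borel_cont c)
 have "uniformly_continuous_on {-1..1} f"
  by (intro compact_uniformly_continuous continuous_on_subset[OF c]) auto
 then obtain d where d: "d > 0" "!!x y. x \<in> {-1..1} ==> y \<in> {-1..1} ==> dist x y < d ==> dist (f x) (f y) < 1"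
  unfolding uniformly_continuous_on_def 
  by (meson zero_less_one)
 have M0: "M \<ge> 0" using M[of 0] by simp
 let ?a = "%p. f (fst p) - f (snd p)"
 let ?b = "%p. Qsq p * (fst p - snd p)^2"
 have le: "Qsq p * ?a p^2 <= 2 * dsq u p + (4 * M^2 / d^2) * ?b p" for p
 proof (cases "fst p \<in> {-1..1} \<and> snd p \<in> {-1..1}")
  case True
  hence Q: "Qsq p = 1" by (auto simp: Qsq_def)
  show ?thesis
  proof (cases "abs (fst p - snd p) < d")
   case near: True
   hence "abs (f (fst p) - f (snd p)) <= 1" using d(2)[of "fst p" "snd p"] True by (auto simp: dist_real_def)
   from small_angle_le[OF this] have "?a p^2 <= 2 * dsq u p" using uf True by auto
   moreover have "0 <= (4 * M^2 / d^2) * ?b p" by (auto simp: Qsq_01)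
   ultimately show ?thesis unfolding Q by linarith
  next
   case far: False
   have "abs (f (fst p) - f (snd p)) <= 2 * M" using M[of "fst p"] M[of "snd p"] by linarith
   from power_mono[OF this, of 2] have "?a p^2 <= 4 * M^2" by (simp add: power_mult_distrib)
   also have "... <= (4 * M^2 / d^2) * (fst p - snd p)^2"
   proof -
    have "d^2 <= (fst p - snd p)^2" using far d(1) power_mono[of d "abs (fst p - snd p)" 2] by simp
    hence "(4 * M^2 / d^2) * d^2 <= (4 * M^2 / d^2) * (fst p - snd p)^2" by (intro mult_left_mono) auto
    thus ?thesis using d(1) by simp
   qed
   finally show ?thesis unfolding Q mult_1 by (rule add_increasing[rotated]) simp
  qed
 next
  case False
  hence "Qsq p = 0" by (auto simp: Qsq_def)
  thus ?thesis by simp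
 qed
 show ?thesis
 proof (rule Bintegrable_bound)
  show "integrable gm (%p. 2 * dsq u p + (4 * M^2 / d^2) * ?b p)"
   using integrable_dsq[OF HmapsD(1,3)[OF u]] integrable_Qsq_dist by (intro Bintegrable_add integrable_mult_right) auto
  show "AE p in gm. norm (Qsq p * ?a p^2) <= norm (2 * dsq u p + (4 * M^2 / d^2) * ?b p)"
  proof (rule AE_I2)
   fix p
   have "0 <= Qsq p * ?a p^2" by (simp add: Qsq_01)
   thus "norm (Qsq p * ?a p^2) <= norm (2 * dsq u p + (4 * M^2 / d^2) * ?b p)"
    using le[of p] unfolding real_norm_def by linarith
  qed
 qed measurable
qed

text \<open>The derivative in \<open>Z\<close> of the integral of \<open>F (t + Z)\<close> over
  \<open>[a,b]\<close> is \<open>F (b + Z) - F (a + Z)\<close>, small where \<open>F\<close> nearly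
  agrees at the two ends. This trades the missing derivative of the phase for a difference of its
  values.\<close>

lemma continuous_primitive_bound:
 fixes F :: "real => real"
 assumes c: "continuous_on UNIV F" and ab: "a <= b"
  and B: "!!Z. Z \<in> closed_segment z z' ==> (abs (F (b + Z) - F (a + Z))) <= B"
 shows "abs ((IL t. ind {a..b} t * F (t + z)) - (IL t. ind {a..b} t * F (t + z'))) <= B * abs (z - z')"
proof -
 define R where "R = abs a + abs b + abs z + abs z' + 1"
 obtain G where G: "!!x. x \<in> {-R..R} ==> (G has_vector_derivative F x) (at x within {-R..R})"
  using antiderivative_continuous[OF continuous_on_subset[OF c]] by blast
 have D: "(G has_real_derivative F x) (at x)" if "abs x < R" for x
 proof -
  have x: "-R < x" "x < R" using that by linarith+
  hence "at x within {-R..R} = at x" by (intro at_within_interior) simp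
  moreover have "(G has_vector_derivative F x) (at x within {-R..R})" using x by (intro G) simp
  ultimately show ?thesis by (simp only: has_real_derivative_iff_has_vector_derivative)
 qed
 have seg: "abs Z <= abs z + abs z'" if "Z \<in> closed_segment z z'" for Z
  using that by (auto simp: closed_segment_eq_real_ivl split: if_splits)
 have P: "(IL t. ind {a..b} t * F (t + Z)) = G (b + Z) - G (a + Z)" if "Z \<in> closed_segment z z'" for Z
 proof -
  have c': "continuous_on {a..b} (%t. F (t + Z))" by (intro continuous_on_compose2[OF c] continuous_intros) auto
  have "((%t. F (t + Z)) has_integral (G (b + Z) - G (a + Z))) {a..b}"
  proof (rule fundamental_theorem_of_calculus[OF ab])
   fix t assume t: "t \<in> {a..b}"
   have "abs (t + Z) < R" using t seg[OF that] unfolding R_def abs_le_iff abs_less_iff atLeastAtMost_iff by linarith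
   hence "((%t. G (t + Z)) has_real_derivative F (t + Z)) (at t)"
    using DERIV_shift[of G "F (t + Z)" t Z] D by simp
   thus "((%t. G (t + Z)) has_vector_derivative F (t + Z)) (at t within {a..b})"
    by (simp add: has_real_derivative_iff_has_vector_derivative has_vector_derivative_at_within)
  qed
  thus ?thesis
   using integral_unique set_borel_integral_eq_integral(2)[OF borel_integrable_atLeastAtMost'[OF c']]
   by (simp add: set_lebesgue_integral_def)
 qed
 have "norm ((G (b + z) - G (a + z)) - (G (b + z') - G (a + z'))) <= B * norm (z - z')"
 proof (rule field_differentiable_bound[where S="closed_segment z z'" and f'="%Z. F (b + Z) - F (a + Z)"])
  fix Z assume Z: "Z \<in> closed_segment z z'"
  have "abs (b + Z) < R" "abs (a + Z) < R" using seg[OF Z] unfolding R_def by linarith+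
  hence "((%Z. G (Z + b) - G (Z + a)) has_real_derivative F (b + Z) - F (a + Z)) (at Z)"
   using D DERIV_shift[of G "F (b + Z)" Z b] DERIV_shift[of G "F (a + Z)" Z a]
   by (intro DERIV_diff) (auto simp: add.commute)
  thus "((%Z. G (b + Z) - G (a + Z)) has_field_derivative F (b + Z) - F (a + Z)) (at Z within closed_segment z z')"
   by (simp add: add.commute has_field_derivative_at_within)
 qed (use B in auto)
 thus ?thesis using P[of z] P[of z'] by simp
qed

lemma phase_Ab_integrable:
 assumes c: "continuous_on UNIV f" and ip: "integrable gm (%p. Qsq p * (f (fst p) - f (snd p))^2)"
  and e: "0 < e" and r: "0 < r" and t: "-1 <= t - r" "t + r <= 1"
 shows "integrable gm (%p. (f (fst p) - f (snd p)) * Ab e r t p)" (is ?A)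
  and "(IG p. abs ((f (fst p) - f (snd p)) * Ab e r t p)) <= (IG p. Qsq p * (f (fst p) - f (snd p))^2) + (IG p. (bubker e p)^2)" (is ?B)
proof -
 have [measurable]: "f \<in> BM" by (intro borel_cont c)
 let ?a = "%p. f (fst p) - f (snd p)"
 have le: "abs (?a p * Ab e r t p) <= Qsq p * ?a p^2 + (Ab e r t p)^2" for p
 proof (cases "fst p \<in> {-1..1} \<and> snd p \<in> {-1..1}")
  case True
  define v z where "v = f (fst p) - f (snd p)" and "z = Ab e r t p"
  have "2 * abs (v * z) <= v^2 + z^2"
   using sum_squares_bound[of "abs v" "abs z"] by (simp add: abs_mult)
  hence "abs (v * z) <= v^2 + z^2" by linarith
  thus ?thesis using True unfolding v_def[symmetric] z_def[symmetric] by (simp add: Qsq_def)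
 next
  case False
  hence "abs (fst p - t) \<ge> r \<or> abs (snd p - t) \<ge> r" using t by auto
  thus ?thesis using Ab_outside[OF r, of p t e] by (simp add: Qsq_01)
 qed
 have i: "integrable gm (%p. Qsq p * ?a p^2 + (Ab e r t p)^2)"
  using ip Ab_sq(1)[OF e r] by simp
 show ?A
  by (rule Bintegrable_bound[OF i]) (measurable, intro AE_I2, use le in \<open>simp add: Qsq_01\<close>)
 hence "(IG p. abs (?a p * Ab e r t p)) <= (IG p. Qsq p * ?a p^2 + (Ab e r t p)^2)"
  by (intro integral_mono i le) (rule integrable_abs)
 also have "... = (IG p. Qsq p * ?a p^2) + (IG p. (bubker e p)^2)"
  using ip Ab_sq[OF e r, of t] by simp
 finally show ?B .
qed

text \<open>Rescaling around \<open>t\<close> makes the kernel independent of the centre, so Fubini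
  moves the average onto the phase: \<open>g\<close> becomes \<open>G z\<close>, the integral of
  \<open>g (t + z)\<close> over \<open>[a,b]\<close>. Its slope is at most \<open>h\<close> for
  \<open>abs z <= r * s\<close> and at most \<open>2 * M\<close> everywhere. In the second case one
  kernel factor is evaluated away from its peak, which produces the additional factor
  \<open>e\<close>.\<close>

lemma linear_term_bound:
 fixes g :: "real => real"
 assumes c: "continuous_on UNIV g" and M: "!!x. abs (g x) <= M"
  and ip: "integrable gm (%p. Qsq p * (g (fst p) - g (snd p))^2)"
  and ab: "a <= b" and r: "0 < r" "-1 <= a - r" "b + r <= 1" and e: "0 < e"
  and s: "0 < s" and h: "!!z. abs z <= r * s ==> (abs (g (b + z) - g (a + z))) <= h"
 shows "integrable lborel (%t. ind {a..b} t * (IG p. (g (fst p) - g (snd p)) * Ab e r t p))"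
  and "abs (IL t. ind {a..b} t * (IG p. (g (fst p) - g (snd p)) * Ab e r t p))
   <= 8 * r * e * (h * pi^2 + e * (8 * M / s^2 * pi))"
proof -
 have [measurable]: "g \<in> BM" by (intro borel_cont c)
 interpret gm: sigma_finite_measure gm by (rule gm_sigma_finite)
 interpret P: pair_sigma_finite "lborel :: real measure" gm ..
 define F where "F t p = (g (t + r * fst p) - g (t + r * snd p)) * bubker e p" for t p
 define f where "f q = ind {a..b} (fst q) * F (fst q) (snd q)" for q :: "real \<times> real \<times> real"
 have Fm [measurable]: "F t \<in> BM2" for t unfolding F_def by measurable
 have [measurable]: "f \<in> borel_measurable (lborel \<Otimes>\<^sub>M gm)" unfolding f_def F_def by measurable
 have F_eq: "F t ((fst p - t) / r, (snd p - t) / r) = (g (fst p) - g (snd p)) * Ab e r t p" for t p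
  using r by (simp add: F_def Ab_def)
 let ?a = "%t. IG p. (g (fst p) - g (snd p)) * Ab e r t p"
 let ?h = "IG p. Qsq p * (g (fst p) - g (snd p))^2"
 have FI: "integrable gm (F t)" "(IG p. F t p) = ?a t"
  "(IG p. abs (F t p)) <= ?h + (IG p. (bubker e p)^2)"
  if "t \<in> {a..b}" for t
 proof -
  have t: "-1 <= t - r" "t + r <= 1" using that r by auto
  note * = phase_Ab_integrable[OF c ip e r(1) t]
  show "integrable gm (F t)" using integral_gm_affine(2)[OF r(1) Fm, of t t] *(1) unfolding F_eq by simp
  show "(IG p. F t p) = ?a t"
   using integral_gm_affine(1)[OF r(1) Fm, of t t] unfolding F_eq by simp
  have m: "(%p. abs (F t p)) \<in> BM2" by measurable
  show "(IG p. abs (F t p)) <= ?h + (IG p. (bubker e p)^2)"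
   using integral_gm_affine(1)[OF r(1) m, of t] *(2) unfolding F_eq by simp
 qed
 define C where "C = ?h + (IG p. (bubker e p)^2)"
 have int_f: "integrable (lborel \<Otimes>\<^sub>M gm) f"
 proof (rule P.Fubini_integrable)
  let ?j = "%t. IG p. norm (f (t, p))"
  show "integrable lborel (%t. ?j t)"
  proof (rule Bintegrable_bound)
   show "integrable lborel (%t. ind {a..b} t * C)"
    by (rule integrable_indicator_continuous) auto
   show "(%t. ?j t) \<in> borel_measurable lborel"
    by (rule gm.borel_measurable_lebesgue_integral) measurable
   show "AE t in lborel. norm (?j t) <= norm (ind {a..b} t * C)"
   proof (intro AE_I2)
    fix t
    show "norm (?j t) <= norm (ind {a..b} t * C)"
     using FI(3)[of t] by (auto simp: f_def ind_def C_def intro: order_trans[OF _ abs_ge_self])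
   qed
  qed
  show "AE t in lborel. integrable gm (%p. f (t, p))"
   using FI(1) by (intro AE_I2) (auto simp: f_def ind_def)
 qed simp
 have f_inner: "(IG p. f (t, p)) = ind {a..b} t * ?a t" for t
  using FI(2)[of t] by (simp add: f_def ind_def)
 show "integrable lborel (%t. ind {a..b} t * ?a t)"
  using P.integrable_fst[of "%t p. f (t, p)"] int_f unfolding f_inner by simp
 define G where "G z = (IL t. ind {a..b} t * g (t + z))" for z
 have ig: "integrable lborel (%t. ind {a..b} t * g (t + z))" for z
  by (intro integrable_indicator_continuous continuous_on_compose2[OF c] continuous_intros) auto
 let ?b = "%p. G (r * fst p) - G (r * snd p)"
 have f_outer: "(IL t. f (t, p)) = bubker e p * ?b p" for p
 proof -
  have "(IL t. f (t, p)) = (IL t. bubker e p * (ind {a..b} t * g (t + r * fst p) - ind {a..b} t * g (t + r * snd p)))"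
   by (intro Bintegral_cong) (auto simp: f_def F_def algebra_simps)
  also have "... = bubker e p * ?b p"
   unfolding G_def by (subst Bintegral_diff[OF ig ig, symmetric]) (rule integral_mult_right_zero)
  finally show ?thesis .
 qed
 have h0: "0 <= h" using h[of 0] s r by simp
 have M0: "0 <= M" using M[of 0] by linarith
 have M2: "abs (g x - g y) <= 2 * M" for x y using M[of x] M[of y] by linarith
 define K where "K = invden e"
 have K0: "0 <= K x" for x unfolding K_def by (rule invden_nonneg[OF e])
 define I :: "real => real" where "I x = ind {-1..1} x" for x
 \<comment> \<open>The majorant left after splitting off \<open>(fst p - snd p)^2\<close>, which
   cancels the weight of \<open>gm\<close>: one factor of the difference comes from the kernel, one
   from the slope of \<open>G\<close>. Only products of functions of one variable remain.\<close>
 define B where "B p = 8 * e ^ 3 * r * (h * (K (fst p) * K (snd p)) + 2 * M / s^2 * (K (fst p) * I (snd p) + I (fst p) * K (snd p)))" for p :: "real \<times> real"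
 have I0: "0 <= I x" for x by (simp add: I_def)
 have B0: "0 <= B p" for p unfolding B_def using e r h0 K0 M0 I0
  by (intro mult_nonneg_nonneg add_nonneg_nonneg divide_nonneg_nonneg) auto
 have key: "abs (bubker e p * ?b p) <= (fst p - snd p)^2 * B p" for p
 proof (cases "abs (fst p) <= 1 \<and> abs (snd p) <= 1")
  case False
  hence "bubker e p = 0" by (intro bubker_outside) auto
  thus ?thesis using B0[of p] by simp
 next
  case True
  obtain x y where p: "p = (x, y)" by force
  have xy: "abs x <= 1" "abs y <= 1" using True p by auto
  have Ixy: "I x = 1" "I y = 1" using xy by (auto simp: I_def abs_le_iff)
  \<comment> \<open>\<open>m\<close> is the slope of \<open>G\<close> along the segment:
    \<open>h\<close> if both points are within \<open>s\<close>, otherwise \<open>2 * M\<close>, and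
    then one of the two densities is at most \<open>1 / s^2\<close>.\<close>
  have "\<exists>m. 0 <= m \<and> abs (G (r * x) - G (r * y)) <= m * abs (r * x - r * y) \<and> m * (K x * K y) <= h * (K x * K y) + 2 * M / s^2 * (K x + K y)"
  proof (cases "abs x <= s \<and> abs y <= s")
   case near: True
   have "abs (G (r * x) - G (r * y)) <= h * abs (r * x - r * y)"
    unfolding G_def
   proof (rule continuous_primitive_bound[OF c ab])
    fix z assume "z \<in> closed_segment (r * x) (r * y)"
    moreover have "abs (r * x) <= r * s" "abs (r * y) <= r * s" using near r by (auto simp: abs_mult)
    ultimately have "abs z <= r * s" by (auto simp: closed_segment_eq_real_ivl split: if_splits)
    thus "abs (g (b + z) - g (a + z)) <= h" by (rule h)
   qed
   moreover have "0 <= 2 * M / s^2 * (K x + K y)" using M0 K0 by (intro mult_nonneg_nonneg divide_nonneg_nonneg add_nonneg_nonneg) auto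
   ultimately show ?thesis using h0 by (intro exI[of _ h]) auto
  next
   case far: False
   have "abs (G (r * x) - G (r * y)) <= (2 * M) * abs (r * x - r * y)"
    unfolding G_def by (rule continuous_primitive_bound[OF c ab]) (rule M2)
   moreover have "2 * M * (K x * K y) <= h * (K x * K y) + 2 * M / s^2 * (K x + K y)"
   proof -
    have "K x * K y <= 1 / s^2 * (K x + K y)"
    proof (cases "abs x <= s")
     case False
     hence "K x * K y <= 1 / s^2 * K y" unfolding K_def
      by (intro mult_right_mono invden_le_away e s invden_nonneg) auto
     also have "... <= 1 / s^2 * (K x + K y)" using K0 by (intro mult_left_mono) auto
     finally show ?thesis .
    next
     case True
     hence "s <= abs y" using far by auto
     hence "K x * K y <= K x * (1 / s^2)" unfolding K_def
      by (intro mult_left_mono invden_le_away e s invden_nonneg) auto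
     also have "... <= 1 / s^2 * (K x + K y)" using K0 by (subst mult.commute) (intro mult_left_mono, auto)
     finally show ?thesis .
    qed
    hence "2 * M * (K x * K y) <= 2 * M * (1 / s^2 * (K x + K y))" using M0 by (intro mult_left_mono) auto
    moreover have "0 <= h * (K x * K y)" using h0 K0 by simp
    ultimately show ?thesis by simp
   qed
   ultimately show ?thesis using M0 by (intro exI[of _ "2 * M"]) auto
  qed
  then obtain m where m: "0 <= m" "abs (G (r * x) - G (r * y)) <= m * abs (r * x - r * y)"
   "m * (K x * K y) <= h * (K x * K y) + 2 * M / s^2 * (K x + K y)" by blast
  have "abs (bubker e p) <= 8 * e ^ 3 * abs (x - y) * (K x * K y)" using bubker_le_prod[OF e, of p] by (simp add: p K_def)
  hence "abs (bubker e p * (G (r * x) - G (r * y))) <= (8 * e ^ 3 * abs (x - y) * (K x * K y)) * (m * abs (r * x - r * y))"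
   unfolding abs_mult using m(2) K0 e by (intro mult_mono) auto
  also have "... = (x - y)^2 * (8 * e ^ 3 * r * (m * (K x * K y)))"
  proof -
   have "abs (r * x - r * y) = r * abs (x - y)" using r(1) by (simp add: right_diff_distrib[symmetric] abs_mult)
   moreover have "(x - y)^2 = abs (x - y) * abs (x - y)" by (simp add: sq_eq)
   ultimately show ?thesis by (simp only: ac_simps)
  qed
  also have "... <= (x - y)^2 * (8 * e ^ 3 * r * (h * (K x * K y) + 2 * M / s^2 * (K x + K y)))"
   using e r m(3) by (intro mult_left_mono) auto
  finally show ?thesis unfolding p B_def fst_conv snd_conv Ixy by simp
 qed
 have [measurable]: "K \<in> BM" "I \<in> BM" unfolding K_def I_def[abs_def] by measurable
 have nnK: "(NL x. en (K x)) = en (mom0 e)"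
  using nn_integral_eq_integral[OF integral_invden(1)[OF e]] integral_invden(2)[of e] invden_nonneg[OF e] by (simp add: K_def)
 have nnI: "(NL x. en (I x)) = 2"
  by (simp add: I_def ennreal_indicator)
 have mom: "0 <= mom0 e" "e * mom0 e <= pi" using mom_nonneg[OF e] mom0_le[OF e] by auto
 let ?e = "8 * e ^ 3 * r * (2 * M / s^2)"
 have eqB: "en (B p) = en (8 * e ^ 3 * r * h) * (en (K (fst p)) * en (K (snd p)))
   + (en ?e * (en (K (fst p)) * en (I (snd p)))
   + en ?e * (en (I (fst p)) * en (K (snd p))))" for p
  unfolding B_def using e r h0 M0 K0 I0
  by (simp add: ennreal_mult[symmetric] ennreal_plus[symmetric] algebra_simps del: ennreal_plus)
 note prods = nn_integral_prod_lborel[of "%x. en (K x)" "%x. en (K x)"]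
  nn_integral_prod_lborel[of "%x. en (K x)" "%x. en (I x)"]
  nn_integral_prod_lborel[of "%x. en (I x)" "%x. en (K x)"]
 let ?c = "h * pi^2 + e * (8 * M / s^2 * pi)"
 let ?d = "8 * e ^ 3 * r * (2 * M / s^2) * (mom0 e * 2) + 8 * e ^ 3 * r * (2 * M / s^2) * (2 * mom0 e)"
 let ?g = "NP p. en (B p)"
 let ?i = "NG p. en (abs (bubker e p * ?b p))"
 have "?i <= ?g"
 proof (rule nn_integral_gm_le[OF _ key B0])
  have "(%z. (IL t. ind {a..b} t * g (t + z))) \<in> BM"
   by (rule lborel.borel_measurable_lebesgue_integral) measurable
  hence [measurable]: "G \<in> BM" unfolding G_def[abs_def] .
  show "(%p. abs (bubker e p * ?b p)) \<in> BM2" by measurable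
 qed
 also have "?g = en (8 * e ^ 3 * r * h) * (en (mom0 e) * en (mom0 e))
   + (en ?e * (en (mom0 e) * 2)
   + en ?e * (2 * en (mom0 e)))"
  unfolding eqB
  by (subst nn_integral_add, simp, simp, subst nn_integral_add, simp, simp, subst (1 2 3) nn_integral_cmult, simp_all add: prods nnK nnI)
 also have "... = en (8 * e ^ 3 * r * h * (mom0 e * mom0 e) + ?d)"
 proof -
  have *: "en x * (en m * en m) + (en y * (en m * 2) + en y * (2 * en m)) = en (x * (m * m) + (y * (m * 2) + y * (2 * m)))"
   if "0 <= x" "0 <= y" "0 <= m" for x y m :: real
  proof -
   have two: "(2::ennreal) = en 2" by simp
   show ?thesis unfolding two using that by (simp only: ennreal_mult[symmetric] ennreal_plus[symmetric] mult_nonneg_nonneg add_nonneg_nonneg zero_le_numeral)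
  qed
  show ?thesis using e r(1) h0 M0 mom(1) by (intro *) auto
 qed
 also have "8 * e ^ 3 * r * h * (mom0 e * mom0 e) + ?d = 8 * r * e * (h * (e * mom0 e)^2 + e * (8 * M / s^2 * (e * mom0 e)))"
  by (simp add: sq_eq power3_eq_cube algebra_simps)
 also have "ennreal ... <= en (8 * r * e * ?c)"
  using e r h0 M0 mom by (intro ennreal_leI mult_left_mono add_mono power_mono) auto
 finally have nn: "?i <= en (8 * r * e * ?c)" .
 let ?f = "IL t. ind {a..b} t * ?a t"
 have "?f = (IL t. IG p. f (t, p))"
  unfolding f_inner ..
 also have "... = (IG p. IL t. f (t, p))"
  using P.Fubini_integral[of "%t p. f (t, p)"] int_f by simp
 finally have eq: "?f = (IG p. bubker e p * ?b p)"
  unfolding f_outer .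
 have "en (norm (IG p. bubker e p * ?b p)) <= en (8 * r * e * ?c)"
 proof (rule order_trans[OF integral_norm_bound_ennreal])
  show "integrable gm (%p. bubker e p * ?b p)"
   using P.integrable_snd[of "%t p. f (t, p)"] int_f unfolding f_outer by simp
 qed (use nn in simp)
 thus "abs ?f <= 8 * r * e * ?c"
  unfolding eq using e r h0 M0 by (subst (asm) ennreal_le_iff) auto
qed

section \<open>Averages of the kernel over the centre, and the nonlinear remainder\<close>

lemma nn_integral_invden_shift:
 assumes e: "0 < e" and r: "0 < r"
 shows "(NL t. en (invden e ((x - t) / r))) = en (r * mom0 e)"
proof -
 have "(NL t. en (invden e ((x - t) / r))) = en r * (NL t. en (invden e t))"
  using r by (subst nn_integral_real_affine[where c="-r" and t=x]) auto
 also have "(NL t. en (invden e t)) = en (mom0 e)"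
  using nn_integral_eq_integral[OF integral_invden(1)[OF e]] integral_invden(2)[of e] invden_nonneg[OF e] by simp
 finally show ?thesis using r mom_nonneg[OF e] by (simp add: ennreal_mult)
qed

text \<open>Integrating a density over the centre gives \<open>r * mom0 e\<close>, at most of order
  \<open>r / e\<close>. Hence \<open>bubker_le_sum\<close> yields a bound of order \<open>e\<close>
  for all pairs, and \<open>bubker_le_far\<close> one of order \<open>e^2\<close> for each pair off
  the diagonal.\<close>

lemma nn_integral_Ab_le:
 assumes e: "0 < e" and r: "0 < r"
 shows "(NL t. en (abs (Ab e r t p))) <= en (4 * pi * r * e)"
  and "fst p ~= snd p ==> (NL t. en (abs (Ab e r t p))) <= en (64 * pi * r^2 * e^2 / abs (fst p - snd p))"
proof -
 have mom: "0 <= mom0 e" "e * mom0 e <= pi" using mom_nonneg[OF e] mom0_le[OF e] by auto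
 define K where "K t = invden e ((fst p - t) / r) + invden e ((snd p - t) / r)" for t
 have [measurable]: "K \<in> BM" unfolding K_def[abs_def] by measurable
 have nn: "(NL t. en (c * K t)) = en (c * (2 * r * mom0 e))" if "0 <= c" for c
 proof -
  have "(NL t. en (c * K t)) = en c * (NL t. en (invden e ((fst p - t) / r)) + en (invden e ((snd p - t) / r)))"
   using that invden_nonneg[OF e] unfolding K_def
   by (subst nn_integral_cmult[symmetric]) (auto simp: ennreal_mult[symmetric] ennreal_plus[symmetric] simp del: ennreal_plus)
  also have "... = en c * (en (r * mom0 e) + en (r * mom0 e))"
   by (subst nn_integral_add) (auto simp: nn_integral_invden_shift[OF e r])
  also have "... = en (c * (2 * r * mom0 e))"
   using that r mom by (simp add: ennreal_mult[symmetric] ennreal_plus[symmetric] del: ennreal_plus)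
  finally show ?thesis .
 qed
 let ?a = "NL t. en (abs (Ab e r t p))"
 have "abs (Ab e r t p) <= 2 * e^2 * K t" for t
  using bubker_le_sum[OF e, of "((fst p - t) / r, (snd p - t) / r)"] by (simp add: Ab_def K_def distrib_left)
 hence "?a <= (NL t. en (2 * e^2 * K t))"
  by (intro nn_integral_mono ennreal_leI)
 also have "... = en (4 * r * e * (e * mom0 e))"
  by (subst nn) (auto simp: sq_eq ac_simps)
 also have "... <= en (4 * r * e * pi)" using mom r e by (intro ennreal_leI mult_left_mono) auto
 finally show "?a <= en (4 * pi * r * e)" by (simp add: ac_simps)
 assume d: "fst p ~= snd p"
 define c where "c = 32 * e ^ 3 / (abs (fst p - snd p) / r)"
 have c: "0 <= c" using e r by (simp add: c_def)
 have "abs (Ab e r t p) <= c * K t" for t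
 proof -
  have "(fst p - t) / r - (snd p - t) / r = (fst p - snd p) / r" by (simp add: diff_divide_distrib)
  moreover have "(fst p - t) / r ~= (snd p - t) / r" using d r by simp
  ultimately show ?thesis
   using bubker_le_far[OF e, of "((fst p - t) / r, (snd p - t) / r)"] r by (simp add: Ab_def K_def c_def)
 qed
 hence "?a <= (NL t. en (c * K t))"
  by (intro nn_integral_mono ennreal_leI)
 also have "... = en (64 * r^2 * e^2 / abs (fst p - snd p) * (e * mom0 e))"
  by (subst nn[OF c]) (simp add: c_def sq_eq power3_eq_cube ac_simps)
 also have "... <= en (64 * r^2 * e^2 / abs (fst p - snd p) * pi)" using mom by (intro ennreal_leI mult_left_mono) auto
 finally show "?a <= en (64 * pi * r^2 * e^2 / abs (fst p - snd p))" by (simp add: ac_simps)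
qed

text \<open>\<open>E\<close> is a fixed integrable function that vanishes on the diagonal. On a thin
  strip around the diagonal the averaged kernel is only O(\<open>e\<close>), but \<open>E\<close>
  has a small integral there; off the strip the averaged kernel is O(\<open>e^2\<close>).\<close>

lemma nonlinear_term_bound:
 fixes E :: "real \<times> real => real"
 assumes iE: "integrable gm E" and E0: "!!p. 0 <= E p" and Ed: "!!x. E (x, x) = 0"
  and r: "0 < r" and s: "0 < s"
 shows "\<exists>e0>0. \<forall>e. 0 < e \<and> e < e0 --> (NL t. NG p. en (E p * abs (Ab e r t p))) <= en (s * e)"
proof -
 interpret gm: sigma_finite_measure gm by (rule gm_sigma_finite)
 interpret P: pair_sigma_finite "lborel :: real measure" gm ..
 have [measurable]: "E \<in> BM2" using iE by (auto dest: borel_measurable_integrable)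
 define J where "J n p = ind {p. abs (fst p - snd p) < 1 / real (Suc n)} p * E p" for n :: nat and p
 have Jm [measurable]: "J n \<in> BM2" for n unfolding J_def[abs_def] by measurable
 have JE: "0 <= J n p" "J n p <= E p" for n p using E0 by (auto simp: J_def ind_def)
 have "(%n. (IG p. J n p)) ----> (IG p. 0)"
 proof (rule integral_dominated_convergence[OF _ _ iE])
  show "AE p in gm. (%n. J n p) ----> 0"
  proof (rule AE_I2)
   fix p :: "real \<times> real"
   show "(%n. J n p) ----> 0"
   proof (cases "fst p = snd p")
    case True
    hence "E p = 0" using Ed[of "fst p"] by (metis prod.collapse)
    thus ?thesis by (simp add: J_def)
   next
    case False
    then obtain N where N: "1 / real (Suc N) < abs (fst p - snd p)"
     using reals_Archimedean[of "abs (fst p - snd p)"] by (auto simp: inverse_eq_divide)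
    have "J n p = 0" if "n \<ge> N" for n
    proof -
     have "1 / real (Suc n) <= 1 / real (Suc N)" using that by (intro divide_left_mono) auto
     thus ?thesis using N by (simp add: J_def)
    qed
    thus ?thesis by (intro tendsto_eventually) (auto simp: eventually_sequentially)
   qed
  qed
  show "AE p in gm. norm (J n p) <= E p" for n using JE by (intro AE_I2) auto
 qed simp_all
 hence "eventually (%n. (IG p. J n p) < s / (8 * pi * r)) sequentially"
  using s r by (intro order_tendstoD(2)[where y=0]) auto
 then obtain n where n: "(IG p. J n p) < s / (8 * pi * r)" by (auto simp: eventually_sequentially)
 define D where "D = 1 / real (Suc n)"
 have D: "0 < D" by (simp add: D_def)
 define T where "T = (IG p. E p)"
 have T: "0 <= T" unfolding T_def using E0 by (intro integral_nonneg_AE) auto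
 \<comment> \<open>Chosen so that the part off the strip is at most \<open>s * e / 2\<close>; the
   choice of \<open>n\<close> gives the other half to the strip.\<close>
 define e0 where "e0 = s * D / (128 * pi * r^2 * (T + 1))"
 have e0: "0 < e0" using s D r T by (simp add: e0_def)
 have iJ: "integrable gm (J n)"
 proof (rule Bintegrable_bound[OF iE])
  show "AE p in gm. norm (J n p) <= norm (E p)"
  proof (rule AE_I2)
   fix p show "norm (J n p) <= norm (E p)" using JE[where n=n and p=p] E0[of p] by simp
  qed
 qed simp
 let ?e = "%e. NL t. NG p. en (E p * abs (Ab e r t p))"
 have "?e e <= en (s * e)" if e: "0 < e" "e < e0" for e
 proof -
  let ?a = "%p. 4 * pi * r * e * J n p + 64 * pi * r^2 * e^2 / D * E p"
  let ?b = "IG p. 4 * pi * r * e * J n p + 64 * pi * r^2 * e^2 / D * E p"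
  have "?e e = (NG p. NL t. en (E p * abs (Ab e r t p)))"
   by (rule P.Fubini'[symmetric]) (simp add: case_prod_beta)
  also have "... <= (NG p. en (?a p))"
  proof (intro nn_integral_mono)
   fix p :: "real \<times> real"
   let ?c = "NL t. en (abs (Ab e r t p))"
   let ?d = "NL t. en (E p * abs (Ab e r t p))"
   have "?d = en (E p) * ?c"
    using E0 by (subst nn_integral_cmult[symmetric]) (auto simp: ennreal_mult Ab_def)
   also have "... <= en (?a p)"
   proof (cases "abs (fst p - snd p) < D")
    case True
    have "en (E p) * ?c <= en (E p) * en (4 * pi * r * e)"
     by (intro mult_left_mono nn_integral_Ab_le e r) auto
    also have "... = en (4 * pi * r * e * J n p)"
     using True E0 r e by (simp add: J_def D_def ennreal_mult[symmetric] mult.commute)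
    also have "... <= en (?a p)"
     using E0 D by (intro ennreal_leI) simp
    finally show ?thesis .
   next
    case False
    hence d: "fst p ~= snd p" "D <= abs (fst p - snd p)" using D by auto
    have "en (E p) * ?c <= en (E p) * en (64 * pi * r^2 * e^2 / abs (fst p - snd p))"
     by (intro mult_left_mono nn_integral_Ab_le e r d) auto
    also have "... <= en (E p) * en (64 * pi * r^2 * e^2 / D)"
     using d D by (intro mult_left_mono ennreal_leI divide_left_mono) auto
    also have "... = en (64 * pi * r^2 * e^2 / D * E p)"
     using E0 D by (simp add: ennreal_mult[symmetric] mult.commute)
    also have "... <= en (?a p)"
     using JE(1)[of n p] r e by (intro ennreal_leI) simp
    finally show ?thesis .
   qed
   finally show "?d <= en (?a p)" .
  qed
  also have "... = en ?b"
  proof (rule nn_integral_eq_integral)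
   show "integrable gm (%p. 4 * pi * r * e * J n p + 64 * pi * r^2 * e^2 / D * E p)"
    by (intro Bintegrable_add integrable_mult_right iJ iE)
   show "AE p in gm. 0 <= 4 * pi * r * e * J n p + 64 * pi * r^2 * e^2 / D * E p"
    using JE E0 r e D by (intro AE_I2 add_nonneg_nonneg mult_nonneg_nonneg) auto
  qed
  also have "?b = 4 * pi * r * e * (IG p. J n p) + 64 * pi * r^2 * e^2 / D * T"
   unfolding T_def integral_mult_right_zero[symmetric]
   by (intro Bintegral_add integrable_mult_right iJ iE)
  also have "... <= s * e / 2 + s * e / 2"
  proof (intro add_mono)
   have "4 * pi * r * e * (IG p. J n p) <= 4 * pi * r * e * (s / (8 * pi * r))"
    using n r e by (intro mult_left_mono) auto
   also have "... = s * e / 2" using r by simp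
   finally show "4 * pi * r * e * (IG p. J n p) <= s * e / 2" .
   have "64 * pi * r^2 * e^2 / D * T = (64 * pi * r^2 * e * T / D) * e" by (simp add: sq_eq)
   also have "... <= (64 * pi * r^2 * e0 * (T + 1) / D) * e"
    using e T D by (intro mult_right_mono divide_right_mono mult_mono) auto
   also have "64 * pi * r^2 * e0 * (T + 1) / D = s / 2"
   proof -
    have "64 * pi * r^2 * (s * D / (128 * pi * r^2 * S)) * S / D = s / 2" if "S > 0" for S
     using that D r by simp
    thus ?thesis using T by (simp only: e0_def)
   qed
   finally show "64 * pi * r^2 * e^2 / D * T <= s * e / 2" by simp
  qed
  finally show ?thesis by (simp add: ennreal_leI mult.commute)
 qed
 thus ?thesis using e0 by blast
qed

text \<open>If the first point is within \<open>r * e / 2\<close> of the centre, the bubble has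
  nonpositive real part there, while it equals \<open>1\<close> at points outside I. Its squared
  distance is then at least \<open>2\<close>, which compensates the division by
  \<open>2\<close>.\<close>

lemma bubble_gain:
 fixes a' b' :: real
 assumes u: "u \<in> Hmaps" and r: "0 < r" and e: "0 < e" "e <= 1" and t: "-1 <= t - r" "t + r <= 1"
 defines "G0 \<equiv> %p. ind {a'<..<b'} (fst p) * ind (- {-1<..<1}) (snd p) * dsq u p"
 shows "(IG p. G0 p * ind {fst p - r * e / 2..fst p + r * e / 2} t) <= (IG p. dsq u p * dsq (wb e r t) p) / 2"
proof -
 note [measurable] = HmapsD(1)[OF u]
 have w: "wb e r t \<in> Hmaps" by (rule Hmaps_wb[OF e(1) r])
 have le: "G0 p * ind {fst p - r * e / 2..fst p + r * e / 2} t <= dsq u p * dsq (wb e r t) p / 2" for p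
 proof (cases "snd p \<notin> {-1<..<1} \<and> t \<in> {fst p - r * e / 2..fst p + r * e / 2}")
  case True
  have "abs (fst p - t) <= r * e / 2"
   using True unfolding abs_le_iff atLeastAtMost_iff by argo
  hence "abs ((fst p - t) / r) <= e / 2"
   using r by (simp add: divide_le_eq mult.commute)
  hence "Re (wb e r t (fst p)) <= 0" unfolding wb_def by (intro Re_bubble_core e)
  moreover have "wb e r t (snd p) = 1"
  proof -
   have "abs (snd p - t) \<ge> r" using True t by auto
   thus ?thesis unfolding wb_def using r by (intro bubble_outside e) auto
  qed
  ultimately have "2 <= dsq (wb e r t) p"
   using HmapsD(2)[OF w, of "fst p"] unfolding cmod_power2
   by (simp add: power2_diff) (simp add: cmod_def)
  hence "dsq u p * 2 <= dsq u p * dsq (wb e r t) p" by (intro mult_left_mono) auto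
  moreover have "G0 p <= dsq u p" by (auto simp: G0_def ind_def)
  ultimately show ?thesis using True by simp
 next
  case False
  thus ?thesis by (auto simp: G0_def)
 qed
 have i: "integrable gm (%p. dsq u p * dsq (wb e r t) p / 2)"
  using integrable_dsq_mult[OF u w] by simp
 have "(IG p. G0 p * ind {fst p - r * e / 2..fst p + r * e / 2} t) <= (IG p. dsq u p * dsq (wb e r t) p / 2)"
 proof (rule integral_mono[OF _ i le])
  let ?a = "%p. G0 p * ind {fst p - r * e / 2..fst p + r * e / 2} t"
  show "integrable gm ?a"
  proof (rule Bintegrable_bound[OF i])
   have "(%p. G0 p * (if fst p - r * e / 2 <= t \<and> t <= fst p + r * e / 2 then 1 else 0)) \<in> borel_measurable gm"
    unfolding G0_def by measurable
   thus "?a \<in> borel_measurable gm"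
    by (rule back_subst[where P="%f. f \<in> borel_measurable gm"]) (auto simp: ind_def)
   let ?b = "%p. G0 p * ind {fst p - r * e / 2..fst p + r * e / 2} t"
   show "AE p in gm. norm (?b p) <= norm (dsq u p * dsq (wb e r t) p / 2)"
   proof (rule AE_I2)
    fix p
    have "0 <= G0 p * ind {fst p - r * e / 2..fst p + r * e / 2} t" by (simp add: G0_def)
    thus "norm (?b p) <= norm (dsq u p * dsq (wb e r t) p / 2)"
     using le[of p] unfolding real_norm_def by (simp del: abs_mult)
   qed
  qed
 qed
 thus ?thesis by simp
qed

text \<open>Suppose that no centre works and integrate the resulting inequality over
  \<open>t\<close> in \<open>[a,b]\<close>. With \<open>T = r * Z / 8\<close> the gain integrates to
  \<open>Z * r * e = 8 * T * e\<close>. The excess energy of the bubble costs at most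
  \<open>T * e\<close>, and the linear and the nonlinear interaction, each entering with the factor
  \<open>2\<close>, at most \<open>2 * T * e\<close> each. So \<open>8 * T * e\<close> would be at
  most \<open>5 * T * e\<close>.\<close>

proposition bubble_strict_inequality:
 fixes f :: "real => real"
 assumes u: "u \<in> Hmaps" and c: "continuous_on UNIV f" and M: "!!x. abs (f x) <= M"
  and uf: "!!x. x \<in> {-1..1} ==> u x = cis (f x)"
  and ab: "a < b" and fab: "f a = f b" and r: "0 < r" "-1 <= a - r" "b + r <= 1"
  and EL: "!!h::real => real. h \<in> BM ==> (\<forall>x. x \<notin> {-1<..<1} --> h x = 0) ==> gag h < \<infinity> ==>
   (IG p. cross u p * (h (fst p) - h (snd p))) = 0"
  and a'b': "a < a'" "a' < b'" "b' < b"
  and Z: "0 < (IG p. ind {a'<..<b'} (fst p) * ind (- {-1<..<1}) (snd p) * dsq u p)" (is "0 < ?Z")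
 shows "\<exists>e t. 0 < e \<and> a <= t \<and> t <= b \<and> gagr (%x. u x * wb e r t x) < gagr u + 4 * pi^2"
proof (rule ccontr)
 assume neg: "\<not> ?thesis"
 note [measurable] = HmapsD(1)[OF u]
 have [measurable]: "f \<in> BM" by (intro borel_cont c)
 interpret gm: sigma_finite_measure gm by (rule gm_sigma_finite)
 interpret P: pair_sigma_finite "lborel :: real measure" gm ..
 define Z where "Z = ?Z"
 have Z0: "Z > 0" using Z by (simp add: Z_def)
 have ip: "integrable gm (%p. Qsq p * (f (fst p) - f (snd p))^2)"
  by (rule integrable_phase[OF u c M uf])
 define D where "D p = f (fst p) - f (snd p)" for p
 \<comment> \<open>On the square \<open>cross u\<close> is \<open>sin (D p)\<close>. The error of
   replacing it by \<open>D p\<close> is quadratic in \<open>D p\<close>, hence integrable by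
   \<open>integrable_phase\<close>, and it vanishes on the diagonal, as
   \<open>nonlinear_term_bound\<close> requires.\<close>
 define E where "E p = Qsq p * abs (sin (D p) - D p)" for p
 have Em [measurable]: "E \<in> BM2" unfolding E_def[abs_def] D_def by measurable
 have E0: "0 <= E p" for p by (simp add: E_def Qsq_01)
 have iE: "integrable gm E"
 proof (rule Bintegrable_bound[OF ip])
  show "AE p in gm. norm (E p) <= norm (Qsq p * (f (fst p) - f (snd p))^2)"
  proof (rule AE_I2)
   fix p
   have "abs (sin (D p) - D p) <= (D p)^2"
    using abs_sin_minus_id_le[of "D p"] zero_le_power2[of "D p"] by linarith
   hence "E p <= Qsq p * (D p)^2" unfolding E_def by (intro mult_left_mono) (auto simp: Qsq_01)
   thus "norm (E p) <= norm (Qsq p * (f (fst p) - f (snd p))^2)"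
    using E0[of p] by (simp add: D_def)
  qed
 qed simp
 define T where "T = r * Z / 8"
 have T: "T > 0" using Z0 r by (simp add: T_def)
 obtain e1 where e1: "e1 > 0" "!!e. 0 < e ==> e < e1 ==> (NL t. NG p. en (E p * abs (Ab e r t p))) <= en (T * e)"
  using nonlinear_term_bound[OF iE E0 _ r(1) T] by (auto simp: E_def D_def)
 have M0: "0 <= M" using M[of 0] by linarith
 define h where "h = T / (16 * r * pi^2)"
 have h: "h > 0" using T r by (simp add: h_def)
 let ?f = "%z. f (b + z) - f (a + z)"
 have "continuous_on UNIV ?f"
  by (intro continuous_intros continuous_on_compose2[OF c]) auto
 hence "isCont ?f 0"
  by (simp add: continuous_on_eq_continuous_at)
 then obtain s0 where s0: "s0 > 0" "!!z. abs z < s0 ==> (abs (f (b + z) - f (a + z))) < h"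
  using h fab unfolding continuous_at_eps_delta by (auto simp: dist_real_def)
 define s where "s = s0 / (2 * r)"
 have s: "s > 0" "!!z. abs z <= r * s ==> (abs (f (b + z) - f (a + z))) <= h"
 proof -
  show "s > 0" using s0 r by (simp add: s_def)
  fix z assume "abs z <= r * s"
  hence "abs z < s0" using s0(1) r(1) by (simp add: s_def)
  thus "abs (f (b + z) - f (a + z)) <= h" using s0(2)[of z] by simp
 qed
 define c1 where "c1 = 8 * r * (8 * M / s^2 * pi)"
 have c1: "c1 \<ge> 0" using r M0 by (simp add: c1_def)
 define c2 where "c2 = (b - a) * (8 * pi^2)"
 have c2: "c2 \<ge> 0" using ab by (simp add: c2_def)
 \<comment> \<open>The entries with \<open>a' - a\<close> and \<open>b - b'\<close> keep all centres
   that profit from a given point of \<open>(a',b')\<close> inside \<open>[a,b]\<close>, so that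
   they form an interval of full length \<open>r * e\<close> in \<open>gf_outer\<close>. The last
   two make the quadratic errors at most \<open>T / 2 * e\<close> and \<open>T * e\<close>.\<close>
 define e where "e = Min {e1 / 2, 1, 2 * (a' - a) / r, 2 * (b - b') / r, T / (2 * (c1 + 1)), T / (c2 + 1)}"
 have e: "0 < e" "e < e1" "e <= 1" "r * e / 2 <= a' - a" "r * e / 2 <= b - b'" "c1 * e <= T / 2" "c2 * e <= T"
 proof -
  have "e <= e1 / 2" "e <= 2 * (a' - a) / r" "e <= 2 * (b - b') / r" and c: "e <= T / (2 * (c1 + 1))" "e <= T / (c2 + 1)"
   unfolding e_def by (intro Min.coboundedI; simp)+
  thus "e < e1" "r * e / 2 <= a' - a" "r * e / 2 <= b - b'" using e1(1) r(1) by (auto simp: field_simps)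
  show "e <= 1" unfolding e_def by (intro Min.coboundedI) simp_all
  show e0: "0 < e" unfolding e_def using e1(1) r(1) a'b' T c1 c2 by (subst Min_gr_iff) auto
  have "(c1 + 1) * e <= T / 2" "(c2 + 1) * e <= T" using c c1 c2 by (auto simp: field_simps)
  thus "c1 * e <= T / 2" "c2 * e <= T" using e0 by (auto simp: distrib_right)
 qed
 define L where "L t = ind {a..b} t * (IG p. D p * Ab e r t p)" for t
 define N where "N t = ind {a..b} t * (IG p. E p * abs (Ab e r t p))" for t
 define G0 where "G0 p = ind {a'<..<b'} (fst p) * ind (- {-1<..<1}) (snd p) * dsq u p" for p
 define G where "G t = ind {a..b} t * (IG p. G0 p * ind {fst p - r * e / 2..fst p + r * e / 2} t)" for t
 have iL: "integrable lborel L" and bL: "(IL t. L t) <= T * e"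
 proof -
  note * = linear_term_bound[OF c M ip less_imp_le[OF ab] r e(1) s]
  show "integrable lborel L" unfolding L_def[abs_def] D_def by (rule *(1))
  have "(IL t. L t) <= 8 * r * e * (h * pi^2 + e * (8 * M / s^2 * pi))"
   using *(2) unfolding L_def D_def by linarith
  also have "... = 8 * r * pi^2 * h * e + c1 * e * e" by (simp add: c1_def algebra_simps)
  also have "... <= T / 2 * e + T / 2 * e"
  proof (intro add_mono mult_right_mono)
   show "8 * r * pi^2 * h <= T / 2" using r by (simp add: h_def)
  qed (use e in auto)
  finally show "(IL t. L t) <= T * e" by simp
 qed
 have iEA: "integrable gm (%p. E p * abs (Ab e r t p))" for t
 proof (rule Bintegrable_bound)
  show "integrable gm (%p. 4 * E p)" using iE by simp
  have w: "wb e r t \<in> Hmaps" by (rule Hmaps_wb[OF e(1) r(1)])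
  have "abs (Ab e r t p) <= 4" for p
  proof -
   have i: "abs (Im (wb e r t x)) <= 1" for x
    using abs_Im_le_cmod[of "wb e r t x"] HmapsD(2)[OF w, of x] by simp
   show ?thesis using cross_wb[OF e(1), of r t p] cross_le(2)[OF w, of p] i[of "fst p"] i[of "snd p"] by linarith
  qed
  thus "AE p in gm. norm (E p * abs (Ab e r t p)) <= norm (4 * E p)"
   using E0 by (intro AE_I2) (auto simp: abs_mult mult.commute[of 4] intro!: mult_left_mono)
 qed measurable
 have nnN: "(NL t. en (N t)) <= en (T * e)"
 proof -
  have "en (N t) <= (NG p. en (E p * abs (Ab e r t p)))" for t
   using nn_integral_eq_integral[OF iEA[of t]] E0 by (auto simp: N_def ind_def)
  thus ?thesis using e1(2)[OF e(1,2)] by (meson nn_integral_mono order_trans)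
 qed
 have N0: "0 <= N t" for t unfolding N_def using E0 by (intro mult_nonneg_nonneg integral_nonneg_AE) auto
 have Nm: "N \<in> BM"
 proof -
  have "(%t. (IG p. E p * abs (Ab e r t p))) \<in> borel_measurable lborel"
   unfolding Ab_def by (rule gm.borel_measurable_lebesgue_integral) measurable
  thus ?thesis unfolding N_def[abs_def] by measurable
 qed
 have iN: "integrable lborel N"
  using nnN N0 Nm by (intro integrableI_bounded) (auto simp: less_top[symmetric] top_unique)
 have bN: "(IL t. N t) <= T * e"
  using nnN N0 iN T e(1) by (subst (asm) nn_integral_eq_integral) (auto simp: ennreal_le_iff)
 have G00: "0 <= G0 p" for p by (simp add: G0_def)
 have iG0: "integrable gm G0"
 proof (rule Bintegrable_bound[OF integrable_dsq[OF HmapsD(1,3)[OF u]]])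
  show "G0 \<in> borel_measurable gm" unfolding G0_def[abs_def] by measurable
  show "AE p in gm. norm (G0 p) <= norm (dsq u p)"
   by (intro AE_I2) (auto simp: G0_def ind_def)
 qed
 have G0m [measurable]: "G0 \<in> BM2" unfolding G0_def[abs_def] by measurable
 define gf where "gf q = G0 (snd q) * (if a <= fst q \<and> fst q <= b \<and> fst (snd q) - r * e / 2 <= fst q \<and> fst q <= fst (snd q) + r * e / 2 then 1 else 0)" for q :: "real \<times> real \<times> real"
 let ?a = "lborel \<Otimes>\<^sub>M gm"
 have [measurable]: "gf \<in> borel_measurable ?a" unfolding gf_def[abs_def] by measurable
 have gf_outer: "(NL t. en (gf (t, p))) = en (G0 p * (r * e))" for p
 proof (cases "fst p \<in> {a'<..<b'}")
  case True
  have "(NL t. en (gf (t, p))) = (NL t. en (G0 p) * ind {fst p - r * e / 2..fst p + r * e / 2} t)"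
   using True e(4,5) by (intro nn_integral_cong) (auto simp: gf_def ind_def)
  also have "... = en (G0 p * (r * e))"
   using r e(1) G00 by (subst nn_integral_cmult_indicator) (auto simp: ennreal_mult[symmetric])
  finally show ?thesis .
 next
  case False
  thus ?thesis by (simp add: gf_def G0_def)
 qed
 let ?e = "\<integral>\<^sup>+q. en (gf q) \<partial>?a"
 have "?e = (NG p. NL t. en (gf (t, p)))"
  by (subst P.nn_integral_snd[symmetric]) auto
 also have "... = en (IG p. G0 p * (r * e))"
  unfolding gf_outer using iG0 G00 r e by (intro nn_integral_eq_integral) auto
 also have "... = en (Z * (r * e))" by (simp add: Z_def G0_def)
 finally have nn_gf: "?e = en (Z * (r * e))" .
 have gf0: "0 <= gf q" for q by (simp add: gf_def G00)
 have igf: "integrable ?a gf"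
  using nn_gf gf0 by (intro integrableI_bounded) auto
 have gf_inner: "(IG p. gf (t, p)) = G t" for t
  unfolding G_def integral_mult_right_zero[symmetric]
  by (intro Bintegral_cong) (auto simp: gf_def ind_def)
 have iG: "integrable lborel G" and bG: "(IL t. G t) = Z * (r * e)"
 proof -
  show "integrable lborel G" using P.integrable_fst[of "%t p. gf (t, p)"] igf unfolding gf_inner by simp
  have "(IL t. G t) = (\<integral>q. gf q \<partial>?a)"
   using P.integral_fst[of "%t p. gf (t, p)"] igf unfolding gf_inner by simp
  also have "... = Z * (r * e)"
   using nn_gf nn_integral_eq_integral[OF igf] gf0 Z0 r e(1) by (simp add: integral_nonneg_AE)
  finally show "(IL t. G t) = Z * (r * e)" .
 qed
 let ?d = "8 * pi^2 * e^2"
 have point: "G t <= ind {a..b} t * ?d + 2 * L t + 2 * N t" for t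
 proof (cases "t \<in> {a..b}")
  case True
  have t: "-1 <= t - r" "t + r <= 1" using True r by auto
  let ?b = "IG p. cross u p * Ab e r t p"
  let ?c = "IG p. dsq u p * dsq (wb e r t) p"
  have "gagr u + 4 * pi^2 <= gagr (%x. u x * wb e r t x)"
   using neg True e(1) by (meson atLeastAtMost_iff not_less)
  moreover have "gagr (%x. u x * wb e r t x) <= gagr u + 4 * pi^2 + 8 * pi^2 * e^2 + 2 * ?b - ?c / 2"
   by (rule bubble_insertion_energy[OF u e(1) r(1) t]) (rule EL)
  ultimately have 1: "?c / 2 <= 8 * pi^2 * e^2 + 2 * ?b"
   by linarith
  have iD: "integrable gm (%p. D p * Ab e r t p)"
   unfolding D_def by (rule phase_Ab_integrable[OF c ip e(1) r(1) t])
  have "cross u p * Ab e r t p <= D p * Ab e r t p + E p * abs (Ab e r t p)" for p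
  proof (cases "fst p \<in> {-1..1} \<and> snd p \<in> {-1..1}")
   case True
   hence "cross u p = sin (D p)" by (simp add: cross_def uf cis_cnj cis_mult D_def)
   moreover have "E p = abs (sin (D p) - D p)" using True by (simp add: E_def Qsq_def)
   moreover have "(sin (D p) - D p) * Ab e r t p <= abs (sin (D p) - D p) * abs (Ab e r t p)"
    by (metis abs_ge_self abs_mult)
   ultimately show ?thesis by (simp add: algebra_simps)
  next
   case False
   hence "abs (fst p - t) \<ge> r \<or> abs (snd p - t) \<ge> r" using t by auto
   thus ?thesis using Ab_outside[OF r(1), of p t e] by simp
  qed
  hence "?b <= (IG p. D p * Ab e r t p + E p * abs (Ab e r t p))"
   using iD iEA[of t] u
   by (intro integral_mono integrable_prod_of_squares[OF _ _ integrable_cross_sq Ab_sq(1)] measurable_cross HmapsD e r Bintegrable_add) auto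
  also have "... = L t + N t" using iD iEA[of t] True by (simp add: L_def N_def)
  finally have 2: "?b <= L t + N t" .
  have "G t <= ?c / 2"
   using bubble_gain[OF u r(1) e(1,3) t, of a' b'] True by (simp add: G_def G0_def)
  thus ?thesis using 1 2 True by simp
 next
  case False
  thus ?thesis by (simp add: G_def L_def N_def)
 qed
 have iI: "integrable lborel (%t. ind {a..b} t * ?d)"
  by (rule integrable_indicator_continuous) auto
 have "(IL t. G t) <= (IL t. ind {a..b} t * ?d + 2 * L t + 2 * N t)"
  by (intro integral_mono iG Bintegrable_add integrable_mult_right iI iL iN point)
 also have "... = (b - a) * ?d + 2 * (IL t. L t) + 2 * (IL t. N t)"
  using iL iN iI ab by simp
 also have "(b - a) * ?d = c2 * e * e" by (simp add: c2_def sq_eq)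
 also have "c2 * e * e + 2 * (IL t. L t) + 2 * (IL t. N t) <= T * e + 2 * (T * e) + 2 * (T * e)"
  using e(1,7) bL bN by (intro add_mono mult_left_mono mult_right_mono) auto
 finally have "8 * (T * e) <= 5 * (T * e)"
  unfolding bG T_def by (simp add: ac_simps)
 thus False using T e(1) by simp
qed

subsection \<open>Continuity of minimizers\<close>

text \<open>Continuity is proved by De Giorgi iteration on the sets where \<open>u\<close> is more than an angle \<open>a\<close> away from a fixed \<open>p\<close>. The comparison map reflects (\<open>ang\<close> is even about the imaginary axis) and truncates \<open>u\<close> to the arc of half-width \<open>a\<close> around \<open>p\<close>.\<close>
definition clamp1 :: "real => real => real" where "clamp1 a s = max (- a) (min a s)"

definition ang :: "complex => real" where "ang z = arcsin (clamp1 1 (Im z))"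

lemma clamp1_id: "abs s <= a ==> clamp1 a s = s"
 by (auto simp: clamp1_def max_def min_def)

lemma continuous_on_ang: "continuous_on S ang"
 unfolding ang_def clamp1_def by (intro continuous_intros) auto

lemma measurable_ang [measurable]: "ang \<in> BM"
 by (intro borel_cont continuous_on_ang)

definition sfold :: "real => complex => complex" where
 "sfold a z = cis (clamp1 a (ang z))"

text \<open>\<open>ang\<close> identifies the left half of the circle with the right one, so the
  left half has to be declared bad separately.\<close>

definition bad :: "real => complex => bool" where
 "bad a z \<longleftrightarrow> Re z < 0 \<or> abs (ang z) > a"

lemma unit_arcsin:
 assumes "cmod z = 1"
 shows "abs (ang z) <= pi / 2" "sin (ang z) = Im z" "cos (ang z) = abs (Re z)"
proof -
 have i: "abs (Im z) <= 1" using abs_Im_le_cmod[of z] assms by simp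
 have ang: "ang z = arcsin (Im z)" unfolding ang_def using clamp1_id[OF i] by simp
 show "abs (ang z) <= pi / 2" using arcsin_bounded[of "Im z"] i by (auto simp: abs_le_iff ang)
 show "sin (ang z) = Im z" unfolding ang using i by (intro sin_arcsin) auto
 have "cos (ang z) = sqrt (1 - (Im z)^2)" unfolding ang using i by (intro cos_arcsin) auto
 also have "1 - (Im z)^2 = (Re z)^2" using assms cmod_power2[of z] by simp
 finally show "cos (ang z) = abs (Re z)" by simp
qed

lemma unit_dist_sq:
 assumes "cmod z = 1" "cmod w = 1"
 shows "csq (z - w) = 2 - 2 * (Re z * Re w + Im z * Im w)"
proof -
 have "(Re z)^2 + (Im z)^2 = 1" "(Re w)^2 + (Im w)^2 = 1" using assms by (simp_all add: cmod_power2[symmetric])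
 thus ?thesis unfolding cmod_power2 by (simp add: sq_eq algebra_simps)
qed

lemma good_eq_cis:
 assumes "cmod z = 1" "\<not> bad a z" shows "z = cis (ang z)" "sfold a z = z" "abs (ang z) <= a"
proof -
 have "Re z \<ge> 0" "abs (ang z) <= a" using assms(2) by (auto simp: bad_def)
 thus "z = cis (ang z)" "abs (ang z) <= a"
  using unit_arcsin[OF assms(1)] by (auto simp: complex_eq_iff)
 thus "sfold a z = z" unfolding sfold_def using clamp1_id by metis
qed

lemma clamp1_lipschitz: "0 <= a ==> (abs (clamp1 a s - clamp1 a t)) <= abs (s - t)"
 unfolding clamp1_def by (auto simp: max_def min_def)

lemma cos_le_of_abs:
 assumes "abs x <= abs y" "abs y <= pi" shows "cos y <= cos x"
proof -
 have "cos (abs y) <= cos (abs x)" using assms by (intro cos_monotone_0_pi_le) auto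
 thus ?thesis by simp
qed

text \<open>For unit vectors a larger inner product means a smaller distance. Reflection replaces
  \<open>Re z * Re w\<close> by the product of absolute values, and clamping shrinks the difference
  of two angles of modulus at most \<open>pi / 2\<close>, so both steps can only raise the inner
  product.\<close>

lemma sfold_lipschitz:
 assumes z: "cmod z = 1" and w: "cmod w = 1" and a: "0 <= a"
 shows "cmod (sfold a z - sfold a w) <= cmod (z - w)"
proof -
 define s t where "s = ang z" and "t = ang w"
 note zs = unit_arcsin[OF z, folded s_def] and wt = unit_arcsin[OF w, folded t_def]
 have "Re z * Re w + Im z * Im w <= abs (Re z) * abs (Re w) + Im z * Im w"
  using abs_ge_self[of "Re z * Re w"] by (simp add: abs_mult)
 also have "... = cos (s - t)" using zs wt by (simp add: cos_diff)
 also have "... <= cos (clamp1 a s - clamp1 a t)"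
  using clamp1_lipschitz[OF a, of s t] zs(1) wt(1) by (intro cos_le_of_abs) auto
 also have "... = Re (sfold a z) * Re (sfold a w) + Im (sfold a z) * Im (sfold a w)"
  by (simp add: sfold_def s_def t_def cos_diff)
 finally have "csq (sfold a z - sfold a w) <= csq (z - w)"
  using unit_dist_sq[OF z w] unit_dist_sq[of "sfold a z" "sfold a w"] by (simp add: sfold_def)
 thus ?thesis by (rule power2_le_imp_le) simp
qed

text \<open>The difference is \<open>2 * sin \<theta> * sin d\<close> with \<open>d\<close> half of
  \<open>s - a\<close> and \<open>d <= \<theta> <= 3 * pi / 4\<close>. Since
  \<open>d <= pi / 4\<close>, the first sine is at least the second.\<close>

lemma cos_diff_gain:
 assumes "t <= a" "a <= s" "s - a <= pi / 2" "s + a - 2 * t <= 3 * pi / 2"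
 shows "cos (a - t) - cos (s - t) \<ge> 2 * (sin ((s - a) / 2))^2"
proof -
 define \<theta> where "\<theta> = (s + a) / 2 - t"
 define d where "d = (s - a) / 2"
 have "cos (a - t) - cos (s - t) = 2 * sin ((a - t + (s - t)) / 2) * sin ((s - t - (a - t)) / 2)"
  by (rule cos_diff_cos)
 also have "(a - t + (s - t)) / 2 = \<theta>" by (simp add: \<theta>_def field_simps)
 also have "(s - t - (a - t)) / 2 = d" by (simp add: d_def)
 finally have eq: "cos (a - t) - cos (s - t) = 2 * sin \<theta> * sin d" .
 have d: "0 <= d" "d <= pi / 4" using assms by (auto simp: d_def)
 have th: "d <= \<theta>" "\<theta> <= 3 * pi / 4" using assms by (auto simp: d_def \<theta>_def field_simps)
 have "sin d <= sin \<theta>"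
 proof (cases "\<theta> <= pi / 2")
  case True
  thus ?thesis using d th by (intro sin_monotone_2pi_le) auto
 next
  case False
  have "sin d <= sin (pi - \<theta>)" using d th False by (intro sin_monotone_2pi_le) auto
  thus ?thesis by simp
 qed
 moreover have "0 <= sin d" using d by (intro sin_ge_zero) auto
 ultimately have "sin d * sin d <= sin \<theta> * sin d" by (intro mult_right_mono) auto
 thus ?thesis unfolding eq d_def[symmetric] by (simp add: sq_eq)
qed

text \<open>If the folded angle of \<open>z\<close> exceeds \<open>a'\<close>, clamping alone gains
  by \<open>cos_diff_gain\<close>. Otherwise \<open>z\<close> lies in the left half circle and the
  reflection gains \<open>2 * cos s * cos t\<close>; both cosines are at least
  \<open>sqrt 2 / 2\<close> because \<open>a' <= pi / 4\<close>, so this is at least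
  \<open>1\<close>, more than is claimed.\<close>

lemma fold_gain:
 assumes z: "cmod z = 1" and w: "cmod w = 1" and a: "0 <= a" "a < a'" "a' <= pi / 4"
  and bz: "bad a' z" and gw: "\<not> bad a w"
 shows "csq (sfold a z - w) + 4 * (sin ((a' - a) / 2))^2 <= csq (z - w)"
proof -
 define s t where "s = ang z" and "t = ang w"
 define c where "c = clamp1 a s"
 note zs = unit_arcsin[OF z, folded s_def] and wt = unit_arcsin[OF w, folded t_def]
 have ta: "abs t <= a" and Rw: "Re w = cos t" using good_eq_cis[OF w gw] gw wt by (auto simp: t_def bad_def)
 have pi2: "0 < pi" by simp
 let ?a = "sin ((a' - a) / 2)"
 have clampgain: "cos (c - t) - cos (s - t) \<ge> 2 * ?a^2" if "abs s > a'"
 proof -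
  have mono: "?a^2 <= (sin ((abs s - a) / 2))^2"
   using that a zs(1) by (intro power_mono sin_monotone_2pi_le sin_ge_zero) auto
  show ?thesis
  proof (cases "s > 0")
   case True
   hence c: "c = a" using that a by (auto simp: c_def clamp1_def)
   have "cos (a - t) - cos (s - t) \<ge> 2 * (sin ((s - a) / 2))^2"
    using True that a ta zs(1) by (intro cos_diff_gain) auto
   thus ?thesis using mono True c by simp
  next
   case False
   hence c: "c = - a" using that a by (auto simp: c_def clamp1_def)
   have "cos (a - (- t)) - cos ((- s) - (- t)) \<ge> 2 * (sin (((- s) - a) / 2))^2"
    using False that a ta zs(1) by (intro cos_diff_gain) auto
   moreover have "cos (a - (- t)) = cos (c - t)" "cos ((- s) - (- t)) = cos (s - t)"
    unfolding c by (metis cos_minus minus_add_distrib minus_diff_eq uminus_add_conv_diff diff_minus_eq_add add.commute)+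
   ultimately show ?thesis using mono False by simp
  qed
 qed
 have clampmono: "cos (s - t) <= cos (c - t)"
 proof -
  have "t = clamp1 a t" using ta by (auto simp: clamp1_def)
  hence "abs (c - t) <= abs (s - t)" unfolding c_def using clamp1_lipschitz[OF a(1), of s t] by simp
  thus ?thesis using zs(1) wt(1) by (intro cos_le_of_abs) auto
 qed
 have "cos (c - t) - (Re z * Re w + Im z * Im w) \<ge> 2 * ?a^2"
 proof (cases "Re z \<ge> 0")
  case True
  hence "abs s > a'" using bz by (auto simp: bad_def s_def)
  moreover have "Re z * Re w + Im z * Im w = cos (s - t)" using zs wt True Rw by (simp add: cos_diff)
  ultimately show ?thesis using clampgain by simp
 next
  case False
  have Rz: "Re z = - cos s" using zs False by simp
  have eq: "cos (s - t) - (Re z * Re w + Im z * Im w) = 2 * (cos s * cos t)"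
   unfolding Rz Rw cos_diff using zs wt by simp
  have cs: "0 <= cos s" "0 <= cos t" using zs(3) wt(3) by auto
  show ?thesis
  proof (cases "abs s > a'")
   case True
   from clampgain[OF this] eq mult_nonneg_nonneg[OF cs] show ?thesis by linarith
  next
   case s: False
   have "sqrt 2 / 2 <= cos s" "sqrt 2 / 2 <= cos t"
    using s a ta by (auto simp: cos_45[symmetric] intro!: cos_le_of_abs)
   hence "(sqrt 2 / 2) * (sqrt 2 / 2) <= cos s * cos t" using cs by (intro mult_mono) auto
   hence "1 <= 2 * (cos s * cos t)" by simp
   moreover have "2 * ?a^2 <= 1"
   proof -
    have "sin ((a' - a) / 2) <= sin (pi / 4)" using a by (intro sin_monotone_2pi_le) auto
    moreover have "0 <= sin ((a' - a) / 2)" using a by (intro sin_ge_zero) auto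
    ultimately have "?a^2 <= (sqrt 2 / 2)^2" by (intro power_mono) (auto simp: sin_45)
    thus ?thesis by (simp add: power_divide)
   qed
   ultimately show ?thesis using eq clampmono by linarith
  qed
 qed
 moreover have "Re (sfold a z) * Re w + Im (sfold a z) * Im w = cos (c - t)"
  using Rw wt by (simp add: sfold_def c_def s_def cos_diff)
 ultimately show ?thesis
  using unit_dist_sq[OF z w] unit_dist_sq[of "sfold a z" w] w by (simp add: sfold_def)
qed

lemma bad_mono: "a <= a' ==> bad a' z ==> bad a z" by (auto simp: bad_def)

lemma measurable_clamp1 [measurable]: "clamp1 a \<in> BM"
 unfolding clamp1_def by measurable

lemma measurable_cis [measurable]: "cis \<in> BM"
 by (intro borel_cont continuous_on_cis continuous_on_id)

lemma measurable_sfold [measurable]: "sfold a \<in> BM"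
 unfolding sfold_def by measurable

lemma measurable_bad [measurable]: "Measurable.pred borel (bad a)"
 unfolding bad_def by measurable

section \<open>Interaction measures of sets, and comparison with the truncated map\<close>

lemma nn_integral_gm_swap:
 assumes [measurable]: "F \<in> BM2"
 shows "(NG p. F (snd p, fst p)) = (NG p. F p)"
proof -
 have "(NG p. F (snd p, fst p)) = (NL x. NL y. en (1 / (x - y)^2) * F (y, x))"
  by (subst nn_integral_gm_iter) auto
 also have "... = (NL y. NL x. en (1 / (x - y)^2) * F (y, x))"
  by (rule lborel_pair.Fubini') (simp add: case_prod_beta)
 also have "... = (NG p. F p)"
  by (subst nn_integral_gm_iter) (auto simp: power2_commute)
 finally show ?thesis .
qed

lemma emeasure_gm_Times:
 assumes [measurable]: "X \<in> sets borel" "Y \<in> sets borel"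
 shows "emg (X \<times> Y) = (NL x. ind X x * (NL y. ind Y y * en (1 / (y - x)^2)))"
proof -
 have "emg (X \<times> Y) = (NG p. ind (X \<times> Y) p)" by (subst nn_integral_indicator) auto
 also have "... = (NL x. NL y. en (1 / (x - y)^2) * ind (X \<times> Y) (x, y))"
  by (subst nn_integral_gm_iter) auto
 also have "... = (NL x. ind X x * (NL y. ind Y y * en (1 / (y - x)^2)))"
 proof (intro nn_integral_cong)
  fix x :: real
  show "(NL y. en (1 / (x - y)^2) * ind (X \<times> Y) (x, y)) = ind X x * (NL y. ind Y y * en (1 / (y - x)^2))"
   by (cases "x \<in> X") (auto simp: indicator_times power2_commute mult.commute)
 qed
 finally show ?thesis .
qed

lemma emeasure_gm_Times_swap:
 assumes [measurable]: "X \<in> sets borel" "Y \<in> sets borel"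
 shows "emg (X \<times> Y) = emg (Y \<times> X)"
proof -
 have "emg (X \<times> Y) = (NG p. ind (X \<times> Y) p)" by (subst nn_integral_indicator) auto
 also have "... = (NG p. ind (X \<times> Y) (snd p, fst p))" by (rule nn_integral_gm_swap[symmetric]) simp
 also have "... = (NG p. ind (Y \<times> X) p)" by (intro nn_integral_cong) (auto simp: ind_def)
 also have "... = emg (Y \<times> X)" by (subst nn_integral_indicator) auto
 finally show ?thesis .
qed

lemma nn_integral_tail:
 assumes d: "0 < d"
 shows "(NL y. ind (- {c - d<..<c + d}) y * en (1 / (y - c)^2)) <= en (2 / d)"
proof -
 let ?a = "NL y. en (1 / y^2) * ind {d..} y"
 have r: "?a = en (1 / d)"
 proof -
  have "?a = en (0 - - (1 / d))"
  proof (rule nn_integral_FTC_atLeast[where F="%y. - (1 / y)"])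
   show "DERIV (%y. - (1 / y)) y :> 1 / y^2" if "d <= y" for y
    using that d by (auto intro!: derivative_eq_intros simp: sq_eq)
   show "((%y::real. - (1 / y)) \<longlongrightarrow> 0) at_top"
    by real_asymp
  qed auto
  thus ?thesis by simp
 qed
 let ?b = "NL y. en (1 / (0 + (-1) * y)^2) * ind {d..} (0 + (-1) * y)"
 have "(NL y. ind (- {c - d<..<c + d}) y * en (1 / (y - c)^2))
  = (NL y. ind (- {c - d<..<c + d}) (c + 1 * y) * en (1 / ((c + 1 * y) - c)^2))"
  by (subst nn_integral_real_affine[where c=1 and t=c]) auto
 also have "... <= (NL y. en (1 / y^2) * ind {d..} y + en (1 / y^2) * ind {d..} (0 + (-1) * y))"
  by (intro nn_integral_mono) (auto simp: ind_def)
 also have "... = ?a + ?b"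
  by (subst nn_integral_add) auto
 also have "?b = ?a"
  by (subst (2) nn_integral_real_affine[where c="-1" and t=0]) auto
 also have "?a + ?a = en (2 / d)"
  unfolding r using d by (simp add: ennreal_plus[symmetric] del: ennreal_plus)
 finally show ?thesis .
qed

abbreviation opn :: "real => real => real set" where "opn c r \<equiv> {c - r<..<c + r}"

text \<open>The competitor folds \<open>u\<close> on \<open>J\<close> only, without a cutoff
  function. Folding fixes good values and is nonexpansive, so the energy can grow only on pairs of
  bad points separated by the boundary of \<open>J\<close>: by at most \<open>4\<close> per pair, in
  both orders, whence the \<open>8\<close>. Inside \<open>J\<close>, pairs of a value good at level
  \<open>a\<close> and one bad at level \<open>a'\<close> gain by \<open>fold_gain\<close>. The
  assumption \<open>BI\<close> keeps the boundary values. If the crossing interaction is infinite,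
  there is nothing to show.\<close>

lemma fold_energy:
 assumes u: "u \<in> Hmaps" and p: "cmod p = 1" and a: "0 <= a" "a < a'" "a' <= pi / 4"
  and min: "!!w. w \<in> Hmaps ==> (\<forall>x. x \<notin> {-1<..<1} --> w x = u x) ==> gag u <= gag w"
  and J: "J \<in> sets borel" and BI: "!!x. x \<in> J ==> bad a (u x * cnj p) ==> x \<in> {-1<..<1}"
 defines "B \<equiv> {x. bad a (u x * cnj p)}" and "B' \<equiv> {x. bad a' (u x * cnj p)}"
 shows "en (4 * (sin ((a' - a) / 2))^2) * emg ((J - B) \<times> (B' \<inter> J)) <= 8 * emg ((B \<inter> J) \<times> (B - J))"
proof (cases "emg ((B \<inter> J) \<times> (B - J)) < \<infinity>")
 case False
 thus ?thesis by (simp add: less_top[symmetric] ennreal_mult_top)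
next
 case True
 note [measurable] = HmapsD(1)[OF u] J
 define v where "v x = u x * cnj p" for x
 have nv: "cmod (v x) = 1" for x using HmapsD(2)[OF u] p by (simp add: v_def norm_mult)
 have pp: "p * cnj p = 1" using p by (simp add: complex_mult_cnj cmod_power2[symmetric])
 have uv: "u x = p * v x" for x using pp by (simp add: v_def algebra_simps)
 have [measurable]: "v \<in> BM" unfolding v_def[abs_def] by measurable
 have Bv: "B = {x. bad a (v x)}" "B' = {x. bad a' (v x)}" by (auto simp: B_def B'_def v_def)
 have [measurable]: "B \<in> sets borel" "B' \<in> sets borel" unfolding Bv by measurable
 have B'B: "B' \<subseteq> B" using bad_mono[of a a'] a by (auto simp: Bv)
 define w where "w x = (if x \<in> J then p * sfold a (v x) else u x)" for x
 have nw: "cmod (w x) = 1" for x using p HmapsD(2)[OF u] by (simp add: w_def norm_mult sfold_def)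
 have [measurable]: "w \<in> BM" unfolding w_def[abs_def] by measurable
 have w_good: "w x = u x" if "x \<notin> B" for x
  using good_eq_cis(2)[OF nv, of a x] that uv by (auto simp: w_def Bv)
 define h where "h = 4 * (sin ((a' - a) / 2))^2"
 have h0: "0 <= h" by (simp add: h_def)
 define G L where "G = (J - B) \<times> (B' \<inter> J)" and "L = (B \<inter> J) \<times> (B - J)"
 define L' where "L' = (B - J) \<times> (B \<inter> J)"
 let ?a = "borel \<Otimes>\<^sub>M borel"
 have [measurable]: "G \<in> sets ?a" "L \<in> sets ?a" "L' \<in> sets ?a"
  unfolding G_def L_def L'_def by measurable
 have d4: "csq (a - b) <= 4" if "cmod a = 1" "cmod b = 1" for a b
 proof -
  have "cmod (a - b) <= 2" using norm_triangle_ineq4[of a b] that by simp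
  from power_mono[OF this, of 2] show ?thesis by simp
 qed
 have pd: "cmod (p * z - p * z') = cmod (z - z')" for z z'
  using p by (metis mult_1 norm_mult right_diff_distrib)
 have point: "dsq w q + h * ind G q <= dsq u q + 4 * ind L q + 4 * ind L' q" for q
 proof -
  obtain x y where q: "q = (x, y)" by force
  have i0: "0 <= 4 * ind L q + 4 * (ind L' q :: real)" by simp
  let ?b = "sfold a (v x) - sfold a (v y)"
  let ?c = "4 * ind L q + 4 * ind L' q"
  consider "x \<in> J" "y \<in> J" | "x \<notin> J" "y \<notin> J" | "x \<in> J" "y \<notin> J" | "x \<notin> J" "y \<in> J" by blast
  thus ?thesis
  proof cases
   case 1
   have wx: "w x = p * sfold a (v x)" "w y = p * sfold a (v y)" using 1 by (auto simp: w_def)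
   show ?thesis
   proof (cases "q \<in> G")
    case True
    hence "\<not> bad a (v x)" "bad a' (v y)" by (auto simp: q G_def Bv)
    hence "csq (sfold a (v y) - v x) + h <= csq (v y - v x)" "sfold a (v x) = v x"
     unfolding h_def using a nv by (auto intro!: fold_gain good_eq_cis)
    hence "dsq w q + h * ind G q <= dsq u q" unfolding q fst_conv snd_conv wx uv pd using True q
     by (auto simp: norm_minus_commute)
    thus ?thesis using i0 by linarith
   next
    case False
    have "cmod ?b <= cmod (v x - v y)" by (intro sfold_lipschitz nv a)
    from power_mono[OF this, of 2] have "dsq w q + h * ind G q <= dsq u q"
     unfolding q fst_conv snd_conv wx uv pd using False q by auto
    thus ?thesis using i0 by linarith
   qed
  next
   case 2
   thus ?thesis by (auto simp: q w_def G_def L_def L'_def)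
  next
   case 3
   hence G: "q \<notin> G" by (auto simp: q G_def)
   show ?thesis
   proof (cases "x \<in> B \<and> y \<in> B")
    case True
    hence "q \<in> L" using 3 by (auto simp: q L_def)
    hence "dsq w q + h * ind G q <= 0 + 4" using G d4[OF nw nw, of x y] by (simp add: q)
    also have "... <= dsq u q + ?c"
     using \<open>q \<in> L\<close> by (intro add_mono) auto
    finally show ?thesis by simp
   next
    case False
    have wy: "w y = u y" using 3 by (simp add: w_def)
    have "dsq w q <= dsq u q"
    proof (cases "x \<in> B")
     case True
     hence y: "\<not> bad a (v y)" using False by (auto simp: Bv)
     have "cmod ?b <= cmod (v x - v y)" by (intro sfold_lipschitz nv a)
     hence "cmod (w x - w y) <= cmod (u x - u y)"
      using 3 unfolding wy uv good_eq_cis(2)[OF nv y] by (simp add: w_def pd)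
     from power_mono[OF this, of 2] show ?thesis by (simp add: q)
    qed (simp add: q w_good wy)
    hence "dsq w q + h * ind G q <= dsq u q" using G by simp
    thus ?thesis using i0 by linarith
   qed
  next
   case 4
   hence G: "q \<notin> G" by (auto simp: q G_def)
   show ?thesis
   proof (cases "x \<in> B \<and> y \<in> B")
    case True
    hence "q \<in> L'" using 4 by (auto simp: q L'_def)
    hence "dsq w q + h * ind G q <= 0 + 4" using G d4[OF nw nw, of x y] by (simp add: q)
    also have "... <= dsq u q + ?c"
     using \<open>q \<in> L'\<close> by (intro add_mono) auto
    finally show ?thesis by simp
   next
    case False
    have wx: "w x = u x" using 4 by (simp add: w_def)
    have "dsq w q <= dsq u q"
    proof (cases "y \<in> B")
     case True
     hence x: "\<not> bad a (v x)" using False by (auto simp: Bv)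
     have "cmod ?b <= cmod (v x - v y)" by (intro sfold_lipschitz nv a)
     hence "cmod (w x - w y) <= cmod (u x - u y)"
      using 4 unfolding wx uv good_eq_cis(2)[OF nv x] by (simp add: w_def pd)
     from power_mono[OF this, of 2] show ?thesis by (simp add: q)
    qed (simp add: q w_good wx)
    hence "dsq w q + h * ind G q <= dsq u q" using G by simp
    thus ?thesis using i0 by linarith
   qed
  qed
 qed
 have LL: "emg L' = emg L" unfolding L_def L'_def by (rule emeasure_gm_Times_swap) measurable
 have "gag w + en h * emg G = (NG q. en (dsq w q) + en h * ind G q)"
  unfolding gag_def by (subst nn_integral_add) (auto simp: nn_integral_cmult_indicator)
 also have "... <= (NG q. (en (dsq u q) + 4 * ind L q) + 4 * ind L' q)"
 proof (intro nn_integral_mono)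
  fix q
  have "en (dsq w q + h * ind G q) <= en (dsq u q + 4 * ind L q + 4 * ind L' q)"
   by (rule ennreal_leI[OF point])
  thus "en (dsq w q) + en h * ind G q <= en (dsq u q) + 4 * ind L q + 4 * ind L' q"
   using h0 by (auto simp: ennreal_plus ind_def split: if_splits)
 qed
 also have "... = gag u + 4 * emg L + 4 * emg L'"
  unfolding gag_def by (subst nn_integral_add, simp, simp, subst nn_integral_add) (auto simp: nn_integral_cmult_indicator)
 also have "... = gag u + 8 * emg L"
  unfolding LL by (simp add: add.assoc distrib_right[symmetric])
 finally have *: "gag w + en h * emg G <= gag u + 8 * emg L" .
 have fin: "gag u < \<infinity>" "8 * emg L < \<infinity>" using HmapsD(3)[OF u] True by (auto simp: L_def ennreal_mult_less_top)
 have "gag w < \<infinity>"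
 proof -
  have "gag w <= gag w + en h * emg G" by simp
  also note *
  also have "gag u + 8 * emg L < \<infinity>" using fin by simp
  finally show ?thesis .
 qed
 hence wH: "w \<in> Hmaps" using nw by (simp add: Hmaps_def)
 have "gag u <= gag w"
 proof (rule min[OF wH], intro allI impI)
  fix x :: real assume x: "x \<notin> {-1<..<1}"
  show "w x = u x"
  proof (cases "x \<in> J")
   case True
   hence "x \<notin> B" using BI x by (auto simp: B_def)
   thus ?thesis by (rule w_good)
  qed (simp add: w_def)
 qed
 hence "gag u + en h * emg G <= gag u + 8 * emg L"
  using * by (meson add_right_mono order_trans)
 thus ?thesis using fin(1) by (auto simp: G_def L_def h_def ennreal_add_left_cancel_le)
qed

text \<open>A nonlocal isoperimetric inequality. From any point of the interval, a piece of length
  \<open>2 * m\<close> in the direction of the centre stays inside, and at least half of it is good.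
  On it \<open>1 / (y - x)^2\<close> is at least \<open>1 / (4 * m^2)\<close>, so every point sees
  good points with total weight at least \<open>1 / (4 * m)\<close>.\<close>

lemma sobolev_step:
 assumes [measurable]: "B \<in> sets borel" "B' \<in> sets borel" and BB: "B' \<subseteq> B" and r: "0 < r" "r <= r0"
  and m: "em (B \<inter> opn c r0) <= en m" "0 <= m" "2 * m <= r"
 shows "em (B' \<inter> opn c r) <= en (4 * m) * emg ((opn c r - B) \<times> (B' \<inter> opn c r))"
proof (cases "m = 0")
 case True
 have "em (B' \<inter> opn c r) <= em (B \<inter> opn c r0)"
  using BB r by (intro emeasure_mono) auto
 thus ?thesis using m True by simp
next
 case False
 hence m0: "m > 0" using m by simp
 let ?a = "%x. NL y. ind (opn c r - B) y * en (1 / (y - x)^2)"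
 have low: "en (1 / (4 * m)) <= ?a x" if x: "x \<in> opn c r" for x
 proof -
  define S where "S = (if x <= c then {x<..<x + 2 * m} else {x - 2 * m<..<x})"
  have S: "S \<subseteq> opn c r" using x m(3) by (auto simp: S_def)
  have [measurable]: "S \<in> sets borel" by (simp add: S_def)
  have eS: "em S = en (2 * m)" using m0 by (simp add: S_def)
  have "en m <= em (S - B)"
  proof -
   have "em S <= em (S - B) + em (B \<inter> opn c r0)"
    using S r by (intro order_trans[OF emeasure_mono emeasure_subadditive]) auto
   also have "... <= em (S - B) + en m" using m by (intro add_left_mono)
   finally have "en m + en m <= em (S - B) + en m"
    using m0 unfolding eS by (simp add: ennreal_plus[symmetric] del: ennreal_plus)
   thus ?thesis using ennreal_add_left_cancel_le[of "en m"] by (simp add: add.commute)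
  qed
  hence "en (1 / (4 * m^2)) * en m <= en (1 / (4 * m^2)) * em (S - B)"
   by (intro mult_left_mono) auto
  also have "... = (NL y. en (1 / (4 * m^2)) * ind (S - B) y)"
   by (subst nn_integral_cmult_indicator) auto
  also have "... <= ?a x"
  proof (intro nn_integral_mono)
   fix y
   show "en (1 / (4 * m^2)) * ind (S - B) y <= ind (opn c r - B) y * en (1 / (y - x)^2)"
   proof (cases "y \<in> S - B")
    case True
    hence y: "y \<in> opn c r - B" using S by auto
    have "abs (y - x) <= 2 * m" "y ~= x" using True by (auto simp: S_def split: if_splits)
    hence "(y - x)^2 <= 4 * m^2" "0 < (y - x)^2"
     using power_mono[of "abs (y - x)" "2 * m" 2] by (auto simp: power_mult_distrib)
    hence "1 / (4 * m^2) <= 1 / (y - x)^2" using m0 by (intro divide_left_mono) auto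
    thus ?thesis using True y by (simp add: ennreal_leI)
   qed simp
  qed
  finally show ?thesis using m0 by (simp add: ennreal_mult[symmetric] sq_eq)
 qed
 let ?b = "(opn c r - B) \<times> (B' \<inter> opn c r)"
 have "en (1 / (4 * m)) * em (B' \<inter> opn c r) = (NL x. en (1 / (4 * m)) * ind (B' \<inter> opn c r) x)"
  by (subst nn_integral_cmult_indicator) auto
 also have "... <= (NL x. ind (B' \<inter> opn c r) x * ?a x)"
  using low by (intro nn_integral_mono) (auto simp: ind_def)
 also have "... = emg ?b"
  by (subst emeasure_gm_Times_swap) (auto simp: emeasure_gm_Times)
 finally have "en (1 / (4 * m)) * em (B' \<inter> opn c r) <= emg ?b" .
 hence "en (4 * m) * (en (1 / (4 * m)) * em (B' \<inter> opn c r)) <= en (4 * m) * emg ?b"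
  by (intro mult_left_mono) auto
 moreover have "en (4 * m) * (en (1 / (4 * m)) * X) = X" for X
  using m0 by (simp add: mult.assoc[symmetric] ennreal_mult[symmetric])
 ultimately show ?thesis by simp
qed

text \<open>A mean value argument over the radius. Points outside \<open>A\<close> see
  \<open>X\<close> with total weight at most \<open>F\<close>, and the radii for which
  \<open>c + r\<close> and \<open>c - r\<close> both avoid \<open>A\<close> still fill at least half
  of the range; one of them does not exceed the mean. \<open>A\<close> enters because the
  interaction is controlled only against points good at the previous level. The \<open>+ 1\<close>
  makes the contradiction strict.\<close>

lemma good_radius:
 fixes A X :: "real set"
 assumes [measurable]: "A \<in> sets borel" "X \<in> sets borel" and r: "0 < r1" "r1 < r0"
  and mA: "em (A \<inter> opn c r0) <= en ((r0 - r1) / 8)"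
  and G: "emg ((opn c r0 - A) \<times> X) <= en F" and F: "0 <= F"
 defines "g \<equiv> %y. (NL x. ind X x * en (1 / (x - y)^2))"
 shows "\<exists>r. r1 < r \<and> r < (r0 + r1) / 2 \<and> g (c + r) + g (c - r) <= en (4 * (F + 1) / (r0 - r1))"
proof (rule ccontr)
 assume neg: "\<not> ?thesis"
 define S where "S = {r1<..<(r0 + r1) / 2}"
 define T where "T = {r \<in> S. c + r \<notin> A \<and> c - r \<notin> A}"
 define K where "K = 4 * (F + 1) / (r0 - r1)"
 have K: "0 < K" using r F by (simp add: K_def)
 have [measurable]: "S \<in> sets borel" by (simp add: S_def)
 have [measurable]: "T \<in> sets borel"
 proof -
  have "T = S \<inter> ((%r. c + r) -` (- A) \<inter> space borel) \<inter> ((%r. c - r) -` (- A) \<inter> space borel)" by (auto simp: T_def)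
  also have "... \<in> sets borel" by measurable
  finally show ?thesis .
 qed
 have [measurable]: "g \<in> BM" unfolding g_def by measurable
 have shift: "(NL r. f (c + r)) = (NL y. f y)" "(NL r. f (c - r)) = (NL y. f y)"
  if [measurable]: "f \<in> BM" for f :: "real => ennreal"
  using nn_integral_real_affine[of f 1 c] nn_integral_real_affine[of f "-1" c] by simp_all
 have mS: "em S = en ((r0 - r1) / 2)"
 proof -
  have "(r0 + r1) / 2 - r1 = (r0 - r1) / 2" by (simp add: field_simps)
  thus ?thesis using r by (simp add: S_def)
 qed
 let ?a = "NL r. ind S r * ind A (c + r)"
 let ?b = "NL r. ind S r * ind A (c - r)"
 have eA: "?a + ?b <= em (A \<inter> opn c r0)"
 proof -
  let ?c = "A \<inter> {c<..<c + r0}"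
  have "?a <= (NL r. ind ?c (c + r))"
   using r by (intro nn_integral_mono) (auto simp: S_def ind_def)
  also have "... = (NL y. ind ?c y)" by (rule shift) simp
  finally have 1: "?a <= (NL y. ind ?c y)" .
  let ?d = "A \<inter> {c - r0<..<c}"
  have "?b <= (NL r. ind ?d (c - r))"
   using r by (intro nn_integral_mono) (auto simp: S_def ind_def)
  also have "... = (NL y. ind ?d y)" by (rule shift) simp
  finally have 2: "?b <= (NL y. ind ?d y)" .
  have "(NL y. ind ?c y) + (NL y. ind ?d y) = (NL y. ind ?c y + ind ?d y)"
   by (rule nn_integral_add[symmetric]) auto
  also have "... <= (NL y. ind (A \<inter> opn c r0) y)"
   using r by (intro nn_integral_mono) (auto simp: ind_def)
  also have "... = em (A \<inter> opn c r0)" by (subst nn_integral_indicator) auto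
  finally show ?thesis using add_mono[OF 1 2] by (rule order_trans[rotated])
 qed
 have [measurable]: "(%r. ind S r * ind A (c + r) :: ennreal) \<in> BM"
  "(%r. ind S r * ind A (c - r) :: ennreal) \<in> BM"
  by measurable
 have mT: "en ((r0 - r1) / 4) <= em T"
 proof -
  have "em S = (NL r. ind S r)" by (subst nn_integral_indicator) auto
  also have "... <= (NL r. ind T r + (ind S r * ind A (c + r) + ind S r * ind A (c - r)))"
   by (intro nn_integral_mono) (auto simp: T_def ind_def)
  also have "... = em T + (?a + ?b)"
   by (simp add: nn_integral_add)
  also have "... <= em T + en ((r0 - r1) / 8)"
   using order_trans[OF eA mA] by (intro add_left_mono)
  also have "... <= em T + en ((r0 - r1) / 4)"
   using r by (intro add_left_mono ennreal_leI) auto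
  finally have 1: "en ((r0 - r1) / 2) <= em T + en ((r0 - r1) / 4)"
   unfolding mS .
  have "en ((r0 - r1) / 4) + en ((r0 - r1) / 4) = en ((r0 - r1) / 4 + (r0 - r1) / 4)"
   using r by (subst ennreal_plus) auto
  also have "(r0 - r1) / 4 + (r0 - r1) / 4 = (r0 - r1) / 2" by simp
  finally have "en ((r0 - r1) / 4) + en ((r0 - r1) / 4) <= em T + en ((r0 - r1) / 4)"
   using 1 by simp
  thus ?thesis using ennreal_add_left_cancel_le[of "en ((r0 - r1) / 4)"] by (simp add: add.commute)
 qed
 let ?e = "{c<..<c + r0} - A"
 let ?f = "{c - r0<..<c} - A"
 have "en (F + 1) = en K * en ((r0 - r1) / 4)"
 proof -
  have "K * ((r0 - r1) / 4) = F + 1" using r by (simp add: K_def)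
  thus ?thesis using K r by (metis ennreal_mult' less_imp_le)
 qed
 also have "... <= en K * em T" by (intro mult_left_mono mT) auto
 also have "... = (NL r. en K * ind T r)" by (subst nn_integral_cmult_indicator) auto
 also have "... <= (NL r. ind T r * g (c + r) + ind T r * g (c - r))"
 proof (intro nn_integral_mono)
  fix r
  show "en K * ind T r <= ind T r * g (c + r) + ind T r * g (c - r)"
  proof (cases "r \<in> T")
   case True
   hence "\<not> g (c + r) + g (c - r) <= en K" using neg unfolding K_def by (auto simp: T_def S_def)
   thus ?thesis using True by simp
  qed simp
 qed
 also have "... = (NL r. ind T r * g (c + r)) + (NL r. ind T r * g (c - r))"
  by (rule nn_integral_add) measurable
 also have "... <= (NL r. ind ?e (c + r) * g (c + r)) + (NL r. ind ?f (c - r) * g (c - r))"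
  using r by (intro add_mono nn_integral_mono) (auto simp: T_def S_def ind_def)
 also have "... = (NL y. ind ?e y * g y) + (NL y. ind ?f y * g y)"
  using shift(1)[of "%y. ind ?e y * g y"]
   shift(2)[of "%y. ind ?f y * g y"] by simp
 also have "... = (NL y. ind ?e y * g y + ind ?f y * g y)"
  by (rule nn_integral_add[symmetric]) measurable
 also have "... <= (NL y. ind (opn c r0 - A) y * g y)"
  using r by (intro nn_integral_mono) (auto simp: ind_def)
 also have "... = emg ((opn c r0 - A) \<times> X)"
  unfolding g_def by (subst emeasure_gm_Times) auto
 also note G
 finally show False using F by (simp add: ennreal_le_iff)
qed

text \<open>For \<open>x\<close> inside radius \<open>r\<close> and \<open>y\<close> between
  \<open>r\<close> and \<open>r0\<close>, an end point of the smaller interval separates them, so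
  \<open>1 / (y - x)^2\<close> is at most the weight of \<open>x\<close> seen from that end point,
  which the choice of the radius controls; \<open>y\<close> ranges over measure at most
  \<open>m\<close>. For farther \<open>y\<close> the tail is \<open>2 / (r0 - r)\<close>, and the
  factor \<open>m\<close> comes from \<open>x\<close>.\<close>

lemma crossing_bound:
 assumes [measurable]: "B \<in> sets borel" and r: "0 < r" "r < r0"
  and m: "em (B \<inter> opn c r0) <= en m" "0 <= m"
  and K: "(NL x. ind (B \<inter> opn c r0) x * en (1 / (x - (c + r))^2))
   + (NL x. ind (B \<inter> opn c r0) x * en (1 / (x - (c - r))^2)) <= en K" and K0: "0 <= K"
 shows "emg ((B \<inter> opn c r) \<times> (B - opn c r)) <= en (m * (K + 2 / (r0 - r)))"
proof -
 define X where "X = B \<inter> opn c r0"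
 have [measurable]: "X \<in> sets borel" by (simp add: X_def)
 let ?i = "%x. en (1 / (x - (c + r))^2) + en (1 / (x - (c - r))^2)"
 let ?a = "%x. NL y. ind (B - opn c r) y * en (1 / (y - x)^2)"
 have inner: "?a x <= ?i x * em X + en (2 / (r0 - r))"
  if x: "x \<in> B \<inter> opn c r" for x
 proof -
  let ?b = "- {x - (r0 - r)<..<x + (r0 - r)}"
  have "?a x <= (NL y. ?i x * ind X y + ind ?b y * en (1 / (y - x)^2))"
  proof (intro nn_integral_mono)
   fix y
   show "ind (B - opn c r) y * en (1 / (y - x)^2) <= ?i x * ind X y + ind ?b y * en (1 / (y - x)^2)"
   proof (cases "y \<in> B - opn c r")
    case y: True
    show ?thesis
    proof (cases "y \<in> opn c r0")
     case True
     have "en (1 / (y - x)^2) <= ?i x"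
     proof (cases "y \<ge> c + r")
      case True
      have "0 < c + r - x" "c + r - x <= y - x" using x True by auto
      hence "(c + r - x)^2 <= (y - x)^2" "0 < (c + r - x)^2" "0 < (y - x)^2" by (auto intro!: power_mono)
      hence "1 / (y - x)^2 <= 1 / (x - (c + r))^2" by (subst power2_commute[of x]) (intro divide_left_mono mult_pos_pos, auto)
      thus ?thesis by (intro add_increasing2 ennreal_leI) auto
     next
      case False
      hence "y <= c - r" using y by auto
      hence "0 < x - (c - r)" "x - (c - r) <= x - y" using x by auto
      hence "(x - (c - r))^2 <= (x - y)^2" "0 < (x - (c - r))^2" "0 < (x - y)^2" by (auto intro!: power_mono)
      hence "1 / (y - x)^2 <= 1 / (x - (c - r))^2" by (subst power2_commute[of y]) (intro divide_left_mono mult_pos_pos, auto)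
      thus ?thesis by (intro add_increasing ennreal_leI) auto
     qed
     thus ?thesis using y True by (intro add_increasing2) (auto simp: X_def)
    next
     case False
     hence "y \<notin> {x - (r0 - r)<..<x + (r0 - r)}" using x by auto
     thus ?thesis using y by (intro add_increasing) auto
    qed
   qed simp
  qed
  also have "... = ?i x * em X + (NL y. ind ?b y * en (1 / (y - x)^2))"
   by (subst nn_integral_add) (auto simp: nn_integral_cmult_indicator)
  also have "... <= ?i x * em X + en (2 / (r0 - r))"
   using r by (intro add_left_mono nn_integral_tail) auto
  finally show ?thesis .
 qed
 have "emg ((B \<inter> opn c r) \<times> (B - opn c r)) = (NL x. ind (B \<inter> opn c r) x * ?a x)"
  by (subst emeasure_gm_Times) auto
 also have "... <= (NL x. ind X x * (?i x * em X + en (2 / (r0 - r))))"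
  using inner r by (intro nn_integral_mono) (auto simp: ind_def X_def)
 also have "... = (NL x. (ind X x * en (1 / (x - (c + r))^2) + ind X x * en (1 / (x - (c - r))^2)) * em X + en (2 / (r0 - r)) * ind X x)"
  by (intro nn_integral_cong) (simp add: distrib_left distrib_right ac_simps)
 also have "... = ((NL x. ind X x * en (1 / (x - (c + r))^2)) + (NL x. ind X x * en (1 / (x - (c - r))^2))) * em X + en (2 / (r0 - r)) * em X"
  by (subst nn_integral_add, simp, simp, subst nn_integral_multc, simp, subst nn_integral_add, simp, simp, subst nn_integral_cmult_indicator, simp_all)
 also have "... <= en K * en m + en (2 / (r0 - r)) * en m"
  using K m(1) by (intro add_mono mult_mono) (auto simp: X_def)
 also have "... = en (m * (K + 2 / (r0 - r)))"
  using K0 m(2) r by (simp add: ennreal_mult[symmetric] ennreal_plus[symmetric] algebra_simps del: ennreal_plus)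
 finally show ?thesis .
qed

text \<open>Three consecutive levels meet: \<open>A\<close> selects the radius, only points of
  \<open>B\<close> are moved by the competitor, and \<open>B'\<close> is to be estimated. The bound
  is linear in the measure \<open>m\<close> of \<open>B\<close>; inserted into
  \<open>sobolev_step\<close> it makes the next measure quadratic in \<open>m\<close>, which is the
  source of the decay.\<close>

lemma degiorgi_step:
 assumes u: "u \<in> Hmaps" and p: "cmod p = 1" and a: "0 <= a" "a < a'" "a' <= pi / 4"
  and min: "!!w. w \<in> Hmaps ==> (\<forall>x. x \<notin> {-1<..<1} --> w x = u x) ==> gag u <= gag w"
  and r: "0 < r1" "r1 < r0" and A: "A \<in> sets borel"
 defines "B \<equiv> {x. bad a (u x * cnj p)}" and "B' \<equiv> {x. bad a' (u x * cnj p)}"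
 assumes BI: "B \<inter> opn c r0 \<subseteq> {-1<..<1}"
  and mA: "em (A \<inter> opn c r0) <= en ((r0 - r1) / 8)"
  and F: "emg ((opn c r0 - A) \<times> (B \<inter> opn c r0)) <= en f" and f: "0 <= f"
  and m: "em (B \<inter> opn c r0) <= en m" "0 <= m"
 shows "emg ((opn c r1 - B) \<times> (B' \<inter> opn c r1)) <= en (8 / (sin ((a' - a) / 2))^2 * m * (f + 2) / (r0 - r1))"
proof -
 note [measurable] = HmapsD(1)[OF u] A
 have [measurable]: "B \<in> sets borel" "B' \<in> sets borel" unfolding B_def B'_def by measurable
 obtain r where rr: "r1 < r" "r < (r0 + r1) / 2"
  and K: "(NL x. ind (B \<inter> opn c r0) x * en (1 / (x - (c + r))^2))
   + (NL x. ind (B \<inter> opn c r0) x * en (1 / (x - (c - r))^2)) <= en (4 * (f + 1) / (r0 - r1))"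
  using good_radius[OF A _ r mA F f] by auto
 have rr0: "r < r0" "r0 - r1 <= 2 * (r0 - r)" using rr r by (auto simp: field_simps)
 define s where "s = (sin ((a' - a) / 2))^2"
 have s: "0 < s" using a pi_gt_zero unfolding s_def by (intro zero_less_power sin_gt_zero) auto
 have J: "opn c r \<in> sets borel" by simp
 let ?a = "m * (4 * (f + 2) / (r0 - r1))"
 let ?b = "(opn c r1 - B) \<times> (B' \<inter> opn c r1)"
 have "en (4 * s) * emg ?b <= en (4 * s) * emg ((opn c r - B) \<times> (B' \<inter> opn c r))"
  using rr by (intro mult_left_mono emeasure_mono) auto
 also have "... <= 8 * emg ((B \<inter> opn c r) \<times> (B - opn c r))"
  unfolding s_def B_def B'_def
  by (rule fold_energy[OF u p a min J]) (use BI rr0 in \<open>auto simp: B_def\<close>)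
 also have "... <= 8 * en (m * (4 * (f + 1) / (r0 - r1) + 2 / (r0 - r)))"
  using r rr rr0 f by (intro mult_left_mono crossing_bound m K) auto
 also have "... <= 8 * en ?a"
 proof (intro mult_left_mono ennreal_leI m)
  have "2 / (r0 - r) <= 4 / (r0 - r1)" using rr0 r by (simp add: field_simps)
  thus "4 * (f + 1) / (r0 - r1) + 2 / (r0 - r) <= 4 * (f + 2) / (r0 - r1)"
   by (simp add: add_divide_distrib[symmetric] algebra_simps) (simp add: add_divide_distrib)
 qed auto
 also have "... = en (8 * ?a)"
  using m f r by (subst ennreal_mult) auto
 finally have "en (1 / (4 * s)) * (en (4 * s) * emg ?b) <= en (1 / (4 * s)) * en (8 * ?a)"
  by (intro mult_left_mono) auto
 moreover have "en (1 / (4 * s)) * (en (4 * s) * X) = X" for X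
  using s by (simp add: mult.assoc[symmetric] ennreal_mult[symmetric])
 moreover have "en (1 / (4 * s)) * en (8 * ?a) = en (8 / s * m * (f + 2) / (r0 - r1))"
  using s m f r by (simp add: ennreal_mult[symmetric])
 ultimately show ?thesis by (simp add: s_def)
qed

lemma bad_far:
 assumes "cmod z = 1" "cmod w = 1" "0 <= a" "a < a'" "a' <= pi / 4" "bad a' z" "\<not> bad a w"
 shows "4 * (sin ((a' - a) / 2))^2 <= csq (z - w)"
 using fold_gain[OF assms] zero_le_power2[of "cmod (sfold a z - w)"] by linarith

lemma half_le_sin:
 fixes x :: real
 assumes "0 <= x" "x <= 1" shows "x / 2 <= sin x"
proof -
 have "x * x <= x * 1" using assms by (intro mult_left_mono) auto
 hence "x^2 / 2 <= x / 2" by (simp add: sq_eq)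
 moreover have "x - sin x <= x^2 / 2" using abs_sin_minus_id_le[of x] by linarith
 ultimately show ?thesis by simp
qed

text \<open>The levels \<open>a k\<close> increase to \<open>2 * a0\<close> and the radii
  \<open>b k\<close> decrease to \<open>R\<close>, both with geometric gaps. A step loses
  \<open>4 ^ k\<close> through the angular gap and \<open>2 ^ k\<close> through the gap of the
  radii, while the measures are claimed to decay like \<open>16 ^ k\<close>; the surplus
  \<open>2 ^ k\<close> closes the induction, and in the limit the bad set has measure zero.\<close>

proposition degiorgi:
 assumes u: "u \<in> Hmaps"
  and min: "!!w. w \<in> Hmaps ==> (\<forall>x. x \<notin> {-1<..<1} --> w x = u x) ==> gag u <= gag w"
  and a0: "0 < a0" "a0 <= pi / 8"
 shows "\<exists>E>0. \<forall>c R p. 0 < R --> cmod p = 1 --> {x. bad a0 (u x * cnj p)} \<inter> opn c (2 * R) \<subseteq> {-1<..<1} -->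
   em ({x. bad a0 (u x * cnj p)} \<inter> opn c (2 * R)) <= en (E * R) -->
   (NG q. ind (opn c (2 * R) \<times> opn c (2 * R)) q * en (dsq u q)) <= en E -->
   em ({x. bad (2 * a0) (u x * cnj p)} \<inter> opn c R) = 0"
proof -
 note [measurable] = HmapsD(1)[OF u]
 define a where "a k = a0 * (2 - 1 / 2 ^ k)" for k :: nat
 have a_Suc: "a (Suc k) - a k = a0 / (2 * 2 ^ k)" for k by (simp add: a_def field_simps)
 have a_lt: "a k < a (Suc k)" for k
 proof -
  have "0 < a0 / (2 * 2 ^ k)" using a0 by simp
  thus ?thesis using a_Suc[of k] by linarith
 qed
 have a_b: "a0 <= a k" "a k < 2 * a0" for k
 proof -
  have "(1::real) / 2 ^ k <= 1" "0 < (1::real) / 2 ^ k" by auto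
  hence "a0 * 1 <= a k" "a k < a0 * 2" unfolding a_def using a0 by (auto intro!: mult_left_mono mult_strict_left_mono)
  thus "a0 <= a k" "a k < 2 * a0" by auto
 qed
 have apos: "0 <= a k" "a k <= pi / 4" for k using a_b[of k] a0 by auto
 define s where "s k = (sin ((a (Suc k) - a k) / 2))^2" for k
 have s_ge: "a0^2 / (64 * 4 ^ k) <= s k" for k
 proof -
  define x where "x = a0 / (4 * 2 ^ k)"
  have "(1::real) <= 2 ^ k" by simp
  moreover have "a0 <= 1" using a0 pi_less_4 by simp
  ultimately have "a0 <= 4 * 2 ^ k" by linarith
  hence x: "0 <= x" "x <= 1" using a0 by (auto simp: x_def divide_le_eq)
  have "(a (Suc k) - a k) / 2 = x" by (simp add: a_Suc x_def)
  hence "(x / 2)^2 <= s k" unfolding s_def using half_le_sin[OF x] x by (intro power_mono) auto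
  moreover have "(x / 2)^2 = a0^2 / (64 * 4 ^ k)"
   by (simp add: x_def sq_eq power_mult_distrib[symmetric])
  ultimately show ?thesis by simp
 qed
 have s0: "0 < s k" for k using s_ge[of k] a0 by (auto intro: less_le_trans[rotated])
 \<comment> \<open>\<open>1024 = 8 * 64 * 2\<close>: the constant of \<open>degiorgi_step\<close>,
   the one in \<open>s_ge\<close>, and the one in the gap of the radii.\<close>
 define C where "C = 1024 / a0^2"
 have C: "0 < C" using a0 by (simp add: C_def)
 define e where "e = min (1 / 256) (1 / (192 * C))"
 have e: "0 < e" "e <= 1 / 256" "3 * (C * e) <= 1 / 64"
 proof -
  show "0 < e" "e <= 1 / 256" using C by (auto simp: e_def)
  have "e <= 1 / (192 * C)" by (simp add: e_def)
  hence "e * (192 * C) <= 1" using C by (simp add: le_divide_eq)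
  thus "3 * (C * e) <= 1 / 64" by (simp add: ac_simps)
 qed
 \<comment> \<open>The bound \<open>e / 16\<close> starts the induction for the levels
   \<open>0\<close> and \<open>1\<close> at once. The bound \<open>4 * s 0\<close> turns small local
   energy into interaction at most \<open>1\<close>, since values separated by one level have
   squared distance at least \<open>4 * s 0\<close>.\<close>
 define E where "E = min (e / 16) (4 * s 0)"
 have "E > 0" using e s0 by (simp add: E_def)
 moreover have "em ({x. bad (2 * a0) (u x * cnj p)} \<inter> opn c R) = 0"
  if R: "0 < R" and p: "cmod p = 1" and BI: "{x. bad a0 (u x * cnj p)} \<inter> opn c (2 * R) \<subseteq> {-1<..<1}"
   and m0: "em ({x. bad a0 (u x * cnj p)} \<inter> opn c (2 * R)) <= en (E * R)"
   and loc: "(NG q. ind (opn c (2 * R) \<times> opn c (2 * R)) q * en (dsq u q)) <= en E" for c R p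
 proof -
  define B where "B k = {x. bad (a k) (u x * cnj p)}" for k
  define b where "b k = R * (1 + 1 / 2 ^ k)" for k :: nat
  have b0: "b 0 = 2 * R" "B 0 = {x. bad a0 (u x * cnj p)}" by (auto simp: b_def B_def a_def)
  have bd: "b k - b (Suc k) = R / (2 * 2 ^ k)" for k by (simp add: b_def field_simps)
  have blt: "b (Suc k) < b k" for k
  proof -
   have "0 < R / (2 * 2 ^ k)" using R by simp
   thus ?thesis using bd[of k] by linarith
  qed
  have bR: "R < b k" for k using R by (simp add: b_def)
  have bmono: "b k <= b 0" for k using R by (simp add: b_def)
  have [measurable]: "B k \<in> sets borel" for k unfolding B_def by measurable
  have Bmono: "B (Suc k) \<subseteq> B k" for k unfolding B_def using bad_mono[OF less_imp_le[OF a_lt]] by auto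
  have B0: "B k \<subseteq> B 0" for k unfolding B_def using bad_mono[of "a 0" "a k"] a_b(1)[of k] by (auto simp: a_def)
  let ?b = "%k. e * R / 16 ^ Suc k"
  \<comment> \<open>Two measures are carried because \<open>degiorgi_step\<close> involves two
    consecutive bad sets. The interaction needs only the bound \<open>1\<close> on entry; the step
    returns \<open>1 / 64\<close>, and the factor \<open>4\<close> in \<open>sobolev_step\<close>
    then gives the ratio \<open>1 / 16\<close>.\<close>
  have inv: "em (B k \<inter> opn c (b k)) <= en (e * R / 16 ^ k) \<and>
    em (B (Suc k) \<inter> opn c (b (Suc k))) <= en (?b k) \<and>
    emg ((opn c (b (Suc k)) - B k) \<times> (B (Suc k) \<inter> opn c (b (Suc k)))) <= en 1" for k
  proof (induction k)
   case 0
   let ?e = "B (Suc 0) \<inter> opn c (b (Suc 0))"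
   have 1: "em (B 0 \<inter> opn c (b 0)) <= en (e * R / 16)"
    using m0 unfolding b0 by (rule order_trans) (use R in \<open>auto intro!: ennreal_leI mult_right_mono simp: E_def\<close>)
   moreover have "em (B 0 \<inter> opn c (b 0)) <= en (e * R)"
    using 1 by (rule order_trans) (use R e in \<open>auto intro!: ennreal_leI\<close>)
   moreover have "em ?e <= em (B 0 \<inter> opn c (b 0))"
    using Bmono[of 0] blt[of 0] by (intro emeasure_mono) auto
   moreover have "emg ((opn c (b (Suc 0)) - B 0) \<times> ?e) <= en 1"
   proof -
    define G where "G = (opn c (b (Suc 0)) - B 0) \<times> ?e"
    have [measurable]: "G \<in> sets BB" unfolding G_def by measurable
    have "en (4 * s 0) * emg G = (NG q. en (4 * s 0) * ind G q)"
     by (subst nn_integral_cmult_indicator) auto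
    also have "... <= (NG q. ind (opn c (2 * R) \<times> opn c (2 * R)) q * en (dsq u q))"
    proof (intro nn_integral_mono)
     fix q
     show "en (4 * s 0) * ind G q <= ind (opn c (2 * R) \<times> opn c (2 * R)) q * en (dsq u q)"
     proof (cases "q \<in> G")
      case True
      hence q: "\<not> bad (a 0) (u (fst q) * cnj p)" "bad (a 1) (u (snd q) * cnj p)"
       and J: "q \<in> opn c (2 * R) \<times> opn c (2 * R)"
       using blt[of 0] by (auto simp: G_def B_def b0)
      have "4 * s 0 <= csq (u (snd q) * cnj p - u (fst q) * cnj p)"
       unfolding s_def using q apos a_lt[of 0] HmapsD(2)[OF u] p
       by (intro bad_far) (auto simp: norm_mult)
      also have "u (snd q) * cnj p - u (fst q) * cnj p = - ((u (fst q) - u (snd q)) * cnj p)" by (simp add: algebra_simps)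
      finally have "4 * s 0 <= dsq u q" using p by (simp add: norm_mult)
      thus ?thesis using True J by (simp add: ennreal_leI)
     qed simp
    qed
    also have "... <= en (4 * s 0)" using loc by (rule order_trans) (auto intro!: ennreal_leI simp: E_def)
    finally have "en (1 / (4 * s 0)) * (en (4 * s 0) * emg G) <= en (1 / (4 * s 0)) * en (4 * s 0)"
     by (intro mult_left_mono) auto
    moreover have "en (1 / (4 * s 0)) * en (4 * s 0) = 1" using s0[of 0] by (simp add: ennreal_mult[symmetric])
    ultimately show ?thesis by (simp add: mult.assoc[symmetric] G_def)
   qed
   ultimately show ?case by simp
  next
   case (Suc k)
   have mk: "0 <= e * R / 16 ^ Suc k" using e R by simp
   have p16: "(2::real) ^ k <= 16 ^ k" by (intro power_mono) auto
   let ?a = "(opn c (b (Suc (Suc k))) - B (Suc k)) \<times> (B (Suc (Suc k)) \<inter> opn c (b (Suc (Suc k))))"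
   have G: "emg ?a <= en (1 / 64)"
   proof -
    let ?c = "b (Suc k) - b (Suc (Suc k))"
    let ?d = "sin ((a (Suc (Suc k)) - a (Suc k)) / 2)"
    have "emg ?a <= en (8 / ?d^2 * ?b k * (1 + 2) / ?c)"
     unfolding B_def
    proof (rule degiorgi_step[OF u p apos(1) a_lt apos(2) min, where A="B k"])
     show "0 < b (Suc (Suc k))" using bR[of "Suc (Suc k)"] R by simp
     show "{x. bad (a (Suc k)) (u x * cnj p)} \<inter> opn c (b (Suc k)) \<subseteq> {-1<..<1}"
      using BI B0[of "Suc k"] bmono[of "Suc k"] unfolding b0(2)[symmetric] B_def[symmetric] b0(1)[symmetric] by auto
     have "em (B k \<inter> opn c (b (Suc k))) <= em (B k \<inter> opn c (b k))"
      using blt[of k] by (intro emeasure_mono) auto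
     also have "... <= en (e * R / 16 ^ k)" using Suc by simp
     also have "... <= en (?c / 8)"
     proof (rule ennreal_leI)
      have "e * R / 16 ^ k <= (1 / 256) * R / 16 ^ k" using e R by (intro divide_right_mono mult_right_mono) auto
      also have "... <= (1 / 256) * R / 2 ^ k" using p16 R by (intro divide_left_mono) auto
      also have "... <= (1 / 32) * R / 2 ^ k" using R by (intro divide_right_mono mult_right_mono) auto
      also have "... = ?c / 8" unfolding bd by simp
      finally show "e * R / 16 ^ k <= ?c / 8" .
     qed
     finally show "em (B k \<inter> opn c (b (Suc k))) <= en (?c / 8)" .
     show "emg ((opn c (b (Suc k)) - B k) \<times> ({x. bad (a (Suc k)) (u x * cnj p)} \<inter> opn c (b (Suc k)))) <= en 1"
      "em ({x. bad (a (Suc k)) (u x * cnj p)} \<inter> opn c (b (Suc k))) <= en (?b k)"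
      using Suc unfolding B_def[symmetric] by auto
    qed (use blt mk in auto)
    also have "... <= en (1 / 64)"
    proof (rule ennreal_leI)
     have "8 / ?d^2 * ?b k * (1 + 2) / ?c = 8 / s (Suc k) * ?b k * 3 / (R / (2 * 2 ^ Suc k))" unfolding bd s_def by simp
     also have "... <= 8 / (a0^2 / (64 * 4 ^ Suc k)) * ?b k * 3 / (R / (2 * 2 ^ Suc k))"
      using s_ge[of "Suc k"] s0[of "Suc k"] mk R a0
      by (intro divide_right_mono mult_right_mono divide_left_mono mult_pos_pos) auto
     also have "... = 3 * (C * e) / 2 ^ Suc k"
     proof -
      have "(16::real) ^ Suc k = 4 ^ Suc k * (2 ^ Suc k * 2 ^ Suc k)" by (simp only: power_mult_distrib[symmetric]) simp
      thus ?thesis using R a0 unfolding C_def by (simp add: divide_simps del: power_Suc)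
     qed
     also have "... <= 3 * (C * e) / 1" using C e one_le_power[of "2::real" "Suc k"] by (intro divide_left_mono) auto
     finally show "8 / ?d^2 * ?b k * (1 + 2) / ?c <= 1 / 64"
      by (rule order_trans) (use e(3) in simp)
    qed
    finally show ?thesis .
   qed
   have "em (B (Suc (Suc k)) \<inter> opn c (b (Suc (Suc k)))) <= en (4 * ?b k) * emg ?a"
   proof (rule sobolev_step[where ?r0.0="b (Suc k)"])
    show "em (B (Suc k) \<inter> opn c (b (Suc k))) <= en (?b k)" using Suc by simp
    have "2 * ?b k <= 2 * (e * R / 1)" using e R by (intro mult_left_mono divide_left_mono one_le_power) auto
    also have "... <= 2 * (1 / 256 * R / 1)" using e R by (intro mult_left_mono mult_right_mono divide_right_mono) auto
    also have "... <= R" using R by simp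
    finally show "2 * ?b k <= b (Suc (Suc k))" using bR[of "Suc (Suc k)"] by linarith
    show "0 < b (Suc (Suc k))" using bR[of "Suc (Suc k)"] R by simp
   qed (use Bmono[of "Suc k"] blt[of "Suc k"] mk in auto)
   also have "... <= en (4 * ?b k) * en (1 / 64)" by (intro mult_left_mono G) auto
   also have "... = en (4 * ?b k * (1 / 64))"
    by (rule ennreal_mult[symmetric], rule mult_nonneg_nonneg[OF _ mk]) simp_all
   also have "4 * ?b k * (1 / 64) = e * R / 16 ^ Suc (Suc k)" by simp
   finally show ?case using Suc G by (auto intro: order_trans)
  qed
  have "em ({x. bad (2 * a0) (u x * cnj p)} \<inter> opn c R) <= en (e * R / 16 ^ k)" for k
  proof -
   have "{x. bad (2 * a0) (u x * cnj p)} \<subseteq> B k" unfolding B_def using bad_mono[OF less_imp_le[OF a_b(2)]] by auto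
   hence "em ({x. bad (2 * a0) (u x * cnj p)} \<inter> opn c R) <= em (B k \<inter> opn c (b k))"
    using bR[of k] by (intro emeasure_mono) auto
   thus ?thesis using inv[of k] by (meson order_trans)
  qed
  moreover have "(%k. en (e * R / 16 ^ k)) ----> en 0"
   by (intro tendsto_ennrealI LIMSEQ_divide_realpow_zero) auto
  ultimately have "em ({x. bad (2 * a0) (u x * cnj p)} \<inter> opn c R) <= en 0"
   by (intro LIMSEQ_le_const) auto
  thus ?thesis by simp
 qed
 ultimately show ?thesis by blast
qed

section \<open>From small oscillation to a continuous representative\<close>

lemma local_energy_small:
 assumes u: "u \<in> Hmaps" and e: "0 < e"
 shows "\<exists>D>0. \<forall>r. r <= D --> (NG q. ind (opn c r \<times> opn c r) q * en (dsq u q)) <= en e"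
proof -
 note [measurable] = HmapsD(1)[OF u]
 define f where "f n q = ind (opn c (1 / real (Suc n)) \<times> opn c (1 / real (Suc n))) q * en (dsq u q)" for n q
 have "(%n. (NG q. f n q)) ----> (NG q. 0)"
 proof (rule nn_integral_dominated_convergence[where w="%q. en (dsq u q)"])
  show "f n \<in> borel_measurable gm" for n unfolding f_def[abs_def] by measurable
  show "AE q in gm. f n q <= en (dsq u q)" for n by (intro AE_I2) (auto simp: f_def ind_def)
  show "(NG q. en (dsq u q)) < \<infinity>" using HmapsD(3)[OF u] by (simp add: gag_def)
  show "AE q in gm. (%n. f n q) ----> 0"
  proof (rule AE_I2)
   fix q :: "real \<times> real"
   show "(%n. f n q) ----> 0"
   proof (cases "q = (c, c)")
    case True
    thus ?thesis by (simp add: f_def)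
   next
    case False
    define d where "d = max (abs (fst q - c)) (abs (snd q - c))"
    have "d > 0" using False by (auto simp: d_def prod_eq_iff max_def)
    then obtain N where N: "1 / real (Suc N) < d"
     using reals_Archimedean[of d] by (auto simp: inverse_eq_divide)
    have "f n q = 0" if "n \<ge> N" for n
    proof -
     have "1 / real (Suc n) <= 1 / real (Suc N)" using that by (intro divide_left_mono) auto
     hence "1 / real (Suc n) < d" using N by linarith
     hence "q \<notin> opn c (1 / real (Suc n)) \<times> opn c (1 / real (Suc n))"
      unfolding d_def less_max_iff_disj by (auto simp: mem_Times_iff)
     thus ?thesis by (simp add: f_def)
    qed
    thus ?thesis by (intro tendsto_eventually) (auto simp: eventually_sequentially)
   qed
  qed
 qed auto
 hence "eventually (%n. (NG q. f n q) < en e) sequentially"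
  using e by (intro order_tendstoD(2)) auto
 then obtain n where n: "(NG q. f n q) < en e" by (auto simp: eventually_sequentially)
 show ?thesis
 proof (intro exI[of _ "1 / real (Suc n)"] conjI allI impI)
  fix r assume r: "r <= 1 / real (Suc n)"
  let ?a = "NG q. ind (opn c r \<times> opn c r) q * en (dsq u q)"
  have "?a <= (NG q. f n q)"
   unfolding f_def using r by (intro nn_integral_mono) (auto simp: ind_def)
  thus "?a <= en e" using n by simp
 qed simp
qed

text \<open>Distances inside the interval are at most \<open>4 * R\<close>, so the unweighted double
  integral is at most \<open>16 * R^2 * e\<close>. If every \<open>y\<close> in \<open>H\<close>
  exceeded \<open>9 * R * e\<close>, it would be at least \<open>18 * R^2 * e\<close>.\<close>

lemma good_center:
 assumes u: "u \<in> Hmaps" and R: "0 < R" and e: "0 < e"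
  and loc: "(NG q. ind (opn c (2 * R) \<times> opn c (2 * R)) q * en (dsq u q)) <= en e"
  and H: "H \<subseteq> opn c (2 * R)" "H \<in> sets borel" "en (2 * R) <= em H"
 shows "\<exists>y\<in>H. (NL x. ind (opn c (2 * R)) x * en (csq (u x - u y))) <= en (9 * R * e)"
proof (rule ccontr)
 assume neg: "\<not> ?thesis"
 note [measurable] = HmapsD(1)[OF u] H(2)
 let ?J = "opn c (2 * R)"
 let ?a = "%x y. ind (?J \<times> ?J) (y, x) * en (dsq u (y, x))"
 let ?b = "%x y. cmod (u x - u y)"
 have "en (18 * R^2 * e) = en (9 * R * e) * en (2 * R)"
  using R e by (simp add: ennreal_mult[symmetric] sq_eq ac_simps)
 also have "... <= en (9 * R * e) * em H" by (intro mult_left_mono H) auto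
 also have "... = (NL y. en (9 * R * e) * ind H y)" by (subst nn_integral_cmult_indicator) auto
 also have "... <= (NL y. ind ?J y * (NL x. ind ?J x * en (?b x y^2)))"
 proof (intro nn_integral_mono)
  fix y
  show "en (9 * R * e) * ind H y <= ind ?J y * (NL x. ind ?J x * en (?b x y^2))"
   using neg H(1) by (cases "y \<in> H") (auto simp: not_le less_imp_le subset_iff ind_def)
 qed
 also have "... = (NL y. NL x. ind ?J y * (ind ?J x * en (?b x y^2)))"
  by (intro nn_integral_cong nn_integral_cmult[symmetric]) measurable
 also have "... <= (NL y. NL x. en ((4 * R)^2) * (en (1 / (y - x)^2) * ?a x y))"
 proof (intro nn_integral_mono)
  fix y x
  show "ind ?J y * (ind ?J x * en (?b x y^2)) <= en ((4 * R)^2) * (en (1 / (y - x)^2) * ?a x y)"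
  proof (cases "y \<in> ?J \<and> x \<in> ?J \<and> x ~= y")
   case True
   hence "abs (y - x) <= 4 * R" by auto
   hence "(y - x)^2 <= (4 * R)^2" using power_mono[of "abs (y - x)" "4 * R" 2] by simp
   hence "1 <= (4 * R)^2 * (1 / (y - x)^2)" using True by (simp add: le_divide_eq)
   hence "1 * ?b x y^2 <= (4 * R)^2 * (1 / (y - x)^2) * ?b x y^2" by (intro mult_right_mono) auto
   hence "en (?b x y^2) <= en ((4 * R)^2 * (1 / (y - x)^2) * ?b x y^2)" by (intro ennreal_leI) simp
   thus ?thesis using True by (simp add: ennreal_mult[symmetric] norm_minus_commute mult.assoc)
  qed (auto simp: ind_def)
 qed
 also have "... = (NL y. NL x. en (1 / (y - x)^2) * (en ((4 * R)^2) * ?a x y))"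
  by (simp only: mult.left_commute)
 also have "... = (NG q. en ((4 * R)^2) * (ind (?J \<times> ?J) q * en (dsq u q)))"
  by (subst nn_integral_gm_iter) auto
 also have "... = en ((4 * R)^2) * (NG q. ind (?J \<times> ?J) q * en (dsq u q))"
  by (subst nn_integral_cmult) auto
 also have "... <= en ((4 * R)^2) * en e" by (intro mult_left_mono loc) auto
 also have "... = en (16 * R^2 * e)" using e by (simp add: ennreal_mult[symmetric] power_mult_distrib)
 finally have "18 * R^2 * e <= 16 * R^2 * e" using e by (subst (asm) ennreal_le_iff) auto
 thus False using R e by simp
qed

lemma bad_dist:
 assumes "cmod z = 1" "cmod p = 1" "0 < a" "a <= pi / 4" "bad a (z * cnj p)"
 shows "2 * sin (a / 2) <= cmod (z - p)"
proof -
 have "4 * (sin ((a - 0) / 2))^2 <= csq (z * cnj p - 1)"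
  using assms by (intro bad_far) (auto simp: norm_mult bad_def ang_def clamp1_def)
 also have "p * cnj p = 1" using assms(2) by (simp add: complex_mult_cnj cmod_power2[symmetric])
 hence "z * cnj p - 1 = (z - p) * cnj p" by (simp add: algebra_simps)
 finally have "(2 * sin (a / 2))^2 <= csq (z - p)" using assms(2) by (simp add: norm_mult power_mult_distrib)
 thus ?thesis by (rule power2_le_imp_le) simp
qed

lemma good_near:
 assumes "cmod z = 1" "cmod p = 1" "\<not> bad a (z * cnj p)"
 shows "cmod (z - p) <= a"
proof -
 define s where "s = ang (z * cnj p)"
 have n: "cmod (z * cnj p) = 1" using assms by (simp add: norm_mult)
 have s: "z * cnj p = cis s" "abs s <= a" using good_eq_cis[OF n assms(3)] by (auto simp: s_def)
 have pp: "p * cnj p = 1" using assms(2) by (simp add: complex_mult_cnj cmod_power2[symmetric])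
 have "cmod (z - p) = cmod ((z - p) * cnj p)" using assms(2) by (simp add: norm_mult)
 also have "(z - p) * cnj p = cis s - cis 0" using s(1) pp by (simp add: algebra_simps)
 also have "cmod ... <= abs (s - 0)" by (rule norm_cis_diff_le)
 finally show ?thesis using s(2) by simp
qed

text \<open>Small local energy provides a value \<open>p = u y\<close> that \<open>u\<close>
  approximates in mean square; Chebyshev's inequality makes the bad set around \<open>p\<close>
  small, and \<open>degiorgi\<close> then removes it on half of the interval. The competitor must
  not touch points outside I, so none of those may be bad: this is arranged by the choice of
  \<open>y\<close>.\<close>

lemma minimizer_local_osc:
 assumes u: "u \<in> Hmaps"
  and min: "!!w. w \<in> Hmaps ==> (\<forall>x. x \<notin> {-1<..<1} --> w x = u x) ==> gag u <= gag w"
  and g: "continuous_on UNIV g" "!!x. x \<notin> {-1<..<1} ==> u x = g x"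
  and c: "c \<in> {-1..1}" and h: "0 < h"
 shows "\<exists>R>0. \<exists>p. AE x in lborel. x \<in> opn c R --> cmod (u x - p) <= h"
proof -
 note [measurable] = HmapsD(1)[OF u]
 define a where "a = min (h / 2) (pi / 8)"
 have a: "0 < a" "a <= pi / 8" "2 * a <= h" using h by (auto simp: a_def)
 define t where "t = 2 * sin (a / 2)"
 have t: "0 < t" unfolding t_def using a pi_gt_zero by (intro mult_pos_pos sin_gt_zero) auto
 obtain E where E: "E > 0" and DG: "!!c R p. 0 < R ==> cmod p = 1 ==> {x. bad a (u x * cnj p)} \<inter> opn c (2 * R) \<subseteq> {-1<..<1} ==>
   em ({x. bad a (u x * cnj p)} \<inter> opn c (2 * R)) <= en (E * R) ==>
   (NG q. ind (opn c (2 * R) \<times> opn c (2 * R)) q * en (dsq u q)) <= en E ==>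
   em ({x. bad (2 * a) (u x * cnj p)} \<inter> opn c R) = 0"
  using degiorgi[OF u min a(1,2)] by meson
 \<comment> \<open>Bad values are at chordal distance at least \<open>t\<close> from
   \<open>p\<close>, so Chebyshev's inequality bounds the bad set by \<open>9 * R * e / t^2\<close>,
   which has to be at most \<open>E * R\<close>.\<close>
 define e where "e = min E (E * t^2 / 9)"
 have e: "0 < e" "e <= E" "9 * e <= E * t^2" using E t by (auto simp: e_def min_def)
 obtain d where d: "d > 0" "!!r. r <= d ==> (NG q. ind (opn c r \<times> opn c r) q * en (dsq u q)) <= en e"
  using local_energy_small[OF u e(1), of c] by blast
 have "isCont g c" using g(1) by (simp add: continuous_on_eq_continuous_at)
 then obtain d' where d': "d' > 0" "!!x. abs (x - c) < d' ==> cmod (g x - g c) < t / 2"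
  using t unfolding continuous_at_eps_delta by (metis dist_norm half_gt_zero real_norm_def)
 define D where "D = (if c = -1 \<or> c = 1 then 1 else min (1 - c) (1 + c))"
 have D: "D > 0" using c by (auto simp: D_def)
 define R where "R = min (d / 2) (min (d' / 2) (D / 2))"
 have R: "0 < R" "2 * R <= d" "2 * R <= d'" "2 * R <= D" using d d' D by (auto simp: R_def)
 let ?J = "opn c (2 * R)"
 \<comment> \<open>At an end point of I the reference point is taken on the exterior side, so that
   \<open>p\<close> is a value of \<open>g\<close> close to \<open>g c\<close> and the nearby
   boundary data are good. For interior \<open>c\<close> the whole interval lies in I.\<close>
 define H where "H = (if c = 1 then {1<..<1 + 2 * R} else if c = -1 then {-1 - 2 * R<..<-1} else ?J)"
 have H: "H \<subseteq> ?J" "H \<in> sets borel" "en (2 * R) <= em H"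
  using R(1) by (auto simp: H_def ennreal_leI)
 have HI: "cmod (g x - u y) < t" if "y \<in> H" "x \<in> ?J" "x \<notin> {-1<..<1}" for x y
 proof (cases "c = -1 \<or> c = 1")
  case True
  hence "u y = g y" using that(1) by (intro g(2)) (auto simp: H_def split: if_splits)
  moreover have "cmod (g x - g c) < t / 2" "cmod (g y - g c) < t / 2"
  proof -
   have "abs (x - c) < d'" "abs (y - c) < d'"
    using that(2) subsetD[OF H(1) that(1)] R(3) by auto
   thus "cmod (g x - g c) < t / 2" "cmod (g y - g c) < t / 2" by (intro d'(2); simp)+
  qed
  ultimately show ?thesis using norm_triangle_ineq4[of "g x - g c" "g y - g c"] by simp
 next
  case False
  hence "D = min (1 - c) (1 + c)" by (simp add: D_def)
  thus ?thesis using that(2,3) R(4) by auto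
 qed
 obtain y where y: "y \<in> H" "(NL x. ind ?J x * en (csq (u x - u y))) <= en (9 * R * e)"
  using good_center[OF u R(1) e(1) d(2)[OF R(2)] H] by blast
 define p where "p = u y"
 have p: "cmod p = 1" using HmapsD(2)[OF u] by (simp add: p_def)
 define B where "B = {x. bad a (u x * cnj p)}"
 have [measurable]: "B \<in> sets borel" unfolding B_def by measurable
 have far: "t <= cmod (u x - p)" if "x \<in> B" for x
  unfolding t_def using that a HmapsD(2)[OF u] p by (intro bad_dist) (auto simp: B_def)
 have BI: "B \<inter> ?J \<subseteq> {-1<..<1}"
 proof (rule subsetI, rule ccontr)
  fix x assume x: "x \<in> B \<inter> ?J" "x \<notin> {-1<..<1}"
  hence "cmod (g x - p) < t" unfolding p_def using HI[OF y(1)] by blast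
  thus False using far[of x] x g(2)[OF x(2)] by simp
 qed
 have Bm: "em (B \<inter> ?J) <= en (E * R)"
 proof -
  have "en (t^2) * em (B \<inter> ?J) = (NL x. en (t^2) * ind (B \<inter> ?J) x)"
   by (subst nn_integral_cmult_indicator) auto
  also have "... <= (NL x. ind ?J x * en (csq (u x - u y)))"
   using far t by (intro nn_integral_mono) (auto simp: ind_def p_def intro!: ennreal_leI power_mono)
  also have "... <= en (9 * R * e)" by (rule y(2))
  also have "... <= en (t^2 * (E * R))"
   using mult_right_mono[OF e(3), of R] R(1) by (intro ennreal_leI) (simp add: ac_simps)
  finally have "en (1 / t^2) * (en (t^2) * em (B \<inter> ?J)) <= en (1 / t^2) * en (t^2 * (E * R))"
   by (intro mult_left_mono) auto
  moreover have "en (1 / t^2) * (en (t^2) * X) = X" for X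
   using t by (simp add: mult.assoc[symmetric] ennreal_mult[symmetric])
  moreover have "en (1 / t^2) * en (t^2 * (E * R)) = en (E * R)"
   using t E R by (simp add: ennreal_mult[symmetric])
  ultimately show ?thesis by simp
 qed
 have loc: "(NG q. ind (?J \<times> ?J) q * en (dsq u q)) <= en E"
  using d(2)[OF R(2)] e(2) by (meson ennreal_leI order_trans)
 have 0: "em ({x. bad (2 * a) (u x * cnj p)} \<inter> opn c R) = 0"
  using DG[OF R(1) p _ _ loc] BI Bm unfolding B_def by blast
 have "AE x in lborel. x \<notin> {x. bad (2 * a) (u x * cnj p)} \<inter> opn c R"
  by (rule AE_not_in) (use 0 in \<open>auto simp: null_sets_def\<close>)
 hence "AE x in lborel. x \<in> opn c R --> cmod (u x - p) <= h"
 proof eventually_elim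
  case (elim x)
  thus ?case using good_near[OF HmapsD(2)[OF u, of x] p, of "2 * a"] a(3) by auto
 qed
 thus ?thesis using R(1) by blast
qed

lemma AE_lborel_ex:
 assumes "AE x in lborel. P x" "a < b"
 shows "\<exists>x. a < x \<and> x < b \<and> P (x::real)"
proof (rule ccontr)
 assume n: "\<not> ?thesis"
 have "AE x in lborel. x \<notin> {a<..<b}" using assms(1) by eventually_elim (use n in auto)
 hence "{a<..<b} \<in> null_sets lborel" by (subst AE_iff_null_sets) auto
 thus False using assms(2) by (auto simp: null_sets_def)
qed

text \<open>Overlapping intervals meet in positive measure, so approximate values for shrinking
  tolerances form a Cauchy sequence at each point, and the limits at nearby points are close. For
  each tolerance a finite subcover gives an estimate almost everywhere. The last clause of the
  conclusion is kept to identify the values at the end points of I.\<close>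

lemma continuous_representative:
 fixes u :: "real => complex"
 assumes osc: "!!c w. c \<in> S ==> 0 < w ==> \<exists>R>0. \<exists>p. AE x in lborel. x \<in> opn c R --> cmod (u x - p) <= w"
  and S: "compact S"
 shows "\<exists>v. continuous_on S v \<and> (AE x in lborel. x \<in> S --> u x = v x) \<and>
   (\<forall>c\<in>S. \<forall>w>0. \<exists>R>0. AE x in lborel. x \<in> opn c R --> cmod (u x - v c) <= w)"
proof -
 have two: "cmod (p - p') <= w + w'" if "AE x in lborel. x \<in> opn c R --> cmod (u x - p) <= w"
  "AE x in lborel. x \<in> opn c' R' --> cmod (u x - p') <= w'" "abs (c - c') < R'" "0 < R" for c c' R R' p p' w w'
 proof -
  define l h where "l = max (c - R) (c' - R')" and "h = min (c + R) (c' + R')"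
  have "l < h" using that(3,4) by (auto simp: l_def h_def)
  from AE_lborel_ex[OF AE_conjI[OF that(1,2)] this]
  obtain x where "l < x" "x < h" "x \<in> opn c R --> cmod (u x - p) <= w" "x \<in> opn c' R' --> cmod (u x - p') <= w'"
   by blast
  hence "cmod (u x - p) <= w" "cmod (u x - p') <= w'" by (auto simp: l_def h_def)
  moreover have "p - p' = (u x - p') - (u x - p)" by simp
  ultimately show ?thesis using norm_triangle_ineq4[of "u x - p'" "u x - p"] by (metis add.commute add_mono order_trans)
 qed
 have "\<exists>q. \<forall>w>0. \<exists>R>0. AE x in lborel. x \<in> opn c R --> cmod (u x - q) <= w" if c: "c \<in> S" for c
 proof -
  have "\<forall>n::nat. \<exists>R p. 0 < R \<and> (AE x in lborel. x \<in> opn c R --> cmod (u x - p) <= 1 / real (Suc n))"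
   using osc[OF c] by (meson of_nat_0_less_iff zero_less_Suc zero_less_divide_1_iff)
  then obtain R p where Rp: "!!n. 0 < R n" "!!n::nat. AE x in lborel. x \<in> opn c (R n) --> cmod (u x - p n) <= 1 / real (Suc n)"
   by metis
  have pp: "cmod (p n - p m) <= 1 / real (Suc n) + 1 / real (Suc m)" for n m
   by (rule two[OF Rp(2) Rp(2)]) (use Rp(1) in auto)
  have "Cauchy p"
  proof (rule CauchyI)
   fix e :: real assume "0 < e"
   then obtain N where N: "1 / real (Suc N) < e / 2" using reals_Archimedean[of "e / 2"] by (auto simp: inverse_eq_divide)
   have "cmod (p m - p n) < e" if "m \<ge> N" "n \<ge> N" for m n
   proof -
    have "1 / real (Suc m) <= 1 / real (Suc N)" "1 / real (Suc n) <= 1 / real (Suc N)" using that by (auto intro!: divide_left_mono)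
    thus ?thesis using pp[of m n] N by (simp add: field_sum_of_halves)
   qed
   thus "\<exists>M. \<forall>m\<ge>M. \<forall>n\<ge>M. cmod (p m - p n) < e" by blast
  qed
  then obtain q where q: "p ----> q" using Cauchy_convergent convergent_def by blast
  have pq: "cmod (p n - q) <= 1 / real (Suc n)" for n
  proof -
   have "(%m. cmod (p n - p m)) ----> cmod (p n - q)" by (intro tendsto_intros q)
   moreover have "(%m. 1 / real (Suc n) + 1 / real (Suc m)) ----> 1 / real (Suc n) + 0"
    by (intro tendsto_intros LIMSEQ_inverse_real_of_nat[unfolded inverse_eq_divide])
   ultimately show ?thesis using pp by (intro LIMSEQ_le[of "%m. cmod (p n - p m)"]) auto
  qed
  have "\<exists>R>0. AE x in lborel. x \<in> opn c R --> cmod (u x - q) <= w" if w: "0 < w" for w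
  proof -
   obtain n where n: "1 / real (Suc n) < w / 2" using w reals_Archimedean[of "w / 2"] by (auto simp: inverse_eq_divide)
   have "AE x in lborel. x \<in> opn c (R n) --> cmod (u x - q) <= w"
    using Rp(2)[of n]
   proof eventually_elim
    case (elim x)
    have "cmod (u x - q) <= cmod (u x - p n) + cmod (p n - q)" using norm_triangle_ineq[of "u x - p n" "p n - q"] by simp
    moreover have "1 / real (Suc n) + 1 / real (Suc n) <= w" using n by argo
    ultimately show ?case using elim pq[of n] by (auto simp del: of_nat_Suc)
   qed
   thus ?thesis using Rp(1) by blast
  qed
  thus ?thesis by blast
 qed
 then obtain v where v: "!!c w. c \<in> S ==> 0 < w ==> \<exists>R>0. AE x in lborel. x \<in> opn c R --> cmod (u x - v c) <= w"
  by metis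
 have vv: "\<exists>R>0. (AE x in lborel. x \<in> opn c R --> cmod (u x - v c) <= w) \<and> (\<forall>c'\<in>S. abs (c' - c) < R --> cmod (v c' - v c) <= 2 * w)"
  if c: "c \<in> S" and w: "0 < w" for c w
 proof -
  obtain R where R: "R > 0" "AE x in lborel. x \<in> opn c R --> cmod (u x - v c) <= w" using v[OF c w] by blast
  have "cmod (v c' - v c) <= 2 * w" if c': "c' \<in> S" "abs (c' - c) < R" for c'
  proof -
   obtain R' where R': "R' > 0" "AE x in lborel. x \<in> opn c' R' --> cmod (u x - v c') <= w" using v[OF c'(1) w] by blast
   show ?thesis using two[OF R'(2) R(2) c'(2) R'(1)] by simp
  qed
  thus ?thesis using R by blast
 qed
 have "continuous_on S v"
  unfolding continuous_on_iff
 proof (intro ballI allI impI)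
  fix c e :: real assume c: "c \<in> S" and e: "0 < e"
  obtain R where R: "R > 0" "\<forall>c'\<in>S. abs (c' - c) < R --> cmod (v c' - v c) <= 2 * (e / 3)" using vv[OF c, of "e / 3"] e by auto
  show "\<exists>d>0. \<forall>x'\<in>S. dist x' c < d --> dist (v x') (v c) < e"
  proof (intro exI[of _ R] conjI ballI impI)
   fix x' assume "x' \<in> S" "dist x' c < R"
   hence "cmod (v x' - v c) <= 2 * (e / 3)" using R(2) by (simp add: dist_real_def)
   thus "dist (v x') (v c) < e" using e by (simp add: dist_norm)
  qed (rule R(1))
 qed
 moreover have "AE x in lborel. x \<in> S --> u x = v x"
 proof -
  have fin: "AE x in lborel. x \<in> S --> cmod (u x - v x) <= 3 * w" if w: "0 < w" for w
  proof -
   have "\<forall>c\<in>S. \<exists>R. R > 0 \<and> (AE x in lborel. x \<in> opn c R --> cmod (u x - v c) <= w) \<and> (\<forall>c'\<in>S. abs (c' - c) < R --> cmod (v c' - v c) <= 2 * w)"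
    using vv[OF _ w] by blast
   from bchoice[OF this] obtain R where R: "!!c. c \<in> S ==> R c > 0" "!!c. c \<in> S ==> AE x in lborel. x \<in> opn c (R c) --> cmod (u x - v c) <= w"
    "!!c c'. c \<in> S ==> c' \<in> S ==> (abs (c' - c)) < R c ==> cmod (v c' - v c) <= 2 * w"
    by blast
   have "S \<subseteq> (\<Union>c\<in>S. opn c (R c))" using R(1) by force
   then obtain T where T: "T \<subseteq> S" "finite T" "S \<subseteq> (\<Union>c\<in>T. opn c (R c))"
    using compactE_image[OF S, of S "%c. opn c (R c)"] by auto
   have "AE x in lborel. \<forall>c\<in>T. x \<in> opn c (R c) --> cmod (u x - v c) <= w"
    using T R(2) by (intro AE_finite_allI) auto
   thus ?thesis
   proof eventually_elim
    case (elim x)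
    show ?case
    proof
     assume x: "x \<in> S"
     then obtain c where c: "c \<in> T" "x \<in> opn c (R c)" using T by blast
     hence "cmod (u x - v c) <= w" "cmod (v x - v c) <= 2 * w" using elim x T R(3)[of c x] by (auto simp: abs_less_iff)
     thus "cmod (u x - v x) <= 3 * w"
      using norm_triangle_ineq4[of "u x - v c" "v x - v c"] by simp
    qed
   qed
  qed
  have "AE x in lborel. \<forall>n::nat. x \<in> S --> cmod (u x - v x) <= 3 * (1 / real (Suc n))"
   unfolding AE_all_countable by (intro allI fin) simp
  thus ?thesis
  proof eventually_elim
   case (elim x)
   show ?case
   proof
    assume "x \<in> S"
    hence le: "cmod (u x - v x) <= 3 * (1 / real (Suc n))" for n using elim by blast
    have "(%n. 3 * (1 / real (Suc n))) ----> 3 * 0"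
     by (intro tendsto_intros LIMSEQ_inverse_real_of_nat[unfolded inverse_eq_divide])
    hence "cmod (u x - v x) <= 3 * 0" using le by (intro LIMSEQ_le_const) auto
    thus "u x = v x" by simp
   qed
  qed
 qed
 ultimately show ?thesis using v by blast
qed

proposition minimizer_continuous:
 assumes u: "u \<in> Hmaps"
  and min: "!!w. w \<in> Hmaps ==> (\<forall>x. x \<notin> {-1<..<1} --> w x = u x) ==> gag u <= gag w"
  and g: "continuous_on UNIV g" "!!x. x \<notin> {-1<..<1} ==> u x = g x"
 shows "\<exists>v. continuous_on {-1..1} v \<and> v ` {-1..1} \<subseteq> sphere 0 1 \<and> (AE x in lborel. x \<in> {-1..1} --> u x = v x) \<and>
   v (-1) = g (-1) \<and> v 1 = g 1"
proof -
 obtain v where v: "continuous_on {-1..1} v" "AE x in lborel. x \<in> {-1..1} --> u x = v x"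
  "!!c h. c \<in> {-1..1} ==> h > 0 ==> \<exists>R>0. AE x in lborel. x \<in> opn c R --> cmod (u x - v c) <= h"
  using continuous_representative[of "{-1..1}" u] minimizer_local_osc[OF u min g] by blast
 have near: "\<exists>x. a < x \<and> x < b \<and> cmod (u x - v c) <= h" if hyp: "c \<in> {-1..1}" "h > 0" "a < b" "a <= c" "c <= b" for c h a b
 proof -
  obtain R where R: "R > 0" "AE x in lborel. x \<in> opn c R --> cmod (u x - v c) <= h" using v(3)[OF hyp(1,2)] by blast
  have "max a (c - R) < min b (c + R)" using hyp R(1) by auto
  from AE_lborel_ex[OF R(2) this] show ?thesis by auto
 qed
 have "v c \<in> sphere 0 1" if c: "c \<in> {-1..1}" for c
 proof -
  have "abs (cmod (v c) - 1) <= h" if h: "h > 0" for h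
  proof -
   obtain x where "cmod (u x - v c) <= h" using near[OF c h, of "c - 1" "c + 1"] by auto
   thus ?thesis using HmapsD(2)[OF u, of x] norm_triangle_ineq3[of "u x" "v c"] by linarith
  qed
  hence "abs (cmod (v c) - 1) <= 0" by (rule dense_ge)
  thus ?thesis by simp
 qed
 moreover have "v c = g c" if c: "c = 1 \<or> c = -1" for c
 proof -
  have "cmod (g c - v c) <= h" if h: "h > 0" for h
  proof -
   have "isCont g c" using g(1) by (simp add: continuous_on_eq_continuous_at)
   then obtain d where d: "d > 0" "!!x. abs (x - c) < d ==> cmod (g x - g c) < h / 2"
    using h unfolding continuous_at_eps_delta by (metis dist_norm half_gt_zero real_norm_def)
   \<comment> \<open>An interval on the exterior side of \<open>c\<close>, where \<open>u\<close>
     equals \<open>g\<close> at every point; closeness of \<open>u\<close> to \<open>v c\<close>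
     there forces \<open>v c = g c\<close>.\<close>
   define a b where "a = (if c = 1 then 1 else -1 - d)" and "b = (if c = 1 then 1 + d else -1)"
   have "\<exists>x. a < x \<and> x < b \<and> cmod (u x - v c) <= h / 2"
    using c h d(1) by (intro near) (auto simp: a_def b_def)
   then obtain x where x: "a < x" "x < b" "cmod (u x - v c) <= h / 2" by blast
   have "x \<notin> {-1<..<1}" "abs (x - c) < d" using x c by (auto simp: a_def b_def split: if_splits)
   hence "u x = g x" "cmod (g x - g c) < h / 2" using g(2) d(2) by auto
   thus ?thesis using x(3) norm_triangle_ineq4[of "g x - v c" "g x - g c"] by simp
  qed
  hence "cmod (g c - v c) <= 0" by (rule dense_ge)
  thus ?thesis by simp
 qed
 ultimately show ?thesis using v by blast
qed

subsection \<open>Degree via local averages\<close>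

text \<open>The winding is taken through a continuous logarithm, for curves in the punctured plane,
  because averages of unit maps do not have modulus one.\<close>

definition wlift :: "(real => complex) => int => bool" where
 "wlift G d \<longleftrightarrow> (\<exists>L. continuous_on TP L \<and> (\<forall>t\<in>TP. G t = exp (L t)) \<and>
   L (2*pi) - L 0 = 2 * of_real pi * \<i> * of_int d)"

lemma continuous_log_diff_constant:
 assumes "connected S" "continuous_on S L" "continuous_on S L'" "!!t. t \<in> S ==> exp (L t) = exp (L' t :: complex)"
 shows "(%t. L t - L' t) constant_on S"
proof (rule continuous_discrete_range_constant[OF assms(1)])
 show "continuous_on S (%t. L t - L' t)" using assms by (intro continuous_intros)
 fix x assume x: "x \<in> S"
 have i: "\<exists>n::int. L t - L' t = 2 * of_int n * of_real pi * \<i>" if "t \<in> S" for t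
  using assms(4)[OF that] unfolding exp_eq by (auto simp: algebra_simps)
 let ?a = "%y. L y - L' y - (L x - L' x)"
 show "\<exists>e>0. \<forall>y. y \<in> S \<and> L y - L' y ~= L x - L' x --> e <= norm (?a y)"
 proof (intro exI[of _ "2 * pi"] conjI allI impI)
  fix y assume y: "y \<in> S \<and> L y - L' y ~= L x - L' x"
  obtain m n :: int where mn: "L y - L' y = 2 * of_int m * of_real pi * \<i>" "L x - L' x = 2 * of_int n * of_real pi * \<i>"
   using i x y by blast
  hence eq: "L y - L' y - (L x - L' x) = of_int (m - n) * (2 * of_real pi * \<i>)" by (simp add: algebra_simps)
  have "norm (?a y) = abs (of_int (m - n)) * (2 * pi)"
   unfolding eq norm_mult norm_of_int by simp
  moreover have "1 <= abs (of_int (m - n) :: real)" using y mn by auto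
  ultimately show "2 * pi <= norm (?a y)" by simp
 qed simp
qed

lemma wlift_unique: "wlift G d ==> wlift G d' ==> d = d'"
proof -
 assume "wlift G d" "wlift G d'"
 then obtain L L' where L: "continuous_on TP L" "!!t. t \<in> TP ==> G t = exp (L t)" "L (2*pi) - L 0 = 2 * of_real pi * \<i> * of_int d"
  and L': "continuous_on TP L'" "!!t. t \<in> TP ==> G t = exp (L' t)" "L' (2*pi) - L' 0 = 2 * of_real pi * \<i> * of_int d'"
  unfolding wlift_def by metis
 have "(%t. L t - L' t) constant_on TP"
  using L L' by (intro continuous_log_diff_constant) auto
 hence "L (2*pi) - L' (2*pi) = L 0 - L' 0" unfolding constant_on_def by auto
 hence "L (2*pi) - L 0 = L' (2*pi) - L' 0" by (simp add: algebra_simps)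
 thus "d = d'" unfolding L(3) L'(3) by simp
qed

lemma wlift_exists:
 assumes "continuous_on TP G" "!!t. t \<in> TP ==> G t ~= 0" "G (2*pi) = G 0"
 shows "\<exists>d. wlift G d"
proof -
 obtain L where L: "continuous_on TP L" "!!t. t \<in> TP ==> G t = exp (L t)"
  using continuous_logarithm_on_contractible[OF assms(1)] assms(2) convex_imp_contractible[of "TP"] by auto
 hence "exp (L (2*pi)) = exp (L 0)" using assms(3) by (metis atLeastAtMost_iff order_refl pi_ge_zero zero_le_mult_iff zero_le_numeral)
 then obtain d :: int where "L (2*pi) = L 0 + (of_int (2 * d) * pi) * \<i>" unfolding exp_eq by auto
 hence "L (2*pi) - L 0 = 2 * of_real pi * \<i> * of_int d" by simp
 thus ?thesis using L unfolding wlift_def by blast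
qed

lemma wlift_mult: "wlift G d ==> wlift H e ==> wlift (%t. G t * H t) (d + e)"
proof -
 assume "wlift G d" "wlift H e"
 then obtain L L' where L: "continuous_on TP L" "!!t. t \<in> TP ==> G t = exp (L t)" "L (2*pi) - L 0 = 2 * of_real pi * \<i> * of_int d"
  and L': "continuous_on TP L'" "!!t. t \<in> TP ==> H t = exp (L' t)" "L' (2*pi) - L' 0 = 2 * of_real pi * \<i> * of_int e"
  unfolding wlift_def by metis
 have "L (2*pi) + L' (2*pi) - (L 0 + L' 0) = 2 * of_real pi * \<i> * of_int (d + e)"
  using L(3) L'(3) by (simp add: algebra_simps)
 thus ?thesis unfolding wlift_def using L L'
  by (intro exI[of _ "%t. L t + L' t"]) (auto intro!: continuous_intros simp: exp_add)
qed

lemma wlift_cnj: "wlift G d ==> wlift (%t. cnj (G t)) (- d)"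
proof -
 assume "wlift G d"
 then obtain L where L: "continuous_on TP L" "!!t. t \<in> TP ==> G t = exp (L t)" "L (2*pi) - L 0 = 2 * of_real pi * \<i> * of_int d"
  unfolding wlift_def by metis
 have "cnj (L (2*pi)) - cnj (L 0) = 2 * of_real pi * \<i> * of_int (- d)"
  using arg_cong[OF L(3), of cnj] by simp
 thus ?thesis unfolding wlift_def using L
  by (intro exI[of _ "%t. cnj (L t)"]) (auto intro!: continuous_intros simp: exp_cnj)
qed

text \<open>As in Rouche's theorem: the quotient of \<open>H\<close> and \<open>G\<close> stays in
  the open unit disc around \<open>1\<close>, where the principal logarithm is continuous and adds
  no winding.\<close>

lemma wlift_perturb:
 assumes G: "wlift G d" and H: "continuous_on TP H" "H (2*pi) = H 0"
  and d: "!!t. t \<in> TP ==> cmod (H t - G t) < cmod (G t)"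
 shows "wlift H d"
proof -
 obtain L where L: "continuous_on TP L" "!!t. t \<in> TP ==> G t = exp (L t)" "L (2*pi) - L 0 = 2 * of_real pi * \<i> * of_int d"
  using G unfolding wlift_def by metis
 define q where "q t = H t * exp (- L t)" for t
 have q1: "cmod (q t - 1) < 1" if "t \<in> TP" for t
 proof -
  have "q t - 1 = (H t - G t) * exp (- L t)" using L(2)[OF that] by (simp add: q_def algebra_simps exp_minus)
  hence "cmod (q t - 1) = cmod (H t - G t) / cmod (G t)" using L(2)[OF that] by (simp add: norm_mult exp_minus norm_inverse divide_inverse)
  also have "... < 1" using d[OF that] L(2)[OF that] by (simp add: divide_less_eq)
  finally show ?thesis .
 qed
 have qn: "q t \<notin> \<real>\<^sub>\<le>\<^sub>0" "q t ~= 0" if "t \<in> TP" for t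
 proof -
  have "abs (Re (q t - 1)) < 1" using q1[OF that] abs_Re_le_cmod[of "q t - 1"] by linarith
  thus "q t \<notin> \<real>\<^sub>\<le>\<^sub>0" "q t ~= 0" by (auto simp: complex_nonpos_Reals_iff)
 qed
 have "continuous_on TP q" unfolding q_def by (intro continuous_intros H L)
 hence cq: "continuous_on TP (%t. Ln (q t))" using qn by (intro continuous_intros) auto
 have ends: "G (2*pi) = G 0"
 proof -
  have "L (2*pi) = L 0 + 2 * of_int d * of_real pi * \<i>" using L(3) by (simp add: algebra_simps)
  hence "exp (L (2*pi)) = exp (L 0)" unfolding exp_eq by (intro exI[of _ d]) simp
  thus ?thesis using L(2)[of "2*pi"] L(2)[of 0] by simp
 qed
 have "exp (- L (2*pi)) = exp (- L 0)" using ends L(2)[of "2*pi"] L(2)[of 0] by (simp add: exp_minus)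
 hence "q (2*pi) = q 0" unfolding q_def using H(2) by simp
 hence "L (2*pi) + Ln (q (2*pi)) - (L 0 + Ln (q 0)) = 2 * of_real pi * \<i> * of_int d"
  using L(3) by simp
 moreover have "H t = exp (L t + Ln (q t))" if "t \<in> TP" for t
  using qn[OF that] by (simp add: exp_add q_def exp_minus)
 ultimately show ?thesis unfolding wlift_def using L(1) cq
  by (intro exI[of _ "%t. L t + Ln (q t)"]) (auto intro!: continuous_intros)
qed

section \<open>Averages over arcs and their variance\<close>

definition U01 :: "real measure" where "U01 = uniform_measure lborel {0..1}"

abbreviation NUb :: "(real => ennreal) => ennreal" (binder "NU " 10) where "NUb f \<equiv> nn_integral U01 f"
abbreviation IUb :: "(real => 'b::{banach,second_countable_topology}) => 'b" (binder "IU " 10) where "IUb f \<equiv> integral\<^sup>L U01 f"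

lemma U01_prob: "prob_space U01"
 unfolding U01_def by (intro prob_space_uniform_measure) auto

lemma sets_U01 [simp, measurable_cong]: "sets U01 = sets borel"
 by (simp add: U01_def)

lemma space_U01 [simp]: "space U01 = UNIV"
 by (simp add: U01_def)

lemma nn_integral_U01:
 assumes [measurable]: "f \<in> BM"
 shows "(NU h. f h) = (NL h. ind {0..1} h * f h)"
 unfolding U01_def by (subst nn_integral_uniform_measure) (auto simp: divide_ennreal_def mult.commute)

definition avg :: "real => (real => complex) => real => complex" where
 "avg d F t = (IU h. F (t + d * h))"

context prob_space
begin

lemma integrable_unit:
 fixes X :: "'a => complex"
 assumes [measurable]: "X \<in> borel_measurable M" and "!!x. cmod (X x) <= B"
 shows "integrable M X"
 by (rule integrable_const_bound[where B=B]) (use assms in auto)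

lemma unit_variance:
 fixes X :: "'a => complex"
 assumes [measurable]: "X \<in> borel_measurable M" and X1: "!!x. cmod (X x) = 1"
 shows "(\<integral>x. csq (X x - c) \<partial>M) = 1 - 2 * Re (cnj c * (\<integral>x. X x \<partial>M)) + csq c"
  and "integrable M (%x. csq (X x - c))"
proof -
 have iX: "integrable M X" by (rule integrable_unit[where B=1]) (auto simp: X1)
 have eq: "csq (X x - c) = 1 - 2 * Re (cnj c * X x) + csq c" for x
 proof -
  have "(Re (X x))^2 + (Im (X x))^2 = 1" using X1[of x] by (simp add: cmod_power2[symmetric])
  thus ?thesis unfolding cmod_power2 by (simp add: sq_eq algebra_simps)
 qed
 have iR: "integrable M (%x. Re (cnj c * X x))" using iX by (intro integrable_Re integrable_mult_right)
 have iR': "integrable M (%x. 2 * Re (cnj c * X x))" using iR by (intro integrable_mult_right)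
 define R where "R x = Re (cnj c * X x)" for x
 have iR2: "integrable M (%x. 2 * R x)" using iR' by (simp add: R_def)
 let ?a = "\<integral>x. csq (X x - c) \<partial>M"
 have "?a = (\<integral>x. 1 - 2 * R x + csq c \<partial>M)" unfolding eq R_def ..
 also have "... = 1 - 2 * (\<integral>x. R x \<partial>M) + csq c"
  using iR2 by (simp add: prob_space)
 also have "(\<integral>x. R x \<partial>M) = (\<integral>x. Re (cnj c * X x) \<partial>M)" by (simp add: R_def)
 also have "(\<integral>x. Re (cnj c * X x) \<partial>M) = Re (cnj c * (\<integral>x. X x \<partial>M))"
  using iX by (subst integral_Re) (auto simp: integral_mult_right_zero)
 finally show "?a = 1 - 2 * Re (cnj c * (\<integral>x. X x \<partial>M)) + csq c" .
 show "integrable M (%x. csq (X x - c))" unfolding eq using iR' by auto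
qed

text \<open>For values of modulus one the variance is \<open>1 - csq m\<close>, so a mean of modulus
  near one is the same as small oscillation. The last clause writes the variance with two
  independent copies, the form that compares with a double integral of differences.\<close>

lemma unit_variance_mean:
 fixes X :: "'a => complex"
 assumes "X \<in> borel_measurable M" and "!!x. cmod (X x) = 1"
 defines "m \<equiv> \<integral>x. X x \<partial>M"
 shows "(\<integral>x. csq (X x - m) \<partial>M) = 1 - csq m"
  and "csq (m - c) <= (\<integral>x. csq (X x - c) \<partial>M)"
  and "cmod m <= 1"
  and "2 * (1 - csq m) = (\<integral>y. \<integral>x. csq (X x - X y) \<partial>M \<partial>M)"
proof -
 note v = unit_variance[OF assms(1,2), folded m_def]
 have mm: "Re (cnj m * m) = csq m" unfolding cmod_power2 by (simp add: sq_eq)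
 let ?b = "\<integral>x. csq (X x - m) \<partial>M"
 show 1: "?b = 1 - csq m" unfolding v(1) mm by simp
 have "0 <= ?b" by (intro integral_nonneg_AE) auto
 hence "csq m <= 1^2" using 1 by simp
 thus m1: "cmod m <= 1" by (rule power2_le_imp_le) simp
 have "csq (m - c) = csq m - 2 * Re (cnj c * m) + csq c"
  unfolding cmod_power2 by (simp add: sq_eq algebra_simps)
 thus "csq (m - c) <= (\<integral>x. csq (X x - c) \<partial>M)" unfolding v(1) using \<open>(cmod m)^2 <= 1^2\<close> by simp
 have iX: "integrable M X" using assms by (intro integrable_unit[where B=1]) auto
 let ?a = "\<integral>y. \<integral>x. csq (X x - X y) \<partial>M \<partial>M"
 let ?c = "\<integral>y. Re (m * cnj (X y)) \<partial>M"
 have "?a = (\<integral>y. 2 - 2 * Re (m * cnj (X y)) \<partial>M)"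
  unfolding v(1) by (intro Bintegral_cong) (simp_all add: assms(2) algebra_simps)
 also have "... = 2 - 2 * ?c"
  using iX by (simp add: prob_space)
 also have "?c = Re (m * cnj m)"
  using iX unfolding m_def by (subst integral_Re) auto
 also have "Re (m * cnj m) = csq m" unfolding cmod_power2 by (simp add: sq_eq)
 finally show "2 * (1 - csq m) = ?a" by simp
qed

lemma unit_covariance:
 fixes X Y :: "'a => complex"
 assumes [measurable]: "X \<in> borel_measurable M" "Y \<in> borel_measurable M"
  and X1: "!!x. cmod (X x) = 1" and Y1: "!!x. cmod (Y x) = 1"
 defines "a \<equiv> \<integral>x. X x \<partial>M" and "b \<equiv> \<integral>x. Y x \<partial>M"
 shows "2 * cmod ((\<integral>x. X x * Y x \<partial>M) - a * b) <= (1 - csq a) + (1 - csq b)"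
proof -
 have i: "integrable M X" "integrable M Y" "integrable M (%x. X x * Y x)"
  by (rule integrable_unit[where B=1]; auto simp: X1 Y1 norm_mult)+
 have eq: "(X x - a) * (Y x - b) = X x * Y x - a * Y x - b * X x + a * b" for x by (simp add: algebra_simps)
 let ?a = "%x. csq (X x - a) + csq (Y x - b)"
 have "(\<integral>x. (X x - a) * (Y x - b) \<partial>M) = (\<integral>x. X x * Y x \<partial>M) - a * b"
  unfolding eq using i by (simp add: prob_space a_def[symmetric] b_def[symmetric])
 hence "cmod ((\<integral>x. X x * Y x \<partial>M) - a * b) <= (\<integral>x. cmod ((X x - a) * (Y x - b)) \<partial>M)"
  by (metis integral_norm_bound)
 also have "... <= (\<integral>x. ?a x / 2 \<partial>M)"
 proof (rule integral_mono)
  show "integrable M (%x. cmod ((X x - a) * (Y x - b)))" unfolding eq using i by auto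
  show "integrable M (%x. ?a x / 2)"
   using unit_variance(2)[of X] unit_variance(2)[of Y] X1 Y1 by auto
  show "cmod ((X x - a) * (Y x - b)) <= ?a x / 2" for x
   using sum_squares_bound[of "cmod (X x - a)" "cmod (Y x - b)"] by (simp add: norm_mult)
 qed
 also have "... = ((1 - csq a) + (1 - csq b)) / 2"
  using unit_variance(2)[of X a] unit_variance(2)[of Y b] unit_variance_mean(1)[of X] unit_variance_mean(1)[of Y] X1 Y1
  by (simp add: a_def b_def)
 finally show ?thesis by simp
qed

end

definition per :: "(real => complex) => bool" where
 "per F \<longleftrightarrow> F \<in> BM \<and> (\<forall>t. F (t + 2 * pi) = F t)"

lemma perD: "per F ==> F \<in> BM" "per F ==> F (t + 2 * pi) = F t" "per F ==> F (2 * pi) = F 0"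
 by (auto simp: per_def) (metis add_0)

lemma periodic_int:
 assumes "!!t. P (t + 2 * pi) = P t"
 shows "P (t + 2 * pi * of_int n) = P t"
proof -
 have nat: "P (t + 2 * pi * real k) = P t" for k t
 proof (induction k)
  case (Suc k)
  have "t + 2 * pi * real (Suc k) = (t + 2 * pi * real k) + 2 * pi" by (simp add: algebra_simps)
  thus ?case using assms Suc by metis
 qed simp
 show ?thesis
 proof (cases "n \<ge> 0")
  case True
  thus ?thesis using nat[of t "nat n"] by simp
 next
  case False
  let ?a = "t + 2 * pi * of_int n"
  have "P (?a + 2 * pi * real (nat (- n))) = P ?a" by (rule nat)
  moreover have "?a + 2 * pi * real (nat (- n)) = t" using False by simp
  ultimately show ?thesis by simp
 qed
qed

lemma nn_integral_shift:
 fixes f :: "real => ennreal"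
 assumes "f \<in> BM"
 shows "(NL x. f (a + x)) = (NL x. f x)"
 using nn_integral_real_affine[OF assms, of 1 a] by simp

lemma nn_integral_periodic:
 fixes P :: "real => ennreal"
 assumes [measurable]: "P \<in> BM" and P: "!!t. P (t + 2 * pi) = P t"
 shows "(NL x. ind {a..a + 2 * pi} x * P x) = (NL x. ind TP x * P x)"
proof -
 define I where "I a b = (NL x. ind {a..<b} x * P x)" for a b
 have clos: "(NL x. ind {a..b} x * P x) = I a b" for a b
  unfolding I_def
 proof (rule nn_integral_cong_AE)
  show "AE x in lborel. ind {a..b} x * P x = ind {a..<b} x * P x"
   using AE_lborel_singleton[of b] by eventually_elim (auto simp: ind_def)
 qed
 have shift: "I (a + 2 * pi * of_int n) (b + 2 * pi * of_int n) = I a b" for a b n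
 proof -
  let ?a = "%x. 2 * pi * of_int n + x"
  have "I (a + 2 * pi * of_int n) (b + 2 * pi * of_int n) = (NL x. ind {a + 2 * pi * of_int n..<b + 2 * pi * of_int n} (?a x) * P (?a x))"
   unfolding I_def by (rule nn_integral_shift[symmetric]) simp
  also have "... = I a b" unfolding I_def
  proof (intro nn_integral_cong)
   fix x :: real
   have "P (?a x) = P x" using periodic_int[of P x n, OF P] by (simp add: add.commute)
   thus "ind {a + 2 * pi * of_int n..<b + 2 * pi * of_int n} (?a x) * P (?a x) = ind {a..<b} x * P x"
    by (auto simp: ind_def)
  qed
  finally show ?thesis .
 qed
 have split: "I a c = I a b + I b c" if "a <= b" "b <= c" for a b c
  unfolding I_def using that by (subst nn_integral_add[symmetric]) (auto intro!: nn_integral_cong simp: ind_def)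
 define n where "n = \<lfloor>a / (2 * pi)\<rfloor>"
 define b where "b = a - 2 * pi * of_int n"
 have "of_int n <= a / (2 * pi)" "a / (2 * pi) < of_int n + 1" unfolding n_def by linarith+
 hence b: "0 <= b" "b <= 2 * pi" unfolding b_def by (auto simp: field_simps)
 have "I a (a + 2 * pi) = I (b + 2 * pi * of_int n) ((b + 2 * pi) + 2 * pi * of_int n)" by (simp add: b_def)
 also have "... = I b (b + 2 * pi)" by (rule shift)
 also have "... = I b (2 * pi) + I (2 * pi) (b + 2 * pi)" using b by (intro split) auto
 also have "I (2 * pi) (b + 2 * pi) = I 0 b" using shift[of 0 1 b] by simp
 also have "I b (2 * pi) + I 0 b = I 0 (2 * pi)" using split[of 0 b "2 * pi"] b by (simp add: add.commute)
 finally show ?thesis unfolding clos .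
qed

definition ed :: "(real => complex) => real => real => ennreal" where
 "ed F x h = en (csq (F (x + h) - F x) / csq (1 - cis h))"

text \<open>The factor \<open>1/2\<close> of one-sidedness is absent for \<open>d = 2 * pi\<close>, where \<open>h\<close> and \<open>2 * pi - h\<close> both occur.\<close>
definition nd :: "real => (real => complex) => ennreal" where
 "nd d F = (NL x. ind TP x * (NL h. ind {0..d} h * ed F x h))"

abbreviation NN :: "(real => complex) => ennreal" where "NN \<equiv> nd (2 * pi)"

lemma measurable_ed [measurable]:
 assumes [measurable]: "F \<in> BM"
 shows "(%q. ed F (fst q) (snd q)) \<in> BM2"
  "ed F x \<in> BM"
 unfolding ed_def by measurable

lemma ed_periodic: "per F ==> ed F (x + 2 * pi) h = ed F x h"
proof -
 assume F: "per F"
 have "F (x + 2 * pi + h) = F (x + h)" using perD(2)[OF F, of "x + h"] by (simp add: ac_simps)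
 thus ?thesis using perD(2)[OF F, of x] by (simp add: ed_def)
qed

lemma nd_window:
 assumes F: "per F"
 shows "(NL x. ind {t..t + 2 * pi} x * (NL h. ind {0..d} h * ed F x h)) = nd d F"
proof -
 have [measurable]: "F \<in> BM" using F perD by auto
 have "(%x. (NL h. ind {0..d} h * ed F x h)) \<in> BM"
  unfolding ed_def by measurable
 thus ?thesis unfolding nd_def by (rule nn_integral_periodic) (simp add: ed_periodic[OF F])
qed

lemma nd_mono: "d <= d' ==> nd d F <= nd d' F"
 unfolding nd_def by (intro nn_integral_mono mult_left_mono) (auto simp: ind_def)

lemma cmod_one_minus_cis: "cmod (1 - cis h) <= abs h"
proof -
 have "csq (1 - cis h) = 2 - 2 * cos h"
  using sin_cos_squared_add[of h] unfolding cmod_power2 by (simp add: sq_eq algebra_simps)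
 also have "... = (2 * sin (h / 2))^2"
  using cos_double_sin[of "h / 2"] unfolding mult_2 field_sum_of_halves by (simp add: sq_eq)
 also have "... <= h^2"
  using abs_sin_x_le_abs_x[of "h / 2"] by (intro iffD1[OF abs_le_square_iff]) simp
 finally show ?thesis
  by (metis abs_ge_zero power2_abs power2_le_imp_le)
qed

lemma diff_le_ed:
 assumes F: "per F" and d: "0 < D" "D <= 2 * pi" and h: "0 <= h" "h <= D"
 shows "en (csq (F (x + h) - F x)) <= en (D^2) * ed F x h"
proof (cases "cis h = 1")
 \<comment> \<open>Here \<open>ed\<close> is \<open>0\<close> through division by zero; the left
   side vanishes as well because \<open>h\<close> is a period.\<close>
 case True
 hence "cos h = 1" by (metis cis.sel(1) one_complex.sel(1))
 then obtain n :: int where "h = of_int n * 2 * pi" using cos_one_2pi_int by blast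
 hence "F (x + h) = F x" using periodic_int[of F x n, OF perD(2)[OF F]] by (simp add: ac_simps)
 thus ?thesis by simp
next
 case False
 hence pos: "0 < csq (1 - cis h)" by simp
 let ?a = "cmod (F (x + h) - F x)"
 have "csq (1 - cis h) <= D^2" using cmod_one_minus_cis[of h] h by (intro power_mono) auto
 hence "1 <= D^2 / csq (1 - cis h)" using pos by (simp add: le_divide_eq)
 hence "1 * ?a^2 <= D^2 / csq (1 - cis h) * ?a^2"
  by (intro mult_right_mono) auto
 hence "?a^2 <= D^2 * (?a^2 / csq (1 - cis h))" by simp
 thus ?thesis unfolding ed_def by (simp add: ennreal_mult[symmetric] ennreal_leI)
qed

text \<open>The variance is half the mean squared difference of two independent points of the arc.
  By symmetry only ordered pairs are kept, which absorbs the half; their difference lies in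
  \<open>[0, D]\<close>, and the bound \<open>D^2\<close> for the squared chord absorbs the factors
  \<open>1 / D\<close> of both averages. So the estimate is uniform in the scale and in
  \<open>t\<close>.\<close>

lemma avg_variance_le_nd:
 assumes F: "per F" and F1: "!!x. cmod (F x) = 1" and d: "0 < D" "D <= 2 * pi"
 shows "en (1 - csq (avg D F t)) <= nd D F"
proof -
 interpret U: prob_space U01 by (rule U01_prob)
 have [measurable]: "F \<in> BM" using F perD by auto
 define X where "X h = F (t + D * h)" for h
 have [measurable]: "X \<in> BM" unfolding X_def by measurable
 have X1: "cmod (X h) = 1" for h by (simp add: X_def F1)
 have m: "avg D F t = (IU x. X x)" by (simp add: avg_def X_def)
 define g where "g y x = csq (X x - X y)" for x y
 have ig: "integrable U01 (g y)" for y unfolding g_def using U.unit_variance(2)[of X "X y"] X1 by simp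
 have g4: "g y x <= 4" "0 <= g y x" for y x
 proof -
  have "cmod (X x - X y) <= 2" using norm_triangle_ineq4[of "X x" "X y"] X1 by simp
  from power_mono[OF this, of 2] show "g y x <= 4" by (simp add: g_def)
 qed (simp add: g_def)
 have mg [measurable]: "(%q. g (fst q) (snd q)) \<in> BM2" unfolding g_def by measurable
 have ig2: "integrable U01 (%y. (IU x. g y x))"
 proof (rule U.integrable_const_bound[where B=4])
  show "AE y in U01. norm (IU x. g y x) <= 4"
  proof (intro AE_I2)
   fix y
   have "(IU x. g y x) <= (IU x. 4)" by (intro integral_mono ig g4) simp
   thus "norm (IU x. g y x) <= 4" using g4 by (simp add: integral_nonneg_AE U.prob_space[simplified])
  qed
  show "(%y. (IU x. g y x)) \<in> borel_measurable U01"
   by (rule U.borel_measurable_lebesgue_integral) (use mg in \<open>simp add: case_prod_beta\<close>)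
 qed
 define P :: "real \<times> real => ennreal" where
  "P q = (if fst q <= snd q then 1 else 0) * (ind {0..1} (fst q) * (ind {0..1} (snd q) * en (g (fst q) (snd q))))" for q
 have [measurable]: "P \<in> BM2" unfolding P_def[abs_def] by measurable
 let ?b = "1 - csq (avg D F t)"
 let ?c = "%y. NL x. P (y, x)"
 have "2 * ?b = (IU y. IU x. g y x)"
  unfolding g_def m using U.unit_variance_mean(4)[of X] X1 by simp
 also have "ennreal ... = (NU y. en (IU x. g y x))"
  using g4 by (intro nn_integral_eq_integral[symmetric] ig2) (auto intro!: AE_I2 integral_nonneg_AE)
 also have "... = (NU y. NU x. en (g y x))"
  using g4 by (intro nn_integral_cong nn_integral_eq_integral[symmetric] ig) auto
 also have "... = (NL y. ind {0..1} y * (NL x. ind {0..1} x * en (g y x)))"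
  unfolding g_def by (subst nn_integral_U01, measurable)+
 also have "... = (NL y. (NL x. ind {0..1} y * (ind {0..1} x * en (g y x))))"
  unfolding g_def by (intro nn_integral_cong nn_integral_cmult[symmetric]) measurable
 also have "... <= (NL y. (NL x. P (y, x) + P (x, y)))"
  by (intro nn_integral_mono) (auto simp: P_def g_def ind_def norm_minus_commute)
 also have "... = (NL y. ?c y) + (NL y. (NL x. P (x, y)))"
  by (simp add: nn_integral_add)
 also have "(NL y. (NL x. P (x, y))) = (NL y. ?c y)"
  by (rule lborel_pair.Fubini') (simp add: case_prod_beta)
 also have "(NL y. ?c y) <= nd D F"
 proof -
  let ?a = "%y. NL h. ind {0..D} h * ed F (t + D * y) h"
  let ?d = "%y. ind {t..t + 2 * pi} (t + D * y) * ?a y"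
  have inner: "?c y <= en D * ?d y" for y
  proof (cases "y \<in> {0..1}")
   case True
   let ?f = "%h. ind {0..D} h * en (csq (F (t + D * y + h) - F (t + D * y)))"
   have "?c y <= (NL x. ?f (- D * y + D * x))"
   proof (intro nn_integral_mono)
    fix x
    have eq: "t + D * y + (- D * y + D * x) = t + D * x" by simp
    show "P (y, x) <= ?f (- D * y + D * x)"
    proof (cases "y <= x \<and> x \<in> {0..1}")
     case xy: True
     have "D * y <= D * x" "D * x <= D * 1" "0 <= D * y" using xy True d by (auto intro!: mult_left_mono mult_nonneg_nonneg)
     thus ?thesis unfolding eq using xy True by (simp add: P_def g_def X_def)
    qed (auto simp: P_def)
   qed
   also have "... = en (1 / D) * (NL h. ?f h)"
   proof -
    have "(NL h. ?f h) = en D * (NL x. ?f (- D * y + D * x))"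
     using d by (subst nn_integral_real_affine[where c=D and t="- D * y"]) auto
    thus ?thesis using d by (simp add: mult.assoc[symmetric] ennreal_mult[symmetric])
   qed
   also have "... <= en (1 / D) * (NL h. en (D^2) * (ind {0..D} h * ed F (t + D * y) h))"
    using diff_le_ed[OF F d] by (intro mult_left_mono nn_integral_mono) (auto simp: ind_def)
   also have "... = en (1 / D) * (en (D^2) * ?a y)"
    by (subst nn_integral_cmult) auto
   also have "... = en D * ?a y"
    using d by (simp add: mult.assoc[symmetric] ennreal_mult[symmetric] sq_eq)
   finally have *: "?c y <= en D * ?a y" .
   have "0 <= D * y" "D * y <= D * 1" using True d by (auto intro!: mult_left_mono)
   hence "0 <= D * y" "D * y <= 2 * pi" using d by linarith+
   hence "t + D * y \<in> {t..t + 2 * pi}" by simp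
   thus ?thesis using * by simp
  qed (simp add: P_def)
  have "(NL y. ?c y) <= (NL y. en D * ?d y)"
   by (intro nn_integral_mono inner)
  also have "... = en D * (NL y. ind {t..t + 2 * pi} (t + D * y) * ?a y)"
   unfolding ed_def by (intro nn_integral_cmult) measurable
  also have "... = (NL x. ind {t..t + 2 * pi} x * (NL h. ind {0..D} h * ed F x h))"
  proof -
   have "(%x. ind {t..t + 2 * pi} x * (NL h. ind {0..D} h * ed F x h)) \<in> BM"
    unfolding ed_def by measurable
   from nn_integral_real_affine[OF this, of D t] show ?thesis using d by simp
  qed
  also have "... = nd D F" by (rule nd_window[OF F])
  finally show ?thesis .
 qed
 finally have fin: "en (2 * ?b) <= nd D F + nd D F" by (auto intro: add_mono)
 have "cmod (avg D F t) <= 1" unfolding m using U.unit_variance_mean(3)[of X] X1 by simp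
 hence "csq (avg D F t) <= 1" by (simp add: power_le_one)
 hence eq: "en (2 * ?b) = 2 * en ?b" by (subst ennreal_mult) auto
 have "nd D F + nd D F = 2 * nd D F" by (simp add: mult_2)
 with ord_eq_le_trans[OF eq[symmetric] fin] have "2 * en ?b <= 2 * nd D F" by simp
 hence "en (1/2) * (2 * en ?b) <= en (1/2) * (2 * nd D F)" by (rule mult_left_mono) simp
 moreover have "en (1/2) * (2 * X) = X" for X
 proof -
  have "en (1/2) * 2 = en (1/2 * 2)" by (subst ennreal_mult) auto
  thus ?thesis by (simp add: mult.assoc[symmetric])
 qed
 ultimately show ?thesis by (simp only:)
qed

lemma integral_U01:
 fixes f :: "real => complex"
 assumes [measurable]: "f \<in> BM"
 shows "(IU h. f h) = (IL h. ind {0..1} h *\<^sub>R f h)"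
proof -
 have dU: "U01 = density lborel (%x. en (ind {0..1} x))"
  unfolding U01_def uniform_measure_def by (intro density_cong) (auto simp: ind_def)
 show ?thesis unfolding dU by (subst integral_density) auto
qed

lemma avg_lborel:
 assumes [measurable]: "F \<in> BM" and d: "0 < D"
 shows "avg D F t = (1 / D) *\<^sub>R (IL y. ind {t..t + D} y *\<^sub>R F y)"
proof -
 let ?a = "IL h. ind {t..t + D} (t + D * h) *\<^sub>R F (t + D * h)"
 have "(IL y. ind {t..t + D} y *\<^sub>R F y) = abs D *\<^sub>R ?a"
  using d by (intro lborel_integral_real_affine) auto
 also have "?a = (IL h. ind {0..1} h *\<^sub>R F (t + D * h))"
  using d by (intro Bintegral_cong) (auto simp: ind_def zero_le_mult_iff)
 finally show ?thesis using d unfolding avg_def by (subst integral_U01) auto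
qed

lemma integrable_ind_bounded:
 fixes F :: "real => complex"
 assumes [measurable]: "F \<in> BM" and B: "!!x. cmod (F x) <= B"
 shows "integrable lborel (%y. ind {a..b} y *\<^sub>R F y)"
proof (rule Bintegrable_bound)
 show "integrable lborel (%y. ind {a..b} y * B)"
  by (intro integrable_mult_left integrable_real_indicator) (auto simp: emeasure_lborel_Icc_eq)
 show "AE x in lborel. norm (ind {a..b} x *\<^sub>R F x) <= norm (ind {a..b} x * B)"
  using B by (intro AE_I2) (auto simp: ind_def intro: order_trans[OF _ abs_ge_self])
qed measurable

lemma avg_lipschitz:
 assumes [measurable]: "F \<in> BM" and F1: "!!x. cmod (F x) <= 1" and d: "0 < D"
 shows "cmod (avg D F t - avg D F t') <= 2 / D * abs (t - t')"
proof -
 have i: "integrable lborel (%y. ind {a..b} y *\<^sub>R F y)" for a b by (rule integrable_ind_bounded[OF _ F1]) simp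
 let ?a = "IL y. ind {t..t + D} y *\<^sub>R F y - ind {t'..t' + D} y *\<^sub>R F y"
 let ?b = "IL y. ind {min t t'..max t t'} y + ind {min t t' + D..max t t' + D} y"
 have "avg D F t - avg D F t' = (1 / D) *\<^sub>R ?a"
  unfolding avg_lborel[OF assms(1) d] by (simp add: Bintegral_diff[OF i i] scaleR_diff_right)
 hence "cmod (avg D F t - avg D F t') = 1 / D * cmod ?a"
  using d by simp
 moreover have "cmod ?a <= ?b"
 proof (rule order_trans[OF integral_norm_bound integral_mono])
  show "integrable lborel (%y. cmod (ind {t..t + D} y *\<^sub>R F y - ind {t'..t' + D} y *\<^sub>R F y))"
   using i by (intro integrable_norm Bintegrable_diff)
  show "integrable lborel (%y. ind {min t t'..max t t'} y + ind {min t t' + D..max t t' + D} y :: real)"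
   by (intro Bintegrable_add integrable_real_indicator) (auto simp: emeasure_lborel_Icc_eq)
  fix y
  show "cmod (ind {t..t + D} y *\<^sub>R F y - ind {t'..t' + D} y *\<^sub>R F y) <= ind {min t t'..max t t'} y + ind {min t t' + D..max t t' + D} y"
   using F1[of y] by (auto simp: ind_def min_def max_def)
 qed
 moreover have "?b = 2 * abs (t - t')"
  by (subst Bintegral_add) (auto simp: min_def max_def)
 ultimately show ?thesis using d by (simp add: divide_right_mono)
qed

lemma avg_continuous:
 assumes "F \<in> BM" "!!x. cmod (F x) <= 1" "0 < D"
 shows "continuous_on S (avg D F)"
proof (rule continuous_on_subset[of UNIV], rule continuous_onI)
 fix t e :: real assume e: "0 < e"
 show "\<exists>d>0. \<forall>x'\<in>UNIV. dist x' t < d --> dist (avg D F x') (avg D F t) <= e"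
 proof (intro exI[of _ "e * D / 2"] conjI ballI impI)
  fix x assume "dist x t < e * D / 2"
  hence "abs (x - t) <= e * D / 2" by (simp add: dist_real_def)
  hence "2 / D * abs (x - t) <= 2 / D * (e * D / 2)" using assms(3) by (intro mult_left_mono) auto
  thus "dist (avg D F x) (avg D F t) <= e"
   using avg_lipschitz[OF assms, of x t] assms(3) by (simp add: dist_norm)
 qed (use e assms(3) in simp)
qed simp

lemma avg_periodic: "per F ==> avg d F (t + 2 * pi) = avg d F t"
proof -
 assume F: "per F"
 have "F (t + 2 * pi + d * h) = F (t + d * h)" for h using perD(2)[OF F, of "t + d * h"] by (simp add: ac_simps)
 thus ?thesis by (simp add: avg_def)
qed

lemma per_avg: "per F ==> (!!x. cmod (F x) <= 1) ==> 0 < d ==> per (avg d F)"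
 unfolding per_def[of "avg d F"] using avg_continuous[of F d UNIV] perD(1)[of F] avg_periodic[of F]
 by (auto intro: borel_cont)

lemma per_mult: "per F ==> per G ==> per (%t. F t * G t)"
 and per_cnj: "per F ==> per (%t. cnj (F t))"
 and per_diff: "per F ==> per G ==> per (%t. F t - G t)"
 by (auto simp: per_def)

lemma avg_cnj: "F \<in> BM ==> avg d (%t. cnj (F t)) t = cnj (avg d F t)"
 unfolding avg_def by simp

lemma nn_integral_U01_half:
 assumes [measurable]: "f \<in> BM" and h: "h \<in> {0..1}"
 shows "(NU k. f ((h + k) / 2)) <= 2 * (NU k. f k)"
proof -
 let ?a = "NL k. ind {0..1} (h / 2 + (1 / 2) * k) * f (h / 2 + (1 / 2) * k)"
 have "(NU k. f ((h + k) / 2)) <= ?a"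
  using h by (subst nn_integral_U01) (auto intro!: nn_integral_mono simp: ind_def add_divide_distrib)
 moreover have "(NU k. f k) = en (1 / 2) * ?a"
  by (subst nn_integral_U01, simp, subst nn_integral_real_affine[where c="1/2" and t="h/2"]) auto
 moreover have "2 * (en (1 / 2) * X) = X" for X
 proof -
  have "2 * en (1 / 2) = en (2 * (1 / 2))" by (subst ennreal_mult) auto
  thus ?thesis by (simp add: mult.assoc[symmetric])
 qed
 ultimately show ?thesis by simp
qed

text \<open>A half arc has density at most \<open>2\<close> with respect to the arc containing it,
  so its mean square deviation from \<open>avg d F t\<close> is at most twice the variance, for
  every position \<open>k\<close> of the half arc.\<close>

lemma avg_half_diff:
 assumes F: "F \<in> BM" and F1: "!!x. cmod (F x) = 1" and k: "k \<in> {0..1}"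
 shows "csq (avg (d / 2) F (t + d / 2 * k) - avg d F t) <= 2 * (1 - csq (avg d F t))"
proof -
 interpret U: prob_space U01 by (rule U01_prob)
 note [measurable] = F
 define c where "c = avg d F t"
 have cX: "c = (IU h. F (t + d * h))" by (simp add: c_def avg_def)
 let ?a = "IU h. csq (F (t + d / 2 * k + d / 2 * h) - c)"
 have le: "csq (avg (d / 2) F (t + d / 2 * k) - c) <= ?a"
  unfolding avg_def by (rule U.unit_variance_mean(2)) (auto simp: F1)
 let ?b = "%h. cmod (F (t + d * h) - c)"
 let ?c = "1 - csq c"
 have "en ?a = (NU h. en (csq (F (t + d * ((k + h) / 2)) - c)))"
  by (subst nn_integral_eq_integral) (auto intro!: U.unit_variance(2) nn_integral_cong simp: F1 algebra_simps add_divide_distrib)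
 also have "... <= 2 * (NU h. en (?b h^2))"
  by (rule nn_integral_U01_half) (use k in auto)
 also have "(NU h. en (?b h^2)) = en (IU h. ?b h^2)"
  by (rule nn_integral_eq_integral) (auto intro!: U.unit_variance(2) simp: F1)
 also have "(IU h. ?b h^2) = 1 - csq c"
  unfolding cX by (rule U.unit_variance_mean(1)) (auto simp: F1)
 also have "2 * en ?c = en (2 * ?c)"
 proof -
  have "cmod c <= 1" unfolding cX by (rule U.unit_variance_mean(3)) (auto simp: F1)
  hence "csq c <= 1" by (simp add: power_le_one)
  thus ?thesis by (subst ennreal_mult) auto
 qed
 finally have "?a <= 2 * ?c"
 proof (subst (asm) ennreal_le_iff)
  have "cmod c <= 1" unfolding cX by (rule U.unit_variance_mean(3)) (auto simp: F1)
  thus "0 <= 2 * ?c" by (simp add: power_le_one)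
 qed auto
 thus ?thesis using le unfolding c_def by linarith
qed

lemma nd_to_0:
 assumes F: "per F" and fin: "NN F < \<infinity>" and e: "0 < e"
 shows "\<exists>m::nat. \<forall>n\<ge>m. nd (1 / 2 ^ n) F <= en e"
proof -
 have [measurable]: "F \<in> BM" using F perD by auto
 define f where "f n q = ind TP (fst q) * (ind {0..1/2^n} (snd q) * ed F (fst q) (snd q))" for n :: nat and q
 have fm [measurable]: "f n \<in> BM2" for n unfolding f_def ed_def by measurable
 let ?c = "%d. \<integral>\<^sup>+q. ind TP (fst q) * (ind {0..d} (snd q) * ed F (fst q) (snd q)) \<partial>LL"
 have nd_eq: "nd d F = ?c d" for d
 proof -
  have "?c d = (NL x. NL h. ind TP x * (ind {0..d} h * ed F x h))"
   unfolding ed_def by (subst lborel.nn_integral_fst[symmetric]) auto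
  also have "... = nd d F"
   unfolding nd_def by (intro nn_integral_cong nn_integral_cmult) auto
  finally show ?thesis by simp
 qed
 let ?b = "%q. ind TP (snd q) * ed F (fst q) (snd q)"
 have "(%n. \<integral>\<^sup>+q. f n q \<partial>LL) ----> (NP q. 0)"
 proof (rule nn_integral_dominated_convergence[where w="%q. ind TP (fst q) * ?b q"])
  show "(NP q. ind TP (fst q) * ?b q) < \<infinity>"
   using fin nd_eq by simp
  show "AE q in LL. f n q <= ind TP (fst q) * ?b q" for n
  proof (rule AE_I2)
   fix q
   have "(1::real) / 2 ^ n <= 1" by simp
   also have "1 <= 2 * pi" using pi_ge_two by simp
   finally show "f n q <= ind TP (fst q) * ?b q"
    unfolding f_def by (intro mult_left_mono mult_right_mono) (auto simp: ind_def)
  qed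
  show "AE q in LL. (%n. f n q) ----> 0"
  proof (rule AE_I2)
   fix q :: "real \<times> real"
   show "(%n. f n q) ----> 0"
   proof (cases "snd q > 0")
    case True
    have "(%n. (1 / 2) ^ n :: real) ----> 0" by (intro LIMSEQ_power_zero) auto
    hence "eventually (%n. (1 / 2) ^ n < snd q) sequentially" using True by (rule order_tendstoD(2))
    hence "eventually (%n. f n q = 0) sequentially"
     by eventually_elim (auto simp: f_def power_one_over)
    thus ?thesis by (rule tendsto_eventually)
   next
    case False
    hence "f n q = 0" for n by (cases "snd q = 0") (auto simp: f_def ed_def)
    thus ?thesis by simp
   qed
  qed
 qed (unfold ed_def, measurable)
 hence "eventually (%n. (NP q. f n q) < en e) sequentially"
  using e by (intro order_tendstoD(2)) auto
 then obtain m where "!!n. n \<ge> m ==> (NP q. f n q) < en e" by (auto simp: eventually_sequentially)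
 thus ?thesis unfolding nd_eq f_def by (intro exI[of _ m]) (auto intro: less_imp_le)
qed

lemma nd_add_le:
 assumes [measurable]: "F \<in> BM" "G \<in> BM"
  and H: "!!x h. (cmod (H (x + h) - H x)) <= cmod (F (x + h) - F x) + cmod (G (x + h) - G x)"
 shows "nd d H <= 2 * nd d F + 2 * nd d G"
proof -
 have le: "ed H x h <= 2 * ed F x h + 2 * ed G x h" for x h
 proof -
  define a b where "a = cmod (F (x + h) - F x)" and "b = cmod (G (x + h) - G x)"
  let ?a = "cmod (1 - cis h)"
  have "csq (H (x + h) - H x) <= (a + b)^2" using H by (intro power_mono) (auto simp: a_def b_def)
  also have "... <= 2 * a^2 + 2 * b^2" using sum_squares_bound[of a b] by (simp add: power2_sum)
  finally have "csq (H (x + h) - H x) / ?a^2 <= (2 * a^2 + 2 * b^2) / ?a^2"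
   by (intro divide_right_mono) auto
  hence "ed H x h <= en (2 * (a^2 / ?a^2) + 2 * (b^2 / ?a^2))"
   unfolding ed_def by (intro ennreal_leI) (simp add: add_divide_distrib)
  also have "... = 2 * ed F x h + 2 * ed G x h"
  proof -
   have *: "en (2 * A + 2 * B) = 2 * en A + 2 * en B" if "0 <= A" "0 <= B" for A B
    using that by (simp add: ennreal_plus ennreal_mult)
   show ?thesis unfolding ed_def a_def b_def by (rule *) auto
  qed
  finally show ?thesis .
 qed
 let ?b = "%x. NL h. ind {0..d} h * ed F x h"
 let ?c = "%x. NL h. ind {0..d} h * ed G x h"
 have "nd d H <= (NL x. 2 * (ind TP x * ?b x) + 2 * (ind TP x * ?c x))"
  unfolding nd_def
 proof (intro nn_integral_mono)
  fix x
  let ?d = "NL h. ind {0..d} h * ed H x h"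
  have "?d <= (NL h. 2 * (ind {0..d} h * ed F x h) + 2 * (ind {0..d} h * ed G x h))"
   using le by (intro nn_integral_mono) (auto simp: ind_def)
  also have "... = 2 * ?b x + 2 * ?c x"
   by (simp add: nn_integral_add nn_integral_cmult)
  finally show "ind TP x * ?d <= 2 * (ind TP x * ?b x) + 2 * (ind TP x * ?c x)"
   by (auto simp: ind_def)
 qed
 also have "... = 2 * nd d F + 2 * nd d G"
  unfolding nd_def ed_def by (simp add: nn_integral_add nn_integral_cmult)
 finally show ?thesis .
qed

lemma unit_mult_diff:
 assumes "cmod a = 1" "cmod b = 1" "cmod c = 1" "cmod d = 1"
 shows "cmod (a * c - b * d) <= cmod (a - b) + cmod (c - d)"
proof -
 have "a * c - b * d = (a - b) * c + b * (c - d)" by (simp add: algebra_simps)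
 thus ?thesis using norm_triangle_ineq[of "(a - b) * c" "b * (c - d)"] assms by (simp add: norm_mult)
qed

definition umap :: "(real => complex) => bool" where
 "umap F \<longleftrightarrow> per F \<and> (\<forall>x. cmod (F x) = 1) \<and> NN F < \<infinity>"

lemma umapD: "umap F ==> per F" "umap F ==> cmod (F x) = 1" "umap F ==> NN F < \<infinity>"
 "umap F ==> F \<in> BM" "umap F ==> cmod (F x) <= 1"
 by (auto simp: umap_def per_def)

lemma nd_mult_le: "umap F ==> umap G ==> nd d (%t. F t * G t) <= 2 * nd d F + 2 * nd d G"
 by (intro nd_add_le unit_mult_diff umapD)

lemma umap_mult: "umap F ==> umap G ==> umap (%t. F t * G t)"
proof -
 assume FG: "umap F" "umap G"
 have "2 * NN F + 2 * NN G < \<infinity>" using umapD(3)[OF FG(1)] umapD(3)[OF FG(2)] by (simp add: ennreal_mult_less_top)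
 hence "NN (%t. F t * G t) < \<infinity>" using nd_mult_le[OF FG] by (rule le_less_trans[rotated])
 thus ?thesis using FG per_mult[of F G] by (auto simp: umap_def norm_mult)
qed

text \<open>The averages of \<open>F\<close> over arcs of length \<open>d\<close> are continuous and, by \<open>avg_variance_le_nd\<close>, bounded away from \<open>0\<close> for small \<open>d\<close>, so they have a winding number.\<close>
definition hasdeg :: "(real => complex) => int => bool" where
 "hasdeg F d \<longleftrightarrow> (\<exists>m. \<forall>n\<ge>m. wlift (avg (1 / 2 ^ n) F) d)"

lemma hasdeg_unique: "hasdeg F d ==> hasdeg F d' ==> d = d'"
 unfolding hasdeg_def by (meson max.cobounded1 max.cobounded2 wlift_unique)

lemma pow_half: "0 < (1::real) / 2 ^ n" "(1::real) / 2 ^ n <= 2 * pi"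
proof -
 have "(1::real) / 2 ^ n <= 1" by simp
 also have "1 <= 2 * pi" using pi_ge_two by simp
 finally show "(1::real) / 2 ^ n <= 2 * pi" .
qed simp

lemma avg_lower:
 assumes F: "per F" "!!x. cmod (F x) = 1" and nd: "nd (1 / 2 ^ n) F <= en e" and e: "0 <= e"
 shows "1 - e <= csq (avg (1 / 2 ^ n) F t)"
proof -
 have "en (1 - csq (avg (1 / 2 ^ n) F t)) <= en e"
  using avg_variance_le_nd[OF F pow_half] nd by (rule order_trans)
 thus ?thesis using e by (subst (asm) ennreal_le_iff) auto
qed

text \<open>With \<open>nd\<close> at most \<open>1/8\<close> all averages have squared modulus at
  least \<open>7/8\<close>, and halving the arc moves them by a squared distance of at most
  \<open>1/4\<close>, too little to reach the origin.\<close>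

lemma wlift_avg_stable:
 assumes F: "per F" "!!x. cmod (F x) = 1" and nd: "nd (1 / 2 ^ m) F <= en (1/8)"
  and w: "wlift (avg (1 / 2 ^ m) F) d" and n: "m <= n"
 shows "wlift (avg (1 / 2 ^ n) F) d"
 using n
proof (induction n rule: dec_induct)
 case (step n)
 have m: "F \<in> BM" "!!x. cmod (F x) <= 1" using F perD by auto
 have ndn: "nd (1 / 2 ^ n) F <= en (1/8)"
  using nd nd_mono[of "1 / 2 ^ n" "1 / 2 ^ m" F] step(1) by (meson divide_left_mono order_trans one_le_numeral power_increasing zero_le_one zero_less_numeral zero_less_power mult_pos_pos)
 show ?case
 proof (rule wlift_perturb[OF step(3)])
  show "continuous_on TP (avg (1 / 2 ^ Suc n) F)" by (intro avg_continuous m pow_half)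
  show "avg (1 / 2 ^ Suc n) F (2 * pi) = avg (1 / 2 ^ Suc n) F 0" using avg_periodic[OF F(1), of _ 0] by simp
  fix t
  let ?a = "avg (1 / 2 ^ n) F t"
  have l: "7 / 8 <= csq ?a" using avg_lower[OF F ndn] by simp
  have "csq (avg (1 / 2 ^ n / 2) F t - avg (1 / 2 ^ n) F t) <= 2 * (1 - csq ?a)"
   using m F avg_half_diff[of F 0 "1 / 2 ^ n" t] by simp
  also have "... < csq ?a" using l by simp
  also have "1 / 2 ^ n / 2 = (1 / 2 ^ Suc n :: real)" by simp
  finally show "cmod (avg (1 / 2 ^ Suc n) F t - avg (1 / 2 ^ n) F t) < cmod ?a"
   by (rule power_less_imp_less_base) simp
 qed
qed (rule w)

lemma wlift_avg_exists:
 assumes F: "per F" "!!x. cmod (F x) = 1" and nd: "nd (1 / 2 ^ m) F <= en (1/8)"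
 shows "\<exists>d. wlift (avg (1 / 2 ^ m) F) d"
proof (rule wlift_exists)
 have m: "F \<in> BM" "!!x. cmod (F x) <= 1" using F perD by auto
 show "continuous_on TP (avg (1 / 2 ^ m) F)" by (intro avg_continuous m pow_half)
 show "avg (1 / 2 ^ m) F (2 * pi) = avg (1 / 2 ^ m) F 0" using avg_periodic[OF F(1), of _ 0] by simp
 show "avg (1 / 2 ^ m) F t ~= 0" for t using avg_lower[OF F nd, of t] by auto
qed

lemma hasdeg_exists:
 assumes "umap F" shows "\<exists>d. hasdeg F d"
proof -
 obtain m where m: "nd (1 / 2 ^ m) F <= en (1/8)" using nd_to_0[of F "1/8"] umapD[OF assms] by auto
 obtain d where "wlift (avg (1 / 2 ^ m) F) d" using wlift_avg_exists[OF umapD(1,2)[OF assms] m] by blast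
 hence "hasdeg F d" unfolding hasdeg_def using wlift_avg_stable[OF umapD(1,2)[OF assms] m] by blast
 thus ?thesis ..
qed

lemma hasdeg_cnj: "umap F ==> hasdeg F d ==> hasdeg (%t. cnj (F t)) (- d)"
 unfolding hasdeg_def using wlift_cnj avg_cnj[OF umapD(4)] by (metis (no_types, lifting) ext)

text \<open>The mean of a product differs from the product of the means by a covariance, at most
  half the sum of the variances, here \<open>1/8\<close>; the product of the means has modulus at
  least \<open>1/2\<close>.\<close>

lemma hasdeg_mult:
 assumes F: "umap F" and G: "umap G" and d: "hasdeg F d" "hasdeg G e"
 shows "hasdeg (%t. F t * G t) (d + e)"
proof -
 interpret U: prob_space U01 by (rule U01_prob)
 note [measurable] = umapD(4)[OF F] umapD(4)[OF G]
 obtain m1 where m1: "!!n. n \<ge> m1 ==> nd (1 / 2 ^ n) F <= en (1/8)" using nd_to_0[of F "1/8"] umapD[OF F] by auto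
 obtain m2 where m2: "!!n. n \<ge> m2 ==> nd (1 / 2 ^ n) G <= en (1/8)" using nd_to_0[of G "1/8"] umapD[OF G] by auto
 obtain m3 where m3: "!!n. n \<ge> m3 ==> wlift (avg (1 / 2 ^ n) F) d" using d by (auto simp: hasdeg_def)
 obtain m4 where m4: "!!n. n \<ge> m4 ==> wlift (avg (1 / 2 ^ n) G) e" using d by (auto simp: hasdeg_def)
 note FG = umap_mult[OF F G]
 let ?a = "%t. F t * G t"
 have "wlift (avg (1 / 2 ^ n) ?a) (d + e)" if n: "n \<ge> max (max m1 m2) (max m3 m4)" for n
 proof (rule wlift_perturb)
  show "wlift (%t. avg (1 / 2 ^ n) F t * avg (1 / 2 ^ n) G t) (d + e)" using n by (intro wlift_mult m3 m4) auto
  show "continuous_on TP (avg (1 / 2 ^ n) ?a)"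
   by (intro avg_continuous pow_half umapD(4,5)[OF FG])
  show "avg (1 / 2 ^ n) ?a (2 * pi) = avg (1 / 2 ^ n) ?a 0"
   using avg_periodic[OF umapD(1)[OF FG], of _ 0] by simp
  fix t
  define a b where "a = avg (1 / 2 ^ n) F t" and "b = avg (1 / 2 ^ n) G t"
  have l: "7 / 8 <= csq a" "7 / 8 <= csq b"
   using avg_lower[OF umapD(1,2)[OF F] m1, of n t] avg_lower[OF umapD(1,2)[OF G] m2, of n t] n by (auto simp: a_def b_def)
  have "2 * cmod (avg (1 / 2 ^ n) ?a t - a * b) <= (1 - csq a) + (1 - csq b)"
   unfolding a_def b_def avg_def by (rule U.unit_covariance) (auto simp: umapD[OF F] umapD[OF G])
  hence 1: "cmod (avg (1 / 2 ^ n) ?a t - a * b) <= 1 / 8" using l by linarith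
  have "(7 / 8) * (7 / 8) <= csq a * csq b" using l by (intro mult_mono) auto
  hence "(7 / 8) * (7 / 8) <= csq (a * b)" by (simp add: norm_mult power_mult_distrib)
  moreover have "(1 / 2)^2 <= (7 / 8) * (7 / 8 :: real)" by (simp add: sq_eq)
  ultimately have "(1 / 2)^2 <= csq (a * b)" by linarith
  hence "1 / 2 <= cmod (a * b)" by (rule power2_le_imp_le) simp
  thus "cmod (avg (1 / 2 ^ n) ?a t - avg (1 / 2 ^ n) F t * avg (1 / 2 ^ n) G t) < cmod (avg (1 / 2 ^ n) F t * avg (1 / 2 ^ n) G t)"
   using 1 unfolding a_def b_def by linarith
 qed
 thus ?thesis unfolding hasdeg_def by blast
qed

lemma hasdeg_continuous:
 assumes F: "per F" "continuous_on UNIV F" "!!x. cmod (F x) = 1" and w: "wlift F d"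
 shows "hasdeg F d"
proof -
 interpret U: prob_space U01 by (rule U01_prob)
 have "uniformly_continuous_on {0..2 * pi + 1} F"
  by (intro compact_uniformly_continuous continuous_on_subset[OF F(2)]) auto
 then obtain D where D: "D > 0" "!!x y. x \<in> {0..2 * pi + 1} ==> y \<in> {0..2 * pi + 1} ==> dist x y < D ==> dist (F x) (F y) < 1 / 2"
  unfolding uniformly_continuous_on_def by (meson half_gt_zero zero_less_one)
 have "(%n. (1 / 2) ^ n :: real) ----> 0" by (intro LIMSEQ_power_zero) auto
 hence "eventually (%n. (1 / 2) ^ n < D) sequentially" using D(1) by (rule order_tendstoD(2))
 then obtain m where m: "!!n. n \<ge> m ==> 1 / 2 ^ n < D" by (auto simp: eventually_sequentially power_one_over)
 have "wlift (avg (1 / 2 ^ n) F) d" if n: "n \<ge> m" for n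
 proof (rule wlift_perturb[OF w])
  show "continuous_on TP (avg (1 / 2 ^ n) F)" using F perD by (intro avg_continuous pow_half) auto
  show "avg (1 / 2 ^ n) F (2 * pi) = avg (1 / 2 ^ n) F 0" using avg_periodic[OF F(1), of _ 0] by simp
  fix t assume t: "t \<in> TP"
  have [measurable]: "F \<in> BM" using F perD by auto
  have p1: "(1::real) / 2 ^ n <= 1" by simp
  let ?a = "%h. cmod (F (t + 1 / 2 ^ n * h) - F t)"
  have close: "AE h in U01. ?a h^2 <= 1 / 4"
   unfolding U01_def
  proof (subst AE_uniform_measure)
   show "AE h in lborel. h \<in> {0..1} --> (?a h)^2 <= 1 / 4"
   proof (intro AE_I2 impI)
    fix h :: real assume h: "h \<in> {0..1}"
    have "1 / 2 ^ n * h <= 1 / 2 ^ n * 1" using h by (intro mult_left_mono) auto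
    moreover have "0 <= 1 / 2 ^ n * h" using h by simp
    ultimately have le: "0 <= 1 / 2 ^ n * h" "1 / 2 ^ n * h < D" "1 / 2 ^ n * h <= 1" using m[OF n] p1 by linarith+
    define k where "k = 1 / 2 ^ n * h"
    have "dist (F (t + k)) (F t) < 1 / 2"
     using t le[folded k_def] by (intro D(2)) (auto simp: dist_real_def)
    hence "dist (F (t + 1 / 2 ^ n * h)) (F t) < 1 / 2" by (simp only: k_def)
    hence "?a h^2 <= (1 / 2)^2" by (intro power_mono) (auto simp: dist_norm)
    thus "?a h^2 <= 1 / 4" by (simp add: sq_eq)
   qed
  qed auto
  let ?b = "avg (1 / 2 ^ n) F t - F t"
  have "csq ?b <= (IU h. ?a h^2)"
   unfolding avg_def by (rule U.unit_variance_mean(2)) (auto simp: F)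
  also have "... <= (IU h. 1 / 4)"
   using close by (intro integral_mono_AE U.unit_variance(2)) (auto simp: F)
  also have "... < 1^2" using U.prob_space by simp
  finally have "cmod ?b < 1" by (rule power_less_imp_less_base) simp
  thus "cmod ?b < cmod (F t)" using F(3) by simp
 qed
 thus ?thesis unfolding hasdeg_def by blast
qed

section \<open>Stability of the degree in the norm, and behaviour of energy under averaging\<close>

definition l2 :: "(real => complex) => ennreal" where
 "l2 F = (NL x. ind TP x * en (csq (F x)))"

lemma (in prob_space) jensen_square:
 fixes X :: "'a => complex"
 assumes [measurable]: "X \<in> borel_measurable M" and B: "!!x. cmod (X x) <= B"
 shows "en (csq (\<integral>x. X x \<partial>M)) <= (\<integral>\<^sup>+x. en (csq (X x)) \<partial>M)"
proof -
 have iX: "integrable M X" by (rule integrable_unit[where B=B]) (auto simp: B)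
 define Y where "Y x = cmod (X x)" for x
 define m where "m = (\<integral>x. Y x \<partial>M)"
 have iY: "integrable M Y" unfolding Y_def[abs_def] using iX by simp
 have Y2: "(Y x)^2 <= B^2" for x unfolding Y_def using B by (intro power_mono) auto
 have iY2: "integrable M (%x. (Y x)^2)"
  by (rule integrable_const_bound[where B="B^2"]) (use Y2 in \<open>auto simp: Y_def\<close>)
 let ?a = "\<integral>x. (Y x)^2 \<partial>M"
 let ?b = "cmod (\<integral>x. X x \<partial>M)"
 have "0 <= (\<integral>x. (Y x - m)^2 \<partial>M)" by (intro integral_nonneg_AE) auto
 also have "... = (\<integral>x. (Y x)^2 - 2 * m * Y x + m^2 \<partial>M)"
  by (intro Bintegral_cong) (auto simp: sq_eq algebra_simps)
 also have "... = ?a - 2 * m * m + m^2"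
  using iY iY2 by (simp add: prob_space m_def)
 finally have "m^2 <= ?a" by (simp add: sq_eq)
 moreover have "?b^2 <= m^2"
  unfolding m_def Y_def by (intro power_mono integral_norm_bound) auto
 ultimately have "en (?b^2) <= en ?a" by (intro ennreal_leI) simp
 also have "... = (\<integral>\<^sup>+x. en ((Y x)^2) \<partial>M)" using iY2 by (intro nn_integral_eq_integral[symmetric]) auto
 finally show ?thesis unfolding Y_def .
qed

lemma l2_window:
 assumes "per F" shows "(NL x. ind {t..t + 2 * pi} x * en (csq (F x))) = l2 F"
proof -
 have [measurable]: "F \<in> BM" using assms perD by auto
 have "(%x. en (csq (F x))) \<in> BM" by measurable
 thus ?thesis unfolding l2_def by (rule nn_integral_periodic) (simp add: perD(2)[OF assms])
qed

lemma l2_add_le: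
 assumes [measurable]: "F \<in> BM" "G \<in> BM"
  and H: "!!x. cmod (H x) <= cmod (F x) + cmod (G x)"
 shows "l2 H <= 2 * l2 F + 2 * l2 G"
proof -
 have le: "en (csq (H x)) <= 2 * en (csq (F x)) + 2 * en (csq (G x))" for x
 proof -
  have "csq (H x) <= (cmod (F x) + cmod (G x))^2" using H by (intro power_mono) auto
  also have "... <= 2 * csq (F x) + 2 * csq (G x)"
   using sum_squares_bound[of "cmod (F x)" "cmod (G x)"] by (simp add: power2_sum)
  finally have "en (csq (H x)) <= en (2 * csq (F x) + 2 * csq (G x))" by (rule ennreal_leI)
  thus ?thesis by (simp add: ennreal_plus ennreal_mult)
 qed
 have "l2 H <= (NL x. 2 * (ind TP x * en (csq (F x))) + 2 * (ind TP x * en (csq (G x))))"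
  unfolding l2_def using le by (intro nn_integral_mono) (auto simp: ind_def)
 also have "... = 2 * l2 F + 2 * l2 G" unfolding l2_def by (simp add: nn_integral_add nn_integral_cmult)
 finally show ?thesis .
qed

lemma avg_sq_le_l2:
 assumes F: "per F" and B: "!!x. cmod (F x) <= B" and d: "0 < D" "D <= 2 * pi"
 shows "en (csq (avg D F t)) <= en (1 / D) * l2 F"
proof -
 interpret U: prob_space U01 by (rule U01_prob)
 have [measurable]: "F \<in> BM" using F perD by auto
 let ?f = "%y. ind {t..t + D} y * en (csq (F y))"
 have "en (csq (avg D F t)) <= (NU h. en (csq (F (t + D * h))))"
  unfolding avg_def by (rule U.jensen_square[where B=B]) (auto simp: B)
 also have "... = (NL h. ind {0..1} h * en (csq (F (t + D * h))))"
  by (subst nn_integral_U01) auto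
 also have "... = (NL h. ?f (t + D * h))"
  using d by (intro nn_integral_cong) (auto simp: ind_def zero_le_mult_iff)
 also have "... = en (1 / D) * (NL y. ?f y)"
 proof -
  have "?f \<in> BM" by measurable
  from nn_integral_real_affine[OF this, of D t] have "(NL y. ?f y) = en D * (NL h. ?f (t + D * h))"
   using d by simp
  thus ?thesis using d by (simp add: mult.assoc[symmetric] ennreal_mult[symmetric])
 qed
 also have "... <= en (1 / D) * (NL x. ind {t..t + 2 * pi} x * en (csq (F x)))"
  using d by (intro mult_left_mono nn_integral_mono) (auto simp: ind_def)
 finally show ?thesis unfolding l2_window[OF F] .
qed

lemma avg_diff:
 assumes [measurable]: "F \<in> BM" "G \<in> BM"
  and "!!x. cmod (F x) <= 1" "!!x. cmod (G x) <= 1"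
 shows "avg d (%t. F t - G t) t = avg d F t - avg d G t"
proof -
 interpret U: prob_space U01 by (rule U01_prob)
 have "integrable U01 (%h. F (t + d * h))" "integrable U01 (%h. G (t + d * h))"
  using assms(3,4) by (auto intro!: U.integrable_unit[where B=1])
 thus ?thesis unfolding avg_def by simp
qed

text \<open>One scale \<open>D\<close> is fixed by \<open>F\<close> alone. Small energy of the
  difference keeps \<open>nd D (G k)\<close> below \<open>1/8\<close>, so that scale already
  determines the degree of \<open>G k\<close>; small L2 distance makes the averages at that scale
  uniformly close, so their windings agree.\<close>

lemma hasdeg_limit:
 assumes F: "umap F" and G: "!!k. umap (G k)"
  and N: "(%k. NN (%t. G k t - F t)) ----> 0" and L: "(%k. l2 (%t. G k t - F t)) ----> 0"
  and d: "hasdeg F d"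
 shows "eventually (%k. hasdeg (G k) d) sequentially"
proof -
 obtain m1 where m1: "!!n. n \<ge> m1 ==> nd (1 / 2 ^ n) F <= en (1/32)" using nd_to_0[of F "1/32"] umapD[OF F] by auto
 obtain m2 where m2: "!!n. n \<ge> m2 ==> wlift (avg (1 / 2 ^ n) F) d" using d by (auto simp: hasdeg_def)
 define m where "m = max m1 m2"
 define D where "D = (1::real) / 2 ^ m"
 have D: "0 < D" "D <= 2 * pi" using pow_half by (auto simp: D_def)
 have nF: "nd D F <= en (1/32)" and wF: "wlift (avg D F) d" using m1[of m] m2[of m] by (auto simp: m_def D_def)
 have e1: "eventually (%k. NN (%t. G k t - F t) < en (1/32)) sequentially" using N by (rule order_tendstoD) simp
 have e2: "eventually (%k. l2 (%t. G k t - F t) < en (D / 4)) sequentially" using L by (rule order_tendstoD) (use D in simp)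
 show ?thesis using e1 e2
 proof eventually_elim
  case (elim k)
  note mF = umapD(4,5)[OF F] and mG = umapD(4,5)[OF G[of k]]
  have mD: "(%t. G k t - F t) \<in> BM" using mF(1) mG(1) by measurable
  have "nd D (G k) <= 2 * nd D F + 2 * nd D (%t. G k t - F t)"
  proof (rule nd_add_le[OF mF(1) mD])
   fix x h
   let ?a = "(G k (x + h) - F (x + h)) - (G k x - F x)"
   have "G k (x + h) - G k x = (F (x + h) - F x) + ?a" by simp
   thus "cmod (G k (x + h) - G k x) <= cmod (F (x + h) - F x) + cmod ?a"
    by (metis norm_triangle_ineq)
  qed
  also have "... <= 2 * en (1/32) + 2 * en (1/32)"
   using nF order_trans[OF nd_mono[OF D(2)] less_imp_le[OF elim(1)]] by (intro add_mono mult_left_mono) auto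
  also have "... = en (1/8)"
  proof -
   have "2 * en (1/32) = en (2 * (1/32))" by (subst ennreal_mult) auto
   thus ?thesis by (simp add: ennreal_plus[symmetric] del: ennreal_plus)
  qed
  finally have nG: "nd (1 / 2 ^ m) (G k) <= en (1/8)" by (simp add: D_def)
  have "wlift (avg D (G k)) d"
  proof (rule wlift_perturb[OF wF])
   show "continuous_on TP (avg D (G k))" by (intro avg_continuous mG D)
   show "avg D (G k) (2 * pi) = avg D (G k) 0" using avg_periodic[OF umapD(1)[OF G], of _ _ 0] by simp
   fix t
   have "en (csq (avg D (%t. G k t - F t) t)) <= en (1 / D) * l2 (%t. G k t - F t)"
   proof (rule avg_sq_le_l2[OF per_diff[OF umapD(1)[OF G] umapD(1)[OF F]] _ D])
    show "cmod (G k x - F x) <= 2" for x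
     using norm_triangle_ineq4[of "G k x" "F x"] umapD(2)[OF F, of x] umapD(2)[OF G, of k x] by simp
   qed
   also have "... <= en (1 / D) * en (D / 4)" using elim(2) by (intro mult_left_mono) auto
   also have "... = en (1 / 4)" using D by (simp add: ennreal_mult[symmetric])
   finally have "csq (avg D (G k) t - avg D F t) <= 1 / 4"
    unfolding avg_diff[OF mG(1) mF(1) mG(2) mF(2)] by (simp add: ennreal_le_iff)
   also have "... < 1 - 1 / 32" by simp
   also have "... <= csq (avg D F t)"
    using avg_lower[OF umapD(1,2)[OF F], of m "1/32" t] nF by (simp add: D_def)
   finally show "cmod (avg D (G k) t - avg D F t) < cmod (avg D F t)"
    by (rule power_less_imp_less_base) simp
  qed
  thus ?case unfolding hasdeg_def using wlift_avg_stable[OF umapD(1,2)[OF G] nG] by (auto simp: D_def)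
 qed
qed

lemma nd_translate:
 assumes F: "per F" shows "nd d (%x. F (x + a)) = nd d F"
proof -
 have [measurable]: "F \<in> BM" using F perD by auto
 let ?f = "%y. ind {a..a + 2 * pi} y * (NL h. ind {0..d} h * ed F y h)"
 have m: "?f \<in> BM" unfolding ed_def by measurable
 have "nd d (%x. F (x + a)) = (NL x. ?f (a + x))"
  unfolding nd_def by (intro nn_integral_cong arg_cong2[where f="(*)"]) (auto simp: ind_def ed_def ac_simps)
 also have "... = (NL y. ?f y)" by (rule nn_integral_shift[OF m])
 also have "... = nd d F" by (rule nd_window[OF F])
 finally show ?thesis .
qed

text \<open>An average is a mean of translates, all of the same energy, and the energy is convex by
  Jensen's inequality. The constant \<open>1\<close> is essential for the sharp estimates that
  follow.\<close>

lemma nd_avg_le: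
 assumes F: "per F" and B: "!!x. cmod (F x) <= 1"
 shows "nd d' (avg d F) <= nd d' F"
proof -
 interpret U: prob_space U01 by (rule U01_prob)
 interpret P: pair_sigma_finite "lborel :: real measure" U01 ..
 have [measurable]: "F \<in> BM" using F perD by auto
 have le: "ed (avg d F) x h <= (NU k. ed F (x + d * k) h)" for x h
 proof -
  have i: "integrable U01 (%k. F (y + d * k))" for y using B by (intro U.integrable_unit[where B=1]) auto
  have eq: "avg d F (x + h) - avg d F x = (IU k. F (x + d * k + h) - F (x + d * k))"
   unfolding avg_def using i[of "x + h"] i[of x] by (simp add: ac_simps)
  let ?c = "NU k. en (csq (F (x + d * k + h) - F (x + d * k)))"
  let ?d = "csq (avg d F (x + h) - avg d F x)"
  have "en ?d <= ?c"
   unfolding eq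
  proof (rule U.jensen_square[where B=2])
   show "cmod (F (x + d * k + h) - F (x + d * k)) <= 2" for k
    using norm_triangle_ineq4[of "F (x + d * k + h)" "F (x + d * k)"] B[of "x + d * k + h"] B[of "x + d * k"] by simp
  qed measurable
  hence "en (1 / csq (1 - cis h)) * en ?d <= en (1 / csq (1 - cis h)) * ?c"
   by (rule mult_left_mono) simp
  also have "... = (NU k. ed F (x + d * k) h)"
   unfolding ed_def by (subst nn_integral_cmult[symmetric]) (auto simp: ennreal_mult[symmetric])
  finally show ?thesis unfolding ed_def by (simp add: ennreal_mult[symmetric])
 qed
 let ?a = "%x. NL h. ind {0..d'} h * (NU k. ed F (x + d * k) h)"
 let ?b = "%k x. NL h. ind {0..d'} h * ed F (x + d * k) h"
 have "nd d' (avg d F) <= (NL x. ind TP x * ?a x)"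
  unfolding nd_def using le by (intro nn_integral_mono mult_left_mono) auto
 also have "... = (NL x. NU k. ind TP x * ?b k x)"
 proof (intro nn_integral_cong)
  fix x
  have "?a x = (NL h. (NU k. ind {0..d'} h * ed F (x + d * k) h))"
   unfolding ed_def by (intro nn_integral_cong nn_integral_cmult[symmetric]) measurable
  also have "... = (NU k. ?b k x)"
   unfolding ed_def by (rule P.Fubini'[symmetric]) (simp add: case_prod_beta)
  finally show "ind TP x * ?a x = (NU k. ind TP x * ?b k x)"
   unfolding ed_def by (subst nn_integral_cmult) auto
 qed
 also have "... = (NU k. NL x. ind TP x * ?b k x)"
  unfolding ed_def by (rule P.Fubini'[symmetric]) (simp add: case_prod_beta)
 also have "... = (NU k. nd d' (%x. F (x + d * k)))"
  unfolding nd_def ed_def by (intro nn_integral_cong) (simp add: ac_simps)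
 also have "... = nd d' F"
  unfolding nd_translate[OF F] using U.emeasure_space_1 by simp
 finally show ?thesis .
qed

lemma l2_avg_minus:
 assumes F: "per F" and B: "!!x. cmod (F x) <= 1" and d: "0 < D" "D <= 2 * pi"
 shows "l2 (%x. avg D F x - F x) <= en D * NN F"
proof -
 interpret U: prob_space U01 by (rule U01_prob)
 have [measurable]: "F \<in> BM" using F perD by auto
 let ?a = "%x. NL h. ind {0..D} h * ed F x h"
 have le: "en (csq (avg D F x - F x)) <= en D * ?a x" for x
 proof -
  have i: "integrable U01 (%k. F (x + D * k))" using B by (intro U.integrable_unit[where B=1]) auto
  have eq: "avg D F x - F x = (IU k. F (x + D * k) - F x)"
   unfolding avg_def using i U.prob_space by simp
  let ?f = "%h. ind {0..D} h * en (csq (F (x + h) - F x))"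
  have "en (csq (avg D F x - F x)) <= (NU k. en (csq (F (x + D * k) - F x)))"
   unfolding eq
  proof (rule U.jensen_square[where B=2])
   show "cmod (F (x + D * k) - F x) <= 2" for k
    using norm_triangle_ineq4[of "F (x + D * k)" "F x"] B[of "x + D * k"] B[of x] by simp
  qed measurable
  also have "... = (NL k. ?f (0 + D * k))"
   using d by (subst nn_integral_U01) (auto intro!: nn_integral_cong simp: ind_def zero_le_mult_iff)
  also have "... = en (1 / D) * (NL h. ?f h)"
  proof -
   have "?f \<in> BM" by measurable
   from nn_integral_real_affine[OF this, of D 0] have "(NL y. ?f y) = en D * (NL h. ?f (0 + D * h))"
    using d by simp
   thus ?thesis using d by (simp add: mult.assoc[symmetric] ennreal_mult[symmetric])
  qed
  also have "... <= en (1 / D) * (NL h. en (D^2) * (ind {0..D} h * ed F x h))"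
   using diff_le_ed[OF F d] by (intro mult_left_mono nn_integral_mono) (auto simp: ind_def)
  also have "... = en (1 / D) * (en (D^2) * ?a x)"
   by (subst nn_integral_cmult) auto
  also have "... = en D * ?a x"
   using d by (simp add: mult.assoc[symmetric] ennreal_mult[symmetric] sq_eq)
  finally show ?thesis .
 qed
 have "l2 (%x. avg D F x - F x) <= (NL x. en D * (ind TP x * ?a x))"
  unfolding l2_def using le by (intro nn_integral_mono) (auto simp: ind_def)
 also have "... = en D * nd D F"
  unfolding nd_def ed_def by (intro nn_integral_cmult) measurable
 also have "... <= en D * NN F" using nd_mono[OF d(2)] by (rule mult_left_mono) simp
 finally show ?thesis .
qed

lemma avg_le1:
 assumes "F \<in> BM" "!!x. cmod (F x) <= 1"
 shows "cmod (avg d F t) <= 1"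
proof -
 interpret U: prob_space U01 by (rule U01_prob)
 have "cmod (avg d F t) <= (IU h. cmod (F (t + d * h)))" unfolding avg_def by (rule integral_norm_bound)
 also have "... <= (IU h. 1)"
  using assms by (intro integral_mono integrable_norm U.integrable_unit[where B=1]) auto
 finally show ?thesis using U.prob_space by simp
qed

text \<open>The first average makes a measurable map continuous, the second makes it C1. Both use
  half the scale, so that the result stays close to the single average over \<open>d\<close>, whose
  modulus is controlled.\<close>

definition mol :: "real => (real => complex) => real => complex" where
 "mol d F = avg (d / 2) (avg (d / 2) F)"

lemma mol_minus_avg:
 assumes F: "F \<in> BM" and F1: "!!x. cmod (F x) = 1" and d: "0 < D"
 shows "csq (mol D F t - avg D F t) <= 2 * (1 - csq (avg D F t))"
proof -
 interpret U: prob_space U01 by (rule U01_prob)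
 note [measurable] = F
 define c where "c = avg D F t"
 define G where "G = avg (D / 2) F"
 have F1': "cmod (F x) <= 1" for x using F1 by simp
 have [measurable]: "G \<in> BM"
  unfolding G_def by (intro borel_cont avg_continuous F F1') (use d in simp)
 have G1: "cmod (G x) <= 1" for x unfolding G_def by (rule avg_le1[OF F F1'])
 have c1: "cmod c <= 1" unfolding c_def by (rule avg_le1[OF F F1'])
 let ?a = "%h. csq (G (t + D / 2 * h) - c)"
 let ?b = "2 * (1 - csq c)"
 have "avg (D / 2) G t - c = (IU h. G (t + D / 2 * h) - c)"
  unfolding avg_def[of _ G] using G1 U.prob_space by (subst Bintegral_diff) (auto intro!: U.integrable_unit)
 hence "en (csq (mol D F t - c)) = en (csq (IU h. G (t + D / 2 * h) - c))" by (simp add: mol_def G_def)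
 also have "... <= (NU h. en (?a h))"
 proof (rule U.jensen_square[where B=2])
  show "cmod (G (t + D / 2 * h) - c) <= 2" for h using norm_triangle_ineq4[of "G (t + D / 2 * h)" c] c1 G1[of "t + D / 2 * h"] by simp
 qed measurable
 also have "... = (NL h. ind {0..1} h * en (?a h))" by (rule nn_integral_U01) measurable
 also have "... <= (NL h. ind {0..1::real} h * en ?b)"
 proof (rule nn_integral_mono)
  fix h :: real
  show "ind {0..1} h * en (?a h) <= ind {0..1} h * en ?b"
   using avg_half_diff[OF F F1, of h D t] unfolding G_def c_def by (cases "h \<in> {0..1}") (auto intro: ennreal_leI)
 qed
 also have "... = en ?b" by (subst nn_integral_multc) auto
 finally show ?thesis using c1 by (subst (asm) ennreal_le_iff) (auto simp: c_def power_le_one)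
qed

lemma avg_has_derivative:
 assumes G: "continuous_on UNIV G" and d: "0 < D"
 shows "(avg D G has_vector_derivative (1 / D) *\<^sub>R (G (t + D) - G t)) (at t)"
proof -
 have Gc: "isCont G x" for x using G by (simp add: continuous_on_eq_continuous_at)
 have "\<exists>P. \<forall>x::real. - \<infinity> < ereal x --> ereal x < \<infinity> --> (P has_vector_derivative G x) (at x)"
  by (rule einterval_antiderivative) (auto simp: Gc)
 then obtain P where P: "!!x. (P has_vector_derivative G x) (at x)" by auto
 let ?a = "%s. (1 / D) *\<^sub>R (P (s + D) - P s)"
 have "avg D G = ?a"
  apply (rule ext) subgoal for s
  using d integral_FTC_atLeastAtMost[of s "s + D" P G] P G
  by (simp add: avg_lborel borel_cont has_vector_derivative_at_within continuous_on_subset) done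
 moreover have "(?a has_vector_derivative (1 / D) *\<^sub>R (G (t + D) - G t)) (at t)"
 proof -
  have "((%s. s + D) has_vector_derivative 1) (at t)" by (auto intro!: derivative_eq_intros)
  from vector_diff_chain_at[OF this P] have "((%s. P (s + D)) has_vector_derivative G (t + D)) (at t)" by (simp add: o_def)
  from has_vector_derivative_diff[OF this P[of t]] show ?thesis
   using has_vector_derivative_scaleR[OF DERIV_const[of "1 / D"]] by fastforce
 qed
 ultimately show ?thesis by simp
qed

lemma C1_avg:
 assumes G: "continuous_on UNIV G" and d: "0 < D"
 shows "avg D G C1_differentiable_on UNIV"
 unfolding C1_differentiable_on_def using avg_has_derivative[OF assms]
 by (intro exI[of _ "%t. (1 / D) *\<^sub>R (G (t + D) - G t)"])
  (auto intro!: continuous_intros continuous_on_compose2[OF G])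

lemma C1_sgn:
 fixes A :: "real => complex"
 assumes A: "A C1_differentiable_on UNIV" and A0: "!!t. A t ~= 0"
 shows "(%t. sgn (A t)) C1_differentiable_on UNIV"
proof -
 obtain D where D: "!!t. (A has_vector_derivative D t) (at t)" and Dc: "continuous_on UNIV D"
  using A unfolding C1_differentiable_on_def by auto
 have Ac: "continuous_on UNIV A" using C1_differentiable_imp_continuous_on[OF A] .
 let ?b = "%t. A t \<bullet> D t"
 have n: "((%t. inverse (norm (A t))) has_real_derivative - (?b t / norm (A t)) * inverse ((norm (A t))^2)) (at t)" for t
 proof -
  have "((%t. A t \<bullet> A t) has_real_derivative 2 * ?b t) (at t)"
   unfolding has_real_derivative_iff_has_vector_derivative
   using bounded_bilinear.has_vector_derivative[OF bounded_bilinear_inner D D, of t] by (simp add: inner_commute)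
  from DERIV_real_sqrt[THEN DERIV_chain2, OF _ this] have "((%t. sqrt (A t \<bullet> A t)) has_real_derivative inverse (sqrt (A t \<bullet> A t)) / 2 * (2 * ?b t)) (at t)"
   using A0[of t] by simp
  hence "((%t. norm (A t)) has_real_derivative (?b t) / norm (A t)) (at t)"
   by (simp add: norm_eq_sqrt_inner[symmetric] field_simps)
  from DERIV_inverse_fun[OF this] show ?thesis using A0[of t] by (simp add: sq_eq)
 qed
 let ?a = "%t. - (?b t / norm (A t)) * inverse ((norm (A t))^2)"
 let ?c = "%t. %t. inverse (norm (A t)) *\<^sub>R A t"
 have "(?c t has_vector_derivative inverse (norm (A t)) *\<^sub>R D t + ?a t *\<^sub>R A t) (at t)" for t
  by (rule has_vector_derivative_scaleR[OF n D])
 moreover have "continuous_on UNIV (%t. inverse (norm (A t)) *\<^sub>R D t + ?a t *\<^sub>R A t)"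
  using A0 by (intro continuous_intros Ac Dc) auto
 ultimately have "\<exists>D. (\<forall>t\<in>UNIV. (?c t has_vector_derivative D t) (at t)) \<and> continuous_on UNIV D"
  by (intro exI[of _ "%t. inverse (norm (A t)) *\<^sub>R D t + ?a t *\<^sub>R A t"]) blast
 thus ?thesis unfolding C1_differentiable_on_def sgn_div_norm .
qed

text \<open>For unit vectors \<open>p\<close>, \<open>q\<close> the squared norm of the difference
  of \<open>\<alpha> p\<close> and \<open>\<beta> q\<close> is
  \<open>\<alpha> * \<beta> * csq (p - q) + (\<alpha> - \<beta>)^2\<close>. Radial projection
  therefore costs only the factor \<open>1 / c\<close>, which tends to one with
  \<open>c\<close>.\<close>

lemma cmod_sgn_diff_le:
 assumes "c <= cmod a" "c <= cmod b" "0 < c"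
 shows "cmod (sgn a - sgn b) <= cmod (a - b) / c"
proof -
 define \<alpha> \<beta> p q where "\<alpha> = cmod a" "\<beta> = cmod b" "p = sgn a" "q = sgn b"
 have ca: "cmod a ~= 0" "cmod b ~= 0" using assms by auto
 have ab: "a = \<alpha> *\<^sub>R p" "b = \<beta> *\<^sub>R q" "c <= \<alpha>" "c <= \<beta>" and pq: "p \<bullet> p = 1" "q \<bullet> q = 1"
  using assms(1,2) ca by (simp_all add: \<alpha>_\<beta>_p_q_def sgn_div_norm dot_square_norm power_inverse)
 have "c^2 * csq (p - q) <= \<alpha> * \<beta> * csq (p - q)"
  using ab(3,4) assms(3) unfolding sq_eq[of c] by (intro mult_right_mono mult_mono) auto
 also have "... + (\<alpha> - \<beta>)^2 = csq (a - b)"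
  unfolding power2_norm_eq_inner ab(1,2) using pq by (simp add: inner_diff algebra_simps inner_commute sq_eq)
 finally have "(c * cmod (p - q))^2 <= csq (a - b)" using zero_le_power2[of "\<alpha> - \<beta>"] unfolding power_mult_distrib by linarith
 hence "c * cmod (p - q) <= cmod (a - b)" using power2_le_imp_le norm_ge_zero by blast
 thus ?thesis using assms(3) by (simp add: \<alpha>_\<beta>_p_q_def field_simps)
qed

text \<open>Mollify and project radially to the circle. Finite energy makes the oscillation on short
  arcs uniformly small, so the mollified map has modulus at least \<open>1 - e\<close> and
  projecting costs the factor \<open>1 / (1 - e)^2\<close> only. That this factor tends to one is
  used twice: for strong convergence and for the sharp lower bound of the energy.\<close>

lemma smooth_approximation:
 assumes F: "umap F" and d: "hasdeg F d" and e: "0 < e" "e <= 1 / 4"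
 shows "\<exists>H. umap H \<and> H C1_differentiable_on UNIV \<and> wlift H d \<and>
  NN H <= en (1 / (1 - e)^2) * NN F \<and> l2 (%t. H t - F t) <= en (5 * e)"
proof -
 note m = umapD[OF F]
 have e2: "0 < e^2 / 8" using e by simp
 from nd_to_0[OF m(1,3) e2] obtain m1 :: nat where m1: "!!n. m1 <= n ==> nd (1 / 2 ^ n) F <= en (e^2 / 8)" by blast
 from d obtain m2 where m2: "!!n. m2 <= n ==> wlift (avg (1 / 2 ^ n) F) d" unfolding hasdeg_def by blast
 obtain N where N: "NN F = en N" "0 <= N" using m(3) by (cases "NN F") auto
 obtain m3 :: nat where m3: "4 * (N + 1) / e < 2 ^ m3" using real_arch_pow[of 2 "4 * (N + 1) / e"] by auto
 \<comment> \<open>The scale serves three purposes: small oscillation, the correct winding of the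
   average, and \<open>4 * N * D <= e\<close> for the L2 distance.\<close>
 define n where "n = m1 + m2 + m3"
 define D where "D = (1::real) / 2 ^ n"
 have D: "0 < D" "D <= 2 * pi" unfolding D_def by (rule pow_half)+
 have DN: "4 * N * D <= e"
 proof -
  have "4 * (N + 1) / e < 2 ^ n" using m3 power_increasing[of m3 n "2::real"] unfolding n_def by (meson le_add2 less_le_trans one_le_numeral)
  hence "4 * (N + 1) < e * 2 ^ n" using e by (simp add: field_simps)
  hence "4 * N <= e * 2 ^ n" by simp
  thus ?thesis by (simp add: D_def field_simps)
 qed
 define A where "A = mol D F"
 define B where "B = avg D F"
 define G where "G = avg (D / 2) F"
 define H where "H t = sgn (A t)" for t
 have D2: "0 < D / 2" "D / 2 <= 2 * pi" using D by auto
 have G: "per G" "cmod (G x) <= 1" "continuous_on UNIV G" for x unfolding G_def using m D2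
  by (auto intro!: per_avg avg_le1 avg_continuous)
 have A: "per A" "cmod (A x) <= 1" "continuous_on S A" for x S unfolding A_def mol_def G_def[symmetric] using G perD D2
  by (auto intro!: per_avg avg_le1 avg_continuous)
 have [measurable]: "F \<in> BM" "G \<in> BM" "A \<in> BM" using m G A perD by auto
 have B: "1 - e^2 / 8 <= csq (B t)" for t
  unfolding B_def D_def using m1[of n] m e by (intro avg_lower) (auto simp: n_def)
 have B1: "cmod (B t) <= 1" for t unfolding B_def by (rule avg_le1[OF m(4,5)])
 have AB: "cmod (A t - B t) <= e / 2" for t
 proof -
  have "csq (A t - B t) <= 2 * (1 - csq (B t))" unfolding A_def B_def by (rule mol_minus_avg[OF m(4,2) D(1)])
  also have "... <= (e / 2)^2" using B[of t] by (simp add: power_divide)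
  finally show ?thesis using e by (auto intro: power2_le_imp_le)
 qed
 have Bl: "1 - e / 4 <= cmod (B t)" for t
 proof -
  have "csq (B t) <= cmod (B t)" using B1[of t] by (simp add: sq_eq mult_left_le_one_le)
  moreover have "e^2 <= e" using e by (simp add: sq_eq mult_left_le_one_le)
  ultimately show ?thesis using B[of t] e by simp
 qed
 have Al: "1 - e <= cmod (A t)" for t
  using norm_triangle_ineq2[of "B t" "A t"] AB[of t] Bl[of t] e by (simp add: norm_minus_commute)
 have A0: "A t ~= 0" for t using Al[of t] e by auto
 have HA: "cmod (H t - A t) <= e" for t
 proof -
  have "H t - A t = (1 - cmod (A t)) *\<^sub>R H t" using A0[of t] by (simp add: H_def sgn_div_norm algebra_simps)
  hence "cmod (H t - A t) = abs (1 - cmod (A t))" using A0[of t] by (simp add: H_def norm_sgn)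
  thus ?thesis using Al[of t] A(2)[of t] by simp
 qed
 have Hp: "H (t + 2 * pi) = H t" for t using perD(2)[OF A(1)] by (simp add: H_def)
 have AC: "A C1_differentiable_on UNIV" unfolding A_def mol_def G_def[symmetric] by (rule C1_avg[OF G(3) D2(1)])
 have HC: "H C1_differentiable_on UNIV" unfolding H_def by (rule C1_sgn[OF AC A0])
 have Hcont: "continuous_on S H" for S using C1_differentiable_imp_continuous_on[OF HC] continuous_on_subset by blast
 have [measurable]: "H \<in> BM" by (intro borel_cont Hcont)
 have "per H" using Hp by (simp add: per_def)
 have wA: "wlift A d"
 proof (rule wlift_perturb)
  show "wlift B d" using m2[of n] by (simp add: B_def D_def n_def)
  show "cmod (A t - B t) < cmod (B t)" for t using AB[of t] Bl[of t] e by simp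
  show "A (2 * pi) = A 0" using perD(3)[OF A(1)] .
 qed (rule A)
 have wH: "wlift H d"
 proof (rule wlift_perturb[OF wA Hcont])
  show "cmod (H t - A t) < cmod (A t)" for t using HA[of t] Al[of t] e by simp
  show "H (2 * pi) = H 0" using Hp[of 0] by simp
 qed
 have NG: "NN G <= NN F" unfolding G_def by (rule nd_avg_le[OF m(1,5)])
 have NA: "NN A <= NN G" unfolding A_def mol_def G_def[symmetric] by (rule nd_avg_le[OF G(1,2)])
 have "NN H <= en (1 / (1 - e)^2) * NN A"
 proof -
  have "ed H x h <= en (1 / (1 - e)^2) * ed A x h" for x h
  proof -
   let ?c = "cmod (1 - cis h)"
   have "cmod (H (x + h) - H x) <= cmod (A (x + h) - A x) / (1 - e)" unfolding H_def using Al e by (intro cmod_sgn_diff_le) auto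
   hence "csq (H (x + h) - H x) <= (cmod (A (x + h) - A x) / (1 - e))^2" by (rule power_mono) simp
   hence "csq (H (x + h) - H x) / ?c^2 <= 1 / (1 - e)^2 * (csq (A (x + h) - A x) / ?c^2)"
    using divide_right_mono[of _ _ "?c^2"] by (fastforce simp: power_divide)
   thus ?thesis unfolding ed_def by (simp add: ennreal_mult[symmetric] ennreal_leI)
  qed
  hence "NN H <= (NL x. ind TP x * (NL h. en (1 / (1 - e)^2) * (ind TP h * ed A x h)))"
   unfolding nd_def by (intro nn_integral_mono mult_left_mono) (auto simp: ind_def)
  also have "... = en (1 / (1 - e)^2) * NN A"
   unfolding nd_def ed_def
   by (subst nn_integral_cmult, measurable) (simp add: nn_integral_cmult[symmetric] ac_simps)
  finally show ?thesis .
 qed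
 also have "... <= en (1 / (1 - e)^2) * NN F" using NA NG by (intro mult_left_mono) auto
 finally have NH: "NN H <= en (1 / (1 - e)^2) * NN F" .
 hence "NN H < \<infinity>" using m(3) by (auto simp: ennreal_mult_less_top intro: le_less_trans)
 hence uH: "umap H" unfolding umap_def using \<open>per H\<close> A0 by (auto simp: H_def norm_sgn)
 let ?a = "%t. H t - A t"
 have "l2 ?a <= (NL x. ind TP x * en (e^2))"
  unfolding l2_def using HA by (intro nn_integral_mono mult_left_mono ennreal_leI power_mono) auto
 also have "... = en (2 * pi * e^2)" by (subst nn_integral_multc) (auto simp: ennreal_mult)
 finally have 1: "l2 ?a <= en (2 * pi * e^2)" .
 let ?b = "%t. A t - G t"
 have "l2 ?b <= en (D / 2) * NN G"
  unfolding A_def mol_def G_def[symmetric] by (rule l2_avg_minus[OF G(1,2) D2])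
 also have "... <= en (D / 2) * NN F" by (intro mult_left_mono NG) simp
 finally have 2: "l2 ?b <= en (D / 2 * N)" using N D by (simp add: ennreal_mult[symmetric])
 have 3: "l2 (%t. G t - F t) <= en (D / 2 * N)"
  using l2_avg_minus[OF m(1,5) D2] N D by (simp add: ennreal_mult[symmetric] G_def)
 have 4: "l2 (%t. A t - F t) <= 2 * l2 ?b + 2 * l2 (%t. G t - F t)"
  by (rule l2_add_le) (auto intro: order_trans[OF _ norm_triangle_ineq])
 have 5: "l2 (%t. H t - F t) <= 2 * l2 ?a + 2 * l2 (%t. A t - F t)"
  by (rule l2_add_le) (auto intro: order_trans[OF _ norm_triangle_ineq])
 have "l2 (%t. H t - F t) <= 2 * en (2 * pi * e^2) + 2 * (2 * en (D / 2 * N) + 2 * en (D / 2 * N))"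
  by (intro order_trans[OF 5] add_mono mult_left_mono 1 order_trans[OF 4] 2 3) auto
 also have "... = en (4 * pi * e^2 + 4 * N * D)"
 proof -
  have "2 * en a + 2 * (2 * en b + 2 * en b) = en (2 * a + 8 * b)" if "0 <= a" "0 <= b" for a b
  proof -
   have "en (2 * a + 8 * b) = en 2 * en a + en 8 * en b" using that by (simp add: ennreal_mult)
   moreover have "8 * x = 4 * x + 4 * x" for x :: ennreal by (simp add: distrib_right[symmetric])
   ultimately show ?thesis by (simp add: algebra_simps)
  qed
  from this[of "2 * pi * e^2" "D / 2 * N"] show ?thesis using N D by (simp add: algebra_simps)
 qed
 also have "... <= en (5 * e)"
 proof (intro ennreal_leI)
  have "pi * e <= 4 * (1 / 4)" using pi_less_4 e by (intro mult_mono) auto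
  hence "pi * e * e <= 1 * e" using e by (intro mult_right_mono) auto
  thus "4 * pi * e^2 + 4 * N * D <= 5 * e" using DN by (simp add: sq_eq mult.assoc)
 qed
 finally show ?thesis using uH HC wH NH by blast
qed

section \<open>The energy as a measure on pairs of angles, and strong approximation\<close>

definition cm :: "(real \<times> real) measure" where
 "cm = density LL
  (%p. ind (TP \<times> TP) p * en (1 / csq (cis (fst p) - cis (snd p))))"

lemma sets_cm [simp, measurable_cong]: "sets cm = sets BB"
 by (simp add: cm_def cong: sets_pair_measure_cong)

lemma nn_integral_cm:
 assumes [measurable]: "f \<in> BM2"
 shows "(\<integral>\<^sup>+p. f p \<partial>cm) = (NL x. ind TP x * (NL y. ind TP y *
  (en (1 / csq (cis x - cis y)) * f (x, y))))"
proof -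
 have "(\<integral>\<^sup>+p. f p \<partial>cm) = (NL x. NL y. ind TP x * (ind TP y * (en (1 / csq (cis x - cis y)) * f (x, y))))"
  unfolding cm_def
  by (subst nn_integral_density, measurable, subst lborel.nn_integral_fst[symmetric]) (auto simp: indicator_times ac_simps)
 also have "... = (NL x. ind TP x * (NL y. ind TP y * (en (1 / csq (cis x - cis y)) * f (x, y))))"
  by (intro nn_integral_cong nn_integral_cmult) measurable
 finally show ?thesis .
qed

lemma NN_cm:
 assumes F: "per F"
 shows "NN F = (\<integral>\<^sup>+p. en (dsq F p) \<partial>cm)"
proof -
 note [measurable] = perD(1)[OF F]
 have "(NL y. ind TP y * (en (1 / csq (cis x - cis y)) * en (dsq F (x, y))))
  = (NL h. ind TP h * ed F x h)" for x
 proof -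
  define Q where "Q y = en (1 / csq (cis x - cis y)) * en (dsq F (x, y))" for y
  have [measurable]: "Q \<in> BM" unfolding Q_def by simp
  have "Q (y + 2 * pi) = Q y" for y using perD(2)[OF F] by (simp add: Q_def cis_mult[symmetric])
  hence "(NL y. ind TP y * Q y) = (NL y. ind {x..x + 2 * pi} y * Q y)"
   by (intro nn_integral_periodic[symmetric]) auto
  also have "... = (NL h. ind {x..x + 2 * pi} (x + h) * Q (x + h))"
   by (rule nn_integral_shift[symmetric]) measurable
  also have "... = (NL h. ind TP h * ed F x h)"
  proof (intro nn_integral_cong arg_cong2[where f="(*)"])
   fix h
   have "cis x - cis (x + h) = cis x * (1 - cis h)" by (simp add: cis_mult[symmetric] algebra_simps)
   hence "cmod (cis x - cis (x + h)) = cmod (1 - cis h)" by (simp add: norm_mult)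
   thus "Q (x + h) = ed F x h" by (simp add: Q_def ed_def ennreal_mult[symmetric] norm_minus_commute)
  qed (auto simp: ind_def)
  finally show ?thesis by (simp add: Q_def)
 qed
 thus ?thesis unfolding nd_def by (subst nn_integral_cm) simp_all
qed

lemma AE_cm:
 assumes "AE x in lborel. x \<in> TP --> P x"
 shows "AE p in cm. P (fst p) \<and> P (snd p)"
 unfolding cm_def using AE_lborel_pair[OF assms]
 by (subst AE_density) (auto simp: ind_def split: if_splits)

text \<open>In a Hilbert space, weak convergence together with convergence of norms is strong
  convergence. L2 convergence gives convergence almost everywhere along a subsequence, so the
  interaction of \<open>H k - F\<close> with \<open>F\<close> vanishes by
  \<open>weak_null_product\<close>; expanding the square and \<open>c ----> 1\<close> do the
  rest.\<close>

lemma strong_convergence: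
 assumes F: "umap F" and H: "!!k. umap (H k)" and c: "c ----> 1" "!!k. 0 <= c k" "!!k. c k <= 2"
  and N: "!!k. NN (H k) <= en (c k) * NN F" and l: "(%k. l2 (%t. H k t - F t)) ----> 0"
 shows "\<exists>r. strict_mono r \<and> (%k. NN (%t. H (r k) t - F t)) ----> 0"
proof -
 note [measurable] = umapD(4)[OF F] umapD(4)[OF H]
 let ?u = "%k x. ind TP x * csq (H k x - F x)"
 have le4: "csq (H k x - F x) <= 4" for k x
  using power_mono[OF norm_triangle_ineq4[of "H k x" "F x"], of 2] umapD(2)[OF F] umapD(2)[OF H] by simp
 have iu: "integrable lborel (?u k)" for k
  by (rule Bintegrable_bound[of lborel "%x. ind TP x * (4::real)"]) (simp, simp, simp add: ind_def le4)
 have "en (IL x. norm (?u k x)) = l2 (%t. H k t - F t)" for k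
  unfolding l2_def using iu[of k] by (subst nn_integral_eq_integral[symmetric]) (auto intro!: nn_integral_cong simp: ind_def)
 hence "(%k. en (IL x. norm (?u k x))) ----> en 0" using l by simp
 hence "(%k. (IL x. norm (?u k x))) ----> 0" by (subst (asm) tendsto_ennreal_iff) auto
 from tendsto_L1_AE_subseq[OF iu this] obtain r :: "nat => nat" where r: "strict_mono r" "AE x in lborel. (%n. ?u (r n) x) ----> 0" by blast
 have "AE x in lborel. x \<in> TP --> (%n. H (r n) x - F x) ----> 0"
  using r(2)
 proof eventually_elim
  case (elim x)
  show ?case
  proof
   assume x: "x \<in> TP"
   hence "(%n. csq (H (r n) x - F x)) ----> 0" using elim by simp
   from tendsto_real_sqrt[OF this] show "(%n. H (r n) x - F x) ----> 0" by (simp add: tendsto_norm_zero_iff)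
  qed
 qed
 from AE_cm[OF this] have lim: "AE p in cm. (%n. H (r n) (fst p) - F (fst p)) ----> 0 \<and> (%n. H (r n) (snd p) - F (snd p)) ----> 0" .
 define V where "V k = (%t. H (r k) t - F t)" for k
 have [measurable]: "V k \<in> BM" for k by (simp add: V_def)
 have pV: "per (V k)" for k unfolding V_def by (intro per_diff umapD F H)
 have ie: "integrable cm (dsq G) \<and> NN G = en (\<integral>p. dsq G p \<partial>cm)" if "per G" "NN G < \<infinity>" for G
 proof -
  have [measurable]: "G \<in> BM" using that perD by auto
  have "integrable cm (dsq G)" using that(2) unfolding NN_cm[OF that(1)] by (intro integrableI_bounded) auto
  thus ?thesis unfolding NN_cm[OF that(1)] by (auto intro!: nn_integral_eq_integral)
 qed
 note ieF = ie[OF umapD(1,3)[OF F]] and ieH = ie[OF umapD(1,3)[OF H]]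
 have "NN (V k) <= 2 * NN (H (r k)) + 2 * NN F" for k
 proof (rule nd_add_le)
  fix x h
  have "V k (x + h) - V k x = (H (r k) (x + h) - H (r k) x) - (F (x + h) - F x)" by (simp add: V_def)
  thus "cmod (V k (x + h) - V k x) <= cmod (H (r k) (x + h) - H (r k) x) + cmod (F (x + h) - F x)"
   using norm_triangle_ineq4 by metis
 qed auto
 moreover have "2 * NN (H (r k)) + 2 * NN F < \<infinity>" for k using umapD(3)[OF F] umapD(3)[OF H] by (simp add: ennreal_mult_less_top)
 ultimately have "NN (V k) < \<infinity>" for k by (rule le_less_trans)
 note ieV = ie[OF pV this]
 define n where "n = (\<integral>p. dsq F p \<partial>cm)"
 have n0: "0 <= n" unfolding n_def by simp
 let ?d = "%k. \<integral>p. dsq (H (r k)) p \<partial>cm"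
 have Hn: "?d k <= c (r k) * n" for k
  using N[of "r k"] ieF ieH[of "r k"] c(2)[of "r k"] n0 by (auto simp: n_def[symmetric] ennreal_mult[symmetric])
 let ?c = "%k. \<integral>p. dsq (V k) p \<partial>cm"
 let ?f = "%p. F (fst p) - F (snd p)"
 have Vn: "?c k <= 6 * n" for k
 proof -
  have "dsq (V k) p <= 2 * dsq (H (r k)) p + 2 * dsq F p" for p
  proof -
   have "V k (fst p) - V k (snd p) = (H (r k) (fst p) - H (r k) (snd p)) - ?f p" by (simp add: V_def)
   moreover have "csq (a - b) <= 2 * csq a + 2 * csq b" for a b
    using power_mono[OF norm_triangle_ineq4[of a b], of 2] sum_squares_bound[of "cmod a" "cmod b"] by (simp add: power2_sum)
   ultimately show ?thesis by simp
  qed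
  hence "?c k <= (\<integral>p. 2 * dsq (H (r k)) p + 2 * dsq F p \<partial>cm)"
   using ieV[of k] ieF ieH[of "r k"] by (intro integral_mono) auto
  also have "... = 2 * ?d k + 2 * n" using ieF ieH[of "r k"] by (simp add: n_def)
  also have "... <= 6 * n" using Hn[of k] mult_right_mono[OF c(3) n0, of "r k"] by simp
  finally show ?thesis .
 qed
 have w: "(%k. \<integral>p. abs (cmod (V k (fst p) - V k (snd p)) * cmod (?f p)) \<partial>cm) ----> 0"
 proof (rule weak_null_product[OF _ _ _ Vn])
  show "AE p in cm. (%k. cmod (V k (fst p) - V k (snd p))) ----> 0"
   using lim by eventually_elim (use tendsto_diff in \<open>fastforce simp: V_def intro!: tendsto_norm_zero\<close>)
 qed (use ieV ieF in auto)
 let ?a = "%k. \<integral>p. abs (cmod (V k (fst p) - V k (snd p)) * cmod (?f p)) \<partial>cm"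
 have le: "?c k <= (c (r k) - 1) * n + 2 * ?a k" for k
 proof -
  let ?b = "%p. abs (cmod (V k (fst p) - V k (snd p)) * cmod (?f p))"
  have ib: "integrable cm ?b" using ieV[of k] ieF by (intro integrable_abs integrable_prod_of_squares) auto
  have "dsq (V k) p <= dsq (H (r k)) p - dsq F p + 2 * ?b p" for p
  proof -
   define a b where "a = V k (fst p) - V k (snd p)" and "b = F (fst p) - F (snd p)"
   have e: "H (r k) (fst p) - H (r k) (snd p) = a + b" by (simp add: a_def b_def V_def)
   have "csq (a + b) = csq a + csq b + 2 * (a \<bullet> b)" by (simp add: power2_norm_eq_inner inner_add inner_commute)
   moreover have "abs (a \<bullet> b) <= abs (cmod a * cmod b)" using Cauchy_Schwarz_ineq2[of a b] by simp
   ultimately show ?thesis unfolding a_def[symmetric] b_def[symmetric] e by linarith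
  qed
  hence "?c k <= (\<integral>p. dsq (H (r k)) p - dsq F p + 2 * ?b p \<partial>cm)"
   using ieV[of k] ieF ieH[of "r k"] ib by (intro integral_mono) auto
  also have "... = ?d k - n + 2 * (\<integral>p. ?b p \<partial>cm)" using ieF ieH[of "r k"] ib by (simp add: n_def)
  also have "... <= (c (r k) - 1) * n + 2 * (\<integral>p. ?b p \<partial>cm)" using Hn[of k] by (simp add: algebra_simps)
  finally show ?thesis .
 qed
 let ?e = "%k. (c (r k) - 1) * n + 2 * ?a k"
 have "?e ----> (1 - 1) * n + 2 * 0"
  by (intro tendsto_intros w LIMSEQ_subseq_LIMSEQ[OF c(1) r(1), unfolded o_def])
 hence "?e ----> 0" by simp
 hence "(%k. \<integral>p. dsq (V k) p \<partial>cm) ----> 0"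
  by (rule tendsto_sandwich[OF always_eventually always_eventually tendsto_const, rotated 2]) (use le in auto)
 hence "(%k. en (?c k)) ----> en 0" by (rule tendsto_ennrealI)
 thus ?thesis using r(1) ieV by (auto simp: V_def)
qed

lemma strong_smooth_approximation:
 assumes F: "umap F" and d: "hasdeg F d"
 obtains H where "!!k::nat. umap (H k)" "!!k. H k C1_differentiable_on UNIV" "!!k. wlift (H k) d"
  "(%k. NN (%t. H k t - F t)) ----> 0" "(%k. l2 (%t. H k t - F t)) ----> 0"
proof -
 \<comment> \<open>The offset \<open>4\<close> keeps \<open>e k\<close> in the range allowed by
   \<open>smooth_approximation\<close> from the start.\<close>
 define e where "e k = 1 / (real k + 4)" for k :: nat
 have e: "0 < e k" "e k <= 1 / 4" for k unfolding e_def by (auto simp: field_simps)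
 have e0: "e ----> 0" unfolding e_def by real_asymp
 from smooth_approximation[OF F d e] obtain H where H: "!!k. umap (H k)" "!!k. H k C1_differentiable_on UNIV" "!!k. wlift (H k) d"
  "!!k. NN (H k) <= en (1 / (1 - e k)^2) * NN F" "!!k. l2 (%t. H k t - F t) <= en (5 * e k)" by metis
 have l0: "(%k. l2 (%t. H k t - F t)) ----> 0"
 proof (rule tendsto_sandwich[OF _ _ tendsto_const])
  show "(%k. en (5 * e k)) ----> 0" using tendsto_ennrealI[OF tendsto_mult[OF tendsto_const[of 5] e0]] by simp
 qed (use H(5) in auto)
 have "(%k. 1 / (1 - e k)^2) ----> 1 / (1 - 0)^2" by (intro tendsto_intros e0) simp
 moreover have "1 / (1 - e k)^2 <= 2" for k
 proof -
  have "(3 / 4)^2 <= (1 - e k)^2" using e[of k] by (intro power_mono) auto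
  hence "1 / (1 - e k)^2 <= 1 / (3 / 4)^2" using e[of k] by (intro divide_left_mono) auto
  thus ?thesis by (simp add: sq_eq)
 qed
 ultimately obtain r where r: "strict_mono r" "(%k. NN (%t. H (r k) t - F t)) ----> 0"
  using strong_convergence[OF F H(1) _ _ _ H(4) l0] by auto
 show ?thesis
  by (rule that[of "%k. H (r k)"]) (use H r LIMSEQ_subseq_LIMSEQ[OF l0 r(1)] in \<open>auto simp: o_def\<close>)
qed

subsection \<open>Lower bound of the energy by the degree\<close>

definition arcm :: "real measure" where
 "arcm = density lborel (%x. en (ind TP x))"

abbreviation IAb :: "(real => 'b::{banach,second_countable_topology}) => 'b" (binder "IA " 10) where "IAb f \<equiv> integral\<^sup>L arcm f"
abbreviation IPb :: "(real \<times> real => 'b::{banach,second_countable_topology}) => 'b" (binder "IP " 10) where "IPb f \<equiv> integral\<^sup>L (arcm \<Otimes>\<^sub>M arcm) f"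

lemma sets_arc [simp, measurable_cong]: "sets arcm = sets borel"
 by (simp add: arcm_def)

lemma space_arc [simp]: "space arcm = UNIV"
 by (simp add: arcm_def)

lemma emeasure_arcm: "emeasure arcm UNIV = en (2 * pi)"
proof -
 have "emeasure arcm UNIV = (NL x. ind TP x * ind UNIV x)"
  unfolding arcm_def ennreal_indicator by (rule emeasure_density) auto
 also have "... = em TP" unfolding nn_integral_indicator[symmetric, OF sets_lborel[THEN equalityD2, THEN subsetD, OF borel_closed[OF closed_atLeastAtMost]]]
  by (rule nn_integral_cong) (simp only: indicator_UNIV mult_1_right)
 finally show ?thesis by simp
qed

lemma measure_arcm [simp]: "measure arcm UNIV = 2 * pi"
 by (simp add: measure_def emeasure_arcm)

lemma finite_measure_arcm: "finite_measure arcm"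
 by (intro finite_measureI) (simp add: emeasure_arcm)

interpretation arcm: finite_measure arcm by (rule finite_measure_arcm)

interpretation arc2: pair_sigma_finite arcm arcm ..

lemma arc_pair: "arcm \<Otimes>\<^sub>M arcm = density LL (%p. en (ind (TP \<times> TP) p))"
proof -
 have "arcm \<Otimes>\<^sub>M arcm = density LL (%(x, y). en (ind TP x) * en (ind TP y))"
  using arcm.sigma_finite_measure unfolding arcm_def by (intro pair_measure_density) (auto intro: sigma_finite_lborel)
 also have "... = density LL (%p. en (ind (TP \<times> TP) p))"
  by (intro density_cong) (auto simp: ind_def)
 finally show ?thesis .
qed

interpretation arcp: finite_measure "arcm \<Otimes>\<^sub>M arcm"
 by (intro finite_measureI)
  (simp add: space_pair_measure arcm.emeasure_pair_measure_Times[of UNIV arcm UNIV, simplified] emeasure_arcm ennreal_mult_eq_top_iff)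

lemma AE_arcI: "(!!x. x \<in> TP ==> P x) ==> AE x in arcm. P x"
 unfolding arcm_def by (subst AE_density) (auto simp: ind_def)

lemma AE_arc_pairI:
 assumes "!!x y. x \<in> TP ==> y \<in> TP ==> P (x, y)"
 shows "AE p in arcm \<Otimes>\<^sub>M arcm. P p"
 unfolding arc_pair using assms by (subst AE_density) (auto simp: ind_def)

lemma integrable_arc:
 fixes f :: "real => complex"
 assumes "f \<in> BM" "!!x. x \<in> TP ==> cmod (f x) <= B"
 shows "integrable arcm f"
 using assms by (intro arcm.integrable_const_bound[of _ B] AE_arcI) auto

lemma integrable_arc_pair:
 fixes f :: "real \<times> real => complex"
 assumes "f \<in> BM2" "!!x y. x \<in> TP ==> y \<in> TP ==> cmod (f (x, y)) <= B"
 shows "integrable (arcm \<Otimes>\<^sub>M arcm) f"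
 using assms by (intro arcp.integrable_const_bound[of _ B] AE_arc_pairI) (auto cong: measurable_cong_sets sets_pair_measure_cong)

lemma integral_arc_FTC:
 fixes G :: "real => complex"
 assumes "!!t. (G has_vector_derivative D t) (at t)" "continuous_on UNIV D"
 shows "(IA t. D t) = G (2 * pi) - G 0"
proof -
 have [measurable]: "D \<in> BM" by (rule borel_cont[OF assms(2)])
 have "(IA t. D t) = (IL t. ind TP t *\<^sub>R D t)"
  unfolding arcm_def by (subst integral_density) auto
 also have "... = G (2 * pi) - G 0"
  using assms by (intro integral_FTC_atLeastAtMost) (auto intro: has_vector_derivative_at_within continuous_on_subset)
 finally show ?thesis .
qed

lemma integral_arc_product:
 fixes f g :: "real => complex"
 assumes [measurable]: "f \<in> BM" "g \<in> BM"
  and B: "!!x. x \<in> TP ==> cmod (f x) <= B" "!!x. x \<in> TP ==> cmod (g x) <= B"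
 shows "(IP p. f (fst p) * g (snd p)) = (IA x. f x) * (IA x. g x)"
proof -
 have "integrable (arcm \<Otimes>\<^sub>M arcm) (%p. f (fst p) * g (snd p))"
 proof (rule integrable_arc_pair[of _ "B * B"])
  fix x y :: real assume "x \<in> TP" "y \<in> TP"
  thus "cmod (f (fst (x, y)) * g (snd (x, y))) <= B * B"
   using B(1)[of x] B(2)[of y] order_trans[OF norm_ge_zero B(1)[of x]] by (auto simp: norm_mult intro!: mult_mono)
 qed measurable
 from arc2.integral_fst'[OF this] show ?thesis by simp
qed

text \<open>The kernel depends on the difference of the angles only, so each power separates into a
  product of two Fourier coefficients; absolute summability permits integration term by
  term.\<close>

lemma arc_series:
 fixes X Y :: "real => complex" and c :: "nat => complex"
 assumes [measurable]: "X \<in> BM" "Y \<in> BM"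
  and B: "!!x. x \<in> TP ==> cmod (X x) <= B" "!!x. x \<in> TP ==> cmod (Y x) <= B"
  and r: "0 <= r" and c: "summable (%n. cmod (c n) * r ^ n)"
  and K: "!!p. (%n. c n * (of_real r * cis (fst p - snd p)) ^ n) sums K p"
 shows "(%n. c n * of_real (r ^ n) * ((IA s. X s * cis (real n * s)) * (IA t. Y t * cis (- real n * t))))
  sums (IP p. X (fst p) * Y (snd p) * K p)"
proof -
 define f where "f n p = X (fst p) * Y (snd p) * (c n * (of_real r * cis (fst p - snd p)) ^ n)" for n p
 have [measurable]: "f n \<in> BM2" for n unfolding f_def by measurable
 have B0: "0 <= B" using order_trans[OF norm_ge_zero B(1)[of 0]] by simp
 let ?b = "%n. cmod (c n) * r ^ n"
 have fb: "cmod (f n (x, y)) <= B * B * ?b n" if "x \<in> TP" "y \<in> TP" for n x y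
  using B(1)[OF that(1)] B(2)[OF that(2)] B0 r
  by (auto simp: f_def norm_mult norm_power intro!: mult_mono)
 let ?a = "arcm \<Otimes>\<^sub>M arcm"
 have fi: "integrable ?a (f n)" for n by (rule integrable_arc_pair, simp, rule fb)
 have s: "summable (%n. B * B * ?b n)" using c by (rule summable_mult)
 have "(%n. integral\<^sup>L ?a (f n)) sums (IP p. (\<Sum>n. f n p))"
 proof (rule sums_integral[OF fi])
  show "AE p in arcm \<Otimes>\<^sub>M arcm. summable (%n. norm (f n p))"
   by (rule AE_arc_pairI) (rule summable_comparison_test'[OF s], use fb in auto)
  show "summable (%n. (IP p. norm (f n p)))"
  proof (rule summable_comparison_test'[where N=0])
   show "summable (%n. measure ?a (space ?a) * (B * B * ?b n))" by (rule summable_mult[OF s])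
   fix n
   have "(IP p. norm (f n p)) <= (IP p. B * B * ?b n)"
    by (intro integral_mono_AE integrable_norm fi AE_arc_pairI fb) auto
   thus "norm (IP p. norm (f n p)) <= measure ?a (space ?a) * (B * B * ?b n)"
    by simp
  qed
 qed
 moreover have "(\<Sum>n. f n p) = X (fst p) * Y (snd p) * K p" for p
  using sums_mult[OF K[of p], of "X (fst p) * Y (snd p)"] by (simp add: f_def sums_iff)
 moreover have "integral\<^sup>L ?a (f n) = c n * of_real (r ^ n) * ((IA s. X s * cis (real n * s)) * (IA t. Y t * cis (- real n * t)))" for n
 proof -
  have fn: "f n p = c n * of_real (r ^ n) * ((X (fst p) * cis (real n * fst p)) * (Y (snd p) * cis (- real n * snd p)))" for p
   by (simp add: f_def power_mult_distrib Complex.DeMoivre cis_mult right_diff_distrib)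
  have "(IP p. (X (fst p) * cis (real n * fst p)) * (Y (snd p) * cis (- real n * snd p)))
   = (IA s. X s * cis (real n * s)) * (IA t. Y t * cis (- real n * t))"
   by (rule integral_arc_product[where B=B]) (use B in \<open>auto simp: norm_mult\<close>)
  thus ?thesis unfolding fn by (simp only: integral_mult_right_zero)
 qed
 ultimately show ?thesis by simp
qed

lemma cis_has_derivative: "((%t. cis (a * t)) has_vector_derivative \<i> * of_real a * cis (a * t)) (at t)"
proof -
 have "((%t. \<i> * of_real (a * t)) has_vector_derivative \<i> * of_real a) (at t)"
  by (auto intro!: derivative_eq_intros has_vector_derivative_mult_right has_vector_derivative_of_real)
 from field_vector_diff_chain_at[OF this DERIV_exp] show ?thesis by (simp add: o_def cis_conv_exp)
qed

lemma integral_arc_cis: "(IA t. cis (real n * t)) = (if n = 0 then of_real (2 * pi) else 0)"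
proof (cases "n = 0")
 case True
 thus ?thesis by (simp add: scaleR_conv_of_real)
next
 case False
 from integral_arc_FTC[OF cis_has_derivative, of "real n"] have "\<i> * of_real (real n) * (IA t. cis (real n * t)) = cis (real n * (2 * pi)) - 1"
  by (simp add: continuous_intros)
 moreover have "cis (real n * (2 * pi)) = 1" using cis_multiple_2pi[of "real n"] by (simp add: mult.commute mult.left_commute)
 ultimately show ?thesis using False by simp
qed

text \<open>A primitive \<open>P\<close> of \<open>cnj H * D\<close> satisfies
  \<open>H = c * exp P\<close>, so it is a logarithm of \<open>H\<close> up to a constant, and its
  increment is that of any continuous logarithm.\<close>

lemma C1_winding_integral:
 assumes D: "!!t. (H has_vector_derivative D t) (at t)" and Dc: "continuous_on UNIV D"
  and H1: "!!t. cmod (H t) = 1" and w: "wlift H d"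
 shows "(IA t. cnj (H t) * D t) = 2 * of_real pi * \<i> * of_int d"
proof -
 have Hc: "continuous_on UNIV H" using D by (intro continuous_at_imp_continuous_on) (auto intro: has_vector_derivative_continuous)
 have "\<exists>P. \<forall>x::real. - \<infinity> < ereal x --> ereal x < \<infinity> --> (P has_vector_derivative cnj (H x) * D x) (at x)"
  by (rule einterval_antiderivative) (use Hc Dc in \<open>auto simp: continuous_on_eq_continuous_at intro!: continuous_intros\<close>)
 then obtain P where P: "!!x. (P has_vector_derivative cnj (H x) * D x) (at x)" by auto
 have HH: "H t * cnj (H t) = 1" for t using H1[of t] by (simp add: complex_norm_square[symmetric])
 have e: "H t * (cnj (H t) * z) = z" for t z using HH[of t] by (simp add: mult.assoc[symmetric])
 have "((%t. H t * exp (- P t)) has_vector_derivative 0) (at t within UNIV)" for t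
 proof -
  have "((%t. exp (- P t)) has_vector_derivative (- (cnj (H t) * D t)) * exp (- P t)) (at t)"
   using field_vector_diff_chain_at[OF has_vector_derivative_minus[OF P[of t]] DERIV_exp] by (simp add: o_def)
  from has_vector_derivative_mult[OF D[of t] this] show ?thesis using e[of t] by (simp add: algebra_simps)
 qed
 then obtain c where "!!t. H t * exp (- P t) = c" using has_vector_derivative_zero_constant[of UNIV "%t. H t * exp (- P t)"] by auto
 hence c: "H t = c * exp (P t)" for t by (metis exp_minus_inverse mult.assoc mult.commute mult.right_neutral)
 have "c ~= 0" using H1[of 0] c[of 0] by auto
 obtain L where L: "continuous_on TP L" "!!t. t \<in> TP ==> H t = exp (L t)" "L (2*pi) - L 0 = 2 * of_real pi * \<i> * of_int d"
  using w unfolding wlift_def by blast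
 have "(%t. L t - (P t + ln c)) constant_on TP"
 proof (rule continuous_log_diff_constant)
  show "continuous_on TP (%t. P t + ln c)" using P by (intro continuous_intros continuous_at_imp_continuous_on) (auto intro: has_vector_derivative_continuous)
  show "exp (L t) = exp (P t + ln c)" if "t \<in> TP" for t using L(2)[OF that] c[of t] \<open>c \<noteq> 0\<close> by (simp add: exp_add mult.commute)
 qed (use L in auto)
 hence "L (2 * pi) - (P (2 * pi) + ln c) = L 0 - (P 0 + ln c)" unfolding constant_on_def by (metis atLeastAtMost_iff order_refl pi_ge_zero mult_nonneg_nonneg zero_le_numeral)
 hence "P (2 * pi) - P 0 = L (2 * pi) - L 0" by (simp add: algebra_simps)
 thus ?thesis using integral_arc_FTC[OF P] Hc Dc L(3) by (simp add: continuous_intros)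
qed

lemma kappa_series:
 fixes z :: complex
 assumes "cmod z < 1"
 shows "(%n. of_nat n * z ^ n) sums (z / (1 - z)^2)"
proof -
 have "(%n. of_nat (Suc n) * z ^ Suc n) sums (z / (1 - z)^2)"
  using sums_mult[OF geometric_deriv_sums[OF assms], of z] by (simp add: algebra_simps)
 thus ?thesis using sums_Suc_iff[of "%n. of_nat n * z ^ n"] by simp
qed

text \<open>The difference of the two sides is exactly \<open>(1 - r)^2\<close>. This dominates the
  regularized kernels by the singular weight of the energy, up to a factor
  \<open>1 / r\<close>.\<close>

lemma one_minus_rcis_lower:
 assumes "0 <= r"
 shows "r * csq (1 - cis t) <= csq (1 - of_real r * cis t)"
proof -
 have sc: "(sin t)^2 = 1 - (cos t)^2" by (simp add: sin_squared_eq)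
 have "csq (1 - of_real r * cis t) = (1 - r)^2 + r * csq (1 - cis t)"
  unfolding cmod_power2 by (simp add: power_mult_distrib sc) (simp add: sq_eq algebra_simps)
 thus ?thesis by simp
qed

lemma kernel_le:
 assumes r: "0 < r" "0 <= c" and ne: "cis x ~= cis y"
 shows "c / csq (1 - of_real r * cis (x - y)) <= c / r / csq (cis x - cis y)"
proof -
 have "cis x - cis y = - cis y * (1 - cis (x - y))" by (simp add: algebra_simps cis_mult)
 hence 1: "cmod (cis x - cis y) = cmod (1 - cis (x - y))" by (simp add: norm_mult)
 let ?a = "cmod (1 - of_real r * cis (x - y))"
 have p: "0 < r * csq (cis x - cis y)" using r ne by simp
 hence "0 < ?a^2" using one_minus_rcis_lower[of r "x - y"] r unfolding 1 by linarith
 hence "c / ?a^2 <= c / (r * csq (cis x - cis y))"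
  using p one_minus_rcis_lower[of r "x - y"] r unfolding 1 by (intro divide_left_mono mult_pos_pos) auto
 thus ?thesis by simp
qed

lemma cis_eq_imp_per_eq:
 assumes "cis s = cis t" "per H" shows "H s = H t"
proof -
 have "sin s = sin t \<and> cos s = cos t" using assms(1) by (simp add: complex_eq_iff)
 then obtain n :: int where "s = t + 2 * pi * of_int n" using sin_cos_eq_iff[of s t] by (auto simp: mult_ac)
 thus ?thesis using periodic_int[of H t n] perD(2)[OF assms(2)] by simp
qed

text \<open>Where \<open>cis x = cis y\<close> nothing is known about \<open>w\<close>, but there
  periodicity makes \<open>dsq H\<close> vanish.\<close>

lemma energy_ge_weighted:
 assumes H: "per H" and N: "NN H = en N" "0 <= N"
  and w: "w \<in> BM2" "0 <= C"
  and wle: "!!x y. cis x ~= cis y ==> (abs (w (x, y))) <= C / csq (cis x - cis y)"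
 shows "integrable (arcm \<Otimes>\<^sub>M arcm) (%p. dsq H p * w p)" "(IP p. dsq H p * abs (w p)) <= C * N"
proof -
 note [measurable] = perD(1)[OF H] w(1)
 have le: "dsq H (x, y) * abs (w (x, y)) <= C * (1 / csq (cis x - cis y) * dsq H (x, y))" for x y
 proof (cases "cis x = cis y")
  case True
  thus ?thesis using cis_eq_imp_per_eq[OF True H] by simp
 next
  case False
  show ?thesis using mult_left_mono[OF wle[OF False], of "dsq H (x, y)"] by (simp add: mult.commute)
 qed
 let ?c = "TP \<times> TP"
 let ?a = "%p. ind ?c p * en (1 / csq (cis (fst p) - cis (snd p))) * en (dsq H p)"
 let ?d = "arcm \<Otimes>\<^sub>M arcm"
 let ?e = "%p. dsq H p * abs (w p)"
 let ?b = "\<integral>\<^sup>+p. en (?e p) \<partial>?d"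
 have "?b = (NP p. en (ind ?c p) * en (?e p))"
  unfolding arc_pair by (rule nn_integral_density) measurable
 also have "... <= (NP p. en C * ?a p)"
 proof (rule nn_integral_mono)
  fix p :: "real \<times> real"
  show "en (ind ?c p) * en (?e p) <= en C * ?a p"
   using le[of "fst p" "snd p"] w(2) by (auto simp: ind_def ennreal_mult[symmetric] intro!: ennreal_leI)
 qed
 also have "... = en C * (\<integral>\<^sup>+p. en (dsq H p) \<partial>cm)"
  unfolding cm_def by (subst nn_integral_cmult, measurable, subst nn_integral_density) auto
 also have "... = en (C * N)" using N w(2) by (simp add: NN_cm[OF H, symmetric] ennreal_mult)
 finally have *: "?b <= en (C * N)" .
 thus i: "integrable ?d (%p. dsq H p * w p)"
  by (intro integrableI_bounded) (auto simp: abs_mult intro: le_less_trans cong: measurable_cong_sets sets_pair_measure_cong)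
 have "integrable ?d (%p. dsq H p * abs (w p))" using integrable_abs[OF i] by (simp add: abs_mult)
 from nn_integral_eq_integral[OF this] * show "(IP p. dsq H p * abs (w p)) <= C * N"
  using N w(2) by simp
qed

text \<open>With \<open>K z = z / (1 - z)\<^sup>2\<close> the Fourier series of \<open>H\<close> gives \<open>\<integral>\<integral> H(s) cnj H(t) K(r cis(s - t)) \<ge> 0\<close>, which dominates the Poisson average of \<open>D(s) cnj H(t)\<close>. As \<open>r\<close> tends to \<open>1\<close> the latter concentrates on the diagonal and yields the winding integral.\<close>
lemma energy_lower_bound_C1:
 assumes U: "umap H" and C1: "H C1_differentiable_on UNIV" and w: "wlift H d"
 shows "en (4 * pi^2 * abs (of_int d)) <= NN H"
proof -
 obtain D where D: "!!t. (H has_vector_derivative D t) (at t)" and Dc: "continuous_on UNIV D"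
  using C1 unfolding C1_differentiable_on_def by auto
 note m = umapD[OF U]
 have Hc: "continuous_on UNIV H" using D by (intro continuous_at_imp_continuous_on) (auto intro: has_vector_derivative_continuous)
 have [measurable]: "H \<in> BM" "D \<in> BM" by (rule m, rule borel_cont[OF Dc])
 have H2: "H (2 * pi) = H 0" using perD(3)[OF m(1)] .
 obtain N where N: "NN H = en N" "0 <= N" using m(3) by (cases "NN H") auto
 have "compact (D ` TP)" by (intro compact_continuous_image continuous_on_subset[OF Dc]) auto
 then obtain B where B: "1 <= B" "!!t. t \<in> TP ==> cmod (D t) <= B"
  using compact_imp_bounded bounded_iff[of "D ` TP"] by (metis imageI max.cobounded1 max.coboundedI2)
 let ?M = "arcm \<Otimes>\<^sub>M arcm"
 define Z where "Z r p = of_real r * cis (fst p - snd p)" for r and p :: "real \<times> real"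
 have [measurable]: "Z r \<in> BM2" for r unfolding Z_def by measurable
 define P where "P r p = (1 - r^2) / csq (1 - Z r p)" for r p
 define b where "b H n = (IA t. H t * cis (real n * t))" for H n
 let ?a = "%r. sqrt (1 - r^2) / (2 * r) * N + sqrt (1 - r^2) * 2 * pi^2"
 have main: "4 * pi^2 * abs (of_int d) <= N + B * ?a r" if r: "0 < r" "r < 1" for r
 proof -
  have z: "cmod (Z r p) = r" for p using r by (simp add: Z_def norm_mult)
  have z1: "1 - r <= cmod (1 - Z r p)" "1 - Z r p ~= 0" for p using norm_triangle_ineq2[of 1 "Z r p"] z[of p] r by auto
  define K where "K p = Z r p / (1 - Z r p)^2" for p
  define Q where "Q p = 1 / (1 - Z r p)" for p
  have [measurable]: "K \<in> BM2" "Q \<in> BM2" "P r \<in> BM2"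
   unfolding K_def Q_def P_def by measurable
  have Qb: "cmod (Q p) <= 1 / (1 - r)" for p unfolding Q_def norm_divide using z1[of p] r by (auto intro!: divide_left_mono)
  have sk: "summable (%n. cmod (of_nat n) * r ^ n)" using kappa_series[of "of_real r"] r
   by (auto simp: sums_iff norm_mult norm_power dest!: summable_Re)
  have sq: "summable (%n. cmod 1 * r ^ n)" using r by simp
  have K: "(%n. of_nat n * (of_real r * cis (fst p - snd p)) ^ n) sums K p" for p
   using kappa_series[of "Z r p"] z[of p] r by (simp add: K_def Z_def)
  have Q: "(%n. 1 * (of_real r * cis (fst p - snd p)) ^ n) sums Q p" for p
   using geometric_sums[of "Z r p"] z[of p] r by (simp add: Q_def Z_def)
  note series = arc_series[OF _ _ _ _ less_imp_le[OF r(1)]]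
  \<comment> \<open>Integration by parts gives the coefficients of the derivative as
    \<open>- \<i> * n\<close> times those of the map, which matches the coefficients
    \<open>1\<close> of \<open>Q\<close> with the \<open>n\<close> of \<open>K\<close>; positivity
    holds because the series has the terms \<open>n * r ^ n * csq (b H n)\<close>. The claim is made
    for a general map because it is applied to \<open>cnj H\<close> too, which supplies the opposite
    frequencies.\<close>
  have QK: "(IP p. D (fst p) * cnj (H (snd p)) * Q p) = - \<i> * (IP p. H (fst p) * cnj (H (snd p)) * K p) \<and>
    0 <= Re (IP p. H (fst p) * cnj (H (snd p)) * K p) \<and> Im (IP p. H (fst p) * cnj (H (snd p)) * K p) = 0"
   if [measurable]: "H \<in> BM" "D \<in> BM" and D: "!!t. (H has_vector_derivative D t) (at t)" "continuous_on UNIV D"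
    "H (2 * pi) = H 0" "!!t. cmod (H t) = 1" "!!t. t \<in> TP ==> cmod (D t) <= B" for H D :: "real => complex"
  proof -
   have c: "(IA t. cnj (H t) * cis (- real n * t)) = cnj (b H n)" for n
    unfolding b_def using Bintegral_cnj[of arcm "%t. H t * cis (real n * t)"] by (simp add: cis_cnj del: Bintegral_cnj)
   have "b D n = - \<i> * (of_nat n * b H n)" for n
   proof -
    have e: "((%t. cis (real n * t)) has_vector_derivative \<i> * of_real (real n) * cis (real n * t)) (at t)" for t by (rule cis_has_derivative)
    have Hc: "continuous_on UNIV H" using D by (intro continuous_at_imp_continuous_on) (auto intro: has_vector_derivative_continuous)
    let ?e = "IA t. H t * (\<i> * of_real (real n) * cis (real n * t)) + D t * cis (real n * t)"
    have "?e = H (2 * pi) * cis (real n * (2 * pi)) - H 0 * cis (real n * 0)"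
     using has_vector_derivative_mult[OF D(1) e] by (rule integral_arc_FTC) (intro continuous_intros Hc D(2))
    also have "cis (real n * (2 * pi)) = 1" using cis_multiple_2pi[of "real n"] by (simp add: mult.commute mult.left_commute)
    also have "?e = (IA t. \<i> * of_nat n * (H t * cis (real n * t)) + D t * cis (real n * t))"
     by (simp add: ac_simps)
    also have "... = \<i> * of_nat n * b H n + b D n" unfolding b_def
    proof (subst Bintegral_add)
     have "integrable arcm (%t. H t * cis (real n * t))" by (rule integrable_arc[where B=1]) (auto simp: norm_mult D)
     thus "integrable arcm (%t. \<i> * of_nat n * (H t * cis (real n * t)))" by (rule integrable_mult_right)
     show "integrable arcm (%t. D t * cis (real n * t))" by (rule integrable_arc[where B=B]) (auto simp: norm_mult D)
    qed simp
    finally show ?thesis using D(3) by (simp add: add_eq_0_iff algebra_simps)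
   qed
   hence bb: "b D n * cnj (b H n) = - \<i> * (of_nat n * (b H n * cnj (b H n)))" for n by simp
   have s1: "(%n. of_nat n * of_real (r ^ n) * (b H n * cnj (b H n))) sums (IP p. H (fst p) * cnj (H (snd p)) * K p)"
    using series[OF _ _ _ _ sk K, of H "%t. cnj (H t)" 1, unfolded c, folded b_def] D(4) by simp
   let ?g = "%n. 1 * of_real (r ^ n) * (b D n * cnj (b H n))"
   have s2: "?g sums (IP p. D (fst p) * cnj (H (snd p)) * Q p)"
    using series[OF _ _ _ _ sq Q, of D "%t. cnj (H t)" B, unfolded c, folded b_def] D(4,5) B(1) by simp
   have "?g sums (- \<i> * (IP p. H (fst p) * cnj (H (snd p)) * K p))"
    unfolding bb using sums_mult[OF s1, of "- \<i>"] by (simp add: ac_simps)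
   from sums_unique2[OF s2 this] have 1: "(IP p. D (fst p) * cnj (H (snd p)) * Q p) = - \<i> * (IP p. H (fst p) * cnj (H (snd p)) * K p)" .
   have "of_nat n * of_real (r ^ n) * (b H n * cnj (b H n)) = of_real (real n * r ^ n * csq (b H n))" for n
    by (simp only: complex_norm_square of_real_mult of_real_of_nat_eq)
   hence s3: "(%n. of_real (real n * r ^ n * csq (b H n))) sums (IP p. H (fst p) * cnj (H (snd p)) * K p)" using s1 by (simp only:)
   have "0 <= Re (IP p. H (fst p) * cnj (H (snd p)) * K p)" using sums_Re[OF s3] by (rule sums_le[OF _ sums_zero, rotated]) (use r in auto)
   moreover have "Im (IP p. H (fst p) * cnj (H (snd p)) * K p) = 0" using sums_unique2[OF sums_Im[OF s3], of 0] by simp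
   ultimately show ?thesis using 1 by blast
  qed
  \<comment> \<open>The Poisson kernel split into its analytic and antianalytic halves; the first is
    treated through \<open>H\<close>, the second through \<open>cnj H\<close>.\<close>
  have P_eq: "complex_of_real (P r p) = Q p + cnj (Q p) - 1" for p
  proof -
   have "complex_of_real (1 - r^2) = (1 - cnj (Z r p)) + (1 - Z r p) - (1 - Z r p) * (1 - cnj (Z r p))"
    using z[of p] by (simp add: algebra_simps complex_norm_square[symmetric])
   moreover have "complex_of_real (csq (1 - Z r p)) = (1 - Z r p) * (1 - cnj (Z r p))" using complex_norm_square[of "1 - Z r p"] by simp
   moreover have "1 - cnj (Z r p) ~= 0" using z1(2)[of p] by (metis complex_cnj_cnj complex_cnj_diff complex_cnj_one complex_cnj_zero)
   ultimately show ?thesis using z1(2)[of p] unfolding P_def Q_def of_real_divide by (simp add: divide_simps)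
  qed
  have B2: "a <= 2 * B" if "a <= B" for a using that B(1) by linarith
  have P0: "0 <= P r p" for p using r by (simp add: P_def power_le_one)
  have iQ: "integrable ?M (%p. F p * Q p)" "integrable ?M (%p. F p * cnj (Q p))" "integrable ?M F"
   if [measurable]: "F \<in> BM2" and F: "!!x y. x \<in> TP ==> y \<in> TP ==> cmod (F (x, y)) <= 2 * B" for F
  proof -
   have "cmod (F (x, y) * Q (x, y)) <= 2 * B * (1 / (1 - r))" if "x \<in> TP" "y \<in> TP" for x y
    unfolding norm_mult using F[OF that] Qb[of "(x, y)"] B(1) by (intro mult_mono) auto
   thus "integrable ?M (%p. F p * Q p)" "integrable ?M (%p. F p * cnj (Q p))"
    by (auto intro!: integrable_arc_pair[where B="2 * B * (1 / (1 - r))"] simp: norm_mult)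
   show "integrable ?M F" using that by (rule integrable_arc_pair)
  qed
  have split: "(IP p. F p * of_real (P r p)) = (IP p. F p * Q p) + (IP p. F p * cnj (Q p)) - (IP p. F p)" "integrable ?M (%p. F p * of_real (P r p))"
   if F: "F \<in> BM2" "!!x y. x \<in> TP ==> y \<in> TP ==> cmod (F (x, y)) <= 2 * B" for F
   using iQ[OF F] unfolding P_eq by (simp_all add: algebra_simps)
  have XP: "(IP p. X (fst p) * of_real (P r p)) = of_real (2 * pi) * (IA t. X t)"
   if [measurable]: "X \<in> BM" and X: "!!x. x \<in> TP ==> cmod (X x) <= B" for X
  proof -
   have 1: "(IP p. Y (fst p) * Q p) = of_real (2 * pi) * (IA t. Y t)"
    if [measurable]: "Y \<in> BM" and Y: "!!x. x \<in> TP ==> cmod (Y x) <= B" for Y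
   proof -
    let ?f = "%n. if n = 0 then of_real (2 * pi) else 0"
    have c: "(IA t. 1 * cis (- real n * t)) = ?f n" for n
     using arg_cong[OF integral_arc_cis[of n], of cnj] Bintegral_cnj[of arcm "%t. cis (real n * t)"] by (simp add: cis_cnj del: Bintegral_cnj split: if_splits)
    let ?c = "%n. 1 * of_real (r ^ n) * ((IA s. Y s * cis (real n * s)) * ?f n)"
    have "?c sums (IP p. Y (fst p) * 1 * Q p)"
     using series[OF _ _ _ _ sq Q, of Y "%_. 1" B] Y B(1) unfolding c by simp
    moreover have "?c sums (\<Sum>n\<in>{0}. 1 * of_real (r ^ n) * ((IA s. Y s * cis (real n * s)) * ?f n))"
     by (rule sums_finite) auto
    ultimately show ?thesis using sums_unique2 by fastforce
   qed
   have "(IP p. X (fst p) * cnj (Q p)) = cnj (IP p. cnj (X (fst p)) * Q p)" using Bintegral_cnj[of ?M "%p. cnj (X (fst p)) * Q p"] by simp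
   also have "... = of_real (2 * pi) * (IA t. X t)" using 1[of "%t. cnj (X t)"] X by (simp add: Bintegral_cnj)
   finally have 2: "(IP p. X (fst p) * cnj (Q p)) = of_real (2 * pi) * (IA t. X t)" .
   have 3: "(IP p. X (fst p)) = of_real (2 * pi) * (IA t. X t)"
    using integral_arc_product[of X "%_. 1" B] X B(1) by (simp add: scaleR_conv_of_real mult.commute)
   show ?thesis by (subst split(1)) (use 1[of X] 2 3 X in \<open>auto intro: B2\<close>)
  qed
  define K1 where "K1 = (IP p. H (fst p) * cnj (H (snd p)) * K p)"
  define K2 where "K2 = (IP p. cnj (H (fst p)) * cnj (cnj (H (snd p))) * K p)"
  define Z0 where "Z0 = (IP p. D (fst p) * cnj (H (snd p)) * of_real (P r p))"
  have Q1: "(IP p. D (fst p) * cnj (H (snd p)) * Q p) = - \<i> * K1" "0 <= Re K1" "Im K1 = 0"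
   using QK[of H D] D Dc H2 m(2) B(2) by (auto simp: K1_def)
  have Q2: "(IP p. cnj (D (fst p)) * H (snd p) * Q p) = - \<i> * K2" "0 <= Re K2" "Im K2 = 0"
   using QK[of "%t. cnj (H t)" "%t. cnj (D t)"] D Dc H2 m(2) B(2) by (auto simp: K2_def intro!: has_vector_derivative_cnj continuous_intros)
  have DHb: "cmod (D x * cnj (H y)) <= B" if "x \<in> TP" for x y using B(2)[OF that] m(2) by (simp add: norm_mult)
  have Z0: "Z0 = - \<i> * K1 + cnj (- \<i> * K2)"
  proof -
   have "(IP p. D (fst p) * cnj (H (snd p)) * cnj (Q p)) = cnj (- \<i> * K2)" unfolding Q2(1)[symmetric] using Bintegral_cnj[of ?M "%p. cnj (D (fst p)) * H (snd p) * Q p"] by simp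
   moreover have "(IP p. D (fst p) * cnj (H (snd p))) = 0"
    using integral_arc_product[of D "%t. cnj (H t)" B] B m(2) integral_arc_FTC[OF D Dc] H2 by simp
   ultimately show ?thesis unfolding Z0_def Q1(1)[symmetric] by (subst split(1)) (use DHb B(1) in \<open>auto intro: B2 DHb\<close>)
  qed
  let ?b = "2 * of_real pi * \<i> * of_int d"
  \<comment> \<open>\<open>K1\<close> and \<open>K2\<close> are nonnegative, so the moduli add up to
    \<open>Re (K1 + K2)\<close>, which is minus the integral of \<open>dsq H * Re K\<close>. Since
    \<open>Re K\<close> is dominated by the energy weight itself with constant \<open>1\<close>, the
    resulting bound is sharp.\<close>
  have "cmod Z0 <= cmod K1 + cmod K2" unfolding Z0 using norm_triangle_ineq[of "- \<i> * K1" "cnj (- \<i> * K2)"] by (simp add: norm_mult)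
  also have "... = Re (K1 + K2)" using Q1 Q2 by (simp add: cmod_def)
  also have "... <= N"
  proof -
   have Kr: "abs (Re (K (x, y))) <= 1 / csq (cis x - cis y)" if ne: "cis x ~= cis y" for x y
   proof -
    have "abs (Re (K (x, y))) <= r / csq (1 - Z r (x, y))" using abs_Re_le_cmod[of "K (x, y)"] z by (simp add: K_def norm_divide norm_power)
    also have "... <= r / r / csq (cis x - cis y)" using kernel_le[OF r(1) _ ne, of r] r by (simp add: Z_def)
    finally show ?thesis using r by simp
   qed
   note ew = energy_ge_weighted[OF m(1) N, of "%p. Re (K p)" 1, OF _ _ Kr]
   have Kb: "cmod (K p) <= r / (1 - r)^2" for p
    unfolding K_def norm_divide norm_power z using z1[of p] r by (intro divide_left_mono power_mono mult_pos_pos) auto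
   have iK: "integrable ?M K" using Kb by (intro integrable_arc_pair) auto
   have iH: "integrable ?M (%p. of_real (dsq H p) * K p)"
   proof (rule integrable_arc_pair)
    fix x y
    have "dsq H (x, y) <= 2^2" using norm_triangle_ineq4[of "H x" "H y"] m(2) by (intro power_mono) (auto simp: m(2))
    thus "cmod (of_real (dsq H (x, y)) * K (x, y)) <= 2^2 * (r / (1 - r)^2)"
     unfolding norm_mult norm_of_real using Kb[of "(x, y)"] by (intro mult_mono) auto
   qed measurable
   \<comment> \<open>The power series of \<open>K\<close> has no constant term, so the
     \<open>2\<close> in \<open>2 - dsq H\<close> drops out.\<close>
   have k0: "(IP p. K p) = 0"
   proof -
    let ?h = "%n. (IA s. 1 * cis (real n * s)) * (IA t. 1 * cis (- real n * t))"
    have S: "(%n. of_nat n * of_real (r ^ n) * ?h n) sums (IP p. 1 * 1 * K p)"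
     using series[OF _ _ _ _ sk K, of "%_. 1" "%_. 1" 1] by simp
    have z0: "of_nat n * of_real (r ^ n) * ?h n = 0" for n
     by (cases "n = 0") (simp_all add: integral_arc_cis)
    show ?thesis using sums_unique2[OF S[unfolded z0] sums_zero] by simp
   qed
   have Ku: "integrable ?M (%p. G (fst p) * cnj (G (snd p)) * K p)" if [measurable]: "G \<in> BM" and "!!t. cmod (G t) = 1" for G
    using Kb that by (intro integrable_arc_pair) (auto simp: norm_mult)
   have "K1 + K2 = (IP p. 2 * K p - of_real (dsq H p) * K p)"
    unfolding K1_def K2_def
   proof (subst Bintegral_add[symmetric])
    have "H (fst p) * cnj (H (snd p)) * K p + cnj (H (fst p)) * cnj (cnj (H (snd p))) * K p = 2 * K p - of_real (dsq H p) * K p" for p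
    proof -
     have 1: "H t * cnj (H t) = 1" for t using m(2)[of t] by (simp add: complex_norm_square[symmetric])
     have e: "complex_of_real (dsq H p) = 2 - H (fst p) * cnj (H (snd p)) - cnj (H (fst p)) * H (snd p)"
      unfolding complex_norm_square using 1 by (simp add: algebra_simps)
     show ?thesis unfolding e by (simp add: algebra_simps)
    qed
    thus "(IP p. H (fst p) * cnj (H (snd p)) * K p + cnj (H (fst p)) * cnj (cnj (H (snd p))) * K p) = (IP p. 2 * K p - of_real (dsq H p) * K p)" by simp
   qed (use Ku[of H] Ku[of "%t. cnj (H t)"] m(2) in auto)
   also have "... = - (IP p. of_real (dsq H p) * K p)" using iK iH k0 by simp
   finally have "Re (K1 + K2) = - (IP p. dsq H p * Re (K p))" using integral_Re[OF iH] by simp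
   also have "... <= (IP p. abs (dsq H p * Re (K p)))" using integral_abs_bound[of ?M "%p. dsq H p * Re (K p)"] by linarith
   also have "... <= N" using ew(2) by (simp add: abs_mult)
   finally show ?thesis .
  qed
  finally have "cmod Z0 <= N" .
  moreover have "cmod (Z0 - of_real (2 * pi) * ?b) <= B * ?a r"
  proof -
   \<comment> \<open>The parameter of Young's inequality: the energy against the Poisson kernel is
     O(\<open>1 - r^2\<close>) and the mass of the kernel is fixed, so this choice makes both terms
     of order \<open>h\<close>.\<close>
   define h where "h = sqrt (1 - r^2)"
   have h: "0 < h" "h^2 = 1 - r^2" using r by (auto simp: h_def power_less_one_iff power_le_one)
   have Pr: "abs (P r (x, y)) <= (1 - r^2) / r / csq (cis x - cis y)" if ne: "cis x ~= cis y" for x y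
   proof -
    have "P r (x, y) <= (1 - r^2) / r / csq (cis x - cis y)"
     unfolding P_def using kernel_le[OF r(1) _ ne, of "1 - r^2"] r by (simp add: Z_def power_le_one)
    thus ?thesis using P0[of "(x, y)"] by simp
   qed
   note ew = energy_ge_weighted[OF m(1) N, of "P r" "(1 - r^2) / r", OF _ _ Pr]
   have ew1: "integrable ?M (%p. dsq H p * P r p)" "(IP p. dsq H p * P r p) <= (1 - r^2) / r * N"
    using ew P0 r by (auto simp: power_le_one)
   let ?d = "IP p. P r p"
   have iP: "integrable ?M (P r)" "?d = 4 * pi^2"
   proof -
    have i: "integrable ?M (%p. complex_of_real (P r p))" using split(2)[of "%_. 1"] B(1) by simp
    thus "integrable ?M (P r)" using integrable_Re[OF i] by simp
    have "complex_of_real ?d = (IP p. complex_of_real (P r p))" by simp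
    also have "... = complex_of_real (2 * pi) * complex_of_real (2 * pi)" using XP[of "%_. 1"] B(1) by (simp add: scaleR_conv_of_real)
    finally have "complex_of_real ?d = complex_of_real (4 * pi^2)" by (simp add: sq_eq del: Bochner_Integration.lebesgue_integral_const)
    thus "?d = 4 * pi^2" unfolding of_real_eq_iff .
   qed
   have X: "(IA t. D t * cnj (H t)) = 2 * of_real pi * \<i> * of_int d"
    using C1_winding_integral[OF D Dc m(2) w] by (simp add: mult.commute)
   have i1: "integrable ?M (%p. D (fst p) * cnj (H (snd p)) * of_real (P r p))" "integrable ?M (%p. D (fst p) * cnj (H (fst p)) * of_real (P r p))"
    by (rule split(2); use DHb B(1) in \<open>auto intro: B2 DHb\<close>)+
   have "Z0 - of_real (2 * pi) * ?b = Z0 - (IP p. D (fst p) * cnj (H (fst p)) * of_real (P r p))"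
    using XP[of "%t. D t * cnj (H t)"] DHb X by simp
   also have "... = (IP p. D (fst p) * cnj (H (snd p)) * of_real (P r p) - D (fst p) * cnj (H (fst p)) * of_real (P r p))"
    unfolding Z0_def by (rule Bintegral_diff[symmetric]) (rule i1)+
   finally have "cmod (Z0 - of_real (2 * pi) * ?b) <=
    (IP p. cmod (D (fst p) * cnj (H (snd p)) * of_real (P r p) - D (fst p) * cnj (H (fst p)) * of_real (P r p)))"
    by (simp only: integral_norm_bound)
   also have "... <= (IP p. B * (1 / (2 * h) * (dsq H p * P r p) + h / 2 * P r p))"
   proof (intro integral_mono_AE AE_arc_pairI)
    fix x y :: real assume "x \<in> TP" "y \<in> TP"
    define a where "a = cmod (H x - H y)"
    have "D x * cnj (H y) * of_real (P r (x, y)) - D x * cnj (H x) * of_real (P r (x, y)) = D x * (cnj (H y - H x) * of_real (P r (x, y)))" by (simp add: algebra_simps)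
    hence "cmod (D x * cnj (H y) * of_real (P r (x, y)) - D x * cnj (H x) * of_real (P r (x, y))) = cmod (D x) * (a * P r (x, y))"
     using P0[of "(x, y)"] by (simp only: norm_mult complex_mod_cnj a_def) (simp add: norm_minus_commute)
    also have "... <= B * (a * P r (x, y))" using B(2)[OF \<open>x \<in> _\<close>] P0 by (intro mult_right_mono) (auto simp: a_def)
    also have "... <= B * ((1 / (2 * h) * a^2 + h / 2) * P r (x, y))"
    proof (intro mult_left_mono mult_right_mono P0)
     have "0 <= (a - h)^2 / (2 * h)" using h by simp
     also have "... = 1 / (2 * h) * a^2 + h / 2 - a" using h(1) by (simp add: sq_eq field_simps)
     finally show "a <= 1 / (2 * h) * a^2 + h / 2" by simp
    qed (use B in auto)
    finally show "cmod (D (fst (x, y)) * cnj (H (snd (x, y))) * of_real (P r (x, y)) - D (fst (x, y)) * cnj (H (fst (x, y))) * of_real (P r (x, y)))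
     <= B * (1 / (2 * h) * (dsq H (x, y) * P r (x, y)) + h / 2 * P r (x, y))" by (simp add: a_def algebra_simps)
   qed (use i1 ew1 iP in \<open>auto intro!: integrable_norm Bintegrable_diff\<close>)
   also have "... = B * (1 / (2 * h) * (IP p. dsq H p * P r p) + h / 2 * (4 * pi^2))" using ew1 iP by simp
   also have "... <= B * (1 / (2 * h) * ((1 - r^2) / r * N) + h / 2 * (4 * pi^2))"
    using ew1(2) h B(1) by (intro mult_left_mono add_mono) auto
   also have "... = B * (h / (2 * r) * N + h * 2 * pi^2)" using h(1) r unfolding h(2)[symmetric] by (simp add: field_simps sq_eq)
   finally show ?thesis unfolding h_def .
  qed
  moreover have "cmod (of_real (2 * pi) * ?b) = 4 * pi^2 * abs (of_int d)" by (simp add: norm_mult sq_eq)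
  ultimately show ?thesis using norm_triangle_sub[of "of_real (2 * pi) * ?b" Z0] by (simp add: norm_minus_commute)
 qed
 have "4 * pi^2 * abs (of_int d) <= N"
 proof (rule tendsto_lowerbound)
  show "((%r. N + B * ?a r) \<longlongrightarrow> N) (at_left 1)"
   by (rule tendsto_eq_intros refl | simp)+
  show "\<forall>\<^sub>F r in at_left 1. 4 * pi^2 * abs (of_int d) <= N + B * ?a r"
   using eventually_at_left_real[OF zero_less_one] by (rule eventually_mono) (rule main, simp_all only: greaterThanLessThan_iff)
 qed simp
 thus ?thesis using N by (simp add: ennreal_leI)
qed

subsection \<open>The degree on the circle and on the line\<close>

theorem energy_lower_bound:
 assumes F: "umap F" and d: "hasdeg F d"
 shows "en (4 * pi^2 * abs (of_int d)) <= NN F"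
proof -
 obtain N where N: "NN F = en N" "0 <= N" using umapD(3)[OF F] by (cases "NN F") auto
 have le: "4 * pi^2 * abs (of_int d) <= 1 / (1 - e)^2 * N" if e: "0 < e" "e < 1 / 4" for e
 proof -
  obtain H where H: "umap H" "H C1_differentiable_on UNIV" "wlift H d" "NN H <= en (1 / (1 - e)^2) * NN F"
   using smooth_approximation[OF F d e(1)] e by auto
  have "en (4 * pi^2 * abs (of_int d)) <= en (1 / (1 - e)^2 * N)"
   using order_trans[OF energy_lower_bound_C1[OF H(1-3)] H(4)] N by (simp add: ennreal_mult[symmetric])
  thus ?thesis using N by (subst (asm) ennreal_le_iff) auto
 qed
 have "4 * pi^2 * abs (of_int d) <= N"
 proof (rule tendsto_lowerbound)
  show "((%e. 1 / (1 - e)^2 * N) \<longlongrightarrow> N) (at_right 0)" by (rule tendsto_eq_intros refl | simp)+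
  have "(0::real) < 1 / 4" by simp
  from eventually_at_right_real[OF this] show "\<forall>\<^sub>F e in at_right 0. 4 * pi^2 * abs (of_int d) <= 1 / (1 - e)^2 * N"
   by (rule eventually_mono) (rule le, simp_all only: greaterThanLessThan_iff)
 qed simp
 thus ?thesis using N by (simp add: ennreal_leI)
qed

section \<open>Periodic representatives and the degree on the circle\<close>

lemma unit_borel_representative:
 fixes g :: "real => complex"
 assumes g: "g \<in> borel_measurable lebesgue" and g1: "AE x in lebesgue. cmod (g x) = 1"
 obtains g' where "g' \<in> BM" "!!x. cmod (g' x) = 1" "AE x in lborel. g x = g' x"
proof -
 have "(%x. Re (g x)) \<in> borel_measurable lebesgue" "(%x. Im (g x)) \<in> borel_measurable lebesgue" using g by measurable
 then obtain r i where ri: "r \<in> borel_measurable lborel" "AE x in lborel. Re (g x) = r x" "i \<in> borel_measurable lborel" "AE x in lborel. Im (g x) = i x"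
  using completion_ex_borel_measurable_real by metis
 note [measurable] = ri(1,3)
 define h where "h x = of_real (r x) + \<i> * of_real (i x)" for x
 have [measurable]: "h \<in> BM" unfolding h_def using ri(1,3) by simp
 show ?thesis
 proof (rule that[of "%x. if cmod (h x) = 1 then h x else 1"])
  have "AE x in lborel. cmod (g x) = 1" using g1 by (simp add: AE_completion_iff)
  thus "AE x in lborel. g x = (if cmod (h x) = 1 then h x else 1)"
   using ri(2,4) by eventually_elim (auto simp: h_def complex_eq_iff cmod_def)
 qed (auto simp: h_def)
qed

lemma AE_lborel_shift:
 assumes "AE x in lborel. P x"
 shows "AE x in lborel. P (x + c :: real)"
proof -
 from assms obtain N where N: "{x \<in> space lborel. \<not> P x} \<subseteq> N" "N \<in> null_sets lborel"
  by (auto simp: eventually_ae_filter)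
 hence [measurable]: "N \<in> sets borel" by auto
 have "AE x in distr lborel borel (%x. c + x). x \<notin> N" unfolding lborel_distr_plus by (rule AE_not_in[OF N(2)])
 hence "AE x in lborel. c + x \<notin> N" by (subst (asm) AE_distr_iff) auto
 thus ?thesis by eventually_elim (use N(1) in \<open>auto simp: add.commute\<close>)
qed

text \<open>A Borel representative of \<open>f (cis t)\<close> need not be periodic, so its values
  on one period are repeated. Agreement almost everywhere survives because countably many translates
  of the exceptional set are null.\<close>

lemma circle_representative:
 fixes f :: "complex => complex"
 assumes "(%t. f (cis t)) \<in> borel_measurable lebesgue" "AE t in lebesgue. cmod (f (cis t)) = 1"
 obtains F where "per F" "!!t. cmod (F t) = 1" "AE t in lborel. f (cis t) = F t"
proof -
 obtain G where G: "G \<in> BM" "!!t. cmod (G t) = 1" "AE t in lborel. f (cis t) = G t"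
  using unit_borel_representative[OF assms] by blast
 note [measurable] = G(1)
 define F where "F t = G (t - 2 * pi * of_int \<lfloor>t / (2 * pi)\<rfloor>)" for t
 have p: "F (t + 2 * pi) = F t" for t
 proof -
  have "\<lfloor>(t + 2 * pi) / (2 * pi)\<rfloor> = \<lfloor>t / (2 * pi)\<rfloor> + 1" by (simp add: add_divide_distrib)
  thus ?thesis by (simp add: F_def algebra_simps)
 qed
 have "AE t in lborel. \<forall>n::int. f (cis (t - 2 * pi * of_int n)) = G (t - 2 * pi * of_int n)"
  unfolding AE_all_countable
 proof
  fix n :: int
  show "AE t in lborel. f (cis (t - 2 * pi * of_int n)) = G (t - 2 * pi * of_int n)"
   using AE_lborel_shift[OF G(3), of "- (2 * pi * of_int n)"] by simp
 qed
 hence "AE t in lborel. f (cis t) = F t"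
 proof eventually_elim
  case (elim t)
  have "cis (t - 2 * pi * of_int \<lfloor>t / (2 * pi)\<rfloor>) = cis t" using cis_multiple_2pi[of "of_int \<lfloor>t / (2 * pi)\<rfloor>"] by (simp add: cis_divide[symmetric])
  thus ?case using elim[rule_format, of "\<lfloor>t / (2 * pi)\<rfloor>"] by (simp add: F_def)
 qed
 moreover have "F \<in> BM" unfolding F_def by measurable
 ultimately show ?thesis using p G(2) by (intro that[of F]) (auto simp: per_def F_def)
qed

lemma circle_norm_eq:
 assumes G: "per G" and eq: "AE t in lborel. g (cis t) = G t"
 shows "circle_Hhalf_norm_sq g = l2 G + NN G"
proof -
 note [measurable] = perD(1)[OF G]
 have le: "AE t in lebesgue. g (cis t) = G t" using eq by (rule AE_completion)
 have "(\<integral>\<^sup>+s\<in>TP. en (csq (g (cis s))) \<partial>lebesgue) = (\<integral>\<^sup>+s. ind TP s * en (csq (G s)) \<partial>lebesgue)"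
  by (intro nn_integral_cong_AE) (use le in eventually_elim, simp add: mult.commute)
 also have "... = l2 G" unfolding l2_def by (rule nn_integral_completion) measurable
 finally have 1: "(\<integral>\<^sup>+s\<in>TP. en (csq (g (cis s))) \<partial>lebesgue) = l2 G" .
 let ?k = "%s t. ind TP t * (en (1 / csq (cis s - cis t)) * en (dsq G (s, t)))"
 have in2: "(\<integral>\<^sup>+t\<in>TP. en (csq (g (cis s) - g (cis t)) / csq (cis s - cis t)) \<partial>lebesgue) = (NL t. ?k s t)"
  if s: "g (cis s) = G s" for s
 proof -
  have "(\<integral>\<^sup>+t\<in>TP. en (csq (g (cis s) - g (cis t)) / csq (cis s - cis t)) \<partial>lebesgue) = (\<integral>\<^sup>+t. ?k s t \<partial>lebesgue)"
   by (intro nn_integral_cong_AE) (use le in eventually_elim, simp add: s ennreal_mult[symmetric] mult.commute)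
  also have "... = (NL t. ?k s t)" by (rule nn_integral_completion) measurable
  finally show ?thesis .
 qed
 have "(\<integral>\<^sup>+s\<in>TP. (\<integral>\<^sup>+t\<in>TP. en (csq (g (cis s) - g (cis t)) / csq (cis s - cis t)) \<partial>lebesgue) \<partial>lebesgue)
  = (\<integral>\<^sup>+s. ind TP s * (NL t. ?k s t) \<partial>lebesgue)"
  by (intro nn_integral_cong_AE) (use le in eventually_elim, subst in2, assumption, rule mult.commute)
 also have "... = (NL s. ind TP s * (NL t. ?k s t))" by (rule nn_integral_completion) measurable
 also have "... = NN G" unfolding NN_cm[OF G] by (subst nn_integral_cm) simp_all
 finally show ?thesis unfolding circle_Hhalf_norm_sq_def 1 by simp
qed

lemma l2_finite:
 assumes "!!t. cmod (F t) = 1" shows "l2 F < \<infinity>"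
 unfolding l2_def by (simp add: assms ennreal_mult_less_top)

lemma hasdeg_AE:
 assumes "F \<in> BM" "G \<in> BM" "AE t in lborel. F t = G t" "hasdeg F d"
 shows "hasdeg G d"
proof -
 have "avg (1 / 2 ^ n) F = avg (1 / 2 ^ n) G" for n
 proof
  fix t
  show "avg (1 / 2 ^ n) F t = avg (1 / 2 ^ n) G t"
   unfolding avg_lborel[OF assms(1) pow_half(1)] avg_lborel[OF assms(2) pow_half(1)]
  proof (intro arg_cong2[where f="(*\<^sub>R)"] refl integral_cong_AE)
   show "AE y in lborel. ind {t..t + 1 / 2 ^ n} y *\<^sub>R F y = ind {t..t + 1 / 2 ^ n} y *\<^sub>R G y"
    using assms(3) by eventually_elim simp
  qed (use assms(1,2) in measurable)
 qed
 thus ?thesis using assms(4) by (simp add: hasdeg_def)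
qed

definition circ_rep :: "(complex => complex) => (real => complex) => bool" where
 "circ_rep f F \<longleftrightarrow> umap F \<and> (AE t in lborel. f (cis t) = F t)"

lemma circ_rep_exists: "f \<in> circle_Hhalf ==> \<exists>F. circ_rep f F"
proof -
 assume f: "f \<in> circle_Hhalf"
 then obtain F where F: "per F" "!!t. cmod (F t) = 1" "AE t in lborel. f (cis t) = F t"
  using circle_representative[of f] unfolding circle_Hhalf_def by blast
 have "NN F < \<infinity>" using f circle_norm_eq[OF F(1,3)] by (auto simp: circle_Hhalf_def)
 thus ?thesis using F by (auto simp: circ_rep_def umap_def)
qed

lemma measurable_lebesgue_AE:
 assumes f: "f \<in> borel_measurable lebesgue" and eq: "AE x in lebesgue. f x = g x"
 shows "g \<in> borel_measurable lebesgue"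
proof (rule measurableI)
 fix A :: "'b set" assume A: "A \<in> sets borel"
 show "g -` A \<inter> space lebesgue \<in> sets lebesgue"
 proof (rule completion.in_sets_AE)
  show "AE x in lebesgue. x \<in> f -` A \<inter> space lebesgue \<longleftrightarrow> x \<in> g -` A \<inter> space lebesgue"
   using eq by eventually_elim auto
  show "f -` A \<inter> space lebesgue \<in> sets lebesgue" using measurable_sets[OF f A] .
 qed auto
qed auto

lemma circ_rep_Hhalf: "circ_rep f F ==> f \<in> circle_Hhalf"
proof -
 assume r: "circ_rep f F"
 hence u: "umap F" and eq: "AE t in lborel. f (cis t) = F t" by (auto simp: circ_rep_def)
 note m = umapD[OF u]
 have le: "AE t in lebesgue. F t = f (cis t)" using AE_completion[OF eq] by eventually_elim simp
 have "F \<in> borel_measurable lebesgue" using m(4) by (simp add: measurable_completion)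
 hence "(%t. f (cis t)) \<in> borel_measurable lebesgue" using le by (rule measurable_lebesgue_AE)
 moreover have "AE t in lebesgue. cmod (f (cis t)) = 1" using le by eventually_elim (metis m(2))
 moreover have "circle_Hhalf_norm_sq f < \<infinity>" using circle_norm_eq[OF m(1) eq] m(3) l2_finite[of F] m(2) by simp
 ultimately show ?thesis by (simp add: circle_Hhalf_def)
qed

lemma circ_rep_diff_norm:
 assumes "circ_rep f F" "circ_rep g G"
 shows "circle_Hhalf_norm_sq (%z. f z - g z) = l2 (%t. F t - G t) + NN (%t. F t - G t)"
proof (rule circle_norm_eq)
 have "AE t in lborel. f (cis t) = F t" "AE t in lborel. g (cis t) = G t" using assms by (auto simp: circ_rep_def)
 thus "AE t in lborel. f (cis t) - g (cis t) = F t - G t" by eventually_elim simp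
qed (use assms in \<open>auto simp: circ_rep_def intro: per_diff umapD\<close>)

lemma circ_rep_deg_unique:
 assumes "circ_rep f F" "circ_rep f G" "hasdeg F d" shows "hasdeg G d"
proof (rule hasdeg_AE[OF _ _ _ assms(3)])
 have "AE t in lborel. f (cis t) = F t" "AE t in lborel. f (cis t) = G t" using assms by (auto simp: circ_rep_def)
 thus "AE t in lborel. F t = G t" by eventually_elim simp
qed (use assms in \<open>auto simp: circ_rep_def intro: umapD\<close>)

lemma chord_lower:
 assumes "0 <= h" "h <= pi" shows "h / 4 <= cmod (1 - cis h)"
proof -
 have s: "h / 8 <= sin (h / 2)"
 proof (cases "h / 2 <= 1")
  case True
  define y where "y = h / 2"
  have y: "0 <= y" "y <= 1" "h = 2 * y" using True assms by (auto simp: y_def)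
  have "y^2 <= y" using y by (simp add: sq_eq mult_left_le_one_le)
  moreover have "2 * (y - sin y) <= y^2" using abs_le_D2[OF abs_sin_minus_id_le[of y]] by simp
  ultimately have "y <= 2 * sin y" by argo
  thus ?thesis using y by simp
 next
  case False
  have "sin 1 <= sin (h / 2)" using False assms by (intro sin_monotone_2pi_le) auto
  moreover have "1 / 2 <= sin (1::real)" using abs_sin_minus_id_le[of 1] by (simp add: abs_le_iff)
  moreover have "h / 8 <= 1 / 2" using assms pi_less_4 by simp
  ultimately show ?thesis by simp
 qed
 have "csq (1 - cis h) = (1 - cos h)^2 + (sin h)^2" by (simp add: cmod_power2)
 also have "... = 2 - 2 * cos (2 * (h / 2))" using sin_cos_squared_add[of h] by (simp add: sq_eq algebra_simps)
 also have "... = (2 * sin (h / 2))^2" unfolding cos_double_sin by (simp add: power_mult_distrib)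
 finally have *: "csq (1 - cis h) = (2 * sin (h / 2))^2" .
 have "0 <= sin (h / 2)" using order_trans[OF _ s, of 0] assms by simp
 hence "cmod (1 - cis h) = 2 * sin (h / 2)" by (intro power2_eq_imp_eq[OF *]) simp_all
 thus ?thesis using s by simp
qed

lemma C1_energy_finite:
 assumes F: "per F" and C1: "F C1_differentiable_on UNIV"
 shows "NN F < \<infinity>"
proof -
 note [measurable] = perD(1)[OF F]
 obtain D where D: "!!t. (F has_vector_derivative D t) (at t)" and Dc: "continuous_on UNIV D"
  using C1 unfolding C1_differentiable_on_def by auto
 have "compact (D ` {- 2 * pi..4 * pi})" by (intro compact_continuous_image continuous_on_subset[OF Dc]) auto
 then obtain B where B: "!!t. t \<in> {- 2 * pi..4 * pi} ==> cmod (D t) <= B" "0 < B"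
  using compact_imp_bounded bounded_pos[of "D ` {- 2 * pi..4 * pi}"] by (metis imageI)
 have lip: "cmod (F y - F x) <= B * abs (y - x)" if "x \<in> {- 2 * pi..4 * pi}" "y \<in> {- 2 * pi..4 * pi}" for x y
  using differentiable_bound[of "{- 2 * pi..4 * pi}" F "%t h. h *\<^sub>R D t" B y x] that B D
  by (auto simp: has_vector_derivative_def onorm_scaleR_left onorm_id intro: has_derivative_at_withinI)
 have le: "ind TP x * (ind TP h * ed F x h) <= ind TP x * (ind TP h * en ((4 * B)^2))" for x h
 proof (cases "x \<in> TP \<and> h \<in> TP")
  case True
  have "cmod (F (x + h) - F x) <= 4 * B * cmod (1 - cis h)"
  proof (cases "h <= pi")
   case hp: True
   have "cmod (F (x + h) - F x) <= B * h" using lip[of x "x + h"] True by simp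
   also have "... <= B * (4 * cmod (1 - cis h))" using chord_lower[of h] True hp B(2) by (intro mult_left_mono) auto
   finally show ?thesis by simp
  next
   case False
   \<comment> \<open>For \<open>h\<close> beyond \<open>pi\<close> the chord belongs to the short
     way round, so the increment is estimated backwards.\<close>
   have "F (x + h) = F (x + h - 2 * pi)" using perD(2)[OF F, of "x + h - 2 * pi"] by simp
   hence "cmod (F (x + h) - F x) <= B * (2 * pi - h)" using lip[of x "x + h - 2 * pi"] True by simp
   also have "... <= B * (4 * cmod (1 - cis (2 * pi - h)))" using chord_lower[of "2 * pi - h"] True False B(2) by (intro mult_left_mono) auto
   also have "cmod (1 - cis (2 * pi - h)) = cmod (cnj (1 - cis h))" by (simp add: cis_divide[symmetric] cis_cnj cis_inverse divide_inverse)
   finally show ?thesis unfolding complex_mod_cnj by (simp add: ac_simps)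
  qed
  hence "csq (F (x + h) - F x) <= (4 * B)^2 * csq (1 - cis h)" using power_mono[of _ _ 2] by (fastforce simp: power_mult_distrib)
  hence "ed F x h <= en ((4 * B)^2)" unfolding ed_def by (intro ennreal_leI) (auto simp: divide_simps)
  thus ?thesis by (auto simp: ind_def)
 qed (auto simp: ind_def)
 have "NN F = (NL x. (NL h. ind TP x * (ind TP h * ed F x h)))"
  unfolding nd_def by (intro nn_integral_cong nn_integral_cmult[symmetric]) measurable
 also have "... <= (NL x. (NL h. ind TP x * (ind TP h * en ((4 * B)^2))))"
  by (intro nn_integral_mono le)
 also have "... = en (2 * pi) * (en (2 * pi) * en ((4 * B)^2))" by (simp add: nn_integral_cmult nn_integral_multc)
 also have "... < \<infinity>" by (simp add: ennreal_mult_less_top)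
 finally show ?thesis .
qed

lemma circle_C1_rep:
 assumes "f \<in> circle_C1"
 shows "circ_rep f (%t. f (cis t))"
  and "hasdeg (%t. f (cis t)) d ==> 1 / (2 * of_real pi * \<i>) * integral TP (%t. cnj (f (cis t)) * vector_derivative (%s. f (cis s)) (at t)) = of_int d"
proof -
 let ?F = "%t. f (cis t)"
 have C1: "?F C1_differentiable_on UNIV" and F1: "!!t. cmod (?F t) = 1" using assms by (auto simp: circle_C1_def)
 obtain D where D: "!!t. (?F has_vector_derivative D t) (at t)" and Dc: "continuous_on UNIV D"
  using C1 unfolding C1_differentiable_on_def by auto
 have Fc: "continuous_on UNIV ?F" by (rule C1_differentiable_imp_continuous_on[OF C1])
 have p: "per ?F" using Fc by (auto simp: per_def cis_mult[symmetric] intro: borel_cont)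
 show "circ_rep f ?F" using p F1 C1_energy_finite[OF p C1] by (simp add: circ_rep_def umap_def)
 assume d: "hasdeg ?F d"
 have "?F t ~= 0" for t using F1[of t] by auto
 then obtain d' where w: "wlift ?F d'" using wlift_exists[of ?F] Fc perD(3)[OF p] continuous_on_subset by blast
 have "d' = d" using hasdeg_unique[OF hasdeg_continuous[OF p Fc F1 w] d] .
 have "(IA t. cnj (?F t) * D t) = (IL t. ind TP t *\<^sub>R (cnj (?F t) * D t))"
  unfolding arcm_def using Fc Dc by (subst integral_density) (auto intro!: borel_cont continuous_intros)
 also have "... = integral TP (%t. cnj (?F t) * D t)"
  unfolding set_lebesgue_integral_def[symmetric]
  by (intro set_borel_integral_eq_integral borel_integrable_atLeastAtMost' continuous_intros continuous_on_subset[OF Fc] continuous_on_subset[OF Dc]) auto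
 finally have "integral TP (%t. cnj (?F t) * D t) = 2 * of_real pi * \<i> * of_int d"
  using C1_winding_integral[OF D Dc F1 w] \<open>d' = d\<close> by simp
 thus "1 / (2 * of_real pi * \<i>) * integral TP (%t. cnj (f (cis t)) * vector_derivative (%s. f (cis s)) (at t)) = of_int d"
  using vector_derivative_at[OF D] by simp
qed

lemma circ_rep_degree: "circ_rep f F ==> \<exists>!d. \<exists>F. circ_rep f F \<and> hasdeg F d"
proof -
 assume r: "circ_rep f F"
 then obtain d where "hasdeg F d" using hasdeg_exists[of F] by (auto simp: circ_rep_def)
 thus ?thesis using r circ_rep_deg_unique hasdeg_unique by blast
qed

text \<open>The definite description is well posed. The winding of averages satisfies its clauses:
  it gives the integral on C1 maps and is eventually constant along norm convergent sequences by
  \<open>hasdeg_limit\<close>. Any other candidate agrees with it, because each class is a norm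
  limit of C1 maps of the same winding by \<open>strong_smooth_approximation\<close>.\<close>

theorem circle_degree_eq:
 assumes "circ_rep f F" "hasdeg F d"
 shows "circle_degree f = d"
proof -
 define deg where "deg f = (if f \<in> circle_Hhalf then (THE d. \<exists>F. circ_rep f F \<and> hasdeg F d) else 0)" for f
 have deg: "deg f = d" if r: "circ_rep f F" and d: "hasdeg F d" for f F d
  unfolding deg_def using circ_rep_Hhalf[OF r] the1_equality[OF circ_rep_degree[OF r]] r d by auto
 have "circle_degree = deg"
  unfolding circle_degree_def
 proof (rule the_equality)
  have "of_int (deg f) = 1 / (2 * of_real pi * \<i>) * integral TP (%t. cnj (f (cis t)) * vector_derivative (%s. f (cis s)) (at t))"
   if f: "f \<in> circle_C1" for f
  proof -
   note r = circle_C1_rep(1)[OF f]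
   obtain d where d: "hasdeg (%t. f (cis t)) d" using hasdeg_exists r by (auto simp: circ_rep_def)
   show ?thesis using circle_C1_rep(2)[OF f d] deg[OF r d] by simp
  qed
  moreover have "(%n. deg (F n)) ----> deg f"
   if f: "f \<in> circle_Hhalf" and F: "\<forall>n::nat. F n \<in> circle_Hhalf" and lim: "(%n. circle_Hhalf_norm_sq (%z. F n z - f z)) ----> 0" for F f
  proof -
   obtain G where G: "circ_rep f G" using circ_rep_exists[OF f] by blast
   have "\<forall>n. \<exists>H. circ_rep (F n) H" using circ_rep_exists F by blast
   then obtain H where H: "!!n. circ_rep (F n) (H n)" by metis
   obtain d where d: "hasdeg G d" using hasdeg_exists G by (auto simp: circ_rep_def)
   have lim: "(%n. l2 (%t. H n t - G t) + NN (%t. H n t - G t)) ----> 0" using lim unfolding circ_rep_diff_norm[OF H G] .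
   have "eventually (%n. hasdeg (H n) d) sequentially"
   proof (rule hasdeg_limit[OF _ _ _ _ d])
    show "(%n. NN (%t. H n t - G t)) ----> 0" "(%n. l2 (%t. H n t - G t)) ----> 0"
     by (rule tendsto_sandwich[OF _ _ tendsto_const lim]; simp)+
   qed (use G H in \<open>auto simp: circ_rep_def\<close>)
   hence "eventually (%n. deg (F n) = deg f) sequentially" by eventually_elim (simp add: deg[OF G d] deg[OF H])
   thus ?thesis by (rule tendsto_eventually)
  qed
  ultimately show "(\<forall>f. f \<notin> circle_Hhalf --> deg f = 0) \<and>
   (\<forall>f\<in>circle_C1. of_int (deg f) = 1 / (2 * of_real pi * \<i>) * integral TP (%t. cnj (f (cis t)) * vector_derivative (%s. f (cis s)) (at t))) \<and>
   (\<forall>F. \<forall>f\<in>circle_Hhalf. (\<forall>n::nat. F n \<in> circle_Hhalf) --> (%n. circle_Hhalf_norm_sq (%z. F n z - f z)) ----> 0 --> (%n. deg (F n)) ----> deg f)"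
   by (simp add: deg_def)
 next
  fix D :: "(complex => complex) => int"
  assume D: "(\<forall>f. f \<notin> circle_Hhalf --> D f = 0) \<and>
   (\<forall>f\<in>circle_C1. of_int (D f) = 1 / (2 * of_real pi * \<i>) * integral TP (%t. cnj (f (cis t)) * vector_derivative (%s. f (cis s)) (at t))) \<and>
   (\<forall>F. \<forall>f\<in>circle_Hhalf. (\<forall>n::nat. F n \<in> circle_Hhalf) --> (%n. circle_Hhalf_norm_sq (%z. F n z - f z)) ----> 0 --> (%n. D (F n)) ----> D f)"
  show "D = deg"
  proof
   fix f
   show "D f = deg f"
   proof (cases "f \<in> circle_Hhalf")
    case False
    thus ?thesis using D by (simp add: deg_def)
   next
    case True
    then obtain G where G: "circ_rep f G" using circ_rep_exists by blast
    hence uG: "umap G" by (simp add: circ_rep_def)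
    obtain d where d: "hasdeg G d" using hasdeg_exists[OF uG] by blast
    obtain H where H: "!!k::nat. umap (H k)" "!!k. H k C1_differentiable_on UNIV" "!!k. wlift (H k) d"
     "(%k. NN (%t. H k t - G t)) ----> 0" "(%k. l2 (%t. H k t - G t)) ----> 0"
     using strong_smooth_approximation[OF uG d] by blast
    \<comment> \<open>Elements of \<open>circle_C1\<close> are functions on the plane;
      \<open>Arg2pi\<close> turns the periodic map into one, and periodicity makes
      \<open>h k (cis t) = H k t\<close> for all \<open>t\<close>.\<close>
    define h where "h k z = H k (Arg2pi z)" for k z
    have h: "h k (cis t) = H k t" for k t
    proof -
     have "cis (Arg2pi (cis t)) = cis t" using Arg2pi_eq[of "cis t"] by (simp add: cis_conv_exp)
     from cis_eq_imp_per_eq[OF this umapD(1)[OF H(1)]] show ?thesis by (simp add: h_def)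
    qed
    have r: "circ_rep (h k) (H k)" for k using H(1) by (simp add: circ_rep_def h)
    have hC: "h k \<in> circle_C1" for k
     using H(2) umapD(2)[OF H(1)] by (auto simp: circle_C1_def h) (metis h_def)
    have hd: "hasdeg (H k) d" for k
     using hasdeg_continuous[OF umapD(1)[OF H(1)] C1_differentiable_imp_continuous_on[OF H(2)] umapD(2)[OF H(1)] H(3)] .
    have "of_int (D (h k)) = (of_int d :: complex)" for k
     using D hC[of k] circle_C1_rep(2)[OF hC[of k], of d] hd[of k] by (simp add: h)
    hence "D (h k) = d" for k by simp
    moreover have "(%k. D (h k)) ----> D f"
    proof -
     have "(%k. circle_Hhalf_norm_sq (%z. h k z - f z)) ----> 0" unfolding circ_rep_diff_norm[OF r G] using tendsto_add[OF H(5,4)] by simp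
     thus ?thesis using D True circ_rep_Hhalf[OF r] by blast
    qed
    ultimately have "D f = d" by (simp add: LIMSEQ_const_iff)
    thus ?thesis using deg[OF G d] by simp
   qed
  qed
 qed
 thus ?thesis using deg[OF assms] by simp
qed

section \<open>Stereographic transfer between the line and the circle\<close>

definition invst :: "real => real" where "invst x = 2 * arctan x - pi / 2"

lemma cis_invst: "cis (invst x) = Complex (2 * x / (1 + x^2)) ((x^2 - 1) / (1 + x^2))"
proof -
 have p: "1 + x^2 ~= 0" using sum_power2_gt_zero_iff[of 1 x] by simp
 have c: "(cos (arctan x))^2 = 1 / (1 + x^2)" by (simp add: cos_arctan power_divide)
 have s: "sin (arctan x) = x * cos (arctan x)" by (simp add: cos_arctan sin_arctan)
 have "sin (2 * arctan x) = 2 * x * (cos (arctan x))^2" unfolding sin_double s by (simp add: sq_eq)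
 moreover have "cos (2 * arctan x) = (1 - x^2) * (cos (arctan x))^2" unfolding cos_double s by (simp add: power_mult_distrib algebra_simps)
 ultimately show ?thesis
  using p by (simp add: complex_eq_iff invst_def cos_diff sin_diff c diff_divide_distrib)
qed

lemma stereographic_invst [simp]: "stereographic (cis (invst x)) = x"
proof -
 have p: "1 + x^2 ~= 0" using sum_power2_gt_zero_iff[of 1 x] by simp
 show ?thesis unfolding stereographic_def cis_invst using p by (simp add: divide_simps) 
qed

text \<open>The projection is conformal: the squared chord is \<open>(x - y)^2\<close> times the
  Jacobians \<open>2 / (1 + x^2)\<close> and \<open>2 / (1 + y^2)\<close>. The weights on line and
  circle therefore correspond exactly, and \<open>NN_lift_line\<close> carries no constant.\<close>

lemma cis_invst_diff: "csq (cis (invst x) - cis (invst y)) = 4 * (x - y)^2 / ((1 + x^2) * (1 + y^2))"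
proof -
 have p: "1 + x^2 ~= 0" "1 + y^2 ~= 0" using sum_power2_gt_zero_iff[of 1 x] sum_power2_gt_zero_iff[of 1 y] by simp_all
 have "((2 * x * (1 + y^2) - 2 * y * (1 + x^2))^2 + ((x^2 - 1) * (1 + y^2) - (y^2 - 1) * (1 + x^2))^2) = 4 * (x - y)^2 * ((1 + x^2) * (1 + y^2))"
  by algebra
 moreover have "(2 * x / (1 + x^2) - 2 * y / (1 + y^2)) = (2 * x * (1 + y^2) - 2 * y * (1 + x^2)) / ((1 + x^2) * (1 + y^2))"
  "((x^2 - 1) / (1 + x^2) - (y^2 - 1) / (1 + y^2)) = ((x^2 - 1) * (1 + y^2) - (y^2 - 1) * (1 + x^2)) / ((1 + x^2) * (1 + y^2))"
  using p by (simp_all add: diff_frac_eq)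
 ultimately show ?thesis unfolding cis_invst cmod_power2 minus_complex.simps complex.sel
  using p by (simp add: power_divide add_divide_distrib[symmetric]) (simp add: sq_eq)
qed

text \<open>The angles \<open>invst x\<close> fill the open period from \<open>- 3 * pi / 2\<close>
  to \<open>pi / 2\<close>, with the pole at both ends. Substitution is done on compact intervals
  and passes to the limit monotonically.\<close>

lemma nn_integral_line_circle:
 fixes P :: "real => ennreal"
 assumes [measurable]: "P \<in> BM" and P: "!!t. P (t + 2 * pi) = P t"
 shows "(NL t. ind TP t * P t) = (NL x. P (invst x) * en (2 / (1 + x^2)))"
proof -
 have [measurable]: "invst \<in> BM" unfolding invst_def by measurable
 let ?A = "%n::nat. {invst (- real n)..invst (real n)}"
 have D: "(invst has_real_derivative 2 / (1 + x^2)) (at x)" for x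
  unfolding invst_def[abs_def] by (rule DERIV_cong[OF DERIV_diff[OF DERIV_cmult[OF DERIV_arctan] DERIV_const]]) (simp only: divide_inverse diff_0_right)
 have sub: "(NL t. P t * ind (?A (Suc n)) t) = (NL x. P (invst x) * en (2 / (1 + x^2)) * ind {- real (Suc n)..real (Suc n)} x)" for n
 proof (rule nn_integral_substitution_aux[OF _ _ D])
  have "1 + x^2 ~= 0" for x :: real using sum_power2_gt_zero_iff[of 1 x] by simp
  thus "continuous_on {- real (Suc n)..real (Suc n)} (%x. 2 / (1 + x^2))" by (intro continuous_intros) auto
 qed auto
 have L: "(%n. (NL t. P t * ind (?A (Suc n)) t)) ----> (NL t. P t * ind {- 3 * pi / 2<..<pi / 2} t)"
 proof (rule nn_integral_LIMSEQ)
  show "incseq (%n t. P t * ind (?A (Suc n)) t)"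
  proof (rule incseq_SucI, rule le_funI)
   fix n t
   have "?A (Suc n) \<subseteq> ?A (Suc (Suc n))" by (intro atLeastatMost_subset_iff[THEN iffD2] disjI2 conjI) (simp_all add: invst_def arctan_le_iff)
   thus "P t * ind (?A (Suc n)) t <= P t * ind (?A (Suc (Suc n))) t" by (auto simp: ind_def)
  qed
  fix t
  show "(%n. P t * ind (?A (Suc n)) t) ----> P t * ind {- 3 * pi / 2<..<pi / 2} t"
  proof (cases "t \<in> {- 3 * pi / 2<..<pi / 2}")
   case True
   hence "- (pi / 2) < t / 2 + pi / 4" "t / 2 + pi / 4 < pi / 2" by (auto simp: field_simps)
   hence a: "arctan (tan (t / 2 + pi / 4)) = t / 2 + pi / 4" by (rule arctan_tan)
   define x where "x = tan (t / 2 + pi / 4)"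
   have t: "t = invst x" using a by (simp add: x_def invst_def)
   obtain m :: nat where m: "abs x <= real m" using real_arch_simple by blast
   have "t \<in> ?A (Suc n)" if "m <= n" for n unfolding t using m that by (auto simp: invst_def arctan_le_iff)
   hence "eventually (%n. P t * ind (?A (Suc n)) t = P t * ind {- 3 * pi / 2<..<pi / 2} t) sequentially"
    using True by (intro eventually_sequentiallyI[of m]) simp
   thus ?thesis by (rule tendsto_eventually)
  next
   case False
   have "t \<notin> ?A (Suc n)" for n
    using False arctan_lbound[of "- real (Suc n)"] arctan_ubound[of "real (Suc n)"] by (auto simp: invst_def)
   thus ?thesis using False by simp
  qed
 qed measurable
 have R: "(%n. (NL x. P (invst x) * en (2 / (1 + x^2)) * ind {- real (Suc n)..real (Suc n)} x)) ----> (NL x. P (invst x) * en (2 / (1 + x^2)))"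
 proof (rule nn_integral_LIMSEQ)
  show "incseq (%n x. P (invst x) * en (2 / (1 + x^2)) * ind {- real (Suc n)..real (Suc n)} x)"
   by (rule incseq_SucI) (auto simp: le_fun_def ind_def)
  fix x :: real
  obtain m :: nat where m: "abs x <= real m" using real_arch_simple by blast
  hence "eventually (%n. P (invst x) * en (2 / (1 + x^2)) * ind {- real (Suc n)..real (Suc n)} x = P (invst x) * en (2 / (1 + x^2))) sequentially"
   by (intro eventually_sequentiallyI[of m]) (auto simp: ind_def)
  thus "(%n. P (invst x) * en (2 / (1 + x^2)) * ind {- real (Suc n)..real (Suc n)} x) ----> P (invst x) * en (2 / (1 + x^2))"
   by (rule tendsto_eventually)
 qed measurable
 have "(NL t. ind TP t * P t) = (NL t. ind {- 3 * pi / 2..- 3 * pi / 2 + 2 * pi} t * P t)"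
  by (rule nn_integral_periodic[symmetric]) (auto simp: P)
 also have "... = (NL t. P t * ind {- 3 * pi / 2<..<pi / 2} t)"
  by (intro nn_integral_cong_AE) (use AE_lborel_singleton[of "- 3 * pi / 2"] AE_lborel_singleton[of "pi / 2"] in eventually_elim, auto simp: ind_def)
 also have "... = (NL x. P (invst x) * en (2 / (1 + x^2)))"
  by (rule LIMSEQ_unique[OF L]) (use R in \<open>simp only: sub\<close>)
 finally show ?thesis .
qed

definition lift_line :: "(real => complex) => real => complex" where
 "lift_line u t = u (stereographic (cis t))"

lemma measurable_stereographic: "(%t. stereographic (cis t)) \<in> BM"
 unfolding stereographic_def by simp

lemma per_lift_line: "u \<in> BM ==> per (lift_line u)"
 using measurable_compose[OF measurable_stereographic, of u] by (auto simp: per_def lift_line_def[abs_def] cis_mult[symmetric])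

lemma NN_lift_line:
 assumes [measurable]: "u \<in> BM"
 shows "NN (lift_line u) = gag u"
proof -
 note [measurable] = perD(1)[OF per_lift_line[OF assms]]
 have [measurable]: "invst \<in> BM" unfolding invst_def by measurable
 define k where "k s t = en (1 / csq (cis s - cis t)) * en (dsq (lift_line u) (s, t))" for s t
 have [measurable]: "(%p. k (fst p) (snd p)) \<in> BM2" unfolding k_def by simp
 have [measurable]: "k s \<in> BM" for s unfolding k_def by simp
 have per: "lift_line u (t + 2 * pi) = lift_line u t" "cis (t + 2 * pi) = cis t" for t by (simp_all add: lift_line_def cis_mult[symmetric])
 have "NN (lift_line u) = (NL s. ind TP s * (NL t. ind TP t * k s t))"
  unfolding NN_cm[OF per_lift_line[OF assms]] k_def by (rule nn_integral_cm) simp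
 also have "... = (NL s. ind TP s * (NL y. k s (invst y) * en (2 / (1 + y^2))))"
  by (subst nn_integral_line_circle) (auto simp: k_def per)
 also have "... = (NL x. (NL y. k (invst x) (invst y) * en (2 / (1 + y^2))) * en (2 / (1 + x^2)))"
  by (rule nn_integral_line_circle) (simp_all add: k_def per)
 also have "... = (NL x. NL y. en (1 / (x - y)^2) * en (dsq u (x, y)))"
 proof (intro nn_integral_cong)
  fix x :: real
  have "(NL y. k (invst x) (invst y) * en (2 / (1 + y^2))) * en (2 / (1 + x^2))
   = (NL y. k (invst x) (invst y) * en (2 / (1 + y^2)) * en (2 / (1 + x^2)))"
   by (rule nn_integral_multc[symmetric]) measurable
  also have "... = (NL y. en (1 / (x - y)^2) * en (dsq u (x, y)))"
  proof (intro nn_integral_cong)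
   fix y :: real
   have p: "0 < 1 + x^2" "0 < 1 + y^2" using sum_power2_gt_zero_iff[of 1 x] sum_power2_gt_zero_iff[of 1 y] by simp_all
   have "1 / (4 * c / (a * b)) * D * (2 / b) * (2 / a) = 1 / c * D" if "0 < a" "0 < b" for a b c D :: real
    using that by (simp add: divide_simps)
   from this[OF p] have "1 / (4 * (x - y)^2 / ((1 + x^2) * (1 + y^2))) * D * (2 / (1 + y^2)) * (2 / (1 + x^2)) = 1 / (x - y)^2 * D" for D .
   thus "k (invst x) (invst y) * en (2 / (1 + y^2)) * en (2 / (1 + x^2)) = en (1 / (x - y)^2) * en (dsq u (x, y))"
    unfolding k_def using p by (simp add: ennreal_mult[symmetric] cis_invst_diff lift_line_def)
  qed
  finally show "(NL y. k (invst x) (invst y) * en (2 / (1 + y^2))) * en (2 / (1 + x^2)) = (NL y. en (1 / (x - y)^2) * en (dsq u (x, y)))" .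
 qed
 also have "... = gag u" unfolding gag_def by (subst nn_integral_gm_iter) simp_all
 finally show ?thesis .
qed

lemma umap_lift_line: "u \<in> Hmaps ==> umap (lift_line u)"
 using HmapsD[of u] by (auto simp: umap_def per_lift_line NN_lift_line) (simp add: lift_line_def)

lemma AE_lift_line:
 assumes "AE x in lborel. P x"
 shows "AE t in lborel. P (stereographic (cis t))"
proof -
 from assms obtain N where N: "{x \<in> space lborel. \<not> P x} \<subseteq> N" "N \<in> null_sets lborel"
  by (auto simp: eventually_ae_filter)
 hence [measurable]: "N \<in> sets borel" by auto
 note [measurable] = measurable_stereographic
 let ?Q = "%t. ind N (stereographic (cis t)) :: ennreal"
 have "AE x in lborel. ?Q (invst x) * en (2 / (1 + x^2)) = 0" using AE_not_in[OF N(2)] by eventually_elim simp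
 hence "(NL x. ?Q (invst x) * en (2 / (1 + x^2))) = (\<integral>\<^sup>+x. 0 \<partial>(lborel :: real measure))" by (rule nn_integral_cong_AE)
 moreover have "(NL t. ind TP t * ?Q t) = (NL x. ?Q (invst x) * en (2 / (1 + x^2)))"
  by (rule nn_integral_line_circle) (simp_all add: cis_mult[symmetric])
 moreover have "(NL t. ind {a..a + 2 * pi} t * ?Q t) = (NL t. ind TP t * ?Q t)" for a
  by (rule nn_integral_periodic) (simp_all add: cis_mult[symmetric])
 ultimately have "(NL t. ind {a..a + 2 * pi} t * ?Q t) = 0" for a by simp
 hence "AE t in lborel. ind {a..a + 2 * pi} t * ?Q t = 0" for a by (subst (asm) nn_integral_0_iff_AE) auto
 hence "AE t in lborel. \<forall>n::int. ind {2 * pi * of_int n..2 * pi * of_int n + 2 * pi} t * ?Q t = 0" unfolding AE_all_countable by blast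
 thus ?thesis
 proof eventually_elim
  case (elim t)
  define n where "n = \<lfloor>t / (2 * pi)\<rfloor>"
  have "of_int n <= t / (2 * pi)" "t / (2 * pi) <= of_int n + 1" unfolding n_def by linarith+
  hence "t \<in> {2 * pi * of_int n..2 * pi * of_int n + 2 * pi}" by (auto simp: field_simps)
  hence "?Q t = 0" using elim[rule_format, of n] by simp
  thus ?case using N(1) by (auto simp: ind_def split: if_splits)
 qed
qed

lemma Hhalf_degree_eq:
 assumes "v \<in> Hmaps" "AE x in lborel. u x = v x" "hasdeg (lift_line v) d"
 shows "Hhalf_degree u = d"
proof -
 have "circ_rep (u \<circ> stereographic) (lift_line v)"
  using umap_lift_line[OF assms(1)] AE_lift_line[OF assms(2)] by (simp add: circ_rep_def lift_line_def)
 thus ?thesis unfolding Hhalf_degree_def using assms(3) by (rule circle_degree_eq)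
qed

lemma Hhalf_degree_hasdeg: "v \<in> Hmaps ==> hasdeg (lift_line v) (Hhalf_degree v)"
 using hasdeg_exists[OF umap_lift_line] Hhalf_degree_eq[of v v] by force

lemma Hhalf_degree_AE:
 assumes "v \<in> Hmaps" "AE x in lborel. u x = v x"
 shows "Hhalf_degree u = Hhalf_degree v"
 by (rule Hhalf_degree_eq[OF assms Hhalf_degree_hasdeg[OF assms(1)]])

lemma Hmaps_mult:
 assumes u: "u \<in> Hmaps" and v: "v \<in> Hmaps"
 shows "(%x. u x * v x) \<in> Hmaps"
proof -
 note [measurable] = HmapsD(1)[OF u] HmapsD(1)[OF v]
 have "umap (%t. lift_line u t * lift_line v t)" by (intro umap_mult umap_lift_line u v)
 hence "NN (lift_line (%x. u x * v x)) < \<infinity>" using umapD(3) by (simp add: lift_line_def[abs_def])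
 thus ?thesis using HmapsD(2)[OF u] HmapsD(2)[OF v] by (simp add: Hmaps_def NN_lift_line norm_mult)
qed

lemma Hhalf_degree_mult:
 assumes u: "u \<in> Hmaps" and v: "v \<in> Hmaps"
 shows "Hhalf_degree (%x. u x * v x) = Hhalf_degree u + Hhalf_degree v"
 using hasdeg_mult[OF umap_lift_line[OF u] umap_lift_line[OF v] Hhalf_degree_hasdeg[OF u] Hhalf_degree_hasdeg[OF v]]
 by (intro Hhalf_degree_eq[OF Hmaps_mult[OF u v]]) (simp_all add: lift_line_def[abs_def])

lemma Hhalf_degree_cnj:
 assumes u: "u \<in> Hmaps"
 shows "Hhalf_degree (%x. cnj (u x)) = - Hhalf_degree u"
 using hasdeg_cnj[OF umap_lift_line[OF u] Hhalf_degree_hasdeg[OF u]]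
 by (intro Hhalf_degree_eq[OF Hmaps_cnj[OF u]]) (simp_all add: lift_line_def[abs_def])

lemma gagr_lower_bound:
 assumes u: "u \<in> Hmaps"
 shows "4 * pi^2 * abs (of_int (Hhalf_degree u)) <= gagr u"
 using energy_lower_bound[OF umap_lift_line[OF u] Hhalf_degree_hasdeg[OF u]] gag_eq_gagr[OF HmapsD(1,3)[OF u]] gagr_nonneg[of u]
 by (simp add: NN_lift_line[OF HmapsD(1)[OF u]])

text \<open>Points with \<open>abs x >= 1\<close> correspond to the upper half circle. The
  transferred map is constant for \<open>t\<close> in \<open>[0, pi]\<close>, and as
  \<open>t\<close> runs from \<open>pi\<close> to \<open>2 * pi\<close> the point on the line runs
  from \<open>-1\<close> to \<open>1\<close>, so the whole winding is the increment of the
  phase.\<close>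

lemma Hhalf_degree_local:
 assumes v: "v \<in> Hmaps" and out: "!!x. abs x \<ge> 1 ==> v x = c"
  and th: "continuous_on {-1..1} \<theta>" "!!x. x \<in> {-1..1} ==> v x = cis (\<theta> x)"
  and d: "\<theta> 1 - \<theta> (-1) = 2 * pi * of_int d"
 shows "Hhalf_degree v = d"
proof (rule Hhalf_degree_eq[OF v])
 let ?s = "%t. stereographic (cis t)"
 \<comment> \<open>At the pole \<open>stereographic\<close> has the default value \<open>0\<close>,
   so \<open>lift_line v\<close> takes the value \<open>v 0\<close> there; replacing it by
   \<open>c\<close> on this null set restores continuity.\<close>
 define F where "F t = (if sin t = 1 then c else v (?s t))" for t
 have c: "c = cis (\<theta> 1)" using out[of 1] th(2)[of 1] by simp
 have big: "abs (?s t) \<ge> 1" if "0 <= sin t" "sin t ~= 1" for t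
 proof -
  have s: "sin t < 1" using that(2) sin_le_one[of t] by linarith
  have "(1 - sin t)^2 <= (1 - sin t) * (1 + sin t)" using s that(1) unfolding sq_eq by (intro mult_left_mono) auto
  also have "... = (cos t)^2" by (simp add: cos_squared_eq sq_eq algebra_simps)
  finally have "abs (1 - sin t) <= abs (cos t)" by (simp only: abs_le_square_iff)
  thus ?thesis using s by (simp add: stereographic_def abs_divide)
 qed
 have vc: "continuous_on UNIV v"
 proof -
  have "continuous_on ({-1..1} \<union> ({..-1} \<union> {1..})) v"
  proof (rule continuous_on_closed_Un)
   show "continuous_on {-1..1} v" using continuous_on_cis[OF th(1)] th(2) continuous_on_cong by (metis (no_types, lifting))
   have "continuous_on ({..-1} \<union> {1..}) (%x::real. c)" by simp
   thus "continuous_on ({..-1} \<union> {1..}) v" by (rule continuous_on_eq) (auto simp: out)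
  qed auto
  moreover have "{-1..1} \<union> ({..-1} \<union> {1..}) = (UNIV :: real set)" by auto
  ultimately show ?thesis by simp
 qed
 have scont: "continuous_on S ?s" if "!!t. t \<in> S ==> sin t ~= 1" for S
  unfolding stereographic_def using that by (intro continuous_intros) (auto intro!: continuous_intros)
 have Fc: "continuous_on UNIV F"
 proof -
  have "continuous_on ({t. sin t ~= 1} \<union> {t. 0 < sin t}) F"
  proof (rule continuous_on_open_Un)
   show "open {t::real. sin t ~= 1}" "open {t::real. 0 < sin t}" by (auto intro!: open_Collect_neq open_Collect_less continuous_intros)
   have "continuous_on {t. sin t ~= 1} (%t. v (?s t))" by (rule continuous_on_compose2[OF vc scont]) auto
   thus "continuous_on {t. sin t ~= 1} F" by (rule continuous_on_eq) (auto simp: F_def)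
   have "continuous_on {t::real. 0 < sin t} (%t. c)" by simp
   thus "continuous_on {t. 0 < sin t} F" by (rule continuous_on_eq) (use big in \<open>auto simp: F_def out\<close>)
  qed
  moreover have "{t. sin t ~= 1} \<union> {t. 0 < sin t} = (UNIV :: real set)" by auto
  ultimately show ?thesis by simp
 qed
 have pF: "per F" using Fc by (auto simp: per_def F_def cis_mult[symmetric] intro: borel_cont)
 have F1: "cmod (F t) = 1" for t using HmapsD(2)[OF v] c by (simp add: F_def)
 have w: "wlift F d"
  unfolding wlift_def
 proof (intro exI[of _ "%t. \<i> * of_real (if t <= pi then \<theta> 1 else \<theta> (?s t) + \<theta> 1 - \<theta> (-1))"] conjI ballI)
  have s1: "sin t ~= 1 \<and> abs (?s t) <= 1" if "t \<in> {pi..2 * pi}" for t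
  proof -
   have s: "sin t <= 0" using that sin_le_zero[of t] by (cases "t = 2 * pi") auto
   have "(cos t)^2 = (1 - sin t) * (1 + sin t)" by (simp add: cos_squared_eq sq_eq algebra_simps)
   also have "... <= (1 - sin t)^2" using s unfolding sq_eq by (intro mult_left_mono) auto
   finally have "abs (cos t) <= abs (1 - sin t)" by (simp only: abs_le_square_iff)
   thus ?thesis using s by (simp add: stereographic_def abs_divide)
  qed
  have ends: "?s pi = -1" "?s (2 * pi) = 1" "stereographic 1 = 1" by (simp_all add: stereographic_def)
  have "continuous_on ({0..pi} \<union> {pi..2 * pi}) (%t. if t <= pi then \<theta> 1 else \<theta> (?s t) + \<theta> 1 - \<theta> (-1))"
  proof (rule continuous_on_If)
   show "continuous_on {pi..2 * pi} (%t. \<theta> (?s t) + \<theta> 1 - \<theta> (-1))"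
    by (intro continuous_intros continuous_on_compose2[OF th(1) scont]) (use s1 in \<open>fastforce simp: abs_le_iff\<close>)+
  qed (use ends in auto)
  moreover have "{0..pi} \<union> {pi..2 * pi} = TP" by auto
  ultimately show "continuous_on TP (%t. \<i> * of_real (if t <= pi then \<theta> 1 else \<theta> (?s t) + \<theta> 1 - \<theta> (-1)))" by (intro continuous_intros) auto
  show "\<i> * of_real (if 2 * pi <= pi then \<theta> 1 else \<theta> (?s (2 * pi)) + \<theta> 1 - \<theta> (-1)) - \<i> * of_real (if 0 <= pi then \<theta> 1 else \<theta> (?s 0) + \<theta> 1 - \<theta> (-1)) = 2 * of_real pi * \<i> * of_int d"
   using d pi_gt_zero by (auto simp: ends complex_eq_iff)
  fix t assume t: "t \<in> TP"
  show "F t = exp (\<i> * of_real (if t <= pi then \<theta> 1 else \<theta> (?s t) + \<theta> 1 - \<theta> (-1)))"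
  proof (cases "t <= pi")
   case True
   hence "0 <= sin t" using t sin_ge_zero by auto
   thus ?thesis using True big[of t] by (auto simp: F_def out c cis_conv_exp)
  next
   case False
   hence "sin t ~= 1" "?s t \<in> {-1..1}" using s1[of t] t by (auto simp: abs_le_iff)
   moreover have "cis (\<theta> (?s t) + \<theta> 1 - \<theta> (-1)) = cis (\<theta> (?s t))"
    using d cis_multiple_2pi[of "of_int d"] by (simp add: add_diff_eq[symmetric] cis_mult[symmetric] del: add_diff_eq)
   ultimately show ?thesis using False unfolding cis_conv_exp[symmetric] by (simp add: F_def th(2))
  qed
 qed
 have "AE t in lborel. F t = lift_line v t"
 proof -
  have "AE x in lborel. x ~= (0::real)" by (rule AE_lborel_singleton)
  from AE_lift_line[OF this] show ?thesis by eventually_elim (auto simp: F_def lift_line_def stereographic_def)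
 qed
 thus "hasdeg (lift_line v) d"
  using hasdeg_AE[OF perD(1)[OF pF] perD(1)[OF per_lift_line[OF HmapsD(1)[OF v]]] _ hasdeg_continuous[OF pF Fc F1 w]] by blast
qed simp

subsection \<open>Existence of minimizers in a degree class\<close>

lemma integral_arc_eq_l2:
 assumes [measurable]: "F \<in> BM"
 shows "(\<integral>\<^sup>+t. en (csq (F t)) \<partial>arcm) = l2 F"
 unfolding arcm_def l2_def by (subst nn_integral_density) (auto intro!: nn_integral_cong split: split_indicator)

text \<open>At scale \<open>e^2\<close> the squared L2 defect is O(\<open>e^2\<close>), and Young's
  inequality with parameter \<open>e\<close> turns it into an L1 defect of order \<open>e\<close>.
  Taking a square as scale avoids roots.\<close>

lemma l1_avg_minus:
 assumes F: "umap F" and C: "NN F <= en C" "0 <= C" and e: "0 < e" "e <= 1"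
 shows "(IA t. cmod (avg (e^2) F t - F t)) <= e * (C + 2 * pi)"
proof -
 note m = umapD[OF F]
 note [measurable] = m(4)
 have "e^2 <= 1" using e by (simp add: power_le_one)
 hence e2: "0 < e^2" "e^2 <= 2 * pi" using e pi_ge_two by simp_all
 let ?V = "%t. avg (e^2) F t - F t"
 have [measurable]: "avg (e^2) F \<in> BM" by (intro perD(1) per_avg m e2)
 have V2: "cmod (?V t) <= 2" for t using norm_triangle_ineq4[of "avg (e^2) F t" "F t"] avg_le1[OF m(4,5), of "e^2" t] m(2)[of t] by simp
 have V4: "cmod (?V t^2) <= 4" for t using power_mono[OF V2[of t], of 2] by (simp add: norm_power)
 have i: "integrable arcm (%t. cmod (?V t))" "integrable arcm (%t. csq (?V t))"
  using integrable_norm[OF integrable_arc[of ?V 2]] integrable_norm[OF integrable_arc[of "%t. ?V t^2" 4]] V2 V4 by (auto simp: norm_power)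
 let ?a = "IA t. csq (?V t)"
 have "en ?a = l2 ?V" using i by (simp add: nn_integral_eq_integral integral_arc_eq_l2[symmetric])
 also have "... <= en (e^2) * NN F" by (rule l2_avg_minus[OF m(1,5) e2])
 also have "... <= en (e^2 * C)" using C mult_left_mono[OF C(1), of "en (e^2)"] by (simp add: ennreal_mult)
 finally have le: "?a <= e^2 * C" using C by (subst (asm) ennreal_le_iff) auto
 have "(IA t. cmod (?V t)) <= (IA t. 1 / e * csq (?V t) + e)"
 proof (intro integral_mono)
  fix t
  have "a <= 1 / e * a^2 + e" if "0 <= a" for a
  proof -
   have "a * e <= a^2 + e^2" using sum_squares_bound[of a e] mult_nonneg_nonneg[OF that, of e] e by argo
   hence "a * e / e <= (a^2 + e^2) / e" using e by (intro divide_right_mono) auto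
   thus ?thesis using e by (simp add: add_divide_distrib sq_eq)
  qed
  thus "cmod (?V t) <= 1 / e * csq (?V t) + e" by simp
 qed (use i in auto)
 also have "... = 1 / e * ?a + 2 * pi * e" using i by simp
 also have "... <= 1 / e * (e^2 * C) + 2 * pi * e" using le e by (intro add_mono mult_left_mono) auto
 finally show ?thesis using e by (simp add: sq_eq algebra_simps)
qed

text \<open>Compactness in the manner of Kolmogorov and Riesz. At each dyadic scale the averages are
  bounded and equi-Lipschitz, so Arzela-Ascoli and a diagonal argument give one subsequence along
  which all scales converge uniformly. By \<open>l1_avg_minus\<close> the maps are L1-close to their
  averages uniformly in \<open>k\<close>, hence Cauchy in L1, and a further subsequence is Cauchy
  almost everywhere.\<close>

lemma circle_compactness:
 assumes F: "!!k::nat. umap (F k)" and C: "!!k. NN (F k) <= en C" "0 <= C"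
 obtains r where "strict_mono r" "AE t in arcm. Cauchy (%k. F (r k) t)"
proof -
 note m = umapD[OF F]
 note [measurable] = m(4)
 define A where "A i k = avg ((1 / 2 ^ i)^2) (F k)" for i :: nat and k
 define P where "P i s = (\<exists>g. \<forall>e>0. \<exists>N. \<forall>n x. n \<ge> N \<and> x \<in> TP --> cmod (A i (s n) x - g x) < e)" for i and s :: "nat => nat"
 obtain s where s: "strict_mono s" "!!i. P i (id \<circ> s)"
 proof (rule subsequence_diagonalization_lemma[of P id])
  fix i and r :: "nat => nat"
  have d: "0 < ((1::real) / 2 ^ i)^2" by simp
  obtain g k where "strict_mono (k :: nat => nat)" "!!e. 0 < e ==> \<exists>N. \<forall>n x. n \<ge> N \<and> x \<in> TP --> cmod (A i (r (k n)) x - g x) < e"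
  proof (rule Arzela_Ascoli[of "TP" "%n. A i (r n)" 1])
   show "cmod (A i (r n) x) <= 1" for n x unfolding A_def by (rule avg_le1[OF m(4,5)])
   fix x e :: real assume "0 < e"
   let ?L = "2 / (1 / 2 ^ i)^2 :: real"
   have L: "0 < ?L" by simp
   show "\<exists>d>0. \<forall>n y. y \<in> TP \<and> norm (x - y) < d --> cmod (A i (r n) x - A i (r n) y) < e"
   proof (intro exI[of _ "e / ?L"] conjI allI impI)
    show "0 < e / ?L" using \<open>0 < e\<close> L by simp
    fix n y assume "y \<in> TP \<and> norm (x - y) < e / ?L"
    hence "?L * abs (x - y) < e" using L by (simp only: pos_less_divide_eq real_norm_def mult.commute[of ?L])
    thus "cmod (A i (r n) x - A i (r n) y) < e"
     unfolding A_def using avg_lipschitz[OF m(4,5) d, of "r n" x y] by (rule le_less_trans[rotated])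
   qed
  qed auto
  thus "\<exists>k::nat => nat. strict_mono k \<and> P i (r \<circ> k)" unfolding P_def o_def by blast
 next
  fix i N and r k1 k2 :: "nat => nat"
  assume P1: "P i (r \<circ> k1)" and k: "!!j. N <= j ==> \<exists>j'. j <= j' \<and> k2 j = k1 j'"
  from P1 obtain g where g: "!!e. 0 < e ==> \<exists>N. \<forall>n x. n \<ge> N \<and> x \<in> TP --> cmod (A i ((r \<circ> k1) n) x - g x) < e" unfolding P_def by blast
  show "P i (r \<circ> k2)" unfolding P_def
  proof (intro exI[of _ g] allI impI)
   fix e :: real assume "0 < e"
   with g obtain M where M: "!!n x. n \<ge> M ==> x \<in> TP ==> cmod (A i ((r \<circ> k1) n) x - g x) < e" by blast
   show "\<exists>N. \<forall>n x. n \<ge> N \<and> x \<in> TP --> cmod (A i ((r \<circ> k2) n) x - g x) < e"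
   proof (intro exI[of _ "max M N"] allI impI)
    fix n x assume n: "n \<ge> max M N \<and> x \<in> TP"
    then obtain j where "n <= j" "k2 n = k1 j" using k by force
    thus "cmod (A i ((r \<circ> k2) n) x - g x) < e" using M[of j x] n by simp
   qed
  qed
 qed blast
 have i1: "integrable arcm (F k)" for k by (rule integrable_arc[of _ 1]) (use m in auto)
 have iA: "integrable arcm (A i k)" for i k unfolding A_def
  by (rule integrable_arc[of _ 1]) (auto intro!: perD(1) per_avg m avg_le1)
 have cau: "\<exists>N. \<forall>i\<ge>N. \<forall>j\<ge>N. (IA t. norm (F (s i) t - F (s j) t)) < e" if e: "0 < e" for e
 proof -
  define B where "B = 2 * (C + 2 * pi) + 4 * pi + 1"
  have B: "0 < B" using C(2) by (simp add: B_def add_nonneg_pos)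
  obtain n :: nat where "(1 / 2) ^ n < e / B" using real_arch_pow_inv[of "e / B" "1 / 2"] e B by auto
  define h where "h = (1::real) / 2 ^ n"
  have h: "0 < h" "h <= 1" "h * B < e" using \<open>(1 / 2) ^ n < e / B\<close> B by (auto simp: h_def field_simps power_divide)
  obtain g where g: "!!e. 0 < e ==> \<exists>N. \<forall>k x. k \<ge> N \<and> x \<in> TP --> cmod (A n (s k) x - g x) < e"
   using s(2)[of n] unfolding P_def by auto
  obtain N where N: "!!k x. k \<ge> N ==> x \<in> TP ==> cmod (A n (s k) x - g x) < h" using g[OF h(1)] by blast
  have "(IA t. norm (F (s i) t - F (s j) t)) < e" if ij: "N <= i" "N <= j" for i j
  proof -
   let ?a = "%t. A n (s i) t - F (s i) t"
   have "(IA t. norm (F (s i) t - F (s j) t)) <= (IA t. cmod (?a t) + cmod (A n (s j) t - F (s j) t) + 2 * h)"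
   proof (intro integral_mono_AE AE_arcI)
    fix t assume t: "t \<in> TP"
    have "F (s i) t - F (s j) t = (A n (s j) t - F (s j) t) - ?a t + ((A n (s i) t - g t) - (A n (s j) t - g t))" by simp
    also have "cmod ... <= (cmod (A n (s j) t - F (s j) t) + cmod (?a t)) + (cmod (A n (s i) t - g t) + cmod (A n (s j) t - g t))"
     by (intro order_trans[OF norm_triangle_ineq] add_mono norm_triangle_ineq4)
    finally show "norm (F (s i) t - F (s j) t) <= cmod (?a t) + cmod (A n (s j) t - F (s j) t) + 2 * h"
     using N[OF ij(1) t] N[OF ij(2) t] by linarith
   qed (use i1 iA in auto)
   also have "... = (IA t. cmod (?a t)) + (IA t. cmod (A n (s j) t - F (s j) t)) + 4 * pi * h"
    using i1 iA by simp
   also have "... <= h * (C + 2 * pi) + h * (C + 2 * pi) + 4 * pi * h"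
    unfolding A_def h_def[symmetric] by (intro add_mono l1_avg_minus F C h) simp
   also have "... <= h * B" using h by (simp add: B_def algebra_simps)
   finally show ?thesis using h by simp
  qed
  thus ?thesis by blast
 qed
 obtain r where r: "strict_mono r" "AE t in arcm. Cauchy (%i. F (s (r i)) t)"
  by (rule cauchy_L1_AE_cauchy_subseq[of arcm "%i. F (s i)"]) (use i1 cau in auto)
 thus ?thesis using that[of "s \<circ> r"] strict_mono_o[OF s(1) r(1)] r(2) by (simp add: o_def)
qed

lemma line_compactness:
 assumes v: "!!k::nat. v k \<in> Hmaps" and C: "!!k. gagr (v k) <= C"
  and g: "g \<in> BM" "!!x. cmod (g x) = 1" and out: "!!k x. x \<notin> {-1<..<1} ==> v k x = g x"
 obtains r u where "strict_mono r" "u \<in> Hmaps" "!!x. x \<notin> {-1<..<1} ==> u x = g x" "AE x in lborel. (%k. v (r k) x) ----> u x"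
proof -
 note m = HmapsD[OF v]
 note [measurable] = m(1) g(1) measurable_stereographic
 have gagC: "gag (v k) <= en C" for k using gag_eq_gagr[OF m(1,3)] C[of k] by (simp add: ennreal_leI)
 have "0 <= C" using gagr_nonneg[of "v 0"] C[of 0] by linarith
 with gagC obtain r where r: "strict_mono r" "AE t in arcm. Cauchy (%k. lift_line (v (r k)) t)"
  using circle_compactness[of "%k. lift_line (v k)" C] umap_lift_line[OF v] by (auto simp: NN_lift_line)
 let ?Q = "%t. (if Cauchy (%k. v (r k) (stereographic (cis t))) then 0 else 1) :: ennreal"
 have [measurable]: "?Q \<in> BM" by measurable
 let ?a = "%x. %k. v (r k) x"
 have "AE t in lborel. ind TP t * ?Q t = 0"
  using r(2) unfolding arcm_def lift_line_def by (subst (asm) AE_density) (auto simp: ind_def elim!: eventually_mono)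
 hence "(NL t. ind TP t * ?Q t) = 0" by (subst nn_integral_0_iff_AE) auto
 moreover have "(NL t. ind TP t * ?Q t) = (NL x. ?Q (invst x) * en (2 / (1 + x^2)))"
  by (rule nn_integral_line_circle) (simp_all add: cis_mult[symmetric])
 ultimately have "(NL x. ?Q (invst x) * en (2 / (1 + x^2))) = 0" by (simp only:)
 moreover have [measurable]: "invst \<in> BM" unfolding invst_def by measurable
 ultimately have "AE x in lborel. ?Q (invst x) * en (2 / (1 + x^2)) = 0"
  by (subst (asm) nn_integral_0_iff_AE; (measurable | assumption))
 hence cau: "AE x in lborel. Cauchy (?a x)"
 proof eventually_elim
  case (elim x)
  have "0 < 2 / (1 + x^2)" using sum_power2_gt_zero_iff[of 1 x] by simp
  thus ?case using elim by (auto split: if_splits)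
 qed
 \<comment> \<open>Outside I the common boundary values are inserted, so they hold at every point;
   inside, \<open>g\<close> is the default where the sequence is not Cauchy.\<close>
 define u where "u x = (if x \<in> {-1<..<1} \<and> Cauchy (?a x) then lim (?a x) else g x)" for x
 have [measurable]: "u \<in> BM" unfolding u_def by measurable
 have conv: "?a x ----> u x" if "Cauchy (?a x)" for x
  using that by (cases "x \<in> {-1<..<1}") (auto simp: u_def out Cauchy_convergent_iff convergent_LIMSEQ_iff)
 have u1: "cmod (u x) = 1" for x
 proof (cases "x \<in> {-1<..<1} \<and> Cauchy (?a x)")
  case True
  hence "(%k. cmod (v (r k) x)) ----> cmod (u x)" using conv by (intro tendsto_norm) auto
  thus ?thesis using m(2) by (simp add: LIMSEQ_const_iff)
 qed (auto simp: u_def g)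
 have "gag u <= en C"
 proof -
  have "gag u = (NG p. liminf (%k. en (dsq (v (r k)) p)))"
   unfolding gag_def
  proof (rule nn_integral_cong_AE)
   show "AE p in gm. en (dsq u p) = liminf (%k. en (dsq (v (r k)) p))"
    using AE_lborel_imp_AE_gm[OF cau]
   proof eventually_elim
    case (elim p)
    hence "(%k. en (dsq (v (r k)) p)) ----> en (dsq u p)" by (intro tendsto_ennrealI tendsto_intros conv) auto
    from lim_imp_Liminf[OF sequentially_bot this] show ?case ..
   qed
  qed
  also have "... <= liminf (%k. gag (v (r k)))"
   unfolding gag_def by (rule nn_integral_liminf) measurable
  also have "... <= liminf (%k::nat. en C)" by (intro Liminf_mono always_eventually allI gagC)
  finally show ?thesis by (simp add: Liminf_const)
 qed
 hence uH: "u \<in> Hmaps" using u1 by (auto simp: Hmaps_def intro: le_less_trans)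
 have o: "x \<notin> {-1<..<1} ==> u x = g x" for x by (auto simp: u_def)
 have "AE x in lborel. ?a x ----> u x" using cau by eventually_elim (rule conv)
 thus ?thesis using that[OF r(1) uH] o by blast
qed

lemma gagr_mult_le:
 assumes u: "u \<in> Hmaps" and v: "v \<in> Hmaps"
 shows "gagr (%x. u x * v x) <= 2 * gagr u + 2 * gagr v"
proof -
 have "NN (%t. lift_line u t * lift_line v t) <= 2 * NN (lift_line u) + 2 * NN (lift_line v)"
  by (intro nd_mult_le umap_lift_line u v)
 hence "gag (%x. u x * v x) <= 2 * gag u + 2 * gag v"
  using NN_lift_line[OF HmapsD(1)[OF u]] NN_lift_line[OF HmapsD(1)[OF v]] NN_lift_line[OF HmapsD(1)[OF Hmaps_mult[OF u v]]] by (simp add: lift_line_def[abs_def])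
 moreover have "2 * en a + 2 * en b = en (2 * a + 2 * b)" if "0 <= a" "0 <= b" for a b
  using that by (simp add: ennreal_mult ennreal_plus)
 ultimately have "en (gagr (%x. u x * v x)) <= en (2 * gagr u + 2 * gagr v)"
  using gag_eq_gagr[OF HmapsD(1,3)[OF u]] gag_eq_gagr[OF HmapsD(1,3)[OF v]] gag_eq_gagr[OF HmapsD(1,3)[OF Hmaps_mult[OF u v]]]
  by (simp only: gagr_nonneg)
 thus ?thesis by (subst (asm) ennreal_le_iff) (simp_all add: gagr_nonneg)
qed

text \<open>The sequence is factored as \<open>u * z k\<close>, where \<open>u\<close> is its limit
  and \<open>z k\<close> tends to \<open>1\<close>; additivity of the degree assigns
  \<open>d - Hhalf_degree u\<close> to \<open>z k\<close>. The degree of \<open>u\<close> is not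
  known in advance, which is why \<open>E0\<close> must bound the energy in all degrees with the
  given boundary values.\<close>

lemma minimizer_exists:
 fixes g :: "real => complex" and d :: int
 defines "K \<equiv> {v \<in> Hmaps. \<forall>x. x \<notin> {-1<..<1} --> v x = g x}"
 assumes g: "g \<in> BM" "!!x. cmod (g x) = 1"
  and low: "!!v. v \<in> K ==> E0 <= gagr v"
  and w: "w \<in> K" "Hhalf_degree w = d" "gagr w < E0 + 4 * pi^2"
 obtains u where "u \<in> K" "Hhalf_degree u = d" "!!v. v \<in> K ==> Hhalf_degree v = d ==> gagr u <= gagr v"
proof -
 define S where "S = gagr ` {v \<in> K. Hhalf_degree v = d}"
 have S: "S ~= {}" "bdd_below S" using w(1,2) by (auto simp: S_def intro!: bdd_belowI[of _ 0] gagr_nonneg)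
 define m where "m = Inf S"
 have mle: "m <= gagr v" if "v \<in> K" "Hhalf_degree v = d" for v unfolding m_def by (rule cInf_lower) (use S that in \<open>auto simp: S_def\<close>)
 have "\<exists>v. v \<in> K \<and> Hhalf_degree v = d \<and> gagr v < m + 1 / real (Suc k)" for k
 proof -
  have "Inf S < m + 1 / real (Suc k)" by (simp add: m_def)
  from cInf_lessD[OF S(1) this] show ?thesis by (auto simp: S_def)
 qed
 then obtain v where v: "!!k. v k \<in> K" "!!k. Hhalf_degree (v k) = d" "!!k. gagr (v k) < m + 1 / real (Suc k)" by metis
 have vH: "v k \<in> Hmaps" "x \<notin> {-1<..<1} ==> v k x = g x" for k x using v(1)[of k] by (auto simp: K_def)
 have bd: "gagr (v k) <= m + 1" for k using v(3)[of k] divide_le_eq_1[of 1 "real (Suc k)"] by (auto intro: less_imp_le order_trans)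
 have lm: "(%k. gagr (v k)) ----> m"
 proof (rule tendsto_sandwich[OF _ _ tendsto_const])
  show "(%k. m + 1 / real (Suc k)) ----> m" using tendsto_add[OF tendsto_const LIMSEQ_Suc[OF lim_1_over_n], of m] by simp
 qed (auto intro!: always_eventually mle v less_imp_le[OF v(3)] simp del: of_nat_Suc)
 obtain r u where r: "strict_mono r" and u: "u \<in> Hmaps" "!!x. x \<notin> {-1<..<1} ==> u x = g x" and lim: "AE x in lborel. (%k. v (r k) x) ----> u x"
  using line_compactness[of v, OF vH(1) bd g vH(2)] by blast
 have uK: "u \<in> K" using u by (simp add: K_def)
 define z where "z k x = v (r k) x * cnj (u x)" for k x
 have zH: "z k \<in> Hmaps" for k unfolding z_def by (intro Hmaps_mult vH Hmaps_cnj u)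
 have uu: "u x * cnj (u x) = 1" for x using HmapsD(2)[OF u(1), of x] by (simp add: complex_norm_square[symmetric])
 have uz: "(%x. u x * z k x) = v (r k)" for k using uu by (auto simp: z_def mult.left_commute)
 have "(%k. gagr (%x. u x * z k x) - gagr u - gagr (z k)) ----> 0"
 proof (rule energy_splitting[OF u(1) zH])
  show "gagr (z k) <= 2 * (m + 1) + 2 * gagr u" for k
   using gagr_mult_le[OF vH(1) Hmaps_cnj[OF u(1)], of "r k"] bd[of "r k"] by (simp add: z_def[abs_def])
  show "AE x in lborel. (%k. z k x) ----> 1" using lim
  proof eventually_elim
   case (elim x)
   from tendsto_mult[OF this tendsto_const[of "cnj (u x)"]] show ?case by (simp add: z_def uu)
  qed
 qed
 hence "(%k. gagr (v (r k)) - (gagr (v (r k)) - gagr u - gagr (z k))) ----> m - 0"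
  unfolding uz by (intro tendsto_diff LIMSEQ_subseq_LIMSEQ[OF lm r, unfolded o_def])
 hence lz: "(%k. gagr u + gagr (z k)) ----> m" by simp
 have dz: "Hhalf_degree (z k) = d - Hhalf_degree u" for k
  unfolding z_def using Hhalf_degree_mult[OF vH(1) Hmaps_cnj[OF u(1)], of "r k"] v(2) by (simp add: Hhalf_degree_cnj[OF u(1)])
 have "Hhalf_degree u = d"
 proof (rule ccontr)
  assume ne: "Hhalf_degree u ~= d"
  have "E0 + 4 * pi^2 <= gagr u + gagr (z k)" for k
  proof -
   have "(1::real) <= abs (of_int (d - Hhalf_degree u))" using ne by linarith
   hence "4 * pi^2 * 1 <= 4 * pi^2 * abs (of_int (d - Hhalf_degree u))" by (intro mult_left_mono) auto
   also have "... <= gagr (z k)" using gagr_lower_bound[OF zH[of k]] by (simp add: dz)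
   finally show ?thesis using low[OF uK] by simp
  qed
  hence "E0 + 4 * pi^2 <= m" by (intro LIMSEQ_le_const[OF lz]) auto
  thus False using mle[OF w(1,2)] w(3) by simp
 qed
 moreover have "gagr u <= m" by (rule LIMSEQ_le_const[OF lz]) (auto simp: gagr_nonneg)
 ultimately show ?thesis using that[OF uK] mle by (meson order_trans)
qed

section \<open>Classes up to null sets, half-harmonicity of minimizers\<close>

lemma gagliardo_AE:
 assumes "AE x in lborel. u x = v x" shows "gagliardo u = gagliardo v"
proof -
 have e: "AE x in lebesgue. u x = v x" using assms by (rule AE_completion)
 show ?thesis
  unfolding gagliardo_def
  by (rule nn_integral_cong_AE) (use e in eventually_elim, rule nn_integral_cong_AE, use e in eventually_elim, simp)
qed

text \<open>Each member of \<open>energy_class g\<close> has a representative here when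
  \<open>g\<close> is a Borel unit map. Prescribing the exterior values at every point makes the set
  stable under multiplication by maps equal to \<open>1\<close> there.\<close>

definition bdry :: "(real => complex) => (real => complex) set" where
 "bdry g = {v \<in> Hmaps. \<forall>x. x \<notin> {-1<..<1} --> v x = g x}"

lemma Hmaps_Hhalf: "v \<in> Hmaps ==> AE x in lborel. u x = v x ==> u \<in> Hhalf"
proof -
 assume v: "v \<in> Hmaps" and e: "AE x in lborel. u x = v x"
 note m = HmapsD[OF v]
 have e': "AE x in lebesgue. v x = u x" using AE_completion[OF e] by eventually_elim simp
 have "u \<in> borel_measurable lebesgue" using measurable_lebesgue_AE[OF _ e'] m(1) by (simp add: measurable_completion)
 moreover have "AE x in lebesgue. cmod (u x) = 1" using e' by eventually_elim (metis m(2))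
 ultimately show ?thesis using m(3) gagliardo_AE[OF e] gagliardo_eq_gag[OF m(1)] by (simp add: Hhalf_def)
qed

lemma bdry_energy_class: "v \<in> bdry g ==> v \<in> energy_class g"
 using Hmaps_Hhalf[of v v] by (auto simp: bdry_def energy_class_def)

lemma energy_class_representative:
 assumes u: "u \<in> energy_class g" and g: "g \<in> BM" "!!x. cmod (g x) = 1"
 obtains v where "v \<in> bdry g" "AE x in lborel. u x = v x"
proof -
 have H: "u \<in> borel_measurable lebesgue" "AE x in lebesgue. cmod (u x) = 1" "gagliardo u < \<infinity>"
  and o: "AE x in lborel. x \<notin> {-1<..<1} --> u x = g x" using u by (auto simp: energy_class_def Hhalf_def AE_completion_iff)
 obtain u' where u': "u' \<in> BM" "!!x. cmod (u' x) = 1" "AE x in lborel. u x = u' x"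
  using unit_borel_representative[OF H(1,2)] by blast
 define v where "v x = (if x \<in> {-1<..<1} then u' x else g x)" for x
 have v: "v \<in> BM" unfolding v_def using u'(1) g(1) by measurable
 have e: "AE x in lborel. u x = v x" using u'(3) o by eventually_elim (auto simp: v_def)
 have "gag v < \<infinity>" using gagliardo_eq_gag[OF v] gagliardo_AE[OF e] H(3) by simp
 hence "v \<in> Hmaps" using v u'(2) g(2) by (simp add: Hmaps_def) (simp add: v_def)
 thus ?thesis using e by (intro that[of v]) (auto simp: bdry_def v_def)
qed

lemma energy_le_iff:
 assumes u: "u \<in> Hmaps" and v: "v \<in> Hmaps"
 shows "energy u <= energy v \<longleftrightarrow> gagr u <= gagr v"
proof -
 have "energy w = en (1 / (2 * pi) * gagr w)" if "w \<in> Hmaps" for w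
  using gag_eq_gagr[OF HmapsD(1,3)[OF that]] gagliardo_eq_gag[OF HmapsD(1)[OF that]] gagr_nonneg[of w]
  by (simp add: energy_def ennreal_mult[symmetric])
 hence "energy u <= energy v \<longleftrightarrow> 1 / (2 * pi) * gagr u <= 1 / (2 * pi) * gagr v"
  using u v gagr_nonneg[of v] by (simp only:) (simp add: ennreal_le_iff)
 thus ?thesis by (simp add: divide_le_cancel)
qed

lemma bdry_mult:
 assumes v: "v \<in> bdry g" and w: "w \<in> Hmaps" "!!x. x \<notin> {-1<..<1} ==> w x = 1"
 shows "(%x. v x * w x) \<in> bdry g"
 using v Hmaps_mult[of v w] w by (auto simp: bdry_def)

text \<open>Finiteness is read off on the circle: the bound \<open>K\<close> says that the energy
  density is at most a multiple of the product of the Jacobians \<open>2 / (1 + x^2)\<close> and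
  \<open>2 / (1 + y^2)\<close>, each of total mass \<open>2 * pi\<close>. This treats the diagonal
  and infinity in one stroke.\<close>

lemma test_function_energy:
 assumes t: "f \<in> test_functions"
 shows "continuous_on UNIV f" "x \<notin> {-1<..<1} ==> f x = 0" "gag f < \<infinity>"
proof -
 have df: "!!n x. (deriv ^^ n) f differentiable (at x)" and sub: "closure {x. f x ~= 0} \<subseteq> {-1<..<1}"
  using t by (auto simp: test_functions_def)
 have D: "(f has_real_derivative deriv f x) (at x)" for x
  using df[of 0 x] by (simp add: field_differentiable_derivI real_differentiable_def field_differentiable_def)
 show c: "continuous_on UNIV f" using df[of 0] by (simp add: continuous_at_imp_continuous_on differentiable_imp_continuous_within)
 have z: "f x = 0" if "x \<notin> {-1<..<1}" for x using sub that closure_subset[of "{x. f x ~= 0}"] by auto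
 thus "x \<notin> {-1<..<1} ==> f x = 0" .
 have [measurable]: "f \<in> BM" by (rule borel_cont[OF c])
 have dc: "continuous_on UNIV (deriv f)" using df[of 1] by (simp add: continuous_at_imp_continuous_on differentiable_imp_continuous_within)
 have "compact (deriv f ` {-1..1})" "compact (f ` {-1..1})" by (auto intro: compact_continuous_image continuous_on_subset[OF c] continuous_on_subset[OF dc])
 then obtain L M where L: "!!x. x \<in> {-1..1} ==> (abs (deriv f x)) <= L" and M: "0 < M" "!!x. x \<in> {-1..1} ==> (abs (f x)) <= M"
  using compact_imp_bounded bounded_pos real_norm_def by (metis imageI)
 have L0: "0 <= L" using L[of 0] by simp
 have lip: "abs (f x - f y) <= L * abs (x - y)" for x y
 proof -
  have in1: "abs (f x - f y) <= L * abs (x - y)" if "x \<in> {-1..1}" "y \<in> {-1..1}" for x y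
   using field_differentiable_bound[of "{-1..1}" f "deriv f" L x y] that L D by (auto intro: has_field_derivative_at_within)
  \<comment> \<open>Projection to \<open>[-1,1]\<close> leaves \<open>f\<close> unchanged, since
    \<open>f\<close> vanishes from the end points on; the Lipschitz bound thus extends to the
    line.\<close>
  define p where "p x = max (-1) (min 1 x)" for x :: real
  have "f (p x) = f x" for x using z[of x] z[of "p x"] by (cases "x \<in> {-1<..<1}") (auto simp: p_def max_def min_def)
  hence "abs (f x - f y) <= L * abs (p x - p y)" using in1[of "p x" "p y"] by (simp add: p_def)
  also have "... <= L * abs (x - y)" using L0 by (intro mult_left_mono) (auto simp: p_def)
  finally show ?thesis .
 qed
 have M2: "abs (f x - f y) <= 2 * M" for x y
 proof -
  have "abs (f x) <= M" for x using M z[of x] by (cases "x \<in> {-1..1}") auto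
  thus ?thesis using abs_triangle_ineq4[of "f x" "f y"] by (smt (verit))
 qed
 define C where "C = 6 * L^2 + 16 * M^2"
 have K: "(f x - f y)^2 * ((1 + x^2) * (1 + y^2)) <= C * (x - y)^2" for x y
 proof -
  have 1: "(f x - f y)^2 * ((1 + x^2) * (1 + y^2)) <= C * (x - y)^2" if "abs x < 1" for x y
  proof -
   define s where "s = (x - y)^2"
   have "x^2 <= 1" using that by (simp add: abs_square_le_1)
   moreover have "y^2 <= 2 * x^2 + 2 * s" using zero_le_power2[of "2 * x - y"] unfolding s_def by (simp add: sq_eq algebra_simps)
   ultimately have "(1 + x^2) * (1 + y^2) <= 2 * (3 + 2 * s)" by (intro mult_mono) auto
   hence "(f x - f y)^2 * ((1 + x^2) * (1 + y^2)) <= (f x - f y)^2 * (2 * (3 + 2 * s))" by (intro mult_left_mono) auto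
   also have "... = 6 * (f x - f y)^2 + (f x - f y)^2 * (4 * s)" by (simp add: algebra_simps)
   also have "... <= 6 * (L^2 * s) + (2 * M)^2 * (4 * s)"
   proof (intro add_mono mult_left_mono mult_right_mono)
    show "(f x - f y)^2 <= L^2 * s" using power_mono[OF lip[of x y], of 2] by (simp add: power_mult_distrib s_def)
    show "(f x - f y)^2 <= (2 * M)^2" using power_mono[OF M2[of x y], of 2] by simp
   qed (auto simp: s_def)
   finally show ?thesis by (simp add: C_def s_def algebra_simps)
  qed
  consider "abs x < 1" | "abs y < 1" | "1 <= abs x" "1 <= abs y" by linarith
  thus ?thesis
  proof cases
   case 2
   thus ?thesis using 1[of y x] by (simp add: power2_commute mult.commute)
  next
   case 3
   hence "f x = 0" "f y = 0" by (auto intro!: z)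
   thus ?thesis by (simp add: C_def)
  qed (rule 1)
 qed
 let ?a = "%x. NL x. en (2 / (1 + x^2))"
 have "gag f = (NL x. NL y. en (1 / (x - y)^2) * en (dsq f (x, y)))"
  unfolding gag_def by (subst nn_integral_gm_iter) simp_all
 also have "... <= (NL x. NL y. en C * en (2 / (1 + x^2)) * en (2 / (1 + y^2)))"
 proof (intro nn_integral_mono)
  fix x y :: real
  have p: "0 < 1 + x^2" "0 < 1 + y^2" using sum_power2_gt_zero_iff[of 1 x] sum_power2_gt_zero_iff[of 1 y] by simp_all
  have "1 / s * d <= C * (2 / a) * (2 / b)" if "d * (a * b) <= C * s" "0 < a" "0 < b" "0 <= s" "0 <= C" for s d a b :: real
  proof (cases "s = 0")
   case False
   hence "1 / s * d <= C / (a * b)" using that by (simp add: field_simps)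
   moreover have "0 <= C / (a * b)" using that by simp
   ultimately have "1 / s * d <= 4 * (C / (a * b))" by argo
   thus ?thesis by simp
  qed (use that in simp)
  from this[OF K p] have "1 / (x - y)^2 * dsq f (x, y) <= C * (2 / (1 + x^2)) * (2 / (1 + y^2))" by (simp add: C_def)
  thus "en (1 / (x - y)^2) * en (dsq f (x, y)) <= en C * en (2 / (1 + x^2)) * en (2 / (1 + y^2))"
   using p by (simp only: ennreal_mult[symmetric] zero_le_divide_1_iff zero_le_power2 C_def add_nonneg_nonneg mult_nonneg_nonneg zero_le_numeral divide_nonneg_pos) (simp add: ennreal_leI)
 qed
 also have "... = en C * ?a x * ?a x"
  by (simp add: nn_integral_cmult nn_integral_multc)
 also have "?a x = en (2 * pi)" using nn_integral_line_circle[of "%_. 1"] by simp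
 finally show "gag f < \<infinity>" by (simp add: ennreal_mult_less_top le_less_trans)
qed

text \<open>For unit values the numerator of the weak form is
  \<open>Im (u x * cnj (u y)) * (f x - f y)\<close>, the first variation of the energy. The rest
  exchanges iterated integrals over Lebesgue measure for an integral of Borel functions over the
  plane.\<close>

lemma half_harmonicI:
 assumes v: "v \<in> Hmaps" and e: "AE x in lborel. u x = v x"
  and EL: "!!f. f \<in> test_functions ==> (IG p. cross v p * (f (fst p) - f (snd p))) = 0"
 shows "half_harmonic u"
 unfolding half_harmonic_def
proof (intro conjI ballI)
 show uH: "u \<in> Hhalf" by (rule Hmaps_Hhalf[OF v e])
 fix f assume t: "f \<in> test_functions"
 note m = HmapsD[OF v]
 have [measurable]: "v \<in> BM" by (rule m)
 have pm[measurable]: "f \<in> BM" by (rule borel_cont[OF test_function_energy(1)[OF t]])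
 have [measurable]: "u \<in> borel_measurable lebesgue" using uH by (simp add: Hhalf_def)
 have [measurable]: "f \<in> borel_measurable lebesgue" using pm by (simp add: measurable_completion)
 have e': "AE x in lebesgue. u x = v x" by (rule AE_completion[OF e])
 let ?k = "%u x y. ((u x - u y) \<bullet> (\<i> * u x * of_real (f x) - \<i> * u y * of_real (f y))) / abs (x - y)^2"
 define h where "h p = 1 / (fst p - snd p)^2 * (cross v p * (f (fst p) - f (snd p)))" for p
 have kv: "?k v x y = h (x, y)" for x y
 proof -
  have "(a - b) \<bullet> (\<i> * a * of_real s - \<i> * b * of_real t) = Im (a * cnj b) * (s - t)" if "cmod a = 1" "cmod b = 1" for a b s t
   using that by (simp add: inner_complex_def algebra_simps)
  from this[OF m(2) m(2)] show ?thesis by (simp add: h_def cross_def)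
 qed
 have hm[measurable]: "h \<in> BM2" unfolding h_def cross_def by measurable
 have ih: "integrable gm (%p. cross v p * (f (fst p) - f (snd p)))"
  using integrable_dsq[OF pm test_function_energy(3)[OF t]]
  by (intro integrable_prod_of_squares integrable_cross_sq[OF v] measurable_cross m) auto
 have ihl: "integrable LL h"
  using ih unfolding gm_def h_def by (subst (asm) integrable_density) (auto simp: cross_def)
 let ?a = "%x. LINT y|lebesgue. ?k u x y"
 have inner: "?a x = (LINT y|lborel. h (x, y))" if x: "u x = v x" for x
 proof -
  have "?a x = (LINT y|lebesgue. h (x, y))"
  proof (rule integral_cong_AE)
   show "AE y in lebesgue. ?k u x y = h (x, y)" using e' by eventually_elim (use kv[of x] x in simp)
   show "(%y. h (x, y)) \<in> borel_measurable lebesgue" by (rule measurable_completion) measurable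
   have [measurable]: "(%y. abs (x - y)^2) \<in> borel_measurable lebesgue" by (rule measurable_completion) measurable
   show "?k u x \<in> borel_measurable lebesgue" by measurable
  qed
  also have "... = (LINT y|lborel. h (x, y))" by (rule integral_completion) measurable
  finally show ?thesis .
 qed
 have out: "AE x in lebesgue. (LINT y|lborel. h (x, y)) = ?a x" using e' by eventually_elim (rule inner[symmetric])
 have hb: "(%x. LINT y|lborel. h (x, y)) \<in> BM" by measurable
 hence hl: "(%x. LINT y|lborel. h (x, y)) \<in> borel_measurable lebesgue" by (simp add: measurable_completion)
 have "(LINT x|lebesgue. LINT y|lebesgue. ?k u x y) = (LINT x|lebesgue. LINT y|lborel. h (x, y))"
  by (rule integral_cong_AE[OF measurable_lebesgue_AE[OF hl out] hl]) (use out in eventually_elim, simp)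
 also have "... = (LINT x|lborel. LINT y|lborel. h (x, y))" using hb by (simp add: integral_completion)
 also have "... = (\<integral>p. h p \<partial>LL)" by (rule lborel_pair.integral_fst'[OF ihl])
 also have "... = (IG p. cross v p * (f (fst p) - f (snd p)))"
  unfolding gm_def h_def by (subst integral_density) (auto simp: cross_def)
 finally show "(LINT x|lebesgue. ?a x) = 0" using EL[OF t] by simp
qed

text \<open>The factor \<open>cis (s * f)\<close> has a continuous phase that vanishes at both ends
  of I, so its degree is zero and the variation stays in the degree class in which \<open>v\<close>
  minimizes.\<close>

lemma degree_minimizer_half_harmonic:
 assumes v: "v \<in> bdry g" and min: "!!w. w \<in> bdry g ==> Hhalf_degree w = Hhalf_degree v ==> gagr v <= gagr w"
  and e: "AE x in lborel. u x = v x"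
 shows "half_harmonic u"
proof (rule half_harmonicI[OF _ e])
 show vH: "v \<in> Hmaps" using v by (simp add: bdry_def)
 fix f assume t: "f \<in> test_functions"
 note tf = test_function_energy[OF t]
 have m: "f \<in> BM" by (rule borel_cont[OF tf(1)])
 show "(IG p. cross v p * (f (fst p) - f (snd p))) = 0"
 proof (rule euler_lagrange[OF vH m tf(3)])
  fix s
  have cH: "(%x. cis (s * f x)) \<in> Hmaps" by (rule Hmaps_cis[OF m tf(3)])
  have z: "f x = 0" if "1 <= abs x" for x using that by (intro tf(2)) auto
  have "Hhalf_degree (%x. cis (s * f x)) = 0"
   by (rule Hhalf_degree_local[OF cH, of 1 "%x. s * f x"]) (auto simp: z tf(2) intro!: continuous_intros continuous_on_subset[OF tf(1)])
  thus "gagr v <= gagr (%x. v x * cis (s * f x))"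
   by (intro min bdry_mult v cH) (simp_all add: tf(2) Hhalf_degree_mult[OF vH cH])
 qed
qed

section \<open>Competitors in the neighbouring degree classes\<close>

lemma Hhalf_degree_wb:
 fixes e r t x :: real
 assumes e: "0 < e" "0 < r" and t: "-1 <= t - r" "t + r <= 1"
 shows "Hhalf_degree (wb e r t) = 1" "x \<notin> {-1<..<1} ==> wb e r t x = 1"
proof -
 have big: "abs ((x - t) / r) \<ge> 1" if "abs x \<ge> 1" for x :: real
 proof -
  have "r <= abs (x - t)" using that t by linarith
  thus ?thesis using e by (simp add: abs_divide)
 qed
 hence o: "wb e r t x = 1" if "abs x \<ge> 1" for x using that bubble_outside[OF e(1)] by (simp add: wb_def)
 thus "x \<notin> {-1<..<1} ==> wb e r t x = 1" by auto
 define c where "c x = max (-1) (min 1 ((x - t) / r))" for x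
 have "bubble e (max (-1) (min 1 X)) = bubble e X" for X
  using bubble_outside[OF e(1), of X] bubble_outside[OF e(1), of 1] bubble_outside[OF e(1), of "-1"]
  by (auto simp: max_def min_def)
 hence bc: "bubble e (c x) = bubble e ((x - t) / r)" for x by (simp add: c_def)
 have c1: "c 1 = 1" "c (-1) = -1" using big[of 1] big[of "-1"] t e by (auto simp: c_def max_def min_def abs_le_iff divide_simps split: if_splits)
 show "Hhalf_degree (wb e r t) = 1"
 proof (rule Hhalf_degree_local[OF Hmaps_wb(1)[OF e], where c = 1 and \<theta> = "%x. pi + 2 * bub_angle e (c x)"])
  show "continuous_on {-1..1} (%x. pi + 2 * bub_angle e (c x))"
   unfolding c_def using e by (intro continuous_intros continuous_on_compose2[OF continuous_bub_angle[OF e(1), of UNIV]]) auto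
  show "wb e r t x = cis (pi + 2 * bub_angle e (c x))" for x using bubble_eq_cis[OF e(1), of "c x"] by (simp add: wb_def bc)
 qed (simp_all add: o c1 bub_angle_ends[OF e(1)])
qed

text \<open>A value midway between \<open>f 1\<close> and another value of \<open>f\<close> is
  attained on either side of the latter, and never at an end point because it differs from
  \<open>f 1\<close>. Interior points are required so that a bubble fits around every centre between
  them.\<close>

lemma equal_values_interior:
 fixes f :: "real => real"
 assumes c: "continuous_on {-1..1} f" and e: "f (-1) = f 1"
 obtains a b where "-1 < a" "a < b" "b < 1" "f a = f b"
proof (cases "\<exists>x\<in>{-1..1}. f x ~= f 1")
 case False
 hence "f x = f 1" if "x \<in> {-1..1}" for x using that by blast
 from this[of "-1/2"] this[of "1/2"] show ?thesis by (intro that[of "-1/2" "1/2"]) auto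
next
 case True
 then obtain x where x: "x \<in> {-1..1}" "f x ~= f 1" by blast
 define y where "y = (f x + f 1) / 2"
 have c1: "continuous_on {-1..x} f" "continuous_on {x..1} f" using x(1) by (auto intro: continuous_on_subset[OF c])
 have y: "y ~= f x" "y ~= f 1" using x(2) by (auto simp: y_def)
 have "f x < f 1 \<or> f 1 < f x" using x(2) by linarith
 hence ex: "(\<exists>a\<ge>-1. a <= x \<and> f a = y) \<and> (\<exists>b\<ge>x. b <= 1 \<and> f b = y)"
 proof
  assume "f x < f 1"
  thus ?thesis using IVT2'[of f x y "-1"] IVT'[of f x y 1] c1 x(1) e by (auto simp: y_def)
 next
  assume "f 1 < f x"
  thus ?thesis using IVT'[of f "-1" y x] IVT2'[of f 1 y x] c1 x(1) e by (auto simp: y_def)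
 qed
 then obtain a b where ab: "-1 <= a" "a <= x" "f a = y" "x <= b" "b <= 1" "f b = y" by blast
 moreover have "a ~= -1" "a ~= x" "b ~= x" "b ~= 1" using ab(3,6) y e by auto
 ultimately show ?thesis using that[of a b] by simp
qed

lemma unit_lift_interval:
 fixes v :: "real => complex"
 assumes v: "continuous_on {-1..1} v" "v ` {-1..1} \<subseteq> sphere 0 1"
 obtains f where "continuous_on {-1..1} f" "!!x. x \<in> {-1..1} ==> v x = exp (\<i> * of_real (f x :: real))"
proof -
 have v1: "cmod (v x) = 1" if "x \<in> {-1..1}" for x using v(2) that by (auto simp: image_subset_iff)
 obtain L where L: "continuous_on {-1..1} L" "!!t. t \<in> {-1..1} ==> v t = exp (L t)"
 proof (rule continuous_logarithm_on_contractible[OF v(1)])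
  show "contractible {-1..1::real}" by (intro convex_imp_contractible) auto
  show "v t ~= 0" if "t \<in> {-1..1}" for t using v1[OF that] by auto
 qed (use that in blast)
 have "v t = exp (\<i> * of_real (Im (L t)))" if "t \<in> {-1..1}" for t
 proof -
  have "Re (L t) = 0" using v1[OF that] L(2)[OF that] by simp
  hence "L t = \<i> * of_real (Im (L t))" by (simp add: complex_eq_iff)
  thus ?thesis using L(2)[OF that] by metis
 qed
 thus ?thesis using that[of "%t. Im (L t)"] L(1) by (auto intro: continuous_intros)
qed

text \<open>Two definite descriptions are resolved: liftings of a continuous map differ by a
  constant, and continuous representatives on \<open>[-1,1]\<close> that agree almost everywhere
  agree everywhere. Degree zero then equates the end values of the phase.\<close>

lemma interval_degree_zero:
 assumes v: "continuous_on {-1..1} v" "v ` {-1..1} \<subseteq> sphere 0 1" "v (-1) = v 1"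
  and e: "AE x in lborel. x \<in> {-1..1} --> u x = v x" and d: "interval_degree u = 0"
 obtains f where "continuous_on {-1..1} f" "!!x. x \<in> {-1..1} ==> v x = cis (f x)" "f (-1) = f 1"
proof -
 obtain f where f: "continuous_on {-1..1} f" "!!x. x \<in> {-1..1} ==> v x = exp (\<i> * of_real (f x))" using unit_lift_interval[OF v(1,2)] by blast
 have "exp (\<i> * of_real (f 1)) = exp (\<i> * of_real (f (-1)))" using f(2)[of 1] f(2)[of "-1"] v(3) by simp
 then obtain k :: int where "\<i> * of_real (f 1) = \<i> * of_real (f (-1)) + (of_int (2 * k) * pi) * \<i>" unfolding exp_eq by blast
 hence k: "f 1 - f (-1) = 2 * pi * of_int k" by (simp add: complex_eq_iff)
 let ?a = "%f x. \<forall>x\<in>{-1..1}. v x = exp (\<i> * of_real (f x))"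
 have "lift_degree v = k"
  unfolding lift_degree_def
 proof (rule the_equality)
  show "\<exists>f. continuous_on {-1..1} f \<and> (?a f x) \<and> of_int k = (f 1 - f (-1)) / (2 * pi)"
   using f k by (intro exI[of _ f]) auto
  fix d assume "\<exists>f. continuous_on {-1..1} f \<and> (?a f x) \<and> of_int d = (f 1 - f (-1)) / (2 * pi)"
  then obtain g where g: "continuous_on {-1..1} g" "!!x. x \<in> {-1..1} ==> v x = exp (\<i> * of_real (g x))" "of_int d = (g 1 - g (-1)) / (2 * pi)" by blast
  have "(%x. \<i> * of_real (f x) - \<i> * of_real (g x)) constant_on {-1..1}"
   using f g by (intro continuous_log_diff_constant) (auto intro!: continuous_intros)
  then obtain c where c: "!!x. x \<in> {-1..1} ==> \<i> * of_real (f x) - \<i> * of_real (g x) = c" unfolding constant_on_def by blast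
  have "f 1 - g 1 = f (-1) - g (-1)" using c[of 1] c[of "-1"] by (auto simp: complex_eq_iff)
  hence "g 1 - g (-1) = 2 * pi * of_int k" using k by simp
  thus "d = k" using g(3) by simp
 qed
 moreover have "interval_degree u = lift_degree v"
  unfolding interval_degree_def
 proof (rule the_equality)
  show "\<exists>v'. continuous_on {-1..1} v' \<and> v' ` {-1..1} \<subseteq> sphere 0 1 \<and> v' (-1) = v' 1 \<and> (AE x in lebesgue. x \<in> {-1..1} --> u x = v' x) \<and> lift_degree v = lift_degree v'"
   using v AE_completion[OF e] by blast
  fix d assume "\<exists>v'. continuous_on {-1..1} v' \<and> v' ` {-1..1} \<subseteq> sphere 0 1 \<and> v' (-1) = v' 1 \<and> (AE x in lebesgue. x \<in> {-1..1} --> u x = v' x) \<and> d = lift_degree v'"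
  then obtain v' where v': "continuous_on {-1..1} v'" "AE x in lborel. x \<in> {-1..1} --> u x = v' x" "d = lift_degree v'" by (auto simp: AE_completion_iff)
  have ae: "AE x in lborel. x \<in> {-1..1} --> v' x = v x" using v'(2) e by eventually_elim auto
  have eq: "v' x = v x" if x: "x \<in> {-1..1}" for x
  proof (rule ccontr)
   assume ne: "v' x ~= v x"
   have "continuous_on {-1..1} (%x. v' x - v x)" by (intro continuous_intros v v')
   then obtain s where s: "s > 0" "!!y. y \<in> {-1..1} ==> dist y x < s ==> dist (v' y - v y) (v' x - v x) < cmod (v' x - v x)"
    using x ne unfolding continuous_on_iff by (metis zero_less_norm_iff right_minus_eq)
   have "max (-1) (x - s) < min 1 (x + s)" using x s(1) by auto
   from AE_lborel_ex[OF ae this] obtain y where y: "max (-1) (x - s) < y" "y < min 1 (x + s)" "y \<in> {-1..1} --> v' y = v y" by blast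
   thus False using s(2)[of y] by (auto simp: dist_norm abs_less_iff norm_minus_commute)
  qed
  have "(\<forall>x\<in>{-1..1}. v' x = exp (\<i> * of_real (f x))) = ?a f x" for f :: "real => real"
   by (intro ball_cong refl) (simp only: eq)
  hence "lift_degree v' = lift_degree v" unfolding lift_degree_def by (simp only:)
  thus "d = lift_degree v" using v'(3) by simp
 qed
 ultimately have "k = 0" using d by simp
 thus ?thesis using that[of f] f k by (simp add: cis_conv_exp)
qed

text \<open>If the integral vanished, some \<open>x\<close> in \<open>(a,b)\<close> would satisfy
  \<open>u x = g y\<close> for almost every exterior \<open>y\<close>, and by continuity for every
  one, making \<open>g\<close> constant there. This is where the boundary data enter the strict
  inequality.\<close>

lemma exterior_interaction_positive:
 assumes u: "u \<in> bdry g" and g: "continuous_on UNIV g" "\<not> g constant_on (UNIV - {-1<..<1})" and ab: "a < b"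
 shows "0 < (IG p. ind {a<..<b} (fst p) * ind (- {-1<..<1}) (snd p) * dsq u p)"
proof (rule ccontr)
 let ?f = "%p. ind {a<..<b} (fst p) * ind (- {-1<..<1}) (snd p) * dsq u p"
 have uH: "u \<in> Hmaps" and ug: "!!x. x \<notin> {-1<..<1} ==> u x = g x" using u by (auto simp: bdry_def)
 note m = HmapsD[OF uH]
 note [measurable] = m(1) measurable_dsq[OF m(1)]
 have i: "integrable gm ?f"
  by (rule Bintegrable_bound[OF integrable_dsq[OF m(1,3)]]) (auto simp: ind_def)
 assume "\<not> 0 < integral\<^sup>L gm ?f"
 moreover have "0 <= integral\<^sup>L gm ?f" by (intro integral_nonneg_AE) auto
 ultimately have "AE p in gm. ?f p = 0" using integral_nonneg_eq_0_iff_AE[OF i] by auto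
 hence "AE p in LL. 0 < en (1 / (fst p - snd p)^2) --> ?f p = 0"
  unfolding gm_def by (subst (asm) AE_density) auto
 hence "AE x in lborel. AE y in lborel. 0 < en (1 / (x - y)^2) --> ?f (x, y) = 0"
  by (drule_tac lborel_pair.AE_pair) simp
 from AE_lborel_ex[OF this ab] obtain x where x: "a < x" "x < b" "AE y in lborel. 0 < en (1 / (x - y)^2) --> ?f (x, y) = 0" by blast
 have ae: "AE y in lborel. y \<notin> {-1<..<1} --> g y = u x"
  using x(3) AE_lborel_singleton[of x] by eventually_elim (use x(1,2) ug in \<open>auto simp: ind_def split: if_splits\<close>)
 have "g y = u x" if y: "y \<notin> {-1<..<1}" for y
 proof (rule ccontr)
  assume ne: "g y ~= u x"
  have "isCont g y" using g(1) by (simp add: continuous_on_eq_continuous_at)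
  then obtain s where s: "s > 0" "!!z. dist z y < s ==> dist (g z) (g y) < dist (g y) (u x)"
   using ne unfolding continuous_at_eps_delta by (metis zero_less_dist_iff)
  have "\<exists>z. y - s < z \<and> z < y + s \<and> z \<notin> {-1<..<1} \<and> g z = u x"
  proof (cases "1 <= y")
   case True
   have "y < y + s" using s by simp
   from AE_lborel_ex[OF ae this] obtain z where "y < z" "z < y + s" "z \<notin> {-1<..<1} --> g z = u x" by blast
   thus ?thesis using s(1) True by (intro exI[of _ z]) auto
  next
   case False
   hence "y - s < y" "y <= -1" using s y by auto
   moreover from AE_lborel_ex[OF ae this(1)] obtain z where "y - s < z" "z < y" "z \<notin> {-1<..<1} --> g z = u x" by blast
   ultimately show ?thesis using s(1) by (intro exI[of _ z]) auto
  qed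
  then obtain z where "y - s < z" "z < y + s" "g z = u x" by blast
  thus False using s(2)[of z] by (auto simp: dist_norm abs_less_iff norm_minus_commute)
 qed
 thus False using g(2) unfolding constant_on_def by auto
qed

lemma bdry_minimizer_EL:
 assumes u: "u \<in> bdry g" and min: "!!w. w \<in> bdry g ==> gagr u <= gagr w"
  and h: "h \<in> BM" "\<forall>x. x \<notin> {-1<..<1} --> h x = 0" "gag h < \<infinity>"
 shows "(IG p. cross u p * (h (fst p) - h (snd p))) = 0"
proof (rule euler_lagrange[OF _ h(1,3)])
 show "u \<in> Hmaps" using u by (simp add: bdry_def)
 show "gagr u <= gagr (%x. u x * cis (t * h x))" for t
  using h(2) by (intro min bdry_mult[OF u Hmaps_cis(1)[OF h(1,3)]]) simp
qed

lemma adjacent_degree_competitors: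
 assumes u: "u \<in> bdry g" and min: "!!w. w \<in> bdry g ==> gagr u <= gagr w"
  and g: "continuous_on UNIV g" "\<not> g constant_on (UNIV - {-1<..<1})"
  and f: "continuous_on {-1..1} f" "!!x. x \<in> {-1..1} ==> u x = cis (f x)" "f (-1) = f 1"
 shows "\<exists>w. w \<in> bdry g \<and> Hhalf_degree w = Hhalf_degree u + 1 \<and> gagr w < gagr u + 4 * pi^2"
  and "\<exists>w. w \<in> bdry g \<and> Hhalf_degree w = Hhalf_degree u - 1 \<and> gagr w < gagr u + 4 * pi^2"
proof -
 obtain a b where ab: "-1 < a" "a < b" "b < 1" "f a = f b" using equal_values_interior[OF f(1,3)] by blast
 \<comment> \<open>The largest radius for which the windows of all centres in \<open>[a,b]\<close>
   stay inside \<open>[-1,1]\<close>.\<close>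
 define r where "r = min (a + 1) (1 - b)"
 have r: "0 < r" "-1 <= a - r" "b + r <= 1" using ab by (auto simp: r_def)
 \<comment> \<open>The phase is continued by constants, because
   \<open>bubble_strict_inequality\<close> works with a continuous bounded phase on the whole
   line.\<close>
 define G where "G x = f (max (-1) (min 1 x))" for x
 have Gc: "continuous_on UNIV G" unfolding G_def by (intro continuous_on_compose2[OF f(1)] continuous_intros) auto
 have G: "G x = f x" if "x \<in> {-1..1}" for x using that by (simp add: G_def)
 have uG: "u x = cis (G x)" if "x \<in> {-1..1}" for x using f(2)[OF that] G[OF that] by simp
 have Gab: "G a = G b" using ab G by simp
 obtain M where "!!x. x \<in> {-1..1} ==> (abs (f x)) <= M"
  using compact_imp_bounded[OF compact_continuous_image[OF f(1)]] by (metis compact_Icc bounded_iff imageI real_norm_def)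
 hence M: "abs (G x) <= M" for x by (simp add: G_def)
 have uH: "u \<in> Hmaps" using u by (simp add: bdry_def)
 have EL: "(IG p. cross u p * (h (fst p) - h (snd p))) = 0"
  if "h \<in> BM" "\<forall>x. x \<notin> {-1<..<1} --> h x = 0" "gag h < \<infinity>" for h :: "real => real"
  by (rule bdry_minimizer_EL[OF u _ that]) (rule min)
 define a' b' where "a' = (2 * a + b) / 3" and "b' = (a + 2 * b) / 3"
 have ab': "a < a'" "a' < b'" "b' < b" using ab by (auto simp: a'_def b'_def)
 have Z: "0 < (IG p. ind {a'<..<b'} (fst p) * ind (- {-1<..<1}) (snd p) * dsq u p)"
  by (rule exterior_interaction_positive[OF u g ab'(2)])
 have wb: "wb e r t \<in> Hmaps" "Hhalf_degree (wb e r t) = 1" "!!x. x \<notin> {-1<..<1} ==> wb e r t x = 1" if "0 < e" "a <= t" "t <= b" for e t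
  using that r Hmaps_wb(1)[of e r t] Hhalf_degree_wb[of e r t] by auto
 obtain e t where et: "0 < e" "a <= t" "t <= b" "gagr (%x. u x * wb e r t x) < gagr u + 4 * pi^2"
 proof -
  have "\<exists>e t. 0 < e \<and> a <= t \<and> t <= b \<and> gagr (%x. u x * wb e r t x) < gagr u + 4 * pi^2"
   by (rule bubble_strict_inequality[OF uH Gc M uG ab(2) Gab r EL ab' Z])
  thus ?thesis using that by blast
 qed
 show "\<exists>w. w \<in> bdry g \<and> Hhalf_degree w = Hhalf_degree u + 1 \<and> gagr w < gagr u + 4 * pi^2"
  using bdry_mult[OF u wb(1,3)[OF et(1-3)]] Hhalf_degree_mult[OF uH wb(1)[OF et(1-3)]] wb(2)[OF et(1-3)] et(4)
  by (intro exI[of _ "%x. u x * wb e r t x"]) simp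
 \<comment> \<open>To lower the degree, a bubble of degree one is inserted into
   \<open>cnj u\<close>, whose phase is the negative one, and the product is conjugated back.
   Stationarity and the interaction with the exterior are unaffected by conjugation.\<close>
 let ?u = "%x. cnj (u x)"
 have EL': "(IG p. cross ?u p * (h (fst p) - h (snd p))) = 0"
  if "h \<in> BM" "\<forall>x. x \<notin> {-1<..<1} --> h x = 0" "gag h < \<infinity>" for h :: "real => real"
 proof -
  have "cross ?u p * (h (fst p) - h (snd p)) = - (cross u p * (h (fst p) - h (snd p)))" for p by (simp add: cross_def algebra_simps)
  thus ?thesis using EL[OF that] by simp
 qed
 have dn: "dsq ?u p = dsq u p" for p unfolding complex_cnj_diff[symmetric] complex_mod_cnj ..
 obtain e t where et: "0 < e" "a <= t" "t <= b" "gagr (%x. ?u x * wb e r t x) < gagr ?u + 4 * pi^2"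
 proof -
  have "\<exists>e t. 0 < e \<and> a <= t \<and> t <= b \<and> gagr (%x. ?u x * wb e r t x) < gagr ?u + 4 * pi^2"
  proof (rule bubble_strict_inequality[OF Hmaps_cnj[OF uH] continuous_on_minus[OF Gc] _ _ ab(2) _ r EL' ab'])
   show "0 < (IG p. ind {a'<..<b'} (fst p) * ind (- {-1<..<1}) (snd p) * dsq ?u p)" unfolding dn by (rule Z)
  qed (use M Gab uG in \<open>simp_all add: cis_cnj\<close>)
  thus ?thesis using that by blast
 qed
 have cw: "(%x. cnj (wb e r t x)) \<in> Hmaps" by (rule Hmaps_cnj[OF wb(1)[OF et(1-3)]])
 let ?a = "%x. u x * cnj (wb e r t x)"
 have "?a = (%x. cnj (?u x * wb e r t x))" by simp
 hence "gagr ?a < gagr u + 4 * pi^2" using et(4) gag_cnj(2)[of "%x. ?u x * wb e r t x"] gag_cnj(2)[of u] by simp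
 moreover have "?a \<in> bdry g" using wb(3)[OF et(1-3)] by (intro bdry_mult[OF u cw]) simp
 moreover have "Hhalf_degree ?a = Hhalf_degree u - 1"
  using Hhalf_degree_mult[OF uH cw] Hhalf_degree_cnj[OF wb(1)[OF et(1-3)]] wb(2)[OF et(1-3)] by simp
 ultimately show "\<exists>w. w \<in> bdry g \<and> Hhalf_degree w = Hhalf_degree u - 1 \<and> gagr w < gagr u + 4 * pi^2" by blast
qed

theorem theorem1p3:
  fixes g u0 :: "real \<Rightarrow> complex" and d0 :: int
  assumes "g \<in> Hhalf"
    and "continuous_on UNIV g"
    and "\<forall>x. cmod (g x) = 1"
    and "\<not> g constant_on (UNIV - {-1<..<1})"
    and "g (-1) = g 1"
    and "is_arg_min energy (\<lambda>v. v \<in> energy_class g) u0"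
    and "interval_degree u0 = 0"
    and "d0 = Hhalf_degree u0"
  shows "u0 \<in> energy_class_deg g d0 \<and> half_harmonic u0 \<and>
    (\<exists>u_plus u_minus.
       is_arg_min energy (\<lambda>v. v \<in> energy_class_deg g (d0 + 1)) u_plus \<and>
       is_arg_min energy (\<lambda>v. v \<in> energy_class_deg g (d0 - 1)) u_minus \<and>
       half_harmonic u_plus \<and> half_harmonic u_minus \<and>
       u_plus \<in> energy_class g \<and> u_minus \<in> energy_class g \<and>
       \<not> (AE x in lebesgue. u_plus x = u0 x) \<and>
       \<not> (AE x in lebesgue. u_minus x = u0 x) \<and>
       \<not> (AE x in lebesgue. u_plus x = u_minus x))"
proof -
 have gm: "g \<in> BM" "!!x. cmod (g x) = 1" using assms(2,3) by (auto intro: borel_cont)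
 have u0: "u0 \<in> energy_class g" "!!w. w \<in> energy_class g ==> energy u0 <= energy w"
  using assms(6) by (auto simp: is_arg_min_def not_less)
 obtain v0 where v0: "v0 \<in> bdry g" "AE x in lborel. u0 x = v0 x" using energy_class_representative[OF u0(1) gm] by blast
 have v0H: "v0 \<in> Hmaps" and v0g: "!!x. x \<notin> {-1<..<1} ==> v0 x = g x" using v0(1) by (auto simp: bdry_def)
 have e0: "energy u0 = energy v0" using gagliardo_AE[OF v0(2)] by (simp add: energy_def)
 have min0: "gagr v0 <= gagr w" if "w \<in> bdry g" for w
  using u0(2)[OF bdry_energy_class[OF that]] that unfolding e0 by (subst (asm) energy_le_iff[OF v0H]) (auto simp: bdry_def)
 have "gag v0 <= gag w" if "w \<in> Hmaps" "\<forall>x. x \<notin> {-1<..<1} --> w x = v0 x" for w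
  using min0[of w] that v0g gag_eq_gagr[OF HmapsD(1,3)[OF v0H]] gag_eq_gagr[OF HmapsD(1,3)[OF that(1)]] by (simp add: bdry_def ennreal_leI)
 from minimizer_continuous[OF v0H this assms(2) v0g] obtain v where v: "continuous_on {-1..1} v" "v ` {-1..1} \<subseteq> sphere 0 1"
  "AE x in lborel. x \<in> {-1..1} --> v0 x = v x" "v (-1) = g (-1)" "v 1 = g 1" by blast
 have v11: "v (-1) = v 1" using v(4,5) assms(5) by simp
 have ae0: "AE x in lborel. x \<in> {-1..1} --> u0 x = v x" using v(3) v0(2) by eventually_elim auto
 obtain F where F: "continuous_on {-1..1} F" "!!x. x \<in> {-1..1} ==> v x = cis (F x)" "F (-1) = F 1"
  using interval_degree_zero[OF v(1,2) v11 ae0 assms(7)] by blast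
 \<comment> \<open>With the continuous representative inserted on \<open>[-1,1]\<close>, the
   relation to the phase \<open>F\<close> holds at every point. At the end points it agrees with
   \<open>g\<close>, so \<open>u\<close> remains in \<open>bdry g\<close>.\<close>
 define u where "u x = (if x \<in> {-1..1} then v x else g x)" for x
 have ae: "AE x in lborel. u0 x = u x" using ae0 v0(2) by eventually_elim (auto simp: u_def v0g)
 have u1: "cmod (u x) = 1" for x using v(2) gm(2) by (auto simp: u_def image_subset_iff)
 have "(%x. if x \<in> {-1..1} then v x else g x) \<in> BM"
  by (rule borel_measurable_continuous_on_if[OF _ v(1) continuous_on_subset[OF assms(2)]]) auto
 hence um: "u \<in> BM" by (simp add: u_def[abs_def])
 have "gag u < \<infinity>" using u0(1) gagliardo_eq_gag[OF um] gagliardo_AE[OF ae] by (simp add: energy_class_def Hhalf_def)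
 hence uH: "u \<in> Hmaps" using um u1 by (simp add: Hmaps_def)
 have "x = -1 \<or> x = 1" if "x \<in> {-1..1}" "x \<notin> {-1<..<1}" for x :: real using that by auto
 hence ub: "u \<in> bdry g" using uH v(4,5) by (fastforce simp: bdry_def u_def)
 have "energy u0 = energy u" using gagliardo_AE[OF ae] by (simp add: energy_def)
 hence min: "gagr u <= gagr w" if "w \<in> bdry g" for w
  using u0(2)[OF bdry_energy_class[OF that]] that energy_le_iff[OF uH, of w] by (simp add: bdry_def)
 have du: "Hhalf_degree u = d0" using Hhalf_degree_AE[OF uH ae] assms(8) by simp
 have uF: "u x = cis (F x)" if "x \<in> {-1..1}" for x using that F(2) by (simp add: u_def)
 note comp = adjacent_degree_competitors[OF ub min assms(2,4) F(1) uF F(3), unfolded du]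
 have ex: "\<exists>w. w \<in> bdry g \<and> Hhalf_degree w = d \<and> (\<forall>z. z \<in> bdry g --> Hhalf_degree z = d --> gagr w <= gagr z)"
  if "\<exists>w. w \<in> bdry g \<and> Hhalf_degree w = d \<and> gagr w < gagr u + 4 * pi^2" for d
 proof -
  from that obtain w where w: "w \<in> bdry g" "Hhalf_degree w = d" "gagr w < gagr u + 4 * pi^2" by blast
  show ?thesis by (rule minimizer_exists[of g "gagr u" w d, folded bdry_def, OF gm min w]) blast+
 qed
 have arg: "is_arg_min energy (%v. v \<in> energy_class_deg g d) w \<and> half_harmonic w \<and> w \<in> energy_class g"
  if w: "w \<in> bdry g" "Hhalf_degree w = d" "\<forall>z. z \<in> bdry g --> Hhalf_degree z = d --> gagr w <= gagr z" for w d
 proof (intro conjI)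
  have wH: "w \<in> Hmaps" using w(1) by (simp add: bdry_def)
  show wE: "w \<in> energy_class g" by (rule bdry_energy_class[OF w(1)])
  show "half_harmonic w" by (rule degree_minimizer_half_harmonic[OF w(1)]) (use w in auto)
  have "energy w <= energy y" if y: "y \<in> energy_class_deg g d" for y
  proof -
   have yE: "y \<in> energy_class g" "Hhalf_degree y = d" using y by (auto simp: energy_class_deg_def)
   obtain z where z: "z \<in> bdry g" "AE x in lborel. y x = z x" using energy_class_representative[OF yE(1) gm] by blast
   have zH: "z \<in> Hmaps" using z(1) by (simp add: bdry_def)
   have "gagr w <= gagr z" using w(3) z(1) Hhalf_degree_AE[OF zH z(2)] yE(2) by simp
   thus ?thesis using energy_le_iff[OF wH zH] gagliardo_AE[OF z(2)] by (simp add: energy_def)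
  qed
  thus "is_arg_min energy (%v. v \<in> energy_class_deg g d) w"
   using wE w(2) by (auto simp: is_arg_min_def energy_class_deg_def not_less)
 qed
 obtain p where p: "p \<in> bdry g" "Hhalf_degree p = d0 + 1" "\<forall>z. z \<in> bdry g --> Hhalf_degree z = d0 + 1 --> gagr p <= gagr z"
  using ex[OF comp(1)] by blast
 obtain n where n: "n \<in> bdry g" "Hhalf_degree n = d0 - 1" "\<forall>z. z \<in> bdry g --> Hhalf_degree z = d0 - 1 --> gagr n <= gagr z"
  using ex[OF comp(2)] by blast
 have pn: "p \<in> Hmaps" "n \<in> Hmaps" using p(1) n(1) by (auto simp: bdry_def)
 have hh: "half_harmonic u0" by (rule degree_minimizer_half_harmonic[OF ub min ae])
 have ne: "\<not> (AE x in lebesgue. f x = h x)" if "h \<in> Hmaps" "Hhalf_degree f ~= Hhalf_degree h" for f h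
  using Hhalf_degree_AE[OF that(1), of f] that(2) by (auto simp: AE_completion_iff)
 have ne0: "\<not> (AE x in lebesgue. f x = u0 x)" if "Hhalf_degree f ~= d0" for f
 proof
  assume "AE x in lebesgue. f x = u0 x"
  hence "AE x in lborel. f x = u0 x" by (simp add: AE_completion_iff)
  hence "AE x in lborel. f x = u x" using ae by eventually_elim simp
  thus False using Hhalf_degree_AE[OF uH] du that by simp
 qed
 show ?thesis
  using u0(1) assms(8) hh arg[OF p] arg[OF n] ne0[of p] ne0[of n] ne[OF pn(2), of p] p(2) n(2)
  by (auto simp: energy_class_deg_def)
qed

end
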